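(* Let $k$ be a field and let $A$ be an $A_\infty$-algebra over $k$. If $A$ is proper and connective, then $A$ has a finite dimensional DG-model, i.e. there is a DG-algebra over $k$ whose underlying graded vector space has finite total dimension and which is quasi-isomorphic to $A$ as an $A_\infty$-algebra. In particular, any proper connective DG-algebra over $k$ is quasi-isomorphic to a DG-algebra of finite total dimension over $k$.
   Context: Grading is cohomological. DG-algebras are unital and $A_\infty$-algebras are (homologically) unital. An $A_\infty$-algebra (in particular a DG-algebra) $A$ over $k$ is proper if its total cohomology $H^*(A)$ is finite dimensional over $k$, and connective if $H^i(A)=0$ for $i>0$. *)

theory Defs
  imports Complex_Main "HOL-Library.Function_Algebras"
begin

text \<open>
  A graded vector space is an independent family of subspaces of an ambient vector space; its
  total space is the span of the components, not the whole ambient type. Hence every graded vector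
  space is represented, with its total space as ambient type. Graded multilinear maps are only
  constrained on tuples of homogeneous elements, which determine them.
\<close>

record ('k, 'a) graded_space =
  smul :: "'k \<Rightarrow> 'a \<Rightarrow> 'a"
  component :: "int \<Rightarrow> 'a set"

definition graded_vector_space ::
    "('k::field, 'a::ab_group_add, 'm) graded_space_scheme \<Rightarrow> bool" where
  "graded_vector_space V \<longleftrightarrow>
     vector_space (smul V) \<and>
     (\<forall>i. module.subspace (smul V) (component V i)) \<and>
     (\<forall>I x. finite I \<and> (\<forall>i\<in>I. x i \<in> component V i) \<and> (\<Sum>i\<in>I. x i) = 0
        \<longrightarrow> (\<forall>i\<in>I. x i = 0))"

definition finite_total_dimension ::
    "('k::field, 'a::ab_group_add, 'm) graded_space_scheme \<Rightarrow> bool" where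
  "finite_total_dimension V \<longleftrightarrow>
     (\<exists>S. finite S \<and> (\<Union>i. component V i) \<subseteq> module.span (smul V) S)"

definition homogeneous ::
    "('k, 'a, 'm) graded_space_scheme \<Rightarrow> int list \<Rightarrow> 'a list \<Rightarrow> bool" where
  "homogeneous V ds xs \<longleftrightarrow> list_all2 (\<lambda>d x. x \<in> component V d) ds xs"

text \<open>
  A family of linear maps from the \<open>n\<close>-th tensor power of \<open>V\<close> to \<open>W\<close>, of degree \<open>p n\<close>, for all
  \<open>n \<ge> 1\<close>, is encoded as one function on lists; its value on the empty list plays no role.
\<close>

definition multilinear_family ::
    "('k, 'a::ab_group_add, 'm) graded_space_scheme \<Rightarrow> ('k, 'b::ab_group_add, 'l) graded_space_scheme
     \<Rightarrow> (nat \<Rightarrow> int) \<Rightarrow> ('a list \<Rightarrow> 'b) \<Rightarrow> bool" where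
  "multilinear_family V W p f \<longleftrightarrow>
     (\<forall>ds xs. xs \<noteq> [] \<and> homogeneous V ds xs
        \<longrightarrow> f xs \<in> component W (sum_list ds + p (length xs))) \<and>
     (\<forall>ds es us vs d x y. homogeneous V ds us \<and> homogeneous V es vs \<and>
        x \<in> component V d \<and> y \<in> component V d
        \<longrightarrow> f (us @ (x + y) # vs) = f (us @ x # vs) + f (us @ y # vs)) \<and>
     (\<forall>ds es us vs d x c. homogeneous V ds us \<and> homogeneous V es vs \<and> x \<in> component V d
        \<longrightarrow> f (us @ smul V c x # vs) = smul W c (f (us @ x # vs)))"

definition signed :: "int \<Rightarrow> 'a::ab_group_add \<Rightarrow> 'a" where
  "signed e x = (if even e then x else - x)"

text \<open>
  The sum over \<open>r + s + t = n\<close>, \<open>s \<ge> 1\<close>, of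
  \<open>(-1)^(r + s t) g_(r+1+t) (1^r \<otimes> m_s \<otimes> 1^t)\<close>, evaluated on elements \<open>xs\<close> of degrees \<open>ds\<close>. The
  Koszul rule contributes the exponent \<open>(2 - s)\<close> times the degree of the first \<open>r\<close> arguments.
\<close>

definition insertion_sum ::
    "('a list \<Rightarrow> 'b::ab_group_add) \<Rightarrow> ('a list \<Rightarrow> 'a) \<Rightarrow> int list \<Rightarrow> 'a list \<Rightarrow> 'b" where
  "insertion_sum g m ds xs =
     (\<Sum>(r, s) \<in> {(r, s). 1 \<le> s \<and> r + s \<le> length xs}.
        signed (int (r + s * (length xs - r - s)) + (2 - int s) * sum_list (take r ds))
          (g (take r xs @ m (take s (drop r xs)) # drop (r + s) xs)))"

record ('k, 'a) ainf_algebra = "('k, 'a) graded_space" +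
  ops :: "'a list \<Rightarrow> 'a"

definition is_ainf_algebra :: "('k::field, 'a::ab_group_add) ainf_algebra \<Rightarrow> bool" where
  "is_ainf_algebra A \<longleftrightarrow>
     graded_vector_space A \<and>
     multilinear_family A A (\<lambda>n. 2 - int n) (ops A) \<and>
     (\<forall>ds xs. xs \<noteq> [] \<and> homogeneous A ds xs \<longrightarrow> insertion_sum (ops A) (ops A) ds xs = 0)"

definition cocycles :: "('k, 'a::ab_group_add) ainf_algebra \<Rightarrow> int \<Rightarrow> 'a set" where
  "cocycles A i = {x \<in> component A i. ops A [x] = 0}"

definition coboundaries :: "('k, 'a::ab_group_add) ainf_algebra \<Rightarrow> int \<Rightarrow> 'a set" where
  "coboundaries A i = (\<lambda>x. ops A [x]) ` component A (i - 1)"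

definition coh_class :: "('k, 'a::ab_group_add) ainf_algebra \<Rightarrow> int \<Rightarrow> 'a \<Rightarrow> 'a set" where
  "coh_class A i x = (\<lambda>b. x + b) ` coboundaries A i"

definition cohomology :: "('k, 'a::ab_group_add) ainf_algebra \<Rightarrow> int \<Rightarrow> 'a set set" where
  "cohomology A i = coh_class A i ` cocycles A i"

text \<open>
  For a chain map \<open>f\<close> the sets in the union all coincide, so this is the induced map on cohomology.
\<close>

definition coh_map ::
    "('k, 'b::ab_group_add) ainf_algebra \<Rightarrow> int \<Rightarrow> ('a \<Rightarrow> 'b) \<Rightarrow> 'a set \<Rightarrow> 'b set" where
  "coh_map B i f c = (\<Union>x\<in>c. coh_class B i (f x))"

definition homologically_unital :: "('k, 'a::ab_group_add) ainf_algebra \<Rightarrow> bool" where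
  "homologically_unital A \<longleftrightarrow>
     (\<exists>e \<in> cocycles A 0. \<forall>i. \<forall>x \<in> cocycles A i.
        coh_class A i (ops A [e, x]) = coh_class A i x \<and>
        coh_class A i (ops A [x, e]) = coh_class A i x)"

text \<open>
  Total cohomology is finite dimensional: almost all cohomology spaces vanish, and each is spanned
  by the classes of finitely many cocycles.
\<close>

definition proper :: "('k::field, 'a::ab_group_add) ainf_algebra \<Rightarrow> bool" where
  "proper A \<longleftrightarrow>
     finite {i. cohomology A i \<noteq> {coh_class A i 0}} \<and>
     (\<forall>i. \<exists>S. finite S \<and> S \<subseteq> cocycles A i \<and>
        cohomology A i = coh_class A i ` module.span (smul A) S)"

definition connective :: "('k, 'a::ab_group_add) ainf_algebra \<Rightarrow> bool" where
  "connective A \<longleftrightarrow> (\<forall>i>0. cohomology A i = {coh_class A i 0})"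

fun blocks :: "nat list \<Rightarrow> 'a list \<Rightarrow> 'a list list" where
  "blocks [] xs = []"
| "blocks (n # ns) xs = take n xs # blocks ns (drop n xs)"

text \<open>
  The exponent for the term \<open>m_q (f_(n_1) \<otimes> ... \<otimes> f_(n_q))\<close> in the equations of a morphism:
  the usual sum of \<open>(q - j) (n_j - 1)\<close>, plus the Koszul exponent, in which each \<open>f_(n_j)\<close>, of
  degree \<open>1 - n_j\<close>, moves past the arguments in the blocks before it. Indices below start at 0.
\<close>

definition block_exponent :: "nat list \<Rightarrow> int list \<Rightarrow> int" where
  "block_exponent ns ds =
     (\<Sum>j<length ns. (int (ns ! j) - 1) *
        (int (length ns - 1 - j) + sum_list (take (sum_list (take j ns)) ds)))"

definition ainf_morphism ::
    "('k::field, 'a::ab_group_add) ainf_algebra \<Rightarrow> ('k, 'b::ab_group_add) ainf_algebra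
     \<Rightarrow> ('a list \<Rightarrow> 'b) \<Rightarrow> bool" where
  "ainf_morphism A B f \<longleftrightarrow>
     multilinear_family A B (\<lambda>n. 1 - int n) f \<and>
     (\<forall>ds xs. xs \<noteq> [] \<and> homogeneous A ds xs \<longrightarrow>
        insertion_sum f (ops A) ds xs =
        (\<Sum>ns \<in> {ns. sum_list ns = length xs \<and> 0 \<notin> set ns}.
           signed (block_exponent ns ds) (ops B (map f (blocks ns xs)))))"

text \<open>
  Preservation of the homological unit need not be required of a quasi-isomorphism: its cohomology
  map is bijective and multiplicative. Over a field, quasi-isomorphisms of this kind are invertible
  up to homotopy, so a single one suffices for being quasi-isomorphic.
\<close>

definition ainf_quasi_isomorphism ::
    "('k::field, 'a::ab_group_add) ainf_algebra \<Rightarrow> ('k, 'b::ab_group_add) ainf_algebra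
     \<Rightarrow> ('a list \<Rightarrow> 'b) \<Rightarrow> bool" where
  "ainf_quasi_isomorphism A B f \<longleftrightarrow>
     ainf_morphism A B f \<and>
     (\<forall>i. bij_betw (coh_map B i (\<lambda>x. f [x])) (cohomology A i) (cohomology B i))"

definition ainf_quasi_isomorphic ::
    "('k::field, 'a::ab_group_add) ainf_algebra \<Rightarrow> ('k, 'b::ab_group_add) ainf_algebra \<Rightarrow> bool" where
  "ainf_quasi_isomorphic A B \<longleftrightarrow> (\<exists>f. ainf_quasi_isomorphism A B f)"

record ('k, 'a) dg_algebra = "('k, 'a) graded_space" +
  dg_diff :: "'a \<Rightarrow> 'a"
  dg_mult :: "'a \<Rightarrow> 'a \<Rightarrow> 'a"
  dg_one :: 'a

definition is_dg_algebra :: "('k::field, 'a::ab_group_add) dg_algebra \<Rightarrow> bool" where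
  "is_dg_algebra A \<longleftrightarrow>
     graded_vector_space A \<and>
     (\<forall>i. \<forall>x \<in> component A i. dg_diff A x \<in> component A (i + 1) \<and> dg_diff A (dg_diff A x) = 0 \<and>
        (\<forall>c. dg_diff A (smul A c x) = smul A c (dg_diff A x)) \<and>
        (\<forall>y \<in> component A i. dg_diff A (x + y) = dg_diff A x + dg_diff A y)) \<and>
     (\<forall>i j. \<forall>x \<in> component A i. \<forall>y \<in> component A j.
        dg_mult A x y \<in> component A (i + j) \<and>
        (\<forall>c. dg_mult A (smul A c x) y = smul A c (dg_mult A x y) \<and>
             dg_mult A x (smul A c y) = smul A c (dg_mult A x y)) \<and>
        (\<forall>x' \<in> component A i. dg_mult A (x + x') y = dg_mult A x y + dg_mult A x' y) \<and>
        (\<forall>y' \<in> component A j. dg_mult A x (y + y') = dg_mult A x y + dg_mult A x y') \<and>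
        dg_diff A (dg_mult A x y) =
          dg_mult A (dg_diff A x) y + signed i (dg_mult A x (dg_diff A y)) \<and>
        (\<forall>l. \<forall>z \<in> component A l. dg_mult A (dg_mult A x y) z = dg_mult A x (dg_mult A y z))) \<and>
     dg_one A \<in> component A 0 \<and>
     (\<forall>i. \<forall>x \<in> component A i. dg_mult A (dg_one A) x = x \<and> dg_mult A x (dg_one A) = x)"

definition ainf_of_dg :: "('k, 'a::ab_group_add) dg_algebra \<Rightarrow> ('k, 'a) ainf_algebra" where
  "ainf_of_dg A =
     \<lparr>smul = smul A, component = component A,
      ops = (\<lambda>xs. case xs of [x] \<Rightarrow> dg_diff A x | [x, y] \<Rightarrow> dg_mult A x y | _ \<Rightarrow> 0)\<rparr>"

definition dg_morphism ::
    "('k::field, 'a::ab_group_add) dg_algebra \<Rightarrow> ('k, 'b::ab_group_add) dg_algebra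
     \<Rightarrow> ('a \<Rightarrow> 'b) \<Rightarrow> bool" where
  "dg_morphism A B f \<longleftrightarrow>
     (\<forall>i. \<forall>x \<in> component A i. f x \<in> component B i \<and> f (dg_diff A x) = dg_diff B (f x) \<and>
        (\<forall>c. f (smul A c x) = smul B c (f x)) \<and>
        (\<forall>y \<in> component A i. f (x + y) = f x + f y)) \<and>
     (\<forall>i j. \<forall>x \<in> component A i. \<forall>y \<in> component A j. f (dg_mult A x y) = dg_mult B (f x) (f y)) \<and>
     f (dg_one A) = dg_one B"

definition dg_quasi_isomorphism ::
    "('k::field, 'a::ab_group_add) dg_algebra \<Rightarrow> ('k, 'b::ab_group_add) dg_algebra
     \<Rightarrow> ('a \<Rightarrow> 'b) \<Rightarrow> bool" where
  "dg_quasi_isomorphism A B f \<longleftrightarrow>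
     dg_morphism A B f \<and>
     (\<forall>i. bij_betw (coh_map (ainf_of_dg B) i f)
        (cohomology (ainf_of_dg A) i) (cohomology (ainf_of_dg B) i))"

text \<open>
  Two DG-algebras are quasi-isomorphic if a zigzag of DG-algebra quasi-isomorphisms joins them. Every
  zigzag can be replaced by a single roof whose apex \<open>C\<close> is a semifree resolution of \<open>A\<close>. The
  dimension of \<open>C\<close> can be bounded by the cardinality of the infinite type \<open>'a list list\<close>, so \<open>C\<close> can
  be realised inside \<open>'a list list \<Rightarrow> 'k\<close>.
\<close>

definition dg_quasi_isomorphic ::
    "('k::field, 'a::ab_group_add) dg_algebra \<Rightarrow> ('k, 'b::ab_group_add) dg_algebra \<Rightarrow> bool" where
  "dg_quasi_isomorphic A B \<longleftrightarrow>
     (\<exists>(C :: ('k, 'a list list \<Rightarrow> 'k) dg_algebra) f g.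
        is_dg_algebra C \<and> dg_quasi_isomorphism C A f \<and> dg_quasi_isomorphism C B g)"

end

theory Submission
  imports Defs "HOL-Library.Product_Plus"
begin

text \<open>
  Homotopy transfer along a contraction of \<open>A\<close> makes a copy \<open>H\<close> of its cohomology a minimal
  \<open>A\<^sub>\<infinity>\<close>-algebra, finite dimensional and concentrated in degrees \<open>- n, \<dots>, 0\<close>. An endomorphism of
  degree \<open>j\<close> of the right \<open>A\<^sub>\<infinity>\<close>-module \<open>H\<close> consists of maps of degree \<open>j + 1 - m\<close> from the
  \<open>m\<close>-th tensor power of \<open>H\<close> to \<open>H\<close>, which vanish for \<open>m > n + j + 1\<close>. Hence the truncation \<open>E\<close>
  of the DG-algebra of endomorphisms to degrees \<open>\<le> 0\<close> is finite dimensional. Evaluation at a unit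
  identifies its cohomology with \<open>H\<close> (Yoneda), so the action of \<open>A\<close> on \<open>H\<close> by left
  multiplication is a quasi-isomorphism from \<open>A\<close> to \<open>E\<close>.

  Such a morphism is a twisting cochain \<open>\<tau>\<close> from the bar construction of \<open>A\<close> to \<open>E\<close>. If \<open>A\<close> is a
  DG-algebra, the functions \<open>\<xi>\<close> from the bar construction to \<open>E\<close> form a DG-bimodule, and the
  triangular matrices \<open>(\<beta>, \<xi>, a)\<close> with \<open>\<beta>\<close> in \<open>E\<close> and \<open>a\<close> in \<open>A\<close> form a DG-algebra whose
  differential has the extra off-diagonal term \<open>\<tau> a - \<beta> \<tau>\<close>. Inserting the unit of \<open>A\<close> contracts
  the bimodule onto the multiples \<open>\<beta> \<tau>\<close>, so both diagonal projections are quasi-isomorphisms,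
  and the triangular DG-algebra is the apex of a roof from \<open>A\<close> to \<open>E\<close>.
\<close>

text \<open>The model cannot simply be cut out of \<open>A\<close>, whose components may be infinite
  dimensional, and \<open>H\<close> itself has higher operations. Endomorphisms of \<open>H\<close>
  compose strictly, which is what rectifies \<open>H\<close>. Units shape the details. The unit of
  \<open>H\<close> is one for the binary product only, so the Yoneda homotopy that inserts it has to
  be corrected length by length, and the bound on lengths ends the process. The unit of a DG-algebra
  is strict, so the analogous homotopy on the bimodule works in one step. The roof is needed because
  \<open>\<tau>\<close> is not multiplicative. The triangular algebra is the homotopy pullback of
  \<open>A\<close> and \<open>E\<close> over the bimodule, along \<open>a \<mapsto> \<tau> a\<close>
  and \<open>\<beta> \<mapsto> \<beta> \<tau>\<close>; up to boundaries \<open>\<tau> a\<close> is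
  \<open>\<tau>[a] \<tau>\<close>. Signs are operators instead of exponents: the involution
  \<open>e\<close> is linear on the whole ambient type, so identities are stated for all words.
  Exponents enter only where \<open>A\<close> is shifted and the model is unshifted.\<close>

primrec split_sum :: "('a list \<Rightarrow> 'a list \<Rightarrow> 'c::comm_monoid_add) \<Rightarrow> 'a list \<Rightarrow> 'c" where
  "split_sum K [] = K [] []"
| "split_sum K (x # xs) = K [] (x # xs) + split_sum (\<lambda>us. K (x # us)) xs"

text \<open>
  A function on lists is a linear form on the bar construction. With the operations \<open>b\<close> on the
  shifted space and the shifted parity involution \<open>e\<close>, which accounts for the Koszul signs,
  \<open>coder b e\<close> is composition with the bar differential, \<open>homot h p e\<close> composition with the
  homotopy \<open>\<Sum> e \<otimes> \<dots> \<otimes> e \<otimes> h \<otimes> p \<otimes> \<dots> \<otimes> p\<close>, and \<open>pull f\<close> composition with the coalgebra map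
  induced by \<open>f\<close>.
\<close>

primrec coder ::
    "('a list \<Rightarrow> 'a) \<Rightarrow> ('a \<Rightarrow> 'a) \<Rightarrow> ('a list \<Rightarrow> 'c::comm_monoid_add) \<Rightarrow> 'a list \<Rightarrow> 'c" where
  "coder b e \<phi> [] = 0"
| "coder b e \<phi> (x # xs) =
     split_sum (\<lambda>us vs. \<phi> (b (x # us) # vs)) xs + coder b e (\<lambda>zs. \<phi> (e x # zs)) xs"

primrec homot ::
    "('a \<Rightarrow> 'a) \<Rightarrow> ('a \<Rightarrow> 'a) \<Rightarrow> ('a \<Rightarrow> 'a) \<Rightarrow> ('a list \<Rightarrow> 'c::comm_monoid_add) \<Rightarrow> 'a list \<Rightarrow> 'c" where
  "homot h p e \<phi> [] = 0"
| "homot h p e \<phi> (x # xs) = \<phi> (h x # map p xs) + homot h p e (\<lambda>zs. \<phi> (e x # zs)) xs"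

primrec pull_aux ::
    "('a list \<Rightarrow> 'b) \<Rightarrow> 'a list \<Rightarrow> ('b list \<Rightarrow> 'c::comm_monoid_add) \<Rightarrow> 'a list \<Rightarrow> 'c" where
  "pull_aux f us \<phi> [] = (if us = [] then \<phi> [] else 0)"
| "pull_aux f us \<phi> (x # xs) =
     pull_aux f [] (\<lambda>zs. \<phi> (f (us @ [x]) # zs)) xs + pull_aux f (us @ [x]) \<phi> xs"

definition pull :: "('a list \<Rightarrow> 'b) \<Rightarrow> ('b list \<Rightarrow> 'c::comm_monoid_add) \<Rightarrow> 'a list \<Rightarrow> 'c" where
  "pull f = pull_aux f []"

section \<open>Sums over the cuts of a word\<close>

lemma split_sum_add: "split_sum (\<lambda>us vs. K us vs + L us vs) xs = split_sum K xs + split_sum L xs"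
  by (induction xs arbitrary: K L) (auto simp: algebra_simps)

lemma split_sum_zero: "split_sum (\<lambda>us vs. 0) xs = 0"
  by (induction xs) auto

lemma split_sum_cong:
  "(\<And>us vs. us @ vs = xs \<Longrightarrow> K us vs = L us vs) \<Longrightarrow> split_sum K xs = split_sum L xs"
proof (induction xs arbitrary: K L)
  case (Cons x xs)
  have "split_sum (\<lambda>us. K (x # us)) xs = split_sum (\<lambda>us. L (x # us)) xs"
    by (rule Cons.IH) (simp add: Cons.prems)
  then show ?case by (simp add: Cons.prems)
qed simp

lemma split_sum_map: "split_sum K (map g xs) = split_sum (\<lambda>us vs. K (map g us) (map g vs)) xs"
  by (induction xs arbitrary: K) auto

lemma split_sum_additive:
  "additive L \<Longrightarrow> L (split_sum K xs) = split_sum (\<lambda>us vs. L (K us vs)) xs"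
  by (induction xs arbitrary: K) (auto simp: additive.add)

lemma split_sum_minus:
  fixes K :: "_ \<Rightarrow> _ \<Rightarrow> 'c::ab_group_add"
  shows "split_sum (\<lambda>us vs. - K us vs) xs = - split_sum K xs"
  by (induction xs arbitrary: K) auto

lemma split_sum_diff:
  fixes K :: "_ \<Rightarrow> _ \<Rightarrow> 'c::ab_group_add"
  shows "split_sum (\<lambda>us vs. K us vs - L us vs) xs = split_sum K xs - split_sum L xs"
  by (induction xs arbitrary: K L) (auto simp: algebra_simps)

text \<open>Coassociativity of cutting: both sides run over the cuts of \<open>xs\<close> into three
  pieces, empty ones included.\<close>

lemma split_sum_assoc:
  "split_sum (\<lambda>us vs. split_sum (\<lambda>u v. K u v vs) us) xs
   = split_sum (\<lambda>us vs. split_sum (\<lambda>u v. K us u v) vs) xs"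
  by (induction xs arbitrary: K) (auto simp: split_sum_add algebra_simps)

lemma split_sum_only_Nil:
  "(\<And>us vs. us \<noteq> [] \<Longrightarrow> us @ vs = xs \<Longrightarrow> K us vs = 0) \<Longrightarrow> split_sum K xs = K [] xs"
proof (cases xs)
  case (Cons x xs')
  assume a: "\<And>us vs. us \<noteq> [] \<Longrightarrow> us @ vs = xs \<Longrightarrow> K us vs = 0"
  have "split_sum (\<lambda>us. K (x # us)) xs' = split_sum (\<lambda>us vs. 0) xs'"
    by (rule split_sum_cong) (simp add: a Cons)
  then show ?thesis using Cons by (simp add: split_sum_zero)
qed simp

lemma split_sum_eq_0:
  "(\<And>us vs. us @ vs = xs \<Longrightarrow> K us vs = 0) \<Longrightarrow> split_sum K xs = 0"
  using split_sum_cong[of xs K "\<lambda>us vs. 0"] by (simp add: split_sum_zero)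

lemma split_sum_in:
  "\<lbrakk>\<And>us vs. us @ vs = xs \<Longrightarrow> K us vs \<in> S; \<And>x y. x \<in> S \<Longrightarrow> y \<in> S \<Longrightarrow> x + y \<in> S\<rbrakk>
   \<Longrightarrow> split_sum K xs \<in> S"
proof (induction xs arbitrary: K)
  case (Cons x xs)
  have "split_sum (\<lambda>us. K (x # us)) xs \<in> S" by (rule Cons.IH) (auto simp: Cons.prems)
  then show ?case by (simp add: Cons.prems)
qed simp

lemma split_sum_apply: "split_sum K xs z = split_sum (\<lambda>us vs. K us vs z) xs"
  by (induction xs arbitrary: K) auto

lemma split_sum_eq_sum: "split_sum K xs = (\<Sum>k\<le>length xs. K (take k xs) (drop k xs))"
  by (induction xs arbitrary: K) (auto simp del: sum.atMost_Suc simp add: sum.atMost_Suc_shift)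

subsection \<open>The bar differential\<close>

lemma coder_add: "coder b e (\<lambda>zs. \<phi> zs + \<psi> zs) xs = coder b e \<phi> xs + coder b e \<psi> xs"
  by (induction xs arbitrary: \<phi> \<psi>) (auto simp: split_sum_add algebra_simps)

lemma coder_zero: "coder b e (\<lambda>zs. 0) xs = 0"
  by (induction xs) (auto simp: split_sum_zero)

lemma coder_minus:
  fixes \<phi> :: "_ \<Rightarrow> 'c::ab_group_add"
  shows "coder b e (\<lambda>zs. - \<phi> zs) xs = - coder b e \<phi> xs"
  by (induction xs arbitrary: \<phi>) (auto simp: split_sum_minus)

lemma coder_diff:
  fixes \<phi> :: "_ \<Rightarrow> 'c::ab_group_add"
  shows "coder b e (\<lambda>zs. \<phi> zs - \<psi> zs) xs = coder b e \<phi> xs - coder b e \<psi> xs"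
  by (induction xs arbitrary: \<phi> \<psi>) (auto simp: split_sum_diff)

lemma coder_additive: "additive L \<Longrightarrow> L (coder b e \<phi> xs) = coder b e (\<lambda>zs. L (\<phi> zs)) xs"
  by (induction xs arbitrary: \<phi>)
    (auto simp: additive.add additive.zero split_sum_additive)

lemma coder_cong:
  "(\<And>zs. zs \<noteq> [] \<Longrightarrow> length zs \<le> length xs \<Longrightarrow> \<phi> zs = \<psi> zs) \<Longrightarrow> coder b e \<phi> xs = coder b e \<psi> xs"
proof (induction xs arbitrary: \<phi> \<psi>)
  case (Cons x xs)
  have "split_sum (\<lambda>us vs. \<phi> (b (x # us) # vs)) xs = split_sum (\<lambda>us vs. \<psi> (b (x # us) # vs)) xs"
    by (rule split_sum_cong) (auto intro!: Cons.prems)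
  moreover have "coder b e (\<lambda>zs. \<phi> (e x # zs)) xs = coder b e (\<lambda>zs. \<psi> (e x # zs)) xs"
    by (rule Cons.IH) (auto intro!: Cons.prems)
  ultimately show ?case by simp
qed simp

lemma coder_apply: "coder b e \<phi> xs z = coder b e (\<lambda>zs. \<phi> zs z) xs"
  by (induction xs arbitrary: \<phi>) (auto simp: split_sum_apply)

lemma coder_map:
  assumes "\<And>x. g (e x) = e (g x)" "\<And>xs. g (b xs) = b (map g xs)"
  shows "coder b e (\<lambda>zs. \<phi> (map g zs)) xs = coder b e \<phi> (map g xs)"
proof (induction xs arbitrary: \<phi>)
  case (Cons x xs)
  show ?case using Cons.IH[of "\<lambda>zs. \<phi> (e (g x) # zs)"] by (simp add: split_sum_map assms)
qed simp

text \<open>The bar differential is a coderivation. A contracted block becomes a single letter,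
  which lies on one side of the cut; if it lies on the right, the sign of passing the left piece
  appears as \<open>map e us\<close>.\<close>

lemma coder_split_sum:
  "coder b e (split_sum K) xs =
   split_sum (\<lambda>us vs. coder b e (\<lambda>u. K u vs) us + coder b e (\<lambda>v. K (map e us) v) vs) xs"
proof (induction xs arbitrary: K)
  case (Cons x xs)
  have "coder b e (split_sum K) (x # xs) =
      split_sum (\<lambda>us vs. K [] (b (x # us) # vs) + split_sum (\<lambda>u v. K (b (x # us) # u) v) vs) xs
      + coder b e (\<lambda>zs. K [] (e x # zs) + split_sum (\<lambda>u v. K (e x # u) v) zs) xs"
    by simp
  also have "\<dots> = coder b e (K []) (x # xs)
      + split_sum (\<lambda>us vs. split_sum (\<lambda>u v. K (b (x # us) # u) v) vs) xs
      + coder b e (split_sum (\<lambda>u v. K (e x # u) v)) xs"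
    by (simp add: split_sum_add coder_add algebra_simps)
  also have "split_sum (\<lambda>us vs. split_sum (\<lambda>u v. K (b (x # us) # u) v) vs) xs
     = split_sum (\<lambda>us vs. split_sum (\<lambda>u1 u2. K (b (x # u1) # u2) vs) us) xs"
    by (rule split_sum_assoc[symmetric])
  also have "coder b e (split_sum (\<lambda>u v. K (e x # u) v)) xs =
      split_sum (\<lambda>us vs. coder b e (\<lambda>u. K (e x # u) vs) us
          + coder b e (\<lambda>v. K (e x # map e us) v) vs) xs"
    by (rule Cons.IH)
  finally show ?case by (simp add: split_sum_add algebra_simps)
qed simp

lemma homot_add: "homot h p e (\<lambda>zs. \<phi> zs + \<psi> zs) xs = homot h p e \<phi> xs + homot h p e \<psi> xs"
  by (induction xs arbitrary: \<phi> \<psi>) (auto simp: algebra_simps)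

lemma homot_zero: "homot h p e (\<lambda>zs. 0) xs = 0"
  by (induction xs) auto

lemma homot_minus:
  fixes \<phi> :: "_ \<Rightarrow> 'c::ab_group_add"
  shows "homot h p e (\<lambda>zs. - \<phi> zs) xs = - homot h p e \<phi> xs"
  by (induction xs arbitrary: \<phi>) auto

lemma homot_additive: "additive L \<Longrightarrow> L (homot h p e \<phi> xs) = homot h p e (\<lambda>zs. L (\<phi> zs)) xs"
  by (induction xs arbitrary: \<phi>) (auto simp: additive.add additive.zero)

lemma homot_cong:
  "(\<And>zs. length zs = length xs \<Longrightarrow> \<phi> zs = \<psi> zs) \<Longrightarrow> homot h p e \<phi> xs = homot h p e \<psi> xs"
proof (induction xs arbitrary: \<phi> \<psi>)
  case (Cons x xs)
  have "homot h p e (\<lambda>zs. \<phi> (e x # zs)) xs = homot h p e (\<lambda>zs. \<psi> (e x # zs)) xs"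
    by (rule Cons.IH) (auto intro!: Cons.prems)
  then show ?case by (simp add: Cons.prems)
qed simp

text \<open>As for the bar differential, except that the homotopy is asymmetric: letters before
  \<open>h\<close> carry \<open>e\<close> and letters after it carry \<open>p\<close>, so the right
  piece becomes \<open>map p vs\<close> when \<open>h\<close> acts on the left one.\<close>

lemma homot_split_sum:
  "homot h p e (split_sum K) xs =
   split_sum (\<lambda>us vs. homot h p e (\<lambda>u. K u (map p vs)) us + homot h p e (\<lambda>v. K (map e us) v) vs) xs"
proof (induction xs arbitrary: K)
  case (Cons x xs)
  have "homot h p e (split_sum K) (x # xs) = K [] (h x # map p xs)
      + split_sum (\<lambda>u v. K (h x # u) v) (map p xs)
      + homot h p e (\<lambda>zs. K [] (e x # zs) + split_sum (\<lambda>u v. K (e x # u) v) zs) xs"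
    by (simp add: algebra_simps)
  also have "\<dots> = homot h p e (K []) (x # xs)
      + split_sum (\<lambda>u v. K (h x # map p u) (map p v)) xs
      + homot h p e (split_sum (\<lambda>u v. K (e x # u) v)) xs"
    by (simp add: homot_add split_sum_map algebra_simps)
  also have "homot h p e (split_sum (\<lambda>u v. K (e x # u) v)) xs =
      split_sum (\<lambda>us vs. homot h p e (\<lambda>u. K (e x # u) (map p vs)) us
          + homot h p e (\<lambda>v. K (e x # map e us) v) vs) xs"
    by (rule Cons.IH)
  finally show ?case by (simp add: split_sum_add algebra_simps)
qed simp

subsection \<open>Pulling back along a family of maps\<close>

lemma pull_Nil [simp]: "pull f \<phi> [] = \<phi> []"
  by (simp add: pull_def)

text \<open>The argument \<open>us\<close> collects the letters of the block that is still open,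
  which keeps the definition primitive recursive. The equation recovers the usual form: choose where
  the first block ends, then continue with the rest.\<close>

lemma pull_aux_Cons:
  "pull_aux f us \<phi> (x # xs) = split_sum (\<lambda>vs ws. pull f (\<lambda>zs. \<phi> (f (us @ x # vs) # zs)) ws) xs"
proof (induction xs arbitrary: us x \<phi>)
  case (Cons y ys)
  have "pull_aux f us \<phi> (x # y # ys) =
      pull f (\<lambda>zs. \<phi> (f (us @ [x]) # zs)) (y # ys) + pull_aux f (us @ [x]) \<phi> (y # ys)"
    by (simp add: pull_def)
  also have "pull_aux f (us @ [x]) \<phi> (y # ys) =
      split_sum (\<lambda>vs ws. pull f (\<lambda>zs. \<phi> (f ((us @ [x]) @ y # vs) # zs)) ws) ys"
    by (rule Cons.IH)
  finally show ?case by simp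
qed (simp add: pull_def)

lemma pull_Cons:
  "pull f \<phi> (x # xs) = split_sum (\<lambda>vs ws. pull f (\<lambda>zs. \<phi> (f (x # vs) # zs)) ws) xs"
  using pull_aux_Cons[of f "[]"] by (simp add: pull_def)

lemma pull_aux_add:
  "pull_aux f us (\<lambda>zs. \<phi> zs + \<psi> zs) xs = pull_aux f us \<phi> xs + pull_aux f us \<psi> xs"
  by (induction xs arbitrary: \<phi> \<psi> us) (auto simp: algebra_simps)

lemma pull_add: "pull f (\<lambda>zs. \<phi> zs + \<psi> zs) xs = pull f \<phi> xs + pull f \<psi> xs"
  by (simp add: pull_def pull_aux_add)

lemma pull_aux_zero: "pull_aux f us (\<lambda>zs. 0) xs = 0"
  by (induction xs arbitrary: us) auto

lemma pull_zero: "pull f (\<lambda>zs. 0) xs = 0"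
  by (simp add: pull_def pull_aux_zero)

lemma pull_aux_additive: "additive L \<Longrightarrow> L (pull_aux f us \<phi> xs) = pull_aux f us (\<lambda>zs. L (\<phi> zs)) xs"
  by (induction xs arbitrary: \<phi> us) (auto simp: additive.add additive.zero)

lemma pull_additive: "additive L \<Longrightarrow> L (pull f \<phi> xs) = pull f (\<lambda>zs. L (\<phi> zs)) xs"
  by (simp add: pull_def pull_aux_additive)

lemma pull_minus:
  fixes \<phi> :: "_ \<Rightarrow> 'c::ab_group_add"
  shows "pull f (\<lambda>zs. - \<phi> zs) xs = - pull f \<phi> xs"
  using pull_additive[of uminus f \<phi> xs] by (simp add: additive_def)

text \<open>Compatibility of a coalgebra map with the coproduct: cutting a list of blocks amounts to
  cutting the original word between two blocks. The first block may have any length, hence the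
  induction on the length of the word.\<close>

lemma pull_split_sum:
  "pull f (split_sum K) xs = split_sum (\<lambda>us vs. pull f (\<lambda>u. pull f (K u) vs) us) xs"
proof (induction xs arbitrary: K rule: length_induct)
  case (1 xs)
  show ?case
  proof (cases xs)
    case (Cons x xs')
    have "pull f (split_sum K) xs = split_sum (\<lambda>vs ws. pull f (\<lambda>zs. K [] (f (x # vs) # zs)) ws
       + pull f (split_sum (\<lambda>u v. K (f (x # vs) # u) v)) ws) xs'"
      unfolding Cons pull_Cons by (rule split_sum_cong) (simp add: pull_add)
    also have "\<dots> = pull f (K []) xs
        + split_sum (\<lambda>vs ws. pull f (split_sum (\<lambda>u v. K (f (x # vs) # u) v)) ws) xs'"
      unfolding Cons pull_Cons by (simp add: split_sum_add)
    also have "split_sum (\<lambda>vs ws. pull f (split_sum (\<lambda>u v. K (f (x # vs) # u) v)) ws) xs'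
      = split_sum (\<lambda>vs ws. split_sum
          (\<lambda>w1 w2. pull f (\<lambda>u. pull f (K (f (x # vs) # u)) w2) w1) ws) xs'"
      by (rule split_sum_cong) (use 1 Cons in auto)
    also have "\<dots> = split_sum (\<lambda>us vs. split_sum
          (\<lambda>u1 u2. pull f (\<lambda>u. pull f (K (f (x # u1) # u)) vs) u2) us) xs'"
      by (rule split_sum_assoc[symmetric])
    finally show ?thesis unfolding Cons by (simp add: pull_Cons)
  qed simp
qed

lemma zero_funs [simp]:
  "coder b e (\<lambda>zs. 0) = (\<lambda>xs. 0)" "homot h p e (\<lambda>zs. 0) = (\<lambda>xs. 0)"
  "pull f (\<lambda>zs. 0) = (\<lambda>xs. 0)" "split_sum (\<lambda>us vs. 0) = (\<lambda>xs. 0)"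
  by (simp_all add: fun_eq_iff coder_zero homot_zero pull_zero split_sum_zero)

subsection \<open>Multilinear functions on lists\<close>

definition lin :: "('k \<Rightarrow> 'a \<Rightarrow> 'a::plus) \<Rightarrow> ('k \<Rightarrow> 'c \<Rightarrow> 'c::plus) \<Rightarrow> ('a \<Rightarrow> 'c) \<Rightarrow> bool" where
  "lin s t f \<longleftrightarrow> (\<forall>x y c. f (x + s c y) = f x + t c (f y))"

text \<open>Unlike \<open>multilinear_family\<close>, this constrains all lists over the ambient
  type, so that identities can be stated without degrees. Operations of this kind are produced by
  \<open>ext\<close>.\<close>

definition multilin ::
    "('k \<Rightarrow> 'a \<Rightarrow> 'a::plus) \<Rightarrow> ('k \<Rightarrow> 'c \<Rightarrow> 'c::plus) \<Rightarrow> ('a list \<Rightarrow> 'c) \<Rightarrow> bool" where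
  "multilin s t \<phi> \<longleftrightarrow>
     (\<forall>us vs x y c. \<phi> (us @ (x + s c y) # vs) = \<phi> (us @ x # vs) + t c (\<phi> (us @ y # vs)))"

lemma multilinD:
  "multilin s t \<phi> \<Longrightarrow> \<phi> (us @ (x + s c y) # vs) = \<phi> (us @ x # vs) + t c (\<phi> (us @ y # vs))"
  by (simp add: multilin_def)

lemma multilinI:
  "(\<And>us vs x y c. \<phi> (us @ (x + s c y) # vs) = \<phi> (us @ x # vs) + t c (\<phi> (us @ y # vs)))
   \<Longrightarrow> multilin s t \<phi>"
  by (simp add: multilin_def)

lemma linD: "lin s t f \<Longrightarrow> f (x + s c y) = f x + t c (f y)"
  by (simp add: lin_def)

lemma lin_additive: "vector_space s \<Longrightarrow> vector_space t \<Longrightarrow> lin s t f \<Longrightarrow> additive f"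
  unfolding additive_def
  by (metis (no_types, opaque_lifting) linD vector_space.vector_space_assms(4))

lemma lin_scale:
  assumes "vector_space s" "vector_space t" "lin s t f"
  shows "f (s c x) = t c (f x)"
  using linD[OF assms(3), of 0 c x] additive.zero[OF lin_additive[OF assms]] by simp

lemma linI:
  assumes "additive f" "\<And>c x. f (s c x) = t c (f x)"
  shows "lin s t f"
  using assms by (simp add: lin_def additive.add)

lemma multilin_Cons: "multilin s t \<phi> \<Longrightarrow> multilin s t (\<lambda>zs. \<phi> (x # zs))"
  unfolding multilin_def by (metis append_Cons)

lemma multilin_append: "multilin s t \<phi> \<Longrightarrow> multilin s t (\<lambda>zs. \<phi> (us @ zs))"
  unfolding multilin_def by (metis append_assoc)

lemma multilin_append2: "multilin s t \<phi> \<Longrightarrow> multilin s t (\<lambda>zs. \<phi> (zs @ us))"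
  unfolding multilin_def by simp

lemma multilin_lin: "multilin s t \<phi> \<Longrightarrow> lin s t (\<lambda>x. \<phi> (us @ x # vs))"
  by (simp add: multilin_def lin_def)

lemma multilin_lin_hd: "multilin s t \<phi> \<Longrightarrow> lin s t (\<lambda>x. \<phi> (x # vs))"
  using multilin_lin[of s t \<phi> "[]"] by simp

lemma multilin_map: "multilin s t \<phi> \<Longrightarrow> lin s s g \<Longrightarrow> multilin s t (\<lambda>zs. \<phi> (map g zs))"
  by (simp add: multilin_def lin_def)

lemma multilin_comp: "multilin s t \<phi> \<Longrightarrow> lin t u g \<Longrightarrow> multilin s u (\<lambda>zs. g (\<phi> zs))"
  by (simp add: multilin_def lin_def)

context
  fixes s :: "'k::field \<Rightarrow> 'a::ab_group_add \<Rightarrow> 'a" and t :: "'k \<Rightarrow> 'c::ab_group_add \<Rightarrow> 'c"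
  assumes vs: "vector_space s" "vector_space t"
begin

lemma scale_additive: "additive (t c)"
  using vs(2) by (simp add: additive_def vector_space.vector_space_assms(1))

lemma multilin_additive:
  "multilin s t \<phi> \<Longrightarrow> additive (\<lambda>x. \<phi> (us @ x # vs))"
  using lin_additive[OF vs multilin_lin] .

lemma multilin_additive_hd: "multilin s t \<phi> \<Longrightarrow> additive (\<lambda>x. \<phi> (x # vs))"
  using lin_additive[OF vs multilin_lin_hd] .

lemma multilin_0: "multilin s t \<phi> \<Longrightarrow> \<phi> (us @ 0 # vs) = 0"
  using additive.zero[OF multilin_additive] .

lemma multilin_0_hd: "multilin s t \<phi> \<Longrightarrow> \<phi> (0 # vs) = 0"
  using multilin_0[of \<phi> "[]"] by simp

lemma multilin_0_mem: "multilin s t \<phi> \<Longrightarrow> 0 \<in> set xs \<Longrightarrow> \<phi> xs = 0"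
  by (metis multilin_0 split_list)

lemma multilin_minus_hd: "multilin s t \<phi> \<Longrightarrow> \<phi> (- x # vs) = - \<phi> (x # vs)"
  using additive.minus[OF multilin_additive_hd] .

lemma multilin_add_hd: "multilin s t \<phi> \<Longrightarrow> \<phi> ((x + y) # vs) = \<phi> (x # vs) + \<phi> (y # vs)"
  using additive.add[OF multilin_additive_hd] .

lemma multilin_diff_hd: "multilin s t \<phi> \<Longrightarrow> \<phi> ((x - y) # vs) = \<phi> (x # vs) - \<phi> (y # vs)"
  using additive.diff[OF multilin_additive_hd] .

lemma multilin_plus: "multilin s t \<phi> \<Longrightarrow> multilin s t \<psi> \<Longrightarrow> multilin s t (\<lambda>zs. \<phi> zs + \<psi> zs)"
  using additive.add[OF scale_additive] by (simp add: multilin_def algebra_simps)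

lemma multilin_zero: "multilin s t (\<lambda>zs. 0)"
  using additive.zero[OF scale_additive] by (simp add: multilin_def)

lemma multilin_uminus: "multilin s t \<phi> \<Longrightarrow> multilin s t (\<lambda>zs. - \<phi> zs)"
  using additive.minus[OF scale_additive] by (simp add: multilin_def algebra_simps)

lemma multilin_diff: "multilin s t \<phi> \<Longrightarrow> multilin s t \<psi> \<Longrightarrow> multilin s t (\<lambda>zs. \<phi> zs - \<psi> zs)"
  using additive.diff[OF scale_additive] by (simp add: multilin_def algebra_simps)

lemma split_sum_scale: "split_sum (\<lambda>us vs. t c (K us vs)) xs = t c (split_sum K xs)"
  by (simp add: split_sum_additive[OF scale_additive])

lemma multilin_split_sum:
  assumes "\<And>vs. multilin s t (\<lambda>us. K us vs)" "\<And>us. multilin s t (K us)"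
  shows "multilin s t (split_sum K)"
proof (rule multilinI)
  fix us vs x y c
  show "split_sum K (us @ (x + s c y) # vs) =
      split_sum K (us @ x # vs) + t c (split_sum K (us @ y # vs))"
    using assms
  proof (induction us arbitrary: K)
    case Nil
    have "K ((x + s c y) # u) = (\<lambda>v. K (x # u) v + t c (K (y # u) v))" for u
      using multilinD[OF Nil(1), of "[]"] by (simp add: fun_eq_iff)
    moreover have "K [] ((x + s c y) # u) = K [] (x # u) + t c (K [] (y # u))" for u
      using multilinD[OF Nil(2), where us = "[]"] by simp
    ultimately show ?case
      by (simp add: split_sum_add split_sum_scale additive.add[OF scale_additive] algebra_simps)
  next
    case (Cons z us)
    have "split_sum (\<lambda>u. K (z # u)) (us @ (x + s c y) # vs) = split_sum (\<lambda>u. K (z # u)) (us @ x # vs)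
        + t c (split_sum (\<lambda>u. K (z # u)) (us @ y # vs))"
      by (rule Cons.IH) (auto intro: multilin_Cons Cons.prems)
    moreover have "K [] (z # us @ (x + s c y) # vs)
        = K [] (z # us @ x # vs) + t c (K [] (z # us @ y # vs))"
      using multilinD[OF Cons.prems(2), of _ "z # us"] by simp
    ultimately show ?case
      by (simp add: additive.add[OF scale_additive] algebra_simps)
  qed
qed

lemma coder_scale: "coder b e (\<lambda>zs. t c (\<phi> zs)) xs = t c (coder b e \<phi> xs)"
  by (simp add: coder_additive[OF scale_additive])

lemma multilin_coder:
  assumes "multilin s t \<phi>" "multilin s s b" "lin s s e"
  shows "multilin s t (coder b e \<phi>)"
proof (rule multilinI)
  fix us vs x y c
  show "coder b e \<phi> (us @ (x + s c y) # vs)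
      = coder b e \<phi> (us @ x # vs) + t c (coder b e \<phi> (us @ y # vs))"
    using assms(1)
  proof (induction us arbitrary: \<phi>)
    case Nil
    have *: "\<phi> ((v + s c w) # u) = \<phi> (v # u) + t c (\<phi> (w # u))" for u v w
      using multilinD[OF Nil, of "[]"] by simp
    have "b ((x + s c y) # u) = b (x # u) + s c (b (y # u))" for u
      using multilinD[OF assms(2), of "[]"] by simp
    then show ?case
      by (simp add: * linD[OF assms(3)] split_sum_add split_sum_scale coder_add coder_scale
          additive.add[OF scale_additive] algebra_simps)
  next
    case (Cons z us)
    have "multilin s t (split_sum (\<lambda>u v. \<phi> (b (z # u) # v)))"
      by (intro multilin_split_sum multilin_Cons Cons.prems
          multilin_comp[OF multilin_Cons[OF assms(2)] multilin_lin_hd[OF Cons.prems]])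
    note multilinD[OF this, of us x c y vs]
    moreover note Cons.IH[OF multilin_Cons[OF Cons.prems], of "e z"]
    ultimately show ?case
      by (simp add: additive.add[OF scale_additive] algebra_simps)
  qed
qed

lemma homot_scale: "homot h p e (\<lambda>zs. t c (\<phi> zs)) xs = t c (homot h p e \<phi> xs)"
  by (simp add: homot_additive[OF scale_additive])

lemma multilin_homot:
  assumes "multilin s t \<phi>" "lin s s h" "lin s s p" "lin s s e"
  shows "multilin s t (homot h p e \<phi>)"
proof (rule multilinI)
  fix us vs x y c
  show "homot h p e \<phi> (us @ (x + s c y) # vs)
      = homot h p e \<phi> (us @ x # vs) + t c (homot h p e \<phi> (us @ y # vs))"
    using assms(1)
  proof (induction us arbitrary: \<phi>)
    case Nil
    have *: "\<phi> ((v + s c w) # u) = \<phi> (v # u) + t c (\<phi> (w # u))" for u v w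
      using multilinD[OF Nil, of "[]"] by simp
    show ?case
      by (simp add: * linD[OF assms(2)] linD[OF assms(4)] homot_add homot_scale
          additive.add[OF scale_additive] algebra_simps)
  next
    case (Cons z us)
    note Cons.IH[OF multilin_Cons[OF Cons.prems], of "e z"]
    moreover have "\<phi> (h z # map p us @ (p x + s c (p y)) # map p vs)
       = \<phi> (h z # map p us @ p x # map p vs) + t c (\<phi> (h z # map p us @ p y # map p vs))"
      using multilinD[OF Cons.prems, of "h z # map p us"] by simp
    ultimately show ?case
      by (simp add: linD[OF assms(3)] additive.add[OF scale_additive] algebra_simps)
  qed
qed

end

lemma pull_aux_scale:
  assumes "vector_space t"
  shows "pull_aux f us (\<lambda>zs. t c (\<phi> zs)) xs = t c (pull_aux f us \<phi> xs)"
  by (simp add: pull_aux_additive[OF scale_additive[OF assms assms]])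

lemma multilin_pull:
  fixes s :: "'k::field \<Rightarrow> 'a::ab_group_add \<Rightarrow> 'a" and t :: "'k \<Rightarrow> 'c::ab_group_add \<Rightarrow> 'c"
    and r :: "'k \<Rightarrow> 'b::ab_group_add \<Rightarrow> 'b"
  assumes "vector_space t" "multilin s r f" "multilin r t \<phi>"
  shows "multilin s t (pull f \<phi>)"
proof -
  note ta = additive.add[OF scale_additive[OF assms(1) assms(1)]]
    additive.zero[OF scale_additive[OF assms(1) assms(1)]]
  have 1: "pull_aux f (u1 @ (x + s c y) # u2) \<phi> xs
      = pull_aux f (u1 @ x # u2) \<phi> xs + t c (pull_aux f (u1 @ y # u2) \<phi> xs)"
    if "multilin r t \<phi>" for u1 u2 x y c xs \<phi>
    using that
  proof (induction xs arbitrary: u2 \<phi>)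
    case (Cons z xs)
    have *: "\<phi> ((v + r c w) # u) = \<phi> (v # u) + t c (\<phi> (w # u))" for u v w
      using multilinD[OF Cons.prems, of "[]"] by simp
    show ?case
      using Cons.IH[of \<phi> "u2 @ [z]"] Cons.prems
      by (simp add: multilinD[OF assms(2)] * pull_aux_add pull_aux_scale[OF assms(1)] ta algebra_simps)
  qed (simp add: ta)
  have 2: "pull_aux f ws \<phi> (us @ (x + s c y) # vs)
      = pull_aux f ws \<phi> (us @ x # vs) + t c (pull_aux f ws \<phi> (us @ y # vs))"
    if "multilin r t \<phi>" for us vs x y c ws \<phi>
    using that
  proof (induction us arbitrary: ws \<phi>)
    case Nil
    have *: "\<phi> ((v + r c w) # u) = \<phi> (v # u) + t c (\<phi> (w # u))" for u v w
      using multilinD[OF Nil, of "[]"] by simp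
    show ?case
      using 1[OF Nil, of ws x c y "[]" vs]
      by (simp add: multilinD[OF assms(2), of _ _ _ _ "[]"] * pull_aux_add
          pull_aux_scale[OF assms(1)] ta algebra_simps)
  next
    case (Cons z us)
    show ?case
      using Cons.IH[OF Cons.prems, of "ws @ [z]"] Cons.IH[OF multilin_Cons[OF Cons.prems], of "[]"]
      by (simp add: ta algebra_simps)
  qed
  show ?thesis using 2[OF assms(3), of "[]"] by (simp add: multilin_def pull_def)
qed

lemma multilin_minus_mem_map:
  assumes "vector_space s" "vector_space t" "multilin s t \<phi>"
  shows "\<phi> (us @ (- x) # vs) = - \<phi> (us @ x # vs)"
  using additive.minus[OF multilin_additive[OF assms]] .

subsection \<open>Identities for the bar differential\<close>

locale shifted_space = vector_space s
  for s :: "'k::field \<Rightarrow> 'a::ab_group_add \<Rightarrow> 'a" +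
  fixes e :: "'a \<Rightarrow> 'a"
  assumes lin_e: "lin s s e" and e_e [simp]: "e (e x) = x"
begin

lemma vs_s: "vector_space s" ..

lemma additive_e: "additive e"
  by (rule lin_additive[OF vs_s vs_s lin_e])

lemmas e_minus [simp] = additive.minus[OF additive_e]
lemmas e_zero [simp] = additive.zero[OF additive_e]
lemmas e_add = additive.add[OF additive_e]

lemma map_e_e [simp]: "map e (map e xs) = xs"
  by (simp add: map_idI)

lemma map_e_comp_e [simp]: "map (e \<circ> e) xs = xs"
  by (simp add: map_idI)

text \<open>The square of an odd coderivation is a coderivation, hence determined by its component
  \<open>coder b e b\<close>, the A_infinity relation. Concretely, nested blocks combine to that
  relation and disjoint blocks cancel in pairs.\<close>

lemma coder_coder:
  fixes t :: "'k \<Rightarrow> 'c::ab_group_add \<Rightarrow> 'c"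
  assumes t: "vector_space t" and \<phi>: "multilin s t \<phi>" and b: "multilin s s b"
    and odd: "\<And>xs. e (b xs) = - b (map e xs)" and bb: "\<And>xs. coder b e b xs = 0"
  shows "coder b e (coder b e \<phi>) xs = 0"
  using \<phi>
proof (induction xs arbitrary: \<phi>)
  case (Cons x xs)
  note \<phi> = Cons.prems
  note zero = multilin_0_hd[OF vs_s t \<phi>]
  define K where "K u v = \<phi> (b (e x # u) # v)" for u v
  have "coder b e (coder b e \<phi>) (x # xs) =
      split_sum (\<lambda>us vs. split_sum (\<lambda>v w. \<phi> (b (b (x # us) # v) # w)) vs
        + coder b e (\<lambda>z. \<phi> (e (b (x # us)) # z)) vs) xs
      + coder b e (\<lambda>zs. split_sum K zs + coder b e (\<lambda>z. \<phi> (x # z)) zs) xs"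
    by (simp add: K_def[abs_def])
  also have "\<dots> = split_sum (\<lambda>us vs. split_sum (\<lambda>v w. \<phi> (b (b (x # us) # v) # w)) vs) xs
      + split_sum (\<lambda>us vs. coder b e (\<lambda>z. \<phi> (e (b (x # us)) # z)) vs) xs
      + coder b e (split_sum K) xs"
    using Cons.IH[OF multilin_Cons[OF \<phi>]] by (simp add: coder_add split_sum_add)
  also have "coder b e (split_sum K) xs =
      split_sum (\<lambda>us vs. \<phi> (coder b e (\<lambda>u. b (e x # u)) us # vs)
        - coder b e (\<lambda>z. \<phi> (e (b (x # us)) # z)) vs) xs"
    unfolding coder_split_sum
  proof (rule split_sum_cong)
    fix us vs
    have "coder b e (\<lambda>u. K u vs) us = \<phi> (coder b e (\<lambda>u. b (e x # u)) us # vs)"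
      unfolding K_def by (rule coder_additive[OF multilin_additive_hd[OF vs_s t \<phi>], symmetric])
    \<comment> \<open>Two disjoint blocks: oddness of \<open>b\<close> turns
      \<open>b (e x # map e us)\<close> into minus \<open>e (b (x # us))\<close>, so these terms
      cancel those in which the blocks are contracted in the other order.\<close>
    moreover have "K (map e us) = (\<lambda>z. - \<phi> (e (b (x # us)) # z))"
      unfolding K_def using odd[of "x # us"] by (simp add: multilin_minus_hd[OF vs_s t \<phi>])
    ultimately show "coder b e (\<lambda>u. K u vs) us + coder b e (K (map e us)) vs =
        \<phi> (coder b e (\<lambda>u. b (e x # u)) us # vs) - coder b e (\<lambda>z. \<phi> (e (b (x # us)) # z)) vs"
      by (simp add: coder_minus)
  qed
  also have "split_sum (\<lambda>us vs. split_sum (\<lambda>v w. \<phi> (b (b (x # us) # v) # w)) vs) xs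
     = split_sum (\<lambda>us w. \<phi> (split_sum (\<lambda>u v. b (b (x # u) # v)) us # w)) xs"
    unfolding split_sum_assoc[symmetric]
    by (rule split_sum_cong)
      (rule split_sum_additive[OF multilin_additive_hd[OF vs_s t \<phi>], symmetric])
  finally have "coder b e (coder b e \<phi>) (x # xs) =
    split_sum (\<lambda>us w. \<phi> (coder b e b (x # us) # w)) xs"
    by (simp add: split_sum_add split_sum_diff multilin_add_hd[OF vs_s t \<phi>])
  then show ?case by (simp only: bb zero split_sum_zero)
qed simp

lemma coder_map_e:
  fixes t :: "'k \<Rightarrow> 'c::ab_group_add \<Rightarrow> 'c"
  assumes t: "vector_space t" and \<phi>: "multilin s t \<phi>"
    and odd: "\<And>xs. e (b xs) = - b (map e xs)"
  shows "coder b e (\<lambda>zs. \<phi> (map e zs)) xs = - coder b e \<phi> (map e xs)"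
  using \<phi>
proof (induction xs arbitrary: \<phi>)
  case (Cons x xs)
  show ?case
    using Cons.IH[OF multilin_Cons[OF Cons.prems], of "e (e x)"]
    by (simp add: odd multilin_minus_hd[OF vs_s t Cons.prems] split_sum_map split_sum_minus)
qed simp

lemma homot_map_e:
  fixes t :: "'k \<Rightarrow> 'c::ab_group_add \<Rightarrow> 'c"
  assumes t: "vector_space t" and \<phi>: "multilin s t \<phi>"
    and odd: "\<And>x. e (h x) = - h (e x)" and p: "\<And>x. e (p x) = p (e x)"
  shows "homot h p e (\<lambda>zs. \<phi> (map e zs)) xs = - homot h p e \<phi> (map e xs)"
  using \<phi>
proof (induction xs arbitrary: \<phi>)
  case (Cons x xs)
  show ?case
    using Cons.IH[OF multilin_Cons[OF Cons.prems], of "e (e x)"]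
    by (simp add: odd p comp_def multilin_minus_hd[OF vs_s t Cons.prems])
qed simp

text \<open>An empty first block contributes nothing because \<open>f [] = 0\<close>; admitting it
  gives the sum the shape to which \<open>coder_split_sum\<close> and \<open>homot_split_sum\<close>
  apply.\<close>

lemma pull_eq_split_sum:
  fixes t :: "'k \<Rightarrow> 'c::ab_group_add \<Rightarrow> 'c"
  assumes "vector_space t" "multilin s t \<phi>" "f [] = 0" "xs \<noteq> []"
  shows "pull f \<phi> xs = split_sum (\<lambda>us. pull f (\<lambda>zs. \<phi> (f us # zs))) xs"
  using assms(3,4) multilin_0_hd[OF vs_s assms(1,2)]
  by (cases xs) (auto simp: pull_Cons pull_zero)

lemma coder_eq_split_sum:
  fixes t :: "'k \<Rightarrow> 'c::ab_group_add \<Rightarrow> 'c"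
  assumes "vector_space t" "multilin s t \<phi>" "b [] = 0"
  shows "coder b e \<phi> xs = split_sum (\<lambda>us vs. \<phi> (b us # vs)) xs
     + (case xs of [] \<Rightarrow> 0 | x # xs \<Rightarrow> coder b e (\<lambda>zs. \<phi> (e x # zs)) xs)"
  using assms(3) multilin_0_hd[OF vs_s assms(1,2)] by (cases xs) auto

text \<open>A coalgebra map commutes with the bar differentials once it does so after projection to
  single letters, which is \<open>f_eq\<close>. On a longer word the differential acts on the first
  block of \<open>f\<close>, where \<open>f_eq\<close> applies, or on the shorter rest.\<close>

lemma coder_pull:
  fixes t :: "'k \<Rightarrow> 'c::ab_group_add \<Rightarrow> 'c"
  assumes t: "vector_space t" and \<phi>: "multilin s t \<phi>" and f: "multilin s s f" "f [] = 0" "b' [] = 0"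
    and even: "\<And>xs. e (f xs) = f (map e xs)"
    and f_eq: "\<And>xs. coder b e f xs = pull f b' xs"
  shows "coder b e (pull f \<phi>) xs = pull f (coder b' e \<phi>) xs"
  using \<phi>
proof (induction xs arbitrary: \<phi> rule: length_induct)
  case (1 xs)
  note \<phi> = \<open>multilin s t \<phi>\<close>
  show ?case
  proof (cases xs)
    case Nil then show ?thesis by simp
  next
    case (Cons x xs')
    define K where "K us vs = pull f (\<lambda>zs. \<phi> (f us # zs)) vs" for us vs
    have K0: "K [] = (\<lambda>vs. 0)"
      using f multilin_0_hd[OF vs_s t \<phi>] by (simp add: K_def[abs_def] pull_zero fun_eq_iff)
    have 2: "coder b e (\<lambda>u. K u vs) us = pull f (\<lambda>y. pull f (\<lambda>zs. \<phi> (b' y # zs)) vs) us" for us vs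
    proof -
      have ad: "additive (\<lambda>y. pull f (\<lambda>zs. \<phi> (y # zs)) vs)"
        by (simp add: additive_def multilin_add_hd[OF vs_s t \<phi>] pull_add)
      show ?thesis unfolding K_def
        using coder_additive[OF ad, of b e f us] pull_additive[OF ad, of f b' us] f_eq by simp
    qed
    \<comment> \<open>The induction hypothesis needs \<open>vs\<close> to be shorter than
      \<open>xs\<close>; for empty \<open>us\<close> the term is zero because
      \<open>f [] = 0\<close>.\<close>
    have 3: "coder b e (K (map e us)) vs = pull f (coder b' e (\<lambda>zs. \<phi> (e (f us) # zs))) vs"
      if "us @ vs = xs" for us vs
    proof (cases "us = []")
      case True
      then show ?thesis
        using f multilin_0_hd[OF vs_s t \<phi>] by (simp add: K0 coder_zero pull_zero)
    next
      case False
      then have "length vs < length xs" using that by auto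
      then show ?thesis
        unfolding K_def even[symmetric] using 1 multilin_Cons[OF \<phi>] by blast
    qed
    have "coder b e (pull f \<phi>) xs = coder b e (split_sum K) xs"
      unfolding K_def by (rule coder_cong) (rule pull_eq_split_sum[of t \<phi> f, OF t \<phi> f(2)])
    also have "\<dots> = split_sum (\<lambda>us vs. coder b e (\<lambda>u. K u vs) us + coder b e (K (map e us)) vs) xs"
      by (rule coder_split_sum)
    also have "\<dots> = split_sum (\<lambda>us vs. pull f (\<lambda>y. pull f (\<lambda>zs. \<phi> (b' y # zs)) vs) us
        + pull f (coder b' e (\<lambda>zs. \<phi> (e (f us) # zs))) vs) xs"
      by (rule split_sum_cong) (simp only: 2 3)
    also have "\<dots> = pull f (split_sum (\<lambda>us vs. \<phi> (b' us # vs))) xs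
        + split_sum (\<lambda>us vs. pull f (coder b' e (\<lambda>zs. \<phi> (e (f us) # zs))) vs) xs"
      by (simp add: split_sum_add pull_split_sum)
    also have "split_sum (\<lambda>us vs. pull f (coder b' e (\<lambda>zs. \<phi> (e (f us) # zs))) vs) xs
      = pull f (\<lambda>xs. case xs of [] \<Rightarrow> 0 | x # xs \<Rightarrow> coder b' e (\<lambda>zs. \<phi> (e x # zs)) xs) xs"
      using f multilin_0_hd[OF vs_s t \<phi>] by (simp add: Cons pull_Cons coder_zero pull_zero)
    also have "pull f (split_sum (\<lambda>us vs. \<phi> (b' us # vs))) xs + \<dots> = pull f (coder b' e \<phi>) xs"
      unfolding pull_add[symmetric] using coder_eq_split_sum[OF t \<phi>, of b'] f(3)
      by (intro arg_cong2[where f = "pull f"] ext) auto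
    finally show ?thesis .
  qed
qed

text \<open>On letters \<open>p x\<close> every block of length at least two is killed, so only the
  subdivision into single letters survives.\<close>

lemma pull_map:
  assumes "\<And>x. f [p x] = p x" "\<And>xs. length xs \<ge> 2 \<Longrightarrow> f (map p xs) = 0"
    "vector_space t" "multilin s t \<phi>"
  shows "pull f \<phi> (map p xs) = \<phi> (map p xs)"
  using assms(4)
proof (induction xs arbitrary: \<phi>)
  case (Cons x xs)
  note \<phi> = Cons.prems
  have "pull f \<phi> (map p (x # xs))
      = split_sum (\<lambda>us vs. pull f (\<lambda>zs. \<phi> (f (map p (x # us)) # zs)) (map p vs)) xs"
    by (simp add: pull_Cons split_sum_map)
  also have "\<dots> = pull f (\<lambda>zs. \<phi> (p x # zs)) (map p xs)"
    by (subst split_sum_only_Nil)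
      (auto simp del: list.map(2) simp add: assms(1,2) multilin_0_hd[OF vs_s assms(3) \<phi>] pull_zero
        Suc_le_eq list.map(2)[of p _ "[]"])
  finally show ?case using Cons.IH[OF multilin_Cons[OF \<phi>]] by simp
qed simp

end

subsection \<open>Homotopy transfer\<close>

lemma split_sum_replace:
  assumes "\<And>u1 u2 v. K (u1 @ q x # u2) v = K (u1 @ x # u2) v"
    "\<And>u1 u2 v. K v (u1 @ q x # u2) = K v (u1 @ x # u2)"
  shows "split_sum K (us @ q x # vs) = split_sum K (us @ x # vs)"
  using assms
proof (induction us arbitrary: K)
  case Nil
  have "K (q x # u) = K (x # u)" for u using Nil(1)[of "[]"] by auto
  moreover have "K [] (q x # u) = K [] (x # u)" for u using Nil(2)[of _ "[]"] by auto
  ultimately show ?case by simp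
next
  case (Cons z us)
  have "split_sum (\<lambda>u. K (z # u)) (us @ q x # vs) = split_sum (\<lambda>u. K (z # u)) (us @ x # vs)"
    by (rule Cons.IH) (use Cons.prems(1)[of "z # _"] Cons.prems(2) in auto)
  then show ?case using Cons.prems(2)[of _ "z # us"] by simp
qed

text \<open>The letter \<open>q x\<close> lies in the contracted block, or to its right, or to its
  left, where it is hit by \<open>e\<close>; in the last case \<open>e\<close> and \<open>q\<close>
  are exchanged.\<close>

lemma coder_replace:
  assumes b: "\<And>us x vs. b (us @ q x # vs) = b (us @ x # vs)"
    and "\<And>us x vs. \<phi> (us @ q x # vs) = \<phi> (us @ x # vs)" and e: "\<And>x. e (q x) = q (e x)"
  shows "coder b e \<phi> (us @ q x # vs) = coder b e \<phi> (us @ x # vs)"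
  using assms(2)
proof (induction us arbitrary: \<phi>)
  case Nil
  show ?case using b[of "[]"] Nil[of "[]"] by (simp add: e)
next
  case (Cons z us)
  have "split_sum (\<lambda>us vs. \<phi> (b (z # us) # vs)) (us @ q x # vs)
      = split_sum (\<lambda>us vs. \<phi> (b (z # us) # vs)) (us @ x # vs)"
    by (rule split_sum_replace) (use b[of "z # _"] Cons.prems[of "_ # _"] in auto)
  moreover have "coder b e (\<lambda>zs. \<phi> (e z # zs)) (us @ q x # vs) = coder b e (\<lambda>zs. \<phi> (e z # zs)) (us @ x # vs)"
    by (rule Cons.IH) (use Cons.prems[of "_ # _"] in auto)
  ultimately show ?case by simp
qed

text \<open>
  The projection \<open>q\<close> onto the span of the components corrects for the ambient type, on which
  all operations are total: contraction identities hold with \<open>q\<close> in place of the identity.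
\<close>

locale transfer_data = shifted_space s e
  for s :: "'k::field \<Rightarrow> 'a::ab_group_add \<Rightarrow> 'a" and e :: "'a \<Rightarrow> 'a" +
  fixes b :: "'a list \<Rightarrow> 'a" and h p q :: "'a \<Rightarrow> 'a"
  assumes multilin_b: "multilin s s b" and b_Nil: "b [] = 0"
    and odd_b: "e (b xs) = - b (map e xs)"
    and coder_b: "coder b e b xs = 0"
    and b_q: "b (us @ q x # vs) = b (us @ x # vs)"
    and lin_h: "lin s s h" and lin_p: "lin s s p" and lin_q: "lin s s q"
    and h_e: "e (h x) = - h (e x)" and p_e: "e (p x) = p (e x)" and q_e: "e (q x) = q (e x)"
    and homotopy: "b [h x] + h (b [x]) = p x - q x"
    and p_d: "p (b [x]) = 0" and d_p: "b [p x] = 0"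
    and h_h: "h (h x) = 0" and h_p: "h (p x) = 0" and p_h: "p (h x) = 0" and p_p: "p (p x) = p x"
    and h_q: "h (q x) = h x" and p_q: "p (q x) = p x"
begin

text \<open>The bar differential is treated as a perturbation: \<open>b1\<close> is the differential
  of the tensor powers and \<open>b2\<close> collects the operations of higher arity.\<close>

definition b1 :: "'a list \<Rightarrow> 'a" where "b1 xs = (if length xs = 1 then b xs else 0)"
definition b2 :: "'a list \<Rightarrow> 'a" where "b2 xs = (if length xs \<noteq> 1 then b xs else 0)"

abbreviation D :: "('a list \<Rightarrow> 'c::ab_group_add) \<Rightarrow> 'a list \<Rightarrow> 'c" where "D \<equiv> coder b e"
abbreviation D1 :: "('a list \<Rightarrow> 'c::ab_group_add) \<Rightarrow> 'a list \<Rightarrow> 'c" where "D1 \<equiv> coder b1 e"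
abbreviation D2 :: "('a list \<Rightarrow> 'c::ab_group_add) \<Rightarrow> 'a list \<Rightarrow> 'c" where "D2 \<equiv> coder b2 e"
abbreviation Hm :: "('a list \<Rightarrow> 'c::ab_group_add) \<Rightarrow> 'a list \<Rightarrow> 'c" where "Hm \<equiv> homot h p e"

lemma zero_simps [simp]: "h 0 = 0" "p 0 = 0" "q 0 = 0"
  using additive.zero[OF lin_additive[OF vs_s vs_s lin_h]]
    additive.zero[OF lin_additive[OF vs_s vs_s lin_p]]
    additive.zero[OF lin_additive[OF vs_s vs_s lin_q]] by auto

lemma b2_single [simp]: "b2 [x] = 0" and b1_Nil [simp]: "b1 [] = 0"
  and b1_single [simp]: "b1 [x] = b [x]" and b1_two [simp]: "b1 (x # y # xs) = 0"
  and b2_two [simp]: "b2 (x # y # xs) = b (x # y # xs)"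
  by (auto simp: b1_def b2_def b_Nil)

lemma multilin_if_length:
  assumes "vector_space t" "multilin s t \<phi>"
  shows "multilin s t (\<lambda>xs. if P (length xs) then \<phi> xs else 0)"
  using multilinD[OF assms(2)] additive.zero[OF scale_additive[OF assms(1) assms(1)]]
  by (simp add: multilin_def)

lemma multilin_b1: "multilin s s b1" and multilin_b2: "multilin s s b2"
  using multilin_if_length[OF vs_s multilin_b, of "\<lambda>n. n = 1"]
    multilin_if_length[OF vs_s multilin_b, of "\<lambda>n. n \<noteq> 1"]
  by (simp_all add: b1_def[abs_def] b2_def[abs_def])

lemma odd_b1: "e (b1 xs) = - b1 (map e xs)" and odd_b2: "e (b2 xs) = - b2 (map e xs)"
  by (auto simp: b1_def b2_def odd_b)

lemma D_eq:
  fixes t :: "'k \<Rightarrow> 'c::ab_group_add \<Rightarrow> 'c"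
  assumes t: "vector_space t" and \<phi>: "multilin s t \<phi>"
  shows "D \<phi> xs = D1 \<phi> xs + D2 \<phi> xs"
  using \<phi>
proof (induction xs arbitrary: \<phi>)
  case (Cons x xs)
  have "b (x # us) = b1 (x # us) + b2 (x # us)" for us by (auto simp: b1_def b2_def)
  then show ?case using Cons.IH[OF multilin_Cons[OF Cons.prems]]
    by (simp add: multilin_add_hd[OF vs_s t Cons.prems] split_sum_add)
qed simp

lemma D1_Cons:
  fixes t :: "'k \<Rightarrow> 'c::ab_group_add \<Rightarrow> 'c"
  assumes t: "vector_space t" and \<phi>: "multilin s t \<phi>"
  shows "D1 \<phi> (x # xs) = \<phi> (b [x] # xs) + D1 (\<lambda>zs. \<phi> (e x # zs)) xs"
  using split_sum_only_Nil[of xs "\<lambda>us vs. \<phi> (b1 (x # us) # vs)"]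
  by (auto simp: b1_def multilin_0_hd[OF vs_s t \<phi>])

text \<open>A block of length at least two shrinks to one letter, so \<open>D2 \<phi>\<close> sees
  \<open>\<phi>\<close> on strictly shorter words only. This drives the recursion for the
  transferred morphism.\<close>

lemma D2_cong:
  fixes t :: "'k \<Rightarrow> 'c::ab_group_add \<Rightarrow> 'c"
  assumes t: "vector_space t" and "multilin s t \<phi>" "multilin s t \<psi>"
    and "\<And>zs. length zs < length xs \<Longrightarrow> \<phi> zs = \<psi> zs"
  shows "D2 \<phi> xs = D2 \<psi> xs"
  using assms(2-)
proof (induction xs arbitrary: \<phi> \<psi>)
  case (Cons x xs)
  have "\<phi> (b2 (x # us) # vs) = \<psi> (b2 (x # us) # vs)" if "us @ vs = xs" for us vs
    using that Cons.prems(3)[of "b2 (x # us) # vs"]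
    by (cases us) (auto simp: multilin_0_hd[OF vs_s t Cons.prems(1)] multilin_0_hd[OF vs_s t Cons.prems(2)])
  then have "split_sum (\<lambda>us vs. \<phi> (b2 (x # us) # vs)) xs = split_sum (\<lambda>us vs. \<psi> (b2 (x # us) # vs)) xs"
    by (intro split_sum_cong)
  moreover have "D2 (\<lambda>zs. \<phi> (e x # zs)) xs = D2 (\<lambda>zs. \<psi> (e x # zs)) xs"
    by (rule Cons.IH) (auto intro: multilin_Cons Cons.prems)
  ultimately show ?case by simp
qed simp

section \<open>The contraction lifted to words\<close>

lemma homot_map_p:
  fixes t :: "'k \<Rightarrow> 'c::ab_group_add \<Rightarrow> 'c"
  assumes t: "vector_space t" and \<phi>: "multilin s t \<phi>"
  shows "Hm \<phi> (map p xs) = 0"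
  using \<phi>
proof (induction xs arbitrary: \<phi>)
  case (Cons x xs)
  then show ?case using Cons.IH[OF multilin_Cons[OF Cons.prems], of "e (p x)"]
    by (simp add: h_p multilin_0_hd[OF vs_s t Cons.prems])
qed simp

lemma homot_comp_p:
  fixes t :: "'k \<Rightarrow> 'c::ab_group_add \<Rightarrow> 'c"
  assumes t: "vector_space t" and \<phi>: "multilin s t \<phi>"
  shows "Hm (\<lambda>zs. \<phi> (map p zs)) xs = 0"
  using \<phi>
proof (induction xs arbitrary: \<phi>)
  case (Cons x xs)
  then show ?case using Cons.IH[OF multilin_Cons[OF Cons.prems], of "p (e x)"]
    by (simp add: p_h multilin_0_hd[OF vs_s t Cons.prems])
qed simp

lemma D1_map_p:
  fixes t :: "'k \<Rightarrow> 'c::ab_group_add \<Rightarrow> 'c"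
  assumes t: "vector_space t" and \<phi>: "multilin s t \<phi>"
  shows "D1 \<phi> (map p xs) = 0"
  using \<phi>
proof (induction xs arbitrary: \<phi>)
  case (Cons x xs)
  then show ?case using Cons.IH[OF multilin_Cons[OF Cons.prems], of "e (p x)"]
    by (simp del: coder.simps add: D1_Cons[OF t Cons.prems] d_p multilin_0_hd[OF vs_s t Cons.prems])
qed simp

lemma D1_comp_p:
  fixes t :: "'k \<Rightarrow> 'c::ab_group_add \<Rightarrow> 'c"
  assumes t: "vector_space t" and \<phi>: "multilin s t \<phi>"
  shows "D1 (\<lambda>zs. \<phi> (map p zs)) xs = 0"
  using \<phi>
proof (induction xs arbitrary: \<phi>)
  case (Cons x xs)
  note m = multilin_map[OF Cons.prems lin_p]
  show ?case using Cons.IH[OF multilin_Cons[OF Cons.prems], of "p (e x)"]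
    by (simp del: coder.simps add: D1_Cons[OF t m] p_d multilin_0_hd[OF vs_s t Cons.prems])
qed simp

text \<open>Two homotopies at the same letter give \<open>h h = 0\<close>. At different letters the
  one on the right meets the \<open>p\<close> of the other, as \<open>h p\<close> or as
  \<open>p h\<close>, and both are zero.\<close>

lemma homot_homot:
  fixes t :: "'k \<Rightarrow> 'c::ab_group_add \<Rightarrow> 'c"
  assumes t: "vector_space t" and \<phi>: "multilin s t \<phi>"
  shows "Hm (Hm \<phi>) xs = 0"
  using \<phi>
proof (induction xs arbitrary: \<phi>)
  case (Cons x xs)
  note \<phi> = Cons.prems
  have "Hm (Hm \<phi>) (x # xs) = \<phi> (h (h x) # map p (map p xs)) + Hm (\<lambda>zs. \<phi> (e (h x) # zs)) (map p xs)
     + (Hm (\<lambda>zs. \<phi> (h (e x) # map p zs)) xs + Hm (Hm (\<lambda>zs. \<phi> (x # zs))) xs)"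
    by (simp add: homot_add)
  then show ?case
    using Cons.IH[OF multilin_Cons[OF \<phi>], of x] homot_map_p[OF t multilin_Cons[OF \<phi>]]
      homot_comp_p[OF t multilin_Cons[OF \<phi>]]
    by (simp add: h_h multilin_0_hd[OF vs_s t \<phi>])
qed simp

text \<open>Such a \<open>\<phi>\<close> does not distinguish \<open>x\<close> from
  \<open>q x\<close>; for it the assumption \<open>homotopy\<close>, which involves
  \<open>q\<close>, becomes a homotopy between \<open>p\<close> and the identity.\<close>

definition normal :: "('a list \<Rightarrow> 'c) \<Rightarrow> bool" where
  "normal \<phi> \<longleftrightarrow> (\<forall>us x vs. \<phi> (us @ q x # vs) = \<phi> (us @ x # vs))"

lemma normalD: "normal \<phi> \<Longrightarrow> \<phi> (us @ q x # vs) = \<phi> (us @ x # vs)"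
  by (simp add: normal_def)

lemma normal_Cons: "normal \<phi> \<Longrightarrow> normal (\<lambda>zs. \<phi> (x # zs))"
  unfolding normal_def by (metis append_Cons)

text \<open>The letter under \<open>h\<close> contributes the difference of \<open>p x\<close> and
  \<open>q x\<close> in front of \<open>map p xs\<close>; over all positions these differences
  telescope from \<open>xs\<close> to \<open>map p xs\<close>. A differential to the left of
  \<open>h\<close> cancels by parity, one to the right meets \<open>p\<close> and vanishes.\<close>

lemma homot_homotopy:
  fixes t :: "'k \<Rightarrow> 'c::ab_group_add \<Rightarrow> 'c"
  assumes t: "vector_space t" and \<phi>: "multilin s t \<phi>" "normal \<phi>"
  shows "D1 (Hm \<phi>) xs + Hm (D1 \<phi>) xs = \<phi> (map p xs) - \<phi> xs"
  using \<phi>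
proof (induction xs arbitrary: \<phi>)
  case (Cons x xs)
  note \<phi> = Cons.prems(1)
  note hom = multilin_homot[OF vs_s t \<phi> lin_h lin_p lin_e]
  have 1: "D1 (Hm \<phi>) (x # xs) = \<phi> (h (b [x]) # map p xs) + Hm (\<lambda>zs. \<phi> (e (b [x]) # zs)) xs
      + D1 (\<lambda>zs. \<phi> (h (e x) # map p zs)) xs + D1 (Hm (\<lambda>zs. \<phi> (x # zs))) xs"
    by (simp del: coder.simps add: D1_Cons[OF t hom] coder_add algebra_simps)
  have 2: "Hm (D1 \<phi>) (x # xs) = \<phi> (b [h x] # map p xs) + D1 (\<lambda>zs. \<phi> (e (h x) # zs)) (map p xs)
      + Hm (\<lambda>zs. \<phi> (b [e x] # zs)) xs + Hm (D1 (\<lambda>zs. \<phi> (x # zs))) xs"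
    by (simp del: coder.simps add: D1_Cons[OF t \<phi>] homot_add algebra_simps)
  have 3: "Hm (\<lambda>zs. \<phi> (e (b [x]) # zs)) xs + Hm (\<lambda>zs. \<phi> (b [e x] # zs)) xs = 0"
    by (simp add: odd_b multilin_minus_hd[OF vs_s t \<phi>] homot_minus)
  have 4: "\<phi> (h (b [x]) # map p xs) + \<phi> (b [h x] # map p xs) = \<phi> (p x # map p xs) - \<phi> (x # map p xs)"
    using homotopy[of x] normalD[OF Cons.prems(2), of "[]"]
    by (simp add: multilin_add_hd[OF vs_s t \<phi>, symmetric] multilin_diff_hd[OF vs_s t \<phi>] add.commute)
  have 5: "D1 (\<lambda>zs. \<phi> (h (e x) # map p zs)) xs = 0" "D1 (\<lambda>zs. \<phi> (e (h x) # zs)) (map p xs) = 0"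
    using D1_map_p[OF t multilin_Cons[OF \<phi>]] D1_comp_p[OF t multilin_Cons[OF \<phi>]] by auto
  have "D1 (Hm \<phi>) (x # xs) + Hm (D1 \<phi>) (x # xs)
      = (\<phi> (h (b [x]) # map p xs) + \<phi> (b [h x] # map p xs))
      + (Hm (\<lambda>zs. \<phi> (e (b [x]) # zs)) xs + Hm (\<lambda>zs. \<phi> (b [e x] # zs)) xs)
      + (D1 (Hm (\<lambda>zs. \<phi> (x # zs))) xs + Hm (D1 (\<lambda>zs. \<phi> (x # zs))) xs)"
    unfolding 1 2 5 by (simp add: algebra_simps)
  also have "\<dots> = \<phi> (p x # map p xs) - \<phi> (x # xs)"
    unfolding 3 4 Cons.IH[OF multilin_Cons[OF \<phi>] normal_Cons[OF Cons.prems(2)], of x] by simp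
  finally show ?case by simp
qed simp

section \<open>The transferred morphism and operations\<close>

definition p1 :: "'a list \<Rightarrow> 'a" where
  "p1 xs = (if length xs = 1 then p (hd xs) else 0)"

text \<open>
  The transferred morphism solves \<open>\<phi> = p1 + Hm (D2 \<phi>)\<close>. On words of length \<open>m\<close> the right-hand
  side depends only on shorter words, so \<open>m\<close> iterations reach the fixed point.
\<close>

primrec trans_iter :: "nat \<Rightarrow> 'a list \<Rightarrow> 'a" where
  "trans_iter 0 = p1"
| "trans_iter (Suc k) = (\<lambda>xs. p1 xs + Hm (D2 (trans_iter k)) xs)"

definition trans_mor :: "'a list \<Rightarrow> 'a" where
  "trans_mor xs = trans_iter (length xs) xs"

definition trans_op :: "'a list \<Rightarrow> 'a" where
  "trans_op xs = D2 trans_mor (map p xs)"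

lemma multilin_p1: "multilin s s p1"
  unfolding multilin_def p1_def
proof (intro allI)
  fix us vs x y c
  have [simp]: "s c 0 = 0" by (rule additive.zero[OF scale_additive[OF vs_s vs_s]])
  show "(if length (us @ (x + s c y) # vs) = 1 then p (hd (us @ (x + s c y) # vs)) else 0) =
       (if length (us @ x # vs) = 1 then p (hd (us @ x # vs)) else 0) +
       s c (if length (us @ y # vs) = 1 then p (hd (us @ y # vs)) else 0)"
    using linD[OF lin_p] by (cases us) auto
qed

lemma multilin_D2:
  fixes t :: "'k \<Rightarrow> 'c::ab_group_add \<Rightarrow> 'c"
  assumes t: "vector_space t" and \<phi>: "multilin s t \<phi>"
  shows "multilin s t (D2 \<phi>)"
  by (rule multilin_coder[OF vs_s t \<phi> multilin_b2 lin_e])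

lemma multilin_Hm:
  fixes t :: "'k \<Rightarrow> 'c::ab_group_add \<Rightarrow> 'c"
  assumes t: "vector_space t" and \<phi>: "multilin s t \<phi>"
  shows "multilin s t (Hm \<phi>)"
  by (rule multilin_homot[OF vs_s t \<phi> lin_h lin_p lin_e])

lemma multilin_iter: "multilin s s (trans_iter k)"
  by (induction k)
    (auto intro!: multilin_p1 multilin_plus[OF vs_s vs_s] multilin_Hm[OF vs_s] multilin_D2[OF vs_s])

text \<open>Since \<open>D2\<close> looks at shorter words only, each iteration settles one more
  length. The start \<open>p1\<close> is already final on words of length at most one, hence the
  \<open>Suc\<close>.\<close>

lemma iter_stable: "length xs \<le> Suc k \<Longrightarrow> trans_iter (Suc k) xs = trans_iter k xs"
proof (induction k arbitrary: xs)
  case 0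
  have "Hm (D2 (trans_iter 0)) xs = Hm (\<lambda>zs. 0) xs"
  proof (rule homot_cong)
    fix zs :: "'a list" assume "length zs = length xs"
    then have "D2 p1 zs = D2 (\<lambda>zs. 0) zs"
      using 0 by (intro D2_cong[OF vs_s multilin_p1 multilin_zero[OF vs_s vs_s]])
        (auto simp: p1_def)
    then show "D2 (trans_iter 0) zs = 0" by simp
  qed
  then show ?case by simp
next
  case (Suc k)
  have "Hm (D2 (trans_iter (Suc k))) xs = Hm (D2 (trans_iter k)) xs"
  proof (rule homot_cong)
    fix zs :: "'a list" assume "length zs = length xs"
    then show "D2 (trans_iter (Suc k)) zs = D2 (trans_iter k) zs"
      using Suc.prems
      by (intro D2_cong[OF vs_s multilin_iter multilin_iter] Suc.IH) simp
  qed
  then show ?case by (simp only: trans_iter.simps)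
qed

lemma iter_eq: "length xs \<le> Suc k \<Longrightarrow> trans_iter k xs = trans_mor xs"
proof (induction k)
  case 0
  then show ?case using iter_stable[of xs 0] by (cases xs) (auto simp: trans_mor_def)
next
  case (Suc k)
  show ?case
  proof (cases "length xs = Suc (Suc k)")
    case True
    then show ?thesis using iter_stable[of xs "Suc k"] by (simp only: trans_mor_def)
  next
    case False
    then show ?thesis using Suc iter_stable[of xs k] by simp
  qed
qed

lemma multilin_mor: "multilin s s trans_mor"
proof (rule multilinI)
  fix us vs x y c
  show "trans_mor (us @ (x + s c y) # vs) = trans_mor (us @ x # vs) + s c (trans_mor (us @ y # vs))"
    using multilinD[OF multilin_iter[of "length (us @ x # vs)"], of us x c y vs]
    by (simp del: trans_iter.simps add: trans_mor_def)
qed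

lemma mor_eq: "trans_mor xs = p1 xs + Hm (D2 trans_mor) xs"
proof -
  have "trans_mor xs = p1 xs + Hm (D2 (trans_iter (length xs))) xs"
    using iter_eq[of xs "Suc (length xs)"] by simp
  also have "Hm (D2 (trans_iter (length xs))) xs = Hm (D2 trans_mor) xs"
    by (intro homot_cong D2_cong[OF vs_s multilin_iter multilin_mor] iter_eq) simp
  finally show ?thesis .
qed

lemma mor_Nil: "trans_mor [] = 0"
  using mor_eq[of "[]"] by (simp add: p1_def)

lemma mor_single: "trans_mor [x] = p x"
  using mor_eq[of "[x]"] by (simp add: p1_def multilin_0_hd[OF vs_s vs_s multilin_mor])

lemma Hm_D2: "Hm (D2 trans_mor) = (\<lambda>xs. trans_mor xs - p1 xs)"
  using mor_eq by (auto simp: fun_eq_iff)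

lemma multilin_D2_mor: "multilin s s (D2 trans_mor)"
  by (rule multilin_D2[OF vs_s multilin_mor])

text \<open>Both summands of the fixed point equation are killed: \<open>p1\<close> because
  \<open>p h = 0\<close>, the other one because the homotopy squares to zero.\<close>

lemma Hm_mor: "Hm trans_mor xs = 0"
proof -
  have "Hm trans_mor xs = Hm p1 xs + Hm (Hm (D2 trans_mor)) xs"
    unfolding homot_add[symmetric] using mor_eq by (intro homot_cong) simp
  also have "Hm p1 xs = 0"
  proof (cases xs)
    case (Cons x xs')
    \<comment> \<open>Behind a first letter \<open>p1\<close> can be nonzero on the empty word only,
      and there the homotopy is zero by definition.\<close>
    have "(\<lambda>zs. p1 (e x # zs)) = (\<lambda>zs. if zs = [] then p (e x) else 0)"
      by (auto simp: p1_def fun_eq_iff)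
    moreover have "Hm (\<lambda>zs. if zs = [] then p (e x) else 0) xs' = 0"
      by (cases xs') (use homot_zero[of h p e] in auto)
    ultimately show ?thesis using Cons by (simp add: p1_def p_h)
  qed simp
  finally show ?thesis using homot_homot[OF vs_s multilin_D2_mor] by simp
qed

lemma mor_map_p: "trans_mor (map p xs) = p1 (map p xs)"
  using mor_eq[of "map p xs"] homot_map_p[OF vs_s multilin_D2_mor] by simp

text \<open>\<open>Hm\<close> and \<open>D2\<close> act on the arguments alone, so the values stay
  in the image of \<open>p\<close>, where those of \<open>p1\<close> lie.\<close>

lemma p_mor: "p (trans_mor xs) = trans_mor xs"
proof -
  note pa = lin_additive[OF vs_s vs_s lin_p]
  have "p (trans_iter k xs) = trans_iter k xs" for k
  proof (induction k arbitrary: xs)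
    case 0
    then show ?case by (auto simp: p1_def p_p)
  next
    case (Suc k)
    have "p (Hm (D2 (trans_iter k)) xs) = Hm (D2 (trans_iter k)) xs"
      by (simp add: homot_additive[OF pa] coder_additive[OF pa] Suc)
    then show ?case by (auto simp: additive.add[OF pa] p1_def p_p)
  qed
  then show ?thesis by (simp add: trans_mor_def)
qed

lemma even_mor: "e (trans_mor xs) = trans_mor (map e xs)"
proof -
  have "e (trans_iter k xs) = trans_iter k (map e xs)" for k
  proof (induction k arbitrary: xs)
    case 0
    then show ?case by (cases xs) (auto simp: p1_def p_e)
  next
    case (Suc k)
    have "e (Hm (D2 (trans_iter k)) xs) = Hm (\<lambda>zs. - D2 (trans_iter k) (map e zs)) xs"
      by (simp add: homot_additive[OF additive_e] coder_additive[OF additive_e] Suc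
          coder_map_e[of s _ b2, OF vs_s multilin_iter odd_b2])
    also have "\<dots> = Hm (D2 (trans_iter k)) (map e xs)"
      by (simp add: homot_minus
          homot_map_e[of s _ h p, OF vs_s multilin_D2[OF vs_s multilin_iter] h_e p_e])
    finally show ?case by (cases xs) (auto simp: e_add p1_def p_e)
  qed
  then show ?thesis by (simp add: trans_mor_def)
qed

text \<open>The homotopy acts either on the first block, where \<open>Hm_mor\<close> applies, or on
  the shorter rest.\<close>

lemma Hm_pull:
  fixes t :: "'k \<Rightarrow> 'c::ab_group_add \<Rightarrow> 'c"
  assumes t: "vector_space t" and \<phi>: "multilin s t \<phi>"
  shows "Hm (pull trans_mor \<phi>) xs = 0"
  using \<phi>
proof (induction xs arbitrary: \<phi> rule: length_induct)
  case (1 xs)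
  note \<phi> = \<open>multilin s t \<phi>\<close>
  define K where "K us vs = pull trans_mor (\<lambda>zs. \<phi> (trans_mor us # zs)) vs" for us vs
  show ?case
  proof (cases "xs = []")
    case False
    have "Hm (pull trans_mor \<phi>) xs = Hm (split_sum K) xs"
    proof (rule homot_cong)
      fix zs :: "'a list" assume "length zs = length xs"
      then have "zs \<noteq> []" using False by auto
      then show "pull trans_mor \<phi> zs = split_sum K zs"
        unfolding K_def by (rule pull_eq_split_sum[of t \<phi> trans_mor, OF t \<phi> mor_Nil])
    qed
    also have "\<dots> = 0"
      unfolding homot_split_sum
    proof (rule split_sum_eq_0)
      fix us vs assume uv: "us @ vs = xs"
      have ad: "additive (\<lambda>y. pull trans_mor (\<lambda>zs. \<phi> (y # zs)) (map p vs))"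
        by (simp add: additive_def multilin_add_hd[OF vs_s t \<phi>] pull_add)
      have "Hm (\<lambda>u. K u (map p vs)) us = 0"
        unfolding K_def using homot_additive[OF ad, of h p e trans_mor us] Hm_mor[of us]
          additive.zero[OF ad] by simp
      moreover have "Hm (K (map e us)) vs = 0"
      proof (cases "us = []")
        case True
        then show ?thesis by (simp add: K_def[abs_def] mor_Nil multilin_0_hd[OF vs_s t \<phi>])
      next
        case False
        then have "length vs < length xs" using uv by auto
        then show ?thesis unfolding K_def using 1 multilin_Cons[OF \<phi>] by blast
      qed
      ultimately show "Hm (\<lambda>u. K u (map p vs)) us + Hm (K (map e us)) vs = 0" by simp
    qed
    finally show ?thesis .
  qed simp
qed

lemma pull_mor_map_p:
  fixes t :: "'k \<Rightarrow> 'c::ab_group_add \<Rightarrow> 'c"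
  assumes t: "vector_space t" and \<phi>: "multilin s t \<phi>"
  shows "pull trans_mor \<phi> (map p xs) = \<phi> (map p xs)"
proof (rule pull_map[OF _ _ t \<phi>])
  show "trans_mor [p x] = p x" for x by (simp add: mor_single p_p)
  show "trans_mor (map p xs) = 0" if "2 \<le> length xs" for xs
    using that by (simp add: mor_map_p p1_def)
qed

text \<open>The tensor trick: the recursion for \<open>trans_mor\<close> extends to the induced coalgebra map.\<close>

lemma pull_mor_eq:
  fixes t :: "'k \<Rightarrow> 'c::ab_group_add \<Rightarrow> 'c"
  assumes t: "vector_space t" and \<phi>: "multilin s t \<phi>"
  shows "pull trans_mor \<phi> xs = \<phi> (map p xs) + Hm (D2 (pull trans_mor \<phi>)) xs"
  using \<phi>
proof (induction xs arbitrary: \<phi> rule: length_induct)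
  case (1 xs)
  note \<phi> = \<open>multilin s t \<phi>\<close>
  define K where "K us vs = pull trans_mor (\<lambda>zs. \<phi> (trans_mor us # zs)) vs" for us vs
  note pl = multilin_pull[OF t multilin_mor]
  have L: "multilin s t (\<lambda>u. pull trans_mor (\<lambda>zs. \<phi> (f u # zs)) vs)" if "multilin s s f" for f vs
  proof -
    have "lin s t (\<lambda>y. pull trans_mor (\<lambda>zs. \<phi> (y # zs)) vs)"
      using linD[OF multilin_lin_hd[OF \<phi>]]
      by (simp add: lin_def pull_add pull_def pull_aux_add pull_aux_scale[OF t])
    from multilin_comp[OF that this] show ?thesis .
  qed
  show ?case
  proof (cases "xs = []")
    case False
    have pe: "pull trans_mor \<phi> zs = split_sum K zs" if "zs \<noteq> []" for zs
      unfolding K_def by (rule pull_eq_split_sum[of t \<phi> trans_mor, OF t \<phi> mor_Nil that])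
    have "Hm (D2 (pull trans_mor \<phi>)) xs = Hm (D2 (split_sum K)) xs"
      by (intro homot_cong coder_cong pe)
    also have "\<dots> = Hm (split_sum (\<lambda>us vs. D2 (\<lambda>u. K u vs) us + D2 (K (map e us)) vs)) xs"
      by (intro homot_cong) (simp add: coder_split_sum)
    also have "\<dots> = split_sum (\<lambda>us vs.
        Hm (\<lambda>u. D2 (\<lambda>u. K u (map p vs)) u + D2 (K (map e u)) (map p vs)) us
      + Hm (\<lambda>v. D2 (\<lambda>u. K u v) (map e us) + D2 (K (map e (map e us))) v) vs) xs"
      by (rule homot_split_sum)
    \<comment> \<open>Homotopy and differential each act on the first block or on the rest. Both on
      the first block give the first difference, by the equation for \<open>trans_mor\<close>; both
      on the rest give the second, by induction. The mixed terms vanish because \<open>Hm\<close>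
      kills \<open>trans_mor\<close> and its coalgebra map.\<close>
    also have "\<dots> = split_sum (\<lambda>us vs. (\<phi> (trans_mor us # map p vs) - \<phi> (p1 us # map p vs))
        + (K us vs - \<phi> (trans_mor us # map p vs))) xs"
    proof (rule split_sum_cong)
      fix us vs assume uv: "us @ vs = xs"
      have K1: "D2 (\<lambda>u. K u v) = (\<lambda>u. pull trans_mor (\<lambda>zs. \<phi> (D2 trans_mor u # zs)) v)" for v
      proof
        fix u
        have ad: "additive (\<lambda>y. pull trans_mor (\<lambda>zs. \<phi> (y # zs)) v)"
          by (simp add: additive_def multilin_add_hd[OF vs_s t \<phi>] pull_add)
        show "D2 (\<lambda>u. K u v) u = pull trans_mor (\<lambda>zs. \<phi> (D2 trans_mor u # zs)) v"
          unfolding K_def using coder_additive[OF ad, of b2 e trans_mor u] by simp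
      qed
      have "Hm (\<lambda>u. D2 (\<lambda>u. K u (map p vs)) u) us = \<phi> (Hm (D2 trans_mor) us # map p vs)"
        unfolding K1 pull_mor_map_p[OF t multilin_Cons[OF \<phi>]]
        by (rule homot_additive[OF multilin_additive_hd[OF vs_s t \<phi>], symmetric])
      then have 2: "Hm (\<lambda>u. D2 (\<lambda>u. K u (map p vs)) u) us
          = \<phi> (trans_mor us # map p vs) - \<phi> (p1 us # map p vs)"
        by (simp add: Hm_D2 multilin_diff_hd[OF vs_s t \<phi>])
      have 3: "Hm (\<lambda>u. D2 (K (map e u)) (map p vs)) us = 0"
      proof -
        have ad: "additive (\<lambda>y. D2 (pull trans_mor (\<lambda>zs. \<phi> (e y # zs))) (map p vs))"
        proof (rule additive.intro)
          fix y y'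
          have "pull trans_mor (\<lambda>zs. \<phi> (e (y + y') # zs)) = (\<lambda>v. pull trans_mor (\<lambda>zs. \<phi> (e y # zs)) v
              + pull trans_mor (\<lambda>zs. \<phi> (e y' # zs)) v)"
            by (simp add: fun_eq_iff e_add multilin_add_hd[OF vs_s t \<phi>] pull_add)
          then show "D2 (pull trans_mor (\<lambda>zs. \<phi> (e (y + y') # zs))) (map p vs) =
             D2 (pull trans_mor (\<lambda>zs. \<phi> (e y # zs))) (map p vs)
             + D2 (pull trans_mor (\<lambda>zs. \<phi> (e y' # zs))) (map p vs)"
            by (simp add: coder_add)
        qed
        show ?thesis
          unfolding K_def even_mor[symmetric]
          using homot_additive[OF ad, of h p e trans_mor us] Hm_mor[of us] additive.zero[OF ad] by simp
      qed
      have 4: "Hm (\<lambda>v. D2 (\<lambda>u. K u v) (map e us)) vs = 0"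
        unfolding K1 by (rule Hm_pull[OF t multilin_Cons[OF \<phi>]])
      have 5: "Hm (\<lambda>v. D2 (K (map e (map e us))) v) vs = K us vs - \<phi> (trans_mor us # map p vs)"
      proof (cases "us = []")
        case True
        then show ?thesis by (simp add: K_def[abs_def] mor_Nil multilin_0_hd[OF vs_s t \<phi>])
      next
        case False
        then have "length vs < length xs" using uv by auto
        then have "pull trans_mor (\<lambda>zs. \<phi> (trans_mor us # zs)) vs = \<phi> (trans_mor us # map p vs)
            + Hm (D2 (pull trans_mor (\<lambda>zs. \<phi> (trans_mor us # zs)))) vs"
          using 1 multilin_Cons[OF \<phi>] by blast
        then show ?thesis by (simp add: K_def[abs_def])
      qed
      show "Hm (\<lambda>u. D2 (\<lambda>u. K u (map p vs)) u + D2 (K (map e u)) (map p vs)) us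
      + Hm (\<lambda>v. D2 (\<lambda>u. K u v) (map e us) + D2 (K (map e (map e us))) v) vs
      = (\<phi> (trans_mor us # map p vs) - \<phi> (p1 us # map p vs))
        + (K us vs - \<phi> (trans_mor us # map p vs))"
        unfolding homot_add 2 3 4 5 by simp
    qed
    also have "\<dots> = split_sum K xs - split_sum (\<lambda>us vs. \<phi> (p1 us # map p vs)) xs"
      by (simp add: split_sum_diff[symmetric] algebra_simps)
    also have "split_sum (\<lambda>us vs. \<phi> (p1 us # map p vs)) xs = \<phi> (map p xs)"
    proof (cases xs)
      case (Cons x xs')
      have "split_sum (\<lambda>us vs. \<phi> (p1 (x # us) # map p vs)) xs' = \<phi> (p x # map p xs')"
        by (subst split_sum_only_Nil) (auto simp: p1_def multilin_0_hd[OF vs_s t \<phi>])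
      then show ?thesis using Cons by (simp add: p1_def multilin_0_hd[OF vs_s t \<phi>])
    qed (use False in simp)
    also have "split_sum K xs = pull trans_mor \<phi> xs" using pe[OF False] by simp
    finally show ?thesis by simp
  qed simp
qed


lemma normal_D2:
  fixes \<phi> :: "'a list \<Rightarrow> 'a"
  assumes "normal \<phi>"
  shows "normal (D2 \<phi>)"
  unfolding normal_def
  by (intro allI coder_replace) (simp_all add: b2_def b_q normalD[OF assms] q_e)

lemma normal_mor: "normal trans_mor"
proof -
  have Hn: "normal (Hm \<phi>)" if "normal \<phi>" for \<phi> :: "'a list \<Rightarrow> 'a"
  proof -
    have "Hm \<phi> (us @ q x # vs) = Hm \<phi> (us @ x # vs)" for us x vs
      using that
    proof (induction us arbitrary: \<phi>)
      case Nil
      then show ?case using normalD[OF Nil, of "[]"] by (simp add: q_e h_q)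
    next
      case (Cons z us)
      then show ?case using Cons.IH[OF normal_Cons[OF Cons.prems]] by (simp add: p_q)
    qed
    then show ?thesis by (simp add: normal_def)
  qed
  have "normal p1"
    unfolding normal_def
  proof (intro allI)
    show "p1 (us @ q x # vs) = p1 (us @ x # vs)" for us x vs
      by (cases us) (auto simp: p1_def p_q)
  qed
  then have "normal (trans_iter k)" for k
  proof (induction k)
    case (Suc k)
    then show ?case using Hn[OF normal_D2[OF Suc.IH[OF Suc.prems]]] by (auto simp: normal_def)
  qed auto
  then show ?thesis
    by (simp del: trans_iter.simps add: normal_def trans_mor_def)
qed

lemma trans_op_Nil: "trans_op [] = 0"
  by (simp add: trans_op_def)

lemma trans_op_single: "trans_op [x] = 0"
  by (simp add: trans_op_def multilin_0_hd[OF vs_s vs_s multilin_mor])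

lemma trans_op_two: "trans_op [x, y] = p (b [p x, p y])"
  by (simp add: trans_op_def multilin_0_hd[OF vs_s vs_s multilin_mor]
      multilin_0[OF vs_s vs_s multilin_mor, of "[_]", simplified] mor_single)

lemma trans_op_p: "trans_op (map p xs) = trans_op xs"
  by (simp add: trans_op_def comp_def p_p)

lemma multilin_trans_op: "multilin s s trans_op"
  unfolding trans_op_def[abs_def] by (rule multilin_map[OF multilin_D2_mor lin_p])

lemma p_trans_op: "p (trans_op xs) = trans_op xs"
  by (simp add: trans_op_def coder_additive[OF lin_additive[OF vs_s vs_s lin_p]] p_mor)

lemma map_p_e: "map p (map e xs) = map e (map p xs)"
  by (simp add: p_e)

lemma odd_trans_op: "e (trans_op xs) = - trans_op (map e xs)"
  unfolding trans_op_def map_p_e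
  by (simp only: coder_additive[OF additive_e] even_mor
      coder_map_e[of s _ b2, OF vs_s multilin_mor odd_b2])

text \<open>Apply \<open>D1\<close> to the fixed point equation: \<open>homot_homotopy\<close>
  yields \<open>trans_op\<close> minus \<open>D2 trans_mor\<close> plus
  \<open>Hm (D2 (D trans_mor))\<close>. The last term sees \<open>D trans_mor\<close> on shorter
  words only, where it is known by induction, and \<open>pull_mor_eq\<close> then evaluates
  it.\<close>

theorem coder_mor: "D trans_mor xs = pull trans_mor trans_op xs"
proof (induction xs rule: length_induct)
  case (1 xs)
  note D2m = multilin_D2_mor
  \<comment> \<open>This is \<open>D D = 0\<close> with \<open>D = D1 + D2\<close>, after removal of
    \<open>D1 D1 = 0\<close>.\<close>
  have DDm: "D1 (D2 trans_mor) zs = - D2 (D trans_mor) zs" for zs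
  proof -
    have Dm: "multilin s s (D trans_mor)"
      by (rule multilin_coder[OF vs_s vs_s multilin_mor multilin_b lin_e])
    have "D1 (\<lambda>zs. D1 trans_mor zs + D2 trans_mor zs) zs = D1 (D1 trans_mor) zs + D1 (D2 trans_mor) zs"
      by (rule coder_add)
    moreover have "D1 (D1 trans_mor) zs = 0"
    proof (rule coder_coder[OF vs_s multilin_mor multilin_b1])
      show "e (b1 xs) = - b1 (map e xs)" for xs by (rule odd_b1)
      have "b [b [x]] = 0" for x
        using coder_b[of "[x]"] by simp
      then show "D1 b1 xs = 0" for xs
      proof (induction xs)
        case (Cons x xs)
        have "b1 (e x # zs) = (if zs = [] then b [e x] else 0)" for zs by (cases zs) auto
        moreover have "D1 (\<lambda>zs. if zs = [] then b [e x] else 0) xs = 0" for xs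
          using coder_cong[of xs "\<lambda>zs. if zs = [] then b [e x] else 0" "\<lambda>zs. 0" b1 e] by simp
        ultimately show ?case
          using Cons.prems by (cases xs) (auto simp del: coder.simps simp: D1_Cons[OF vs_s multilin_b1])
      qed simp
    qed
    moreover have "D (D trans_mor) zs = 0"
      by (rule coder_coder[OF vs_s multilin_mor multilin_b odd_b coder_b])
    moreover have "D trans_mor = (\<lambda>zs. D1 trans_mor zs + D2 trans_mor zs)"
      using D_eq[OF vs_s multilin_mor] by (rule ext)
    ultimately show ?thesis
      using D_eq[OF vs_s Dm, of zs]
      by (simp add: eq_neg_iff_add_eq_0 add.commute)
  qed
  have 2: "D1 p1 zs = 0" for zs
  proof (cases zs)
    case (Cons z zs')
    have "p1 (e z # us) = (if us = [] then p (e z) else 0)" for us by (cases us) (auto simp: p1_def)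
    moreover have "D1 (\<lambda>zs. if zs = [] then p (e z) else 0) zs' = 0"
      using coder_cong[of zs' "\<lambda>zs. if zs = [] then p (e z) else 0" "\<lambda>zs. 0" b1 e] by simp
    moreover have "p1 (b [z] # zs') = 0" by (simp add: p1_def p_d)
    ultimately show ?thesis using Cons
      by (simp del: coder.simps add: D1_Cons[OF vs_s multilin_p1])
  qed simp
  have "D1 trans_mor xs = D1 p1 xs + D1 (Hm (D2 trans_mor)) xs"
    unfolding coder_add[symmetric] using mor_eq by (intro coder_cong) simp
  also have "D1 (Hm (D2 trans_mor)) xs
      = D2 trans_mor (map p xs) - D2 trans_mor xs - Hm (D1 (D2 trans_mor)) xs"
  proof -
    have D2n: "normal (D2 trans_mor)" by (rule normal_D2[OF normal_mor])
    show ?thesis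
    using homot_homotopy[OF vs_s multilin_D2_mor D2n, of xs] by (simp add: algebra_simps)
  qed
  also have "Hm (D1 (D2 trans_mor)) xs = - Hm (D2 (D trans_mor)) xs"
    unfolding homot_minus[symmetric] by (intro homot_cong DDm)
  also have "Hm (D2 (D trans_mor)) xs = Hm (D2 (pull trans_mor trans_op)) xs"
  proof (rule homot_cong)
    fix zs :: "'a list" assume l: "length zs = length xs"
    show "D2 (D trans_mor) zs = D2 (pull trans_mor trans_op) zs"
      by (rule D2_cong[OF vs_s multilin_coder[OF vs_s vs_s multilin_mor multilin_b lin_e]
            multilin_pull[OF vs_s multilin_mor multilin_trans_op]])
        (use 1 l in auto)
  qed
  also have "Hm (D2 (pull trans_mor trans_op)) xs = pull trans_mor trans_op xs - trans_op (map p xs)"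
    using pull_mor_eq[OF vs_s multilin_trans_op, of xs] by simp
  finally show ?case
    using D_eq[OF vs_s multilin_mor, of xs] 2 trans_op_def[of xs] trans_op_p[of xs] by simp
qed

text \<open>On words of letters \<open>p x\<close> the map \<open>pull trans_mor\<close> is the
  identity, so there the relation is \<open>D (D trans_mor) = 0\<close> read through the morphism.
  Such words suffice because \<open>trans_op\<close> factors through \<open>p\<close> on both
  sides.\<close>

theorem coder_trans_op: "coder trans_op e trans_op xs = 0"
proof -
  have "pull trans_mor (coder trans_op e trans_op) (map p xs) = D (pull trans_mor trans_op) (map p xs)"
    by (rule coder_pull[OF vs_s multilin_trans_op multilin_mor mor_Nil trans_op_Nil even_mor
          coder_mor, symmetric])
  also have "\<dots> = D (D trans_mor) (map p xs)"
    using coder_mor by (metis ext)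
  also have "\<dots> = 0"
    by (rule coder_coder[OF vs_s multilin_mor multilin_b odd_b coder_b])
  finally have "coder trans_op e trans_op (map p xs) = 0"
    by (simp add: pull_mor_map_p[OF vs_s
        multilin_coder[OF vs_s vs_s multilin_trans_op multilin_trans_op lin_e]])
  moreover have "coder trans_op e (\<lambda>zs. trans_op (map p zs)) xs = coder trans_op e trans_op (map p xs)"
    by (rule coder_map) (simp_all add: p_e trans_op_p p_trans_op)
  ultimately show ?thesis by (simp add: trans_op_p)
qed

end

subsection \<open>The algebra of module endomorphisms\<close>

lemma vector_space_fun: "vector_space s \<Longrightarrow> vector_space (\<lambda>c \<psi> x. s c (\<psi> x))"
  unfolding vector_space_def by (simp add: fun_eq_iff)

text \<open>The cut at the seam is counted in the first sum; the test \<open>x1 = []\<close> removes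
  it from the second.\<close>

lemma split_sum_append:
  "split_sum K (as @ xs) = split_sum (\<lambda>a1 a2. K a1 (a2 @ xs)) as
     + split_sum (\<lambda>x1 x2. if x1 = [] then 0 else K (as @ x1) x2) xs"
proof (induction as arbitrary: K)
  case Nil
  show ?case by (cases xs) auto
next
  case (Cons a as)
  show ?case using Cons.IH[of "\<lambda>u. K (a # u)"] by (simp add: algebra_simps cong: if_cong)
qed

text \<open>The terms are sorted by the position of the contracted block: inside \<open>as\<close>,
  across the seam, inside \<open>xs\<close>. The tests for empty lists force a block across the seam
  to take letters from both sides.\<close>

lemma coder_append:
  "coder b e \<phi> (as @ xs) = coder b e (\<lambda>a. \<phi> (a @ xs)) as
     + split_sum (\<lambda>a1 a2. if a2 = [] then 0 else
         split_sum (\<lambda>x1 x2. if x1 = [] then 0 else \<phi> (map e a1 @ b (a2 @ x1) # x2)) xs) as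
     + coder b e (\<lambda>z. \<phi> (map e as @ z)) xs"
proof (induction as arbitrary: \<phi>)
  case (Cons a as)
  show ?case using Cons.IH[of "\<lambda>z. \<phi> (e a # z)"] by (simp add: split_sum_append algebra_simps cong: if_cong)
qed simp

text \<open>
  Composition in the convolution algebra of a right module; the first letter of a word is the
  module element.
\<close>

definition mod_comp :: "('a list \<Rightarrow> 'b::comm_monoid_add) \<Rightarrow> ('a list \<Rightarrow> 'a) \<Rightarrow> 'a list \<Rightarrow> 'b" where
  "mod_comp \<psi> \<chi> = split_sum (\<lambda>us vs. \<psi> (\<chi> us # vs))"

lemma comp_eq: "mod_comp \<psi> \<chi> xs = split_sum (\<lambda>us vs. \<psi> (\<chi> us # vs)) xs"
  by (simp add: mod_comp_def)

lemma comp_assoc: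
  fixes \<psi> :: "'a::ab_group_add list \<Rightarrow> 'b::ab_group_add"
  assumes "\<And>vs. additive (\<lambda>x. \<psi> (x # vs))" "\<chi> [] = 0"
  shows "mod_comp (mod_comp \<psi> \<chi>) \<omega> = mod_comp \<psi> (mod_comp \<chi> \<omega>)"
proof
  fix xs
  have [simp]: "\<psi> (0 # vs) = 0" for vs using additive.zero[OF assms(1)] .
  have "mod_comp (mod_comp \<psi> \<chi>) \<omega> xs
      = split_sum (\<lambda>us vs. split_sum (\<lambda>u v. \<psi> (\<chi> (\<omega> us # u) # v)) vs) xs"
    by (simp add: comp_eq assms(2))
  also have "\<dots> = split_sum (\<lambda>us vs. split_sum (\<lambda>u v. \<psi> (\<chi> (\<omega> u # v) # vs)) us) xs"
    by (rule split_sum_assoc[symmetric])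
  also have "\<dots> = mod_comp \<psi> (mod_comp \<chi> \<omega>) xs"
    unfolding comp_eq by (rule split_sum_cong) (rule split_sum_additive[OF assms(1), symmetric])
  finally show "mod_comp (mod_comp \<psi> \<chi>) \<omega> xs = mod_comp \<psi> (mod_comp \<chi> \<omega>) xs" .
qed

text \<open>The algebra lives on the image of \<open>p\<close> inside the ambient type: by
  \<open>b_p\<close> and \<open>p_b\<close> the operations depend on that image only and stay in it.
  Minimality is \<open>b_single\<close>.\<close>

locale minimal_algebra = shifted_space s e
  for s :: "'k::field \<Rightarrow> 'a::ab_group_add \<Rightarrow> 'a" and e :: "'a \<Rightarrow> 'a" +
  fixes b :: "'a list \<Rightarrow> 'a" and p :: "'a \<Rightarrow> 'a"
  assumes multilin_b: "multilin s s b" and b_Nil: "b [] = 0" and b_single: "b [x] = 0"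
    and odd_b: "e (b xs) = - b (map e xs)"
    and coder_b: "coder b e b xs = 0"
    and b_p: "b (map p xs) = b xs" and p_b: "p (b xs) = b xs"
    and lin_p: "lin s s p" and p_e: "e (p x) = p (e x)" and p_p: "p (p x) = p x"
begin

abbreviation scale_fun :: "'k \<Rightarrow> ('a list \<Rightarrow> 'a) \<Rightarrow> 'a list \<Rightarrow> 'a" where
  "scale_fun \<equiv> \<lambda>c \<psi> xs. s c (\<psi> xs)"

lemmas vs_fun = vector_space_fun[OF vs_s]
lemmas additive_p = lin_additive[OF vs_s vs_s lin_p]
lemmas p_zero [simp] = additive.zero[OF additive_p]

text \<open>A family of maps from tensor powers of the image of \<open>p\<close> to that image,
  spread to all words by means of \<open>p\<close>. The first letter is the module element, so the
  empty word gets 0.\<close>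

definition end_fun :: "('a list \<Rightarrow> 'a) \<Rightarrow> bool" where
  "end_fun \<psi> \<longleftrightarrow> multilin s s \<psi> \<and> \<psi> [] = 0 \<and> (\<forall>xs. \<psi> (map p xs) = \<psi> xs) \<and> (\<forall>xs. p (\<psi> xs) = \<psi> xs)"

text \<open>Conjugation by parity; on an endomorphism of degree \<open>j\<close> it is the sign
  \<open>(-1)^j\<close>, see \<open>econj_end_comp\<close>.\<close>

definition econj :: "('a list \<Rightarrow> 'a) \<Rightarrow> 'a list \<Rightarrow> 'a" where
  "econj \<psi> xs = e (\<psi> (map e xs))"

text \<open>The graded commutator with the bar differential of the module. Blocks in
  \<open>coder\<close> may contain the module letter, in which case \<open>b\<close> acts as the
  module structure.\<close>

definition end_diff :: "('a list \<Rightarrow> 'a) \<Rightarrow> 'a list \<Rightarrow> 'a" where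
  "end_diff \<psi> xs = mod_comp b \<psi> xs - coder b e (econj \<psi>) xs"

definition end_one :: "'a list \<Rightarrow> 'a" where
  "end_one xs = (if length xs = 1 then p (hd xs) else 0)"

lemma end_funD:
  assumes "end_fun \<psi>"
  shows "multilin s s \<psi>" "\<psi> [] = 0" "\<psi> (map p xs) = \<psi> xs" "p (\<psi> xs) = \<psi> xs" "\<psi> (0 # xs) = 0"
    "\<psi> (p x # xs) = \<psi> (x # xs)"
proof -
  show m: "multilin s s \<psi>" and "\<psi> [] = 0" and pp: "\<And>xs. \<psi> (map p xs) = \<psi> xs"
    and "p (\<psi> xs) = \<psi> xs"
    using assms by (auto simp: end_fun_def)
  show "\<psi> (0 # xs) = 0" by (rule multilin_0_hd[OF vs_s vs_s m])
  show "\<psi> (p x # xs) = \<psi> (x # xs)"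
    using pp[of "p x # xs"] pp[of "x # xs"] by (simp add: p_p)
qed

lemma end_fun_b: "end_fun b"
  by (simp add: end_fun_def multilin_b b_Nil b_p p_b)

lemma multilin_comp_fun:
  assumes "multilin s s \<psi>" "multilin s s \<chi>"
  shows "multilin s s (mod_comp \<psi> \<chi>)"
  unfolding mod_comp_def
  by (intro multilin_split_sum[OF vs_s vs_s] multilin_Cons assms
      multilin_comp[OF assms(2) multilin_lin_hd[OF assms(1)]])

lemma end_fun_comp:
  assumes "end_fun \<psi>" "end_fun \<chi>"
  shows "end_fun (mod_comp \<psi> \<chi>)"
proof -
  note 1 = end_funD[OF assms(1)] and 2 = end_funD[OF assms(2)]
  have "\<psi> (\<chi> us # map p vs) = \<psi> (\<chi> us # vs)" for us vs
    using 1(3)[of "\<chi> us # map p vs"] 1(3)[of "\<chi> us # vs"] by (simp add: o_def p_p)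
  then show ?thesis
    by (simp add: end_fun_def multilin_comp_fun 1 2 comp_eq split_sum_map split_sum_additive[OF additive_p])
qed

lemma multilin_econj: "multilin s s \<psi> \<Longrightarrow> multilin s s (econj \<psi>)"
  unfolding econj_def by (intro multilin_comp[OF _ lin_e] multilin_map lin_e)

lemma end_fun_econj:
  assumes "end_fun \<psi>" shows "end_fun (econj \<psi>)"
proof -
  note 1 = end_funD[OF assms(1)]
  have "map e (map p xs) = map p (map e xs)" for xs by (simp add: p_e)
  then have "econj \<psi> (map p xs) = econj \<psi> xs" for xs unfolding econj_def by (metis 1(3))
  then show ?thesis
    using multilin_econj[OF 1(1)] by (simp add: end_fun_def 1 econj_def p_e[symmetric])
qed

lemma multilin_coder_b: "multilin s s \<psi> \<Longrightarrow> multilin s s (coder b e \<psi>)"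
  by (rule multilin_coder[OF vs_s vs_s _ multilin_b lin_e])

lemma end_fun_coder:
  assumes "end_fun \<psi>" shows "end_fun (coder b e \<psi>)"
proof -
  note 1 = end_funD[OF assms(1)]
  have "coder b e (\<lambda>zs. \<psi> (map p zs)) xs = coder b e \<psi> (map p xs)" for xs
    by (rule coder_map) (simp_all add: p_e b_p p_b)
  then show ?thesis
    by (simp add: end_fun_def multilin_coder_b 1 coder_additive[OF additive_p])
qed

lemma end_fun_diff: "end_fun \<psi> \<Longrightarrow> end_fun \<chi> \<Longrightarrow> end_fun (\<lambda>xs. \<psi> xs - \<chi> xs)"
  by (simp add: end_fun_def multilin_diff[OF vs_s vs_s] additive.diff[OF additive_p])

lemma end_fun_add: "end_fun \<psi> \<Longrightarrow> end_fun \<chi> \<Longrightarrow> end_fun (\<lambda>xs. \<psi> xs + \<chi> xs)"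
  by (simp add: end_fun_def multilin_plus[OF vs_s vs_s] additive.add[OF additive_p])

lemma end_fun_zero: "end_fun (\<lambda>xs. 0)"
  by (simp add: end_fun_def multilin_zero[OF vs_s vs_s])

lemma end_fun_scale:
  assumes "end_fun \<psi>" shows "end_fun (\<lambda>xs. s c (\<psi> xs))"
proof -
  have "lin s s (s c)"
    by (rule linI[OF scale_additive[OF vs_s vs_s]]) (simp add: mult.commute)
  then show ?thesis
    using assms additive.zero[OF scale_additive[OF vs_s vs_s]] by (auto simp: end_fun_def lin_scale[OF vs_s vs_s lin_p] intro: multilin_comp)
qed

lemma end_fun_end_diff: "end_fun \<psi> \<Longrightarrow> end_fun (end_diff \<psi>)"
  unfolding end_diff_def[abs_def]
  by (intro end_fun_diff end_fun_comp end_fun_coder end_fun_econj end_fun_b)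

lemma end_fun_one: "end_fun end_one"
proof -
  have "multilin s s end_one"
  proof (rule multilinI)
    fix us vs x y c
    have [simp]: "s c 0 = 0" by (rule additive.zero[OF scale_additive[OF vs_s vs_s]])
    show "end_one (us @ (x + s c y) # vs) = end_one (us @ x # vs) + s c (end_one (us @ y # vs))"
      using linD[OF lin_p] by (cases us) (auto simp: end_one_def)
  qed
  moreover have "end_one (map p xs) = end_one xs" for xs
    by (cases xs) (auto simp: end_one_def p_p)
  ultimately show ?thesis by (auto simp: end_fun_def end_one_def p_p)
qed

lemma econj_econj [simp]: "econj (econj \<psi>) = \<psi>"
  by (simp add: econj_def fun_eq_iff)

lemma econj_comp: "econj (mod_comp \<psi> \<chi>) = mod_comp (econj \<psi>) (econj \<chi>)"
  by (simp add: econj_def fun_eq_iff comp_eq split_sum_map split_sum_additive[OF additive_e])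

lemma econj_b: "econj b = (\<lambda>xs. - b xs)"
  by (simp add: econj_def fun_eq_iff odd_b)

lemma econj_coder:
  assumes "multilin s s \<psi>"
  shows "econj (coder b e \<psi>) = (\<lambda>xs. - coder b e (econj \<psi>) xs)"
proof
  fix xs
  have "coder b e (econj \<psi>) xs = e (coder b e (\<lambda>zs. \<psi> (map e zs)) xs)"
    unfolding econj_def by (rule coder_additive[OF additive_e, symmetric])
  then show "econj (coder b e \<psi>) xs = - coder b e (econj \<psi>) xs"
    by (simp add: coder_map_e[of s _ b, OF vs_s assms odd_b] econj_def)
qed

lemma comp_minus_left:
  fixes \<psi> :: "'a list \<Rightarrow> 'c::ab_group_add"
  shows "mod_comp (\<lambda>xs. - \<psi> xs) \<chi> = (\<lambda>xs. - mod_comp \<psi> \<chi> xs)"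
  by (simp add: comp_eq fun_eq_iff split_sum_minus)

lemma comp_diff_left:
  fixes \<psi> :: "'a list \<Rightarrow> 'c::ab_group_add"
  shows "mod_comp (\<lambda>xs. \<psi> xs - \<psi>' xs) \<chi> = (\<lambda>xs. mod_comp \<psi> \<chi> xs - mod_comp \<psi>' \<chi> xs)"
  by (simp add: comp_eq fun_eq_iff split_sum_diff)

lemma comp_diff_right:
  assumes "multilin s s \<psi>"
  shows "mod_comp \<psi> (\<lambda>xs. \<chi> xs - \<chi>' xs) = (\<lambda>xs. mod_comp \<psi> \<chi> xs - mod_comp \<psi> \<chi>' xs)"
  by (simp add: comp_eq fun_eq_iff split_sum_diff multilin_diff_hd[OF vs_s vs_s assms])

lemma comp_one: "end_fun \<psi> \<Longrightarrow> mod_comp \<psi> end_one = \<psi>"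
proof
  fix xs assume "end_fun \<psi>"
  note 1 = end_funD[OF this]
  show "mod_comp \<psi> end_one xs = \<psi> xs"
  proof (cases xs)
    case (Cons x xs')
    have "split_sum (\<lambda>us vs. \<psi> (end_one (x # us) # vs)) xs' = \<psi> (p x # xs')"
      by (subst split_sum_only_Nil) (auto simp: end_one_def 1)
    then show ?thesis using Cons 1 by (simp add: comp_eq end_one_def)
  qed (simp add: 1 comp_eq end_one_def)
qed

lemma one_comp: "end_fun \<psi> \<Longrightarrow> mod_comp end_one \<psi> = \<psi>"
proof
  fix xs assume "end_fun \<psi>"
  note 1 = end_funD[OF this]
  have "mod_comp end_one \<psi> xs = split_sum (\<lambda>us vs. if vs = [] then \<psi> us else 0) xs"
    unfolding comp_eq by (rule split_sum_cong) (auto simp: end_one_def 1)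
  also have "\<dots> = \<psi> xs"
  proof -
    have "split_sum (\<lambda>us vs. if vs = [] then \<psi> us else 0) xs = \<psi> xs" for \<psi> :: "'a list \<Rightarrow> 'a"
      by (induction xs arbitrary: \<psi>) auto
    then show ?thesis .
  qed
  finally show "mod_comp end_one \<psi> xs = \<psi> xs" .
qed

text \<open>The contracted block lies among the letters fed to \<open>\<chi>\<close>, or to the
  right of them; in the second case the signs of those letters are inside
  \<open>\<chi> (map e us)\<close>.\<close>

lemma coder_comp:
  assumes "multilin s s \<psi>"
  shows "coder b e (mod_comp \<psi> \<chi>) xs = mod_comp \<psi> (coder b e \<chi>) xs
     + split_sum (\<lambda>us vs. coder b e (\<lambda>v. \<psi> (\<chi> (map e us) # v)) vs) xs"
proof -
  have "coder b e (\<lambda>u. \<psi> (\<chi> u # vs)) us = \<psi> (coder b e \<chi> us # vs)" for us vs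
    by (rule coder_additive[OF multilin_additive_hd[OF vs_s vs_s assms], symmetric])
  then show ?thesis
    unfolding mod_comp_def coder_split_sum by (simp add: split_sum_add)
qed

text \<open>On a word \<open>\<chi> us # vs\<close> a block containing the first letter is
  \<open>b\<close> applied after \<open>\<chi>\<close>, and associativity regroups it as
  \<open>mod_comp b \<chi>\<close>.\<close>

lemma comp_coder:
  assumes "end_fun \<psi>" "end_fun \<chi>"
  shows "mod_comp (coder b e \<psi>) \<chi> xs = mod_comp \<psi> (mod_comp b \<chi>) xs
     + split_sum (\<lambda>us vs. coder b e (\<lambda>v. \<psi> (e (\<chi> us) # v)) vs) xs"
proof -
  note 1 = end_funD[OF assms(1)]
  have "mod_comp (coder b e \<psi>) \<chi> xs = mod_comp (mod_comp \<psi> b) \<chi> xs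
    + split_sum (\<lambda>us vs. coder b e (\<lambda>v. \<psi> (e (\<chi> us) # v)) vs) xs"
    unfolding split_sum_add[symmetric] comp_eq by (simp add: b_Nil 1)
  then show ?thesis by (simp add: comp_assoc[of \<psi> b, OF multilin_additive_hd[OF vs_s vs_s 1(1)] b_Nil])
qed

text \<open>The terms with two bar differentials vanish by \<open>coder_coder\<close>. Left over is
  \<open>b\<close> applied twice after \<open>\<psi>\<close>; by the A_infinity relation it cancels
  the blocks to the right of \<open>\<psi>\<close> that \<open>coder_comp\<close> produces.\<close>

lemma end_diff_end_diff:
  assumes "end_fun \<psi>" shows "end_diff (end_diff \<psi>) xs = 0"
proof -
  note E = end_funD[OF end_fun_econj[OF assms]]
  define \<chi> where "\<chi> = econj \<psi>"
  have \<chi>: "end_fun \<chi>" "\<psi> = econj \<chi>" using assms by (auto simp: \<chi>_def end_fun_econj)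
  note X = end_funD[OF \<chi>(1)]
  have 1: "econj (end_diff \<psi>) = (\<lambda>xs. - mod_comp b \<chi> xs + coder b e \<psi> xs)"
  proof
    fix xs
    have "econj (end_diff \<psi>) xs = econj (mod_comp b \<psi>) xs - econj (coder b e \<chi>) xs"
      by (simp add: econj_def end_diff_def additive.diff[OF additive_e] \<chi>_def)
    then show "econj (end_diff \<psi>) xs = - mod_comp b \<chi> xs + coder b e \<psi> xs"
      by (simp add: econj_comp econj_b comp_minus_left econj_coder[OF X(1)] \<chi>(2))
  qed
  have "end_diff (end_diff \<psi>) xs = mod_comp b (mod_comp b \<psi>) xs - mod_comp b (coder b e \<chi>) xs
     - coder b e (\<lambda>xs. - mod_comp b \<chi> xs + coder b e \<psi> xs) xs"
    unfolding end_diff_def[of "end_diff \<psi>"] 1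
    by (simp add: end_diff_def[abs_def] comp_diff_right[OF multilin_b] \<chi>_def)
  also have "coder b e (\<lambda>xs. - mod_comp b \<chi> xs + coder b e \<psi> xs) xs = - coder b e (mod_comp b \<chi>) xs"
    using coder_coder[OF vs_s end_funD(1)[OF assms] multilin_b odd_b coder_b]
    by (simp add: coder_diff)
  also have "coder b e (mod_comp b \<chi>) xs = mod_comp b (coder b e \<chi>) xs
     + split_sum (\<lambda>us vs. coder b e (\<lambda>v. b (e (\<psi> us) # v)) vs) xs"
    by (simp add: coder_comp[OF multilin_b] \<chi>_def econj_def)
  also have "split_sum (\<lambda>us vs. coder b e (\<lambda>v. b (e (\<psi> us) # v)) vs) xs = - mod_comp b (mod_comp b \<psi>) xs"
  proof -
    have "mod_comp (coder b e b) \<psi> xs = 0" unfolding comp_eq coder_b by (simp add: split_sum_zero)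
    then show ?thesis using comp_coder[OF end_fun_b assms] by (simp add: add_eq_0_iff)
  qed
  finally show ?thesis by simp
qed

lemma end_diff_comp:
  assumes "end_fun \<psi>" "end_fun \<chi>"
  shows "end_diff (mod_comp \<psi> \<chi>) xs = mod_comp (end_diff \<psi>) \<chi> xs + mod_comp (econj \<psi>) (end_diff \<chi>) xs"
proof -
  note 1 = end_funD[OF assms(1)] and e1 = end_funD[OF end_fun_econj[OF assms(1)]]
  have "end_diff (mod_comp \<psi> \<chi>) xs = mod_comp (mod_comp b \<psi>) \<chi> xs - coder b e (mod_comp (econj \<psi>) (econj \<chi>)) xs"
    unfolding end_diff_def econj_comp
    by (simp add: comp_assoc[of b \<psi>, OF multilin_additive_hd[OF vs_s vs_s multilin_b] 1(2)])
  also have "coder b e (mod_comp (econj \<psi>) (econj \<chi>)) xs = mod_comp (econj \<psi>) (coder b e (econj \<chi>)) xs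
      + split_sum (\<lambda>us vs. coder b e (\<lambda>v. econj \<psi> (e (\<chi> us) # v)) vs) xs"
    by (simp add: coder_comp[OF e1(1)] econj_def)
  also have "split_sum (\<lambda>us vs. coder b e (\<lambda>v. econj \<psi> (e (\<chi> us) # v)) vs) xs
     = mod_comp (coder b e (econj \<psi>)) \<chi> xs - mod_comp (econj \<psi>) (mod_comp b \<chi>) xs"
    by (simp add: comp_coder[OF end_fun_econj[OF assms(1)] assms(2)])
  finally show ?thesis
    by (simp add: end_diff_def[abs_def] comp_diff_left comp_diff_right[OF e1(1)])
qed

lemma end_diff_one: "end_diff end_one xs = 0"
proof -
  have "econj end_one = end_one"
  proof
    show "econj end_one xs = end_one xs" for xs
      by (cases xs) (auto simp: econj_def end_one_def p_e)
  qed
  moreover have "coder b e end_one xs = b xs"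
  proof -
    have "coder b e end_one xs = mod_comp end_one b xs"
    proof (cases xs)
      case (Cons x xs')
      have "coder b e (\<lambda>zs. end_one (e x # zs)) xs' = coder b e (\<lambda>zs. 0) xs'"
        by (rule coder_cong) (auto simp: end_one_def)
      then show ?thesis using Cons by (simp add: comp_eq b_Nil end_funD[OF end_fun_one])
    qed (simp add: comp_eq b_Nil end_funD[OF end_fun_one])
    then show ?thesis by (simp add: one_comp[OF end_fun_b])
  qed
  ultimately show ?thesis by (simp add: end_diff_def comp_one[OF end_fun_b])
qed

subsection \<open>Left multiplications\<close>

text \<open>The left action of words on the algebra as a right module over itself. The default 0 for
  empty \<open>as\<close> makes it a candidate for a twisting cochain, the one for empty
  \<open>xs\<close> keeps it in \<open>end_fun\<close>.\<close>

definition left_mult :: "'a list \<Rightarrow> 'a list \<Rightarrow> 'a" where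
  "left_mult as xs = (if as = [] \<or> xs = [] then 0 else b (as @ xs))"

lemma left_mult_Nil [simp]: "left_mult [] = (\<lambda>xs. 0)" "left_mult as [] = 0"
  by (auto simp: left_mult_def)

lemma end_fun_left_mult: "end_fun (left_mult as)"
proof -
  have "multilin s s (left_mult as)"
    using multilin_append[OF multilin_b, of as] multilin_zero[OF vs_s vs_s]
    by (cases "as = []") (auto simp: multilin_def left_mult_def)
  moreover have "b (as @ map p xs) = b (as @ xs)" for xs
    using b_p[of "as @ map p xs"] b_p[of "as @ xs"] by (simp add: o_def p_p)
  ultimately show ?thesis by (auto simp: end_fun_def left_mult_def p_b)
qed

lemma multilin_left_mult: "multilin s scale_fun left_mult"
  using multilinD[OF multilin_append2[OF multilin_b]] additive.zero[OF scale_additive[OF vs_s vs_s]]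
  by (auto simp: multilin_def fun_eq_iff left_mult_def)

lemma econj_left_mult: "econj (left_mult as) = (\<lambda>xs. - left_mult (map e as) xs)"
  by (simp add: econj_def left_mult_def fun_eq_iff odd_b)

text \<open>The Maurer-Cartan equation for left multiplication. It is the A_infinity relation on
  \<open>as @ xs\<close>, sorted by the position of the inner block with
  \<open>coder_append\<close>.\<close>

theorem coder_left_mult:
  "coder b e left_mult as xs
     = - (end_diff (left_mult as) xs + split_sum (\<lambda>a1 a2. mod_comp (left_mult (map e a1)) (left_mult a2)) as xs)"
proof (cases "as = [] \<or> xs = []")
  case True
  have *: "end_diff (left_mult as) [] = 0" for as
    by (rule end_funD[OF end_fun_end_diff[OF end_fun_left_mult]])
  have "mod_comp (left_mult u) (left_mult v) [] = 0" for u v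
    by (simp add: end_funD[OF end_fun_comp[OF end_fun_left_mult end_fun_left_mult]])
  then have 1: "split_sum (\<lambda>a1 a2. mod_comp (left_mult (map e a1)) (left_mult a2)) as [] = 0"
    by (simp add: split_sum_apply split_sum_zero)
  have 2: "coder b e left_mult as [] = 0" by (simp add: coder_apply coder_zero)
  have 3: "end_diff (left_mult []) = (\<lambda>xs. 0)"
  proof -
    have "econj (left_mult []) = (\<lambda>xs. 0)" by (simp add: econj_def fun_eq_iff)
    moreover have "mod_comp b (\<lambda>xs. 0) = (\<lambda>xs. 0)"
      using end_funD(5)[OF end_fun_b] by (simp add: mod_comp_def fun_eq_iff)
    ultimately show ?thesis by (simp add: end_diff_def[abs_def])
  qed
  have 4: "mod_comp (\<lambda>xs. 0 :: 'a) \<psi> = (\<lambda>xs. 0)" for \<psi> :: "'a list \<Rightarrow> 'a"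
    by (simp add: mod_comp_def)
  show ?thesis using True 1 2 3 4 * by (cases "as = []") auto
next
  case False
  define S where "S = split_sum (\<lambda>a1 a2. if a2 = [] then 0 else
       split_sum (\<lambda>x1 x2. if x1 = [] then 0 else b (map e a1 @ b (a2 @ x1) # x2)) xs) as"
  have "0 = coder b e (\<lambda>a. b (a @ xs)) as + S + coder b e (\<lambda>z. b (map e as @ z)) xs"
    unfolding S_def coder_append[symmetric] coder_b by simp
  also have "coder b e (\<lambda>a. b (a @ xs)) as = coder b e left_mult as xs"
    unfolding coder_apply using False by (intro coder_cong) (auto simp: left_mult_def)
  also have "coder b e (\<lambda>z. b (map e as @ z)) xs = - coder b e (econj (left_mult as)) xs"
    unfolding coder_minus[symmetric] using False
    by (intro coder_cong) (auto simp: left_mult_def econj_def odd_b)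
  \<comment> \<open>A block across the seam that takes all of \<open>as\<close> belongs to the
    differential of \<open>left_mult as\<close>; one that leaves a nonempty \<open>a1\<close> is a
    product of two left multiplications.\<close>
  also have "S = mod_comp b (left_mult as) xs
      + split_sum (\<lambda>a1 a2. mod_comp (left_mult (map e a1)) (left_mult a2)) as xs"
  proof -
    have 0: "b (us @ 0 # vs) = 0" for us vs by (rule multilin_0[OF vs_s vs_s multilin_b])
    have 1: "split_sum (\<lambda>x1 x2. if x1 = [] then 0 else b (b (as @ x1) # x2)) xs = mod_comp b (left_mult as) xs"
      unfolding comp_eq using False 0[of "[]"] by (intro split_sum_cong) (auto simp: left_mult_def)
    have 2: "(if a2 = [] then 0 else
        split_sum (\<lambda>x1 x2. if x1 = [] then 0 else b (map e a1 @ b (a2 @ x1) # x2)) xs)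
        = mod_comp (left_mult (map e a1)) (left_mult a2) xs" if "a1 \<noteq> []" for a1 a2
      using that 0 by (cases "a2 = []")
        (auto simp: comp_eq left_mult_def split_sum_zero intro!: split_sum_cong)
    have 3: "mod_comp (\<lambda>xs. 0 :: 'a) \<psi> = (\<lambda>xs. 0)" for \<psi> by (simp add: mod_comp_def)
    have 4: "(if a2 = [] then 0 else
        split_sum (\<lambda>x1 x2. if x1 = [] then 0 else b (e a # map e us @ b (a2 @ x1) # x2)) xs)
        = mod_comp (left_mult (e a # map e us)) (left_mult a2) xs" for a us a2
      using 2[of "a # us" a2] by (simp cong: if_cong)
    obtain a as' where as: "as = a # as'" using False by (cases as) auto
    show ?thesis
      unfolding S_def as split_sum_apply using 1 as
      by (simp add: 4 3 cong: if_cong)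
  qed
  finally show ?thesis by (simp add: end_diff_def algebra_simps add_eq_0_iff)
qed

end

subsection \<open>Degrees\<close>

lemma signed_simps [simp]:
  "signed k (0 :: 'a::ab_group_add) = 0" "signed 0 x = x" "signed k (- x) = - signed k x"
  by (auto simp: signed_def)

lemma signed_signed: "signed k (signed l x) = signed (k + l) x"
  by (auto simp: signed_def)

lemma signed_add: "signed k (x + y) = signed k x + signed k y"
  by (auto simp: signed_def)

lemma signed_even: "even k \<Longrightarrow> signed k x = x" and signed_odd: "odd k \<Longrightarrow> signed k x = - x"
  by (auto simp: signed_def)

lemma signed_cong: "even (k - l) \<Longrightarrow> signed k x = signed l x"
  by (auto simp: signed_def)

lemma additive_signed: "additive L \<Longrightarrow> L (signed k x) = signed k (L x)"
  by (auto simp: signed_def additive.minus)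

lemma signed_apply: "signed k \<psi> xs = signed k (\<psi> xs)"
  by (auto simp: signed_def)

lemma signed_mem: "module s \<Longrightarrow> module.subspace s S \<Longrightarrow> x \<in> S \<Longrightarrow> signed k x \<in> S"
  by (auto simp: signed_def module.subspace_neg)

text \<open>Every letter is shifted by one, so all components of a family share one number
  \<open>m\<close>: it is 2 for operations, 1 for morphisms, and \<open>j + 1\<close> for
  endomorphisms of degree \<open>j\<close>.\<close>

definition hdeg :: "(int \<Rightarrow> 'a set) \<Rightarrow> (int \<Rightarrow> 'b set) \<Rightarrow> int \<Rightarrow> ('a list \<Rightarrow> 'b) \<Rightarrow> bool" where
  "hdeg C C' m \<phi> \<longleftrightarrow> (\<forall>ds xs. xs \<noteq> [] \<longrightarrow> list_all2 (\<lambda>d x. x \<in> C d) ds xs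
     \<longrightarrow> \<phi> xs \<in> C' (sum_list ds - int (length xs) + m))"

lemma hdegD:
  "hdeg C C' m \<phi> \<Longrightarrow> xs \<noteq> [] \<Longrightarrow> list_all2 (\<lambda>d x. x \<in> C d) ds xs
   \<Longrightarrow> k = sum_list ds - int (length xs) + m \<Longrightarrow> \<phi> xs \<in> C' k"
  by (simp add: hdeg_def)

lemma hdegI:
  "(\<And>ds xs. xs \<noteq> [] \<Longrightarrow> list_all2 (\<lambda>d x. x \<in> C d) ds xs
     \<Longrightarrow> \<phi> xs \<in> C' (sum_list ds - int (length xs) + m)) \<Longrightarrow> hdeg C C' m \<phi>"
  by (simp add: hdeg_def)

lemma mem_degree: "x \<in> C k \<Longrightarrow> k = l \<Longrightarrow> x \<in> C (l :: int)"
  by simp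

lemma hdeg_Cons: "hdeg C C' m \<phi> \<Longrightarrow> x \<in> C d \<Longrightarrow> m' = m + d - 1 \<Longrightarrow> hdeg C C' m' (\<lambda>zs. \<phi> (x # zs))"
  unfolding hdeg_def
proof (intro allI impI, goal_cases)
  case (1 ds xs)
  then have "\<phi> (x # xs) \<in> C' (sum_list (d # ds) - int (length (x # xs)) + m)"
    by (metis list.simps(3) list_all2_Cons)
  then show ?case by (rule mem_degree) (use 1 in simp)
qed

lemma homogeneous_append:
  assumes "list_all2 P ds xs" "us @ vs = xs"
  obtains d1 d2 where "ds = d1 @ d2" "list_all2 P d1 us" "list_all2 P d2 vs"
  using assms by (auto simp: list_all2_append2)

context
  fixes C' :: "int \<Rightarrow> 'c::ab_group_add set"
  assumes C': "\<And>i. 0 \<in> C' i" "\<And>i x y. x \<in> C' i \<Longrightarrow> y \<in> C' i \<Longrightarrow> x + y \<in> C' i"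
begin

lemma hdeg_coder:
  assumes b: "hdeg C C 2 b" and e: "\<And>d x. x \<in> C d \<Longrightarrow> e x \<in> C d"
    and "hdeg C C' m \<phi>" "m' = m + 1"
  shows "hdeg C C' m' (coder b e \<phi>)"
proof -
  have "coder b e \<phi> xs \<in> C' (sum_list ds - int (length xs) + m + 1)"
    if "list_all2 (\<lambda>d x. x \<in> C d) ds xs" "hdeg C C' m \<phi>" for ds xs m \<phi>
    using that
  proof (induction xs arbitrary: ds m \<phi> rule: list.induct)
    case (Cons x xs)
    then obtain d ds' where ds: "ds = d # ds'" and x: "x \<in> C d"
      and xs: "list_all2 (\<lambda>d x. x \<in> C d) ds' xs"
      by (auto simp: list_all2_Cons2)
    have 1: "split_sum (\<lambda>us vs. \<phi> (b (x # us) # vs)) xs \<in> C' (sum_list ds - int (length (x # xs)) + m + 1)"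
    proof (rule split_sum_in)
      fix us vs assume uv: "us @ vs = xs"
      obtain d1 d2 where d: "ds' = d1 @ d2" "list_all2 (\<lambda>d x. x \<in> C d) d1 us"
        "list_all2 (\<lambda>d x. x \<in> C d) d2 vs"
        using homogeneous_append[OF xs uv] .
      have "b (x # us) \<in> C (sum_list (d # d1) - int (length (x # us)) + 2)"
        by (rule hdegD[OF b]) (use x d in auto)
      then show "\<phi> (b (x # us) # vs) \<in> C' (sum_list ds - int (length (x # xs)) + m + 1)"
        by (intro hdegD[OF Cons.prems(2),
            of _ "(sum_list (d # d1) - int (length (x # us)) + 2) # d2"])
          (use d ds uv in auto)
    qed (rule C'(2))
    have "hdeg C C' (m + d - 1) (\<lambda>zs. \<phi> (e x # zs))"
      by (rule hdeg_Cons[OF Cons.prems(2) e[OF x]]) simp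
    from Cons.IH[OF xs this] have "coder b e (\<lambda>zs. \<phi> (e x # zs)) xs
        \<in> C' (sum_list ds - int (length (x # xs)) + m + 1)"
      by (simp add: ds algebra_simps)
    then show ?case using 1 C'(2) by simp
  qed (simp add: C')
  then show ?thesis using assms(3,4) by (intro hdegI) (metis (no_types, lifting) add.assoc)
qed

lemma hdeg_homot:
  assumes h: "\<And>d x. x \<in> C d \<Longrightarrow> h x \<in> C (d - 1)" and p: "\<And>d x. x \<in> C d \<Longrightarrow> p x \<in> C d"
    and e: "\<And>d x. x \<in> C d \<Longrightarrow> e x \<in> C d"
    and "hdeg C C' m \<phi>" "m' = m - 1"
  shows "hdeg C C' m' (homot h p e \<phi>)"
proof -
  have "homot h p e \<phi> xs \<in> C' (sum_list ds - int (length xs) + m - 1)"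
    if "list_all2 (\<lambda>d x. x \<in> C d) ds xs" "hdeg C C' m \<phi>" for ds xs m \<phi>
    using that
  proof (induction xs arbitrary: ds m \<phi> rule: list.induct)
    case (Cons x xs)
    then obtain d ds' where ds: "ds = d # ds'" and x: "x \<in> C d"
      and xs: "list_all2 (\<lambda>d x. x \<in> C d) ds' xs"
      by (auto simp: list_all2_Cons2)
    have "list_all2 (\<lambda>d x. x \<in> C d) ds' (map p xs)"
      using xs p by (simp add: list_all2_map2) (erule list_all2_mono, auto)
    then have 1: "\<phi> (h x # map p xs) \<in> C' (sum_list ds - int (length (x # xs)) + m - 1)"
      by (intro hdegD[OF Cons.prems(2), of _ "(d - 1) # ds'"]) (use h x ds in auto)
    have "hdeg C C' (m + d - 1) (\<lambda>zs. \<phi> (e x # zs))"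
      by (rule hdeg_Cons[OF Cons.prems(2) e[OF x]]) simp
    from Cons.IH[OF xs this] have "homot h p e (\<lambda>zs. \<phi> (e x # zs)) xs
        \<in> C' (sum_list ds - int (length (x # xs)) + m - 1)"
      by (simp add: ds algebra_simps)
    then show ?case using 1 C'(2) by simp
  qed (simp add: C')
  note * = this
  show ?thesis
    by (intro hdegI, rule mem_degree[of _ C', OF *[OF _ assms(4)]]) (use assms(5) in auto)
qed

lemma hdeg_pull:
  assumes f: "hdeg C C0 1 f" and "hdeg C0 C' m \<phi>"
  shows "hdeg C C' m (pull f \<phi>)"
proof -
  have "pull f \<phi> xs \<in> C' (sum_list ds - int (length xs) + m)"
    if "list_all2 (\<lambda>d x. x \<in> C d) ds xs" "hdeg C0 C' m \<phi>" "xs \<noteq> []" for ds xs m \<phi>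
    using that
  proof (induction xs arbitrary: ds m \<phi> rule: length_induct)
    case (1 xs)
    then obtain x xs' where xs': "xs = x # xs'" by (cases xs) auto
    obtain d ds' where ds: "ds = d # ds'" and x: "x \<in> C d"
      and hom: "list_all2 (\<lambda>d x. x \<in> C d) ds' xs'"
      using 1(2) xs' by (auto simp: list_all2_Cons2)
    show ?case
      unfolding xs' pull_Cons
    proof (rule split_sum_in)
      fix us vs assume uv: "us @ vs = xs'"
      obtain d1 d2 where d: "ds' = d1 @ d2" "list_all2 (\<lambda>d x. x \<in> C d) d1 us"
        "list_all2 (\<lambda>d x. x \<in> C d) d2 vs"
        using homogeneous_append[OF hom uv] .
      have fx: "f (x # us) \<in> C0 (sum_list (d # d1) - int (length (x # us)) + 1)"
        by (rule hdegD[OF f]) (use x d in auto)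
      show "pull f (\<lambda>zs. \<phi> (f (x # us) # zs)) vs \<in> C' (sum_list ds - int (length (x # xs')) + m)"
      proof (cases "vs = []")
        case True
        then show ?thesis
          using fx d uv ds
          by (auto intro!: hdegD[OF 1(3), of _ "[sum_list (d # d1) - int (length (x # us)) + 1]"])
      next
        case False
        have "hdeg C0 C' (m + (sum_list (d # d1) - int (length (x # us)) + 1) - 1)
            (\<lambda>zs. \<phi> (f (x # us) # zs))"
          by (rule hdeg_Cons[OF 1(3) fx]) simp
        moreover have "length vs < length xs" using uv xs' by auto
        ultimately have "pull f (\<lambda>zs. \<phi> (f (x # us) # zs)) vs \<in>
          C' (sum_list d2 - int (length vs) + (m + (sum_list (d # d1) - int (length (x # us)) + 1) - 1))"
          using 1(1) d(3) False by blast
        then show ?thesis using uv[symmetric] by (simp add: ds d algebra_simps)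
      qed
    qed (rule C'(2))
  qed
  then show ?thesis using assms(2) by (intro hdegI) auto
qed

end

text \<open>Passage from the operator form of the signs to exponents: on a homogeneous word the
  letters \<open>e\<close> together amount to the sign of the total shifted degree.\<close>

lemma multilin_map_homogeneous:
  fixes t :: "'k::field \<Rightarrow> 'c::ab_group_add \<Rightarrow> 'c"
  assumes "vector_space s" "vector_space t" "multilin s t \<phi>"
    and e_C: "\<And>i x. x \<in> C i \<Longrightarrow> e x = signed (i - 1) x"
  shows "list_all2 (\<lambda>d x. x \<in> C d) ds xs \<Longrightarrow>
    \<phi> (us @ map e xs) = signed (sum_list ds - int (length xs)) (\<phi> (us @ xs))"
proof (induction xs arbitrary: us ds rule: list.induct)
  case (Cons x xs)
  then obtain d ds' where ds: "ds = d # ds'" and x: "x \<in> C d"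
    and hom: "list_all2 (\<lambda>d x. x \<in> C d) ds' xs"
    by (auto simp: list_all2_Cons2)
  have "\<phi> (us @ map e (x # xs)) = signed (sum_list ds' - int (length xs)) (\<phi> (us @ e x # xs))"
    using Cons.IH[OF hom, of "us @ [e x]"] by simp
  also have "\<phi> (us @ e x # xs) = signed (d - 1) (\<phi> (us @ x # xs))"
    unfolding e_C[OF x] by (rule additive_signed[OF multilin_additive[OF assms(1-3)]])
  finally show ?case by (simp add: ds signed_signed algebra_simps)
qed simp

text \<open>The two unit laws look different because of the shift: for \<open>x\<close> of degree
  \<open>i\<close> the product \<open>b [x, u]\<close> carries the sign \<open>(-1)^i\<close>, which
  is that of \<open>- e\<close>. No condition is put on higher operations with \<open>u\<close>
  among the arguments.\<close>

locale graded_minimal_algebra = minimal_algebra s e b p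
  for s :: "'k::field \<Rightarrow> 'a::ab_group_add \<Rightarrow> 'a" and e b p +
  fixes C :: "int \<Rightarrow> 'a set" and S :: "'a set" and n :: int and u :: 'a
  assumes subspace_C: "subspace (C i)"
    and indep_C: "finite I \<Longrightarrow> (\<And>i. i \<in> I \<Longrightarrow> f i \<in> C i) \<Longrightarrow> sum f I = 0 \<Longrightarrow> i \<in> I \<Longrightarrow> f i = 0"
    and e_C: "x \<in> C i \<Longrightarrow> e x = signed (i - 1) x"
    and p_C: "x \<in> C i \<Longrightarrow> p x \<in> C i"
    and b_C: "hdeg C C 2 b"
    and finite_S: "finite S" and S_C: "S \<subseteq> (\<Union>i. C i)" and p_S: "range p \<subseteq> span S"
    and p_bounds: "x \<in> C i \<Longrightarrow> p x \<noteq> 0 \<Longrightarrow> - n \<le> i \<and> i \<le> 0" and n_nonneg: "n \<ge> 0"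
    and u_C: "u \<in> C 0" and p_u: "p u = u"
    and u_left: "b [u, x] = p x" and u_right: "b [x, u] = - e (p x)"
begin

lemma module_s: "module s"
  by (simp add: module_axioms)

lemma C_closed: "0 \<in> C i" "x \<in> C i \<Longrightarrow> y \<in> C i \<Longrightarrow> x + y \<in> C i" "x \<in> C i \<Longrightarrow> signed k x \<in> C i"
  "x \<in> C i \<Longrightarrow> s c x \<in> C i" "x \<in> C i \<Longrightarrow> e x \<in> C i" "x \<in> C i \<Longrightarrow> - x \<in> C i"
  "x \<in> C i \<Longrightarrow> y \<in> C i \<Longrightarrow> x - y \<in> C i"
  using subspace_C[of i] signed_mem[OF module_s subspace_C[of i]] e_C[of _ i]
  by (auto simp: subspace_0 subspace_add subspace_scale subspace_neg subspace_diff)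

text \<open>Letters are replaced one at a time by elements of the spanning set \<open>S\<close>. Its
  elements are homogeneous, so degree arguments become available for functions on the whole ambient
  type.\<close>

lemma eq_0_of_words:
  assumes \<phi>: "multilin s t \<phi>" and t: "vector_space t" and p: "\<And>xs. \<phi> (map p xs) = \<phi> xs"
    and words: "\<And>ws. set ws \<subseteq> S \<Longrightarrow> length ws = length xs \<Longrightarrow> \<phi> ws = 0"
  shows "\<phi> xs = 0"
proof -
  have "\<phi> (us @ map p vs) = 0" if "set us \<subseteq> S" "length us + length vs = length xs" for us vs
    using that
  proof (induction vs arbitrary: us)
    case Nil
    then show ?case using words by simp
  next
    case (Cons v vs)
    have "\<phi> (us @ x # map p vs) = 0" if "x \<in> span S" for x
      using that
    proof (induction rule: span_induct_alt)
      case base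
      show ?case by (rule multilin_0[OF vs_s t \<phi>])
    next
      case (step c w y)
      have "\<phi> ((us @ [w]) @ map p vs) = 0"
        using Cons.prems step by (intro Cons.IH) auto
      then show ?case
        using multilinD[OF \<phi>, of us y c w] step additive.zero[OF scale_additive[OF t t]]
        by (simp add: add.commute)
    qed
    then show ?case using p_S by auto
  qed
  from this[of "[]" xs] show ?thesis using p by simp
qed

lemma map_e_homogeneous:
  assumes "vector_space t" "multilin s t \<phi>" "list_all2 (\<lambda>d x. x \<in> C d) ds xs"
  shows "\<phi> (us @ map e xs) = signed (sum_list ds - int (length xs)) (\<phi> (us @ xs))"
  by (rule multilin_map_homogeneous[OF vs_s assms(1,2) e_C assms(3)])

definition end_comp :: "int \<Rightarrow> ('a list \<Rightarrow> 'a) set" where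
  "end_comp j = {\<psi>. end_fun \<psi> \<and> hdeg C C (j + 1) \<psi>}"

lemma end_compD: "\<psi> \<in> end_comp j \<Longrightarrow> end_fun \<psi>" "\<psi> \<in> end_comp j \<Longrightarrow> hdeg C C (j + 1) \<psi>"
  by (auto simp: end_comp_def)

lemma S_homogeneous: "set ws \<subseteq> S \<Longrightarrow> \<exists>ds. list_all2 (\<lambda>d x. x \<in> C d) ds ws"
proof (induction ws)
  case (Cons w ws)
  then obtain ds where "list_all2 (\<lambda>d x. x \<in> C d) ds ws" by auto
  moreover obtain d where "w \<in> C d" using Cons.prems S_C by auto
  ultimately show ?case by (intro exI[of _ "d # ds"]) simp
qed simp

text \<open>On letters with nonzero image under \<open>p\<close> the arguments have total degree at
  most 0 and a nonzero value has degree at least \<open>- n\<close>, while every letter lowers the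
  degree of the value by one.\<close>

lemma end_comp_long:
  assumes "\<psi> \<in> end_comp j" "int (length xs) > n + j + 1"
  shows "\<psi> xs = 0"
proof (rule eq_0_of_words[OF _ vs_s])
  note 1 = end_funD[OF end_compD(1)[OF assms(1)]]
  show "multilin s s \<psi>" "\<And>xs. \<psi> (map p xs) = \<psi> xs" by (simp_all add: 1)
  fix ws assume ws: "set ws \<subseteq> S" "length ws = length xs"
  obtain ds where ds: "list_all2 (\<lambda>d x. x \<in> C d) ds ws" using S_homogeneous[OF ws(1)] by auto
  show "\<psi> ws = 0"
  proof (cases "0 \<in> set (map p ws)")
    case True
    then show ?thesis using multilin_0_mem[OF vs_s vs_s 1(1) True] 1(3) by simp
  next
    case False
    have "sum_list ds \<le> 0"
      using ds False by (induction rule: list_all2_induct) (use p_bounds in fastforce)+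
    show ?thesis
    proof (rule ccontr)
      assume nz: "\<psi> ws \<noteq> 0"
      then have ne: "ws \<noteq> []" using 1(2) by auto
      have "\<psi> ws \<in> C (sum_list ds - int (length ws) + (j + 1))"
        by (rule hdegD[OF end_compD(2)[OF assms(1)] ne ds]) simp
      from p_bounds[OF this] nz 1(4) have "- n \<le> sum_list ds - int (length ws) + (j + 1)" by auto
      then show False using \<open>sum_list ds \<le> 0\<close> assms(2) ws(2) by simp
    qed
  qed
qed

text \<open>On a homogeneous word the sign of the arguments occurs twice, once from
  \<open>map e\<close> and once in the degree of the value; what remains is the sign of
  \<open>j\<close>.\<close>

lemma econj_end_comp:
  assumes "\<psi> \<in> end_comp j"
  shows "econj \<psi> = (\<lambda>xs. signed j (\<psi> xs))"
proof
  fix xs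
  note 0 = end_compD(1)[OF assms]
  note 1 = end_funD[OF 0] and 2 = end_funD[OF end_fun_econj[OF 0]]
  define \<phi> where "\<phi> xs = econj \<psi> xs - signed j (\<psi> xs)" for xs
  have ms: "multilin s s (\<lambda>xs. signed j (\<psi> xs))"
    using 1(1) multilin_uminus[OF vs_s vs_s 1(1)] by (cases "even j") (auto simp: signed_def)
  have "\<phi> xs = 0"
  proof (rule eq_0_of_words[OF _ vs_s])
    show "multilin s s \<phi>" unfolding \<phi>_def
      by (rule multilin_diff[OF vs_s vs_s 2(1) ms])
    show "\<And>xs. \<phi> (map p xs) = \<phi> xs" by (simp add: \<phi>_def 1 2)
    fix ws assume ws: "set ws \<subseteq> S" "length ws = length xs"
    obtain ds where ds: "list_all2 (\<lambda>d x. x \<in> C d) ds ws" using S_homogeneous[OF ws(1)] by auto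
    show "\<phi> ws = 0"
    proof (cases "ws = []")
      case False
      let ?k = "sum_list ds - int (length ws)"
      have "econj \<psi> ws = signed ?k (e (\<psi> ws))"
        using map_e_homogeneous[OF vs_s 1(1) ds, of "[]"]
        by (simp add: econj_def additive_signed[OF additive_e])
      also have "e (\<psi> ws) = signed (?k + (j + 1) - 1) (\<psi> ws)"
        by (rule e_C) (rule hdegD[OF end_compD(2)[OF assms] False ds], simp)
      finally have "econj \<psi> ws = signed (?k + (?k + (j + 1) - 1)) (\<psi> ws)" by (simp add: signed_signed)
      also have "\<dots> = signed j (\<psi> ws)" by (rule signed_cong) simp
      finally show ?thesis by (simp add: \<phi>_def)
    qed (simp add: \<phi>_def 1 2)
  qed
  then show "econj \<psi> xs = signed j (\<psi> xs)" by (simp add: \<phi>_def)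
qed

lemma end_comp_comp:
  assumes "\<psi> \<in> end_comp i" "\<chi> \<in> end_comp j"
  shows "mod_comp \<psi> \<chi> \<in> end_comp (i + j)"
proof -
  have "hdeg C C (i + j + 1) (mod_comp \<psi> \<chi>)"
    unfolding mod_comp_def
  proof (intro hdegI split_sum_in)
    fix ds xs us vs
    assume xs: "list_all2 (\<lambda>d x. x \<in> C d) ds xs" and uv: "us @ vs = xs"
    obtain d1 d2 where d: "ds = d1 @ d2" "list_all2 (\<lambda>d x. x \<in> C d) d1 us"
      "list_all2 (\<lambda>d x. x \<in> C d) d2 vs"
      using homogeneous_append[OF xs uv] .
    show "\<psi> (\<chi> us # vs) \<in> C (sum_list ds - int (length xs) + (i + j + 1))"
    proof (cases "us = []")
      case True
      then show ?thesis using end_funD[OF end_compD(1)[OF assms(1)]] end_funD[OF end_compD(1)[OF assms(2)]]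
        by (simp add: C_closed)
    next
      case False
      have "\<chi> us \<in> C (sum_list d1 - int (length us) + (j + 1))"
        by (rule hdegD[OF end_compD(2)[OF assms(2)] False d(2)]) simp
      then show ?thesis
        by (intro hdegD[OF end_compD(2)[OF assms(1)],
            of _ "(sum_list d1 - int (length us) + (j + 1)) # d2"]) (use d uv in auto)
    qed
  qed (rule C_closed)
  then show ?thesis using end_fun_comp assms by (auto simp: end_comp_def)
qed

lemma end_comp_closed:
  "(\<lambda>xs. 0) \<in> end_comp j"
  "\<psi> \<in> end_comp j \<Longrightarrow> \<chi> \<in> end_comp j \<Longrightarrow> (\<lambda>xs. \<psi> xs + \<chi> xs) \<in> end_comp j"
  "\<psi> \<in> end_comp j \<Longrightarrow> \<chi> \<in> end_comp j \<Longrightarrow> (\<lambda>xs. \<psi> xs - \<chi> xs) \<in> end_comp j"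
  "\<psi> \<in> end_comp j \<Longrightarrow> (\<lambda>xs. s c (\<psi> xs)) \<in> end_comp j"
  by (auto simp: end_comp_def hdeg_def C_closed end_fun_zero end_fun_add end_fun_diff end_fun_scale)

lemma end_comp_signed: "\<psi> \<in> end_comp j \<Longrightarrow> (\<lambda>xs. signed k (\<psi> xs)) \<in> end_comp j"
  using end_comp_closed(1)[of j] end_comp_closed(3)[of "\<lambda>xs. 0" j \<psi>]
  by (cases "even k") (auto simp: signed_def)

lemma b_end_comp: "b \<in> end_comp 1"
  using b_C by (simp add: end_comp_def end_fun_b)

lemma end_comp_econj: "\<psi> \<in> end_comp j \<Longrightarrow> econj \<psi> \<in> end_comp j"
  by (simp add: econj_end_comp end_comp_signed)

lemma end_comp_end_diff:
  assumes "\<psi> \<in> end_comp j" shows "end_diff \<psi> \<in> end_comp (j + 1)"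
proof -
  have "coder b e (econj \<psi>) \<in> end_comp (j + 1)"
    using end_fun_coder[OF end_compD(1)[OF end_comp_econj[OF assms]]]
      hdeg_coder[of C C b e "j + 1" "econj \<psi>" "j + 1 + 1"] b_C end_compD(2)[OF end_comp_econj[OF assms]]
    by (auto simp: end_comp_def C_closed)
  moreover have "mod_comp b \<psi> \<in> end_comp (j + 1)"
    using end_comp_comp[OF b_end_comp assms] by (simp add: add.commute)
  ultimately show ?thesis unfolding end_diff_def[abs_def] by (intro end_comp_closed)
qed

lemma end_comp_one: "end_one \<in> end_comp 0"
proof -
  have "end_one xs \<in> C (sum_list ds - int (length xs) + 1)"
    if hom: "list_all2 (\<lambda>d x. x \<in> C d) ds xs" for ds xs
  proof (cases "length xs = 1")
    case True
    then obtain x where "xs = [x]" by (auto simp: length_Suc_conv)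
    moreover from this obtain d where "ds = [d]" using hom by (auto simp: list_all2_Cons2)
    ultimately have "xs = [x]" "ds = [d]" by auto
    then show ?thesis using hom by (simp add: end_one_def p_C)
  qed (simp add: end_one_def C_closed)
  then show ?thesis by (simp add: end_comp_def end_fun_one hdeg_def)
qed

lemma end_comp_left_mult:
  assumes "list_all2 (\<lambda>d x. x \<in> C d) ds as"
  shows "left_mult as \<in> end_comp (sum_list ds - int (length as) + 1)"
proof -
  have "left_mult as xs \<in> C (sum_list es - int (length xs) + (sum_list ds - int (length as) + 1 + 1))"
    if "list_all2 (\<lambda>d x. x \<in> C d) es xs" for es xs
  proof (cases "as = [] \<or> xs = []")
    case False
    have "list_all2 (\<lambda>d x. x \<in> C d) (ds @ es) (as @ xs)"
      using assms that by (rule list_all2_appendI)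
    then show ?thesis
      using False by (auto simp: left_mult_def intro!: hdegD[OF b_C])
  qed (auto simp: left_mult_def C_closed)
  then show ?thesis by (simp add: end_comp_def end_fun_left_mult hdeg_def)
qed

lemma end_diff_add:
  "end_fun \<psi> \<Longrightarrow> end_fun \<chi> \<Longrightarrow> end_diff (\<lambda>xs. \<psi> xs + \<chi> xs) xs = end_diff \<psi> xs + end_diff \<chi> xs"
  by (simp add: end_diff_def econj_def[abs_def] comp_eq e_add coder_add split_sum_add
      multilin_add_hd[OF vs_s vs_s multilin_b])

lemma end_diff_scale:
  "end_diff (\<lambda>xs. s c (\<psi> xs)) xs = s c (end_diff \<psi> xs)"
proof -
  have "b (s c x # xs) = s c (b (x # xs))" for x xs
    using lin_scale[OF vs_s vs_s multilin_lin_hd[OF multilin_b]] .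
  then show ?thesis
    by (simp add: end_diff_def econj_def[abs_def] comp_eq lin_scale[OF vs_s vs_s lin_e]
        coder_scale[OF vs_s vs_s] split_sum_scale[OF vs_s vs_s] scale_right_diff_distrib)
qed

lemma end_diff_minus: "end_diff (\<lambda>xs. - \<psi> xs) xs = - end_diff \<psi> xs"
  using end_diff_scale[of "-1" \<psi>] by simp

lemma end_diff_subtract:
  "end_fun \<psi> \<Longrightarrow> end_fun \<chi> \<Longrightarrow> end_diff (\<lambda>xs. \<psi> xs - \<chi> xs) xs = end_diff \<psi> xs - end_diff \<chi> xs"
  using end_diff_add[of \<psi> "\<lambda>xs. - \<chi> xs"] end_diff_minus[of \<chi>] end_fun_scale[of \<chi> "-1"] by simp

lemma end_diff_signed: "end_diff (\<lambda>xs. signed k (\<psi> xs)) xs = signed k (end_diff \<psi> xs)"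
  using end_diff_minus by (auto simp: signed_def)

lemma end_diff_single: "end_fun \<psi> \<Longrightarrow> end_diff \<psi> [x] = 0"
  using end_funD[OF end_fun_econj] end_funD(5)[OF end_fun_b]
  by (simp add: end_diff_def comp_eq b_single end_funD)

subsection \<open>The Yoneda argument\<close>

text \<open>The homotopy of the Yoneda lemma: \<open>u\<close> becomes the module element and the
  old module element becomes the first algebra argument.\<close>

definition prepend_unit :: "('a list \<Rightarrow> 'a) \<Rightarrow> 'a list \<Rightarrow> 'a" where
  "prepend_unit \<psi> xs = (if xs = [] then 0 else \<psi> (u # xs))"

lemma end_comp_prepend_unit:
  assumes "\<psi> \<in> end_comp j" shows "prepend_unit \<psi> \<in> end_comp (j - 1)"
proof -
  note 1 = end_funD[OF end_compD(1)[OF assms]]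
  have "multilin s s (prepend_unit \<psi>)"
    using multilinD[OF multilin_Cons[OF 1(1)]] by (simp add: multilin_def prepend_unit_def)
  moreover have "\<psi> (u # map p xs) = \<psi> (u # xs)" for xs
    using 1(3)[of "u # xs"] by (simp add: p_u)
  moreover have "hdeg C C j (prepend_unit \<psi>)"
    using hdeg_Cons[OF end_compD(2)[OF assms] u_C, of j]
    by (auto simp: hdeg_def prepend_unit_def)
  ultimately show ?thesis by (auto simp: end_comp_def end_fun_def prepend_unit_def 1)
qed

text \<open>Higher operations involving \<open>u\<close> need not vanish, but they contract at least
  three letters and so feed \<open>\<psi>\<close> with words shorter than \<open>xs\<close>, where
  it is zero. Only \<open>b [u, x] = p x\<close> remains, and it reproduces
  \<open>\<psi>\<close>.\<close>

lemma end_diff_unit: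
  assumes \<psi>: "end_fun \<psi>" and "\<psi> [u] = 0" and short: "\<And>zs. length zs < length xs \<Longrightarrow> \<psi> zs = 0"
    and ne: "xs \<noteq> []"
  shows "end_diff \<psi> (u # xs) = end_diff (prepend_unit \<psi>) xs - econj \<psi> xs"
proof -
  note 1 = end_funD[OF \<psi>] and 2 = end_funD[OF end_fun_econj[OF \<psi>]]
  obtain x xs' where xs: "xs = x # xs'" using ne by (cases xs) auto
  have "mod_comp b \<psi> (u # xs) = split_sum (\<lambda>us vs. b (\<psi> (u # us) # vs)) xs"
    using end_funD(5)[OF end_fun_b] by (simp add: comp_eq 1)
  also have "\<dots> = mod_comp b (prepend_unit \<psi>) xs"
    unfolding comp_eq by (rule split_sum_cong) (auto simp: prepend_unit_def assms(2))
  finally have 3: "mod_comp b \<psi> (u # xs) = mod_comp b (prepend_unit \<psi>) xs" .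
  have 4: "coder b e (\<lambda>z. econj \<psi> (e u # z)) xs = coder b e (econj (prepend_unit \<psi>)) xs"
    by (rule coder_cong) (simp add: econj_def prepend_unit_def)
  have "split_sum (\<lambda>us vs. econj \<psi> (b (u # us) # vs)) xs
      = split_sum (\<lambda>us vs. econj \<psi> (b (u # x # us) # vs)) xs'"
    by (simp add: xs b_single 2)
  also have "\<dots> = econj \<psi> xs"
  proof (subst split_sum_only_Nil)
    fix us vs assume "us \<noteq> []" "us @ vs = xs'"
    then have "length (map e (b (u # x # us) # vs)) < length xs" using xs by auto
    from short[OF this] show "econj \<psi> (b (u # x # us) # vs) = 0" unfolding econj_def by simp
  qed (simp add: xs u_left 2)
  finally have 5: "split_sum (\<lambda>us vs. econj \<psi> (b (u # us) # vs)) xs = econj \<psi> xs" .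
  show ?thesis unfolding end_diff_def 3 by (simp add: 4 5)
qed

text \<open>The homotopy formula is exact only in the lowest length where \<open>\<psi>\<close> is
  nonzero, so the primitive is improved one length at a time.\<close>

lemma yoneda_truncated:
  assumes \<psi>: "\<psi> \<in> end_comp j" and "end_diff \<psi> = (\<lambda>xs. 0)" "\<psi> [u] = 0"
  shows "\<exists>\<chi> \<in> end_comp (j - 1). \<forall>xs. length xs \<le> L \<longrightarrow> \<psi> xs = end_diff \<chi> xs"
proof (induction L)
  case 0
  have "end_diff (\<lambda>xs. 0) [] = 0" using end_funD(2)[OF end_fun_end_diff[OF end_fun_zero]] .
  then show ?case
    using end_funD(2)[OF end_compD(1)[OF \<psi>]] by (intro bexI[of _ "\<lambda>xs. 0"]) (auto simp: end_comp_closed)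
next
  case (Suc L)
  then obtain \<chi> where \<chi>: "\<chi> \<in> end_comp (j - 1)" "\<And>xs. length xs \<le> L \<Longrightarrow> \<psi> xs = end_diff \<chi> xs"
    by auto
  define \<psi>' where "\<psi>' xs = \<psi> xs - end_diff \<chi> xs" for xs
  have dc: "end_diff \<chi> \<in> end_comp j" using end_comp_end_diff[OF \<chi>(1)] by simp
  have m: "\<psi>' \<in> end_comp j" unfolding \<psi>'_def by (rule end_comp_closed(3)[OF \<psi> dc])
  have z: "\<psi>' zs = 0" if "length zs \<le> L" for zs using \<chi>(2)[OF that] by (simp add: \<psi>'_def)
  have d0: "end_diff \<psi>' zs = 0" for zs
    using end_diff_subtract[OF end_compD(1)[OF \<psi>] end_compD(1)[OF dc]] assms(2)
      end_diff_end_diff[OF end_compD(1)[OF \<chi>(1)]]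
    by (simp add: \<psi>'_def[abs_def])
  have u0: "\<psi>' [u] = 0" using assms(3) end_diff_single[OF end_compD(1)[OF \<chi>(1)]] by (simp add: \<psi>'_def)
  \<comment> \<open>The error \<open>\<psi>'\<close> is a cocycle that vanishes up to length
    \<open>L\<close>. By \<open>end_diff_unit\<close> prepending the unit gives a primitive of it on
    length \<open>L + 1\<close>, up to the sign of \<open>j\<close>.\<close>
  define \<chi>' where "\<chi>' xs = \<chi> xs + signed j (prepend_unit \<psi>' xs)" for xs
  have sm: "(\<lambda>xs. signed j (prepend_unit \<psi>' xs)) \<in> end_comp (j - 1)"
    by (rule end_comp_signed[OF end_comp_prepend_unit[OF m]])
  have "\<chi>' \<in> end_comp (j - 1)" unfolding \<chi>'_def by (rule end_comp_closed(2)[OF \<chi>(1) sm])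
  moreover have "\<psi> xs = end_diff \<chi>' xs" if len: "length xs \<le> Suc L" for xs
  proof (cases "xs = []")
    case True
    then show ?thesis
      using end_funD(2)[OF end_compD(1)[OF \<psi>]] end_funD(2)[OF end_fun_end_diff[OF end_compD(1)[OF \<open>\<chi>' \<in> _\<close>]]]
      by simp
  next
    case False
    have "end_diff \<psi>' (u # xs) = end_diff (prepend_unit \<psi>') xs - econj \<psi>' xs"
      by (rule end_diff_unit[OF end_compD(1)[OF m] u0 _ False]) (use z len in auto)
    then have "end_diff (prepend_unit \<psi>') xs = signed j (\<psi>' xs)"
      using d0 by (simp add: econj_end_comp[OF m])
    then have "end_diff \<chi>' xs = end_diff \<chi> xs + signed (j + j) (\<psi>' xs)"
      by (simp add: \<chi>'_def[abs_def] end_diff_add[OF end_compD(1)[OF \<chi>(1)] end_compD(1)[OF sm]]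
          end_diff_signed signed_signed)
    then show ?thesis by (simp add: \<psi>'_def signed_even)
  qed
  ultimately show ?case by blast
qed

text \<open>Beyond length \<open>n + j + 1\<close> both sides vanish by
  \<open>end_comp_long\<close>, so a primitive up to that length is one everywhere.\<close>

theorem yoneda:
  assumes \<psi>: "\<psi> \<in> end_comp j" and "end_diff \<psi> = (\<lambda>xs. 0)" "\<psi> [u] = 0"
  obtains \<chi> where "\<chi> \<in> end_comp (j - 1)" "\<psi> = end_diff \<chi>"
proof -
  obtain \<chi> where \<chi>: "\<chi> \<in> end_comp (j - 1)"
    "\<And>xs. length xs \<le> nat (n + j + 1) \<Longrightarrow> \<psi> xs = end_diff \<chi> xs"
    using yoneda_truncated[OF assms, of "nat (n + j + 1)"] by auto
  have dc: "end_diff \<chi> \<in> end_comp j" using end_comp_end_diff[OF \<chi>(1)] by simp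
  have "\<psi> xs = end_diff \<chi> xs" for xs
    using \<chi>(2)[of xs] end_comp_long[OF \<psi>, of xs] end_comp_long[OF dc, of xs]
    by (cases "length xs \<le> nat (n + j + 1)") auto
  then show ?thesis using that \<chi>(1) by blast
qed

end

lemma pull_aux_map:
  assumes "\<And>xs. g' (f xs) = f (map g xs)"
  shows "pull_aux f us (\<lambda>zs. \<phi> (map g' zs)) xs = pull_aux f (map g us) \<phi> (map g xs)"
proof (induction xs arbitrary: us \<phi>)
  case (Cons x xs)
  show ?case
    using Cons.IH[of "[]" "\<lambda>zs. \<phi> (f (map g us @ [g x]) # zs)"] Cons.IH[of "us @ [x]" \<phi>]
    by (simp add: assms)
qed simp

lemma pull_map_map:
  "(\<And>xs. g' (f xs) = f (map g xs)) \<Longrightarrow> pull f (\<lambda>zs. \<phi> (map g' zs)) xs = pull f \<phi> (map g xs)"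
  using pull_aux_map[of g' f g "[]"] by (simp add: pull_def)

lemma pull_aux_in:
  "(\<And>zs. \<phi> zs \<in> Y) \<Longrightarrow> 0 \<in> Y \<Longrightarrow> (\<And>x y. x \<in> Y \<Longrightarrow> y \<in> Y \<Longrightarrow> x + y \<in> Y)
   \<Longrightarrow> pull_aux f us \<phi> xs \<in> Y"
  by (induction xs arbitrary: us \<phi>) auto

lemma pull_in:
  "(\<And>zs. \<phi> zs \<in> Y) \<Longrightarrow> 0 \<in> Y \<Longrightarrow> (\<And>x y. x \<in> Y \<Longrightarrow> y \<in> Y \<Longrightarrow> x + y \<in> Y) \<Longrightarrow> pull f \<phi> xs \<in> Y"
  by (simp add: pull_def pull_aux_in)

lemma is_dg_algebraI:
  assumes "graded_vector_space A"
    and "\<And>i x. x \<in> component A i \<Longrightarrow> dg_diff A x \<in> component A (i + 1)"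
    and "\<And>i x. x \<in> component A i \<Longrightarrow> dg_diff A (dg_diff A x) = 0"
    and "\<And>i x c. x \<in> component A i \<Longrightarrow> dg_diff A (smul A c x) = smul A c (dg_diff A x)"
    and "\<And>i x y. x \<in> component A i \<Longrightarrow> y \<in> component A i
      \<Longrightarrow> dg_diff A (x + y) = dg_diff A x + dg_diff A y"
    and "\<And>i j x y. x \<in> component A i \<Longrightarrow> y \<in> component A j \<Longrightarrow> dg_mult A x y \<in> component A (i + j)"
    and "\<And>i j x y c. x \<in> component A i \<Longrightarrow> y \<in> component A j
      \<Longrightarrow> dg_mult A (smul A c x) y = smul A c (dg_mult A x y)"
    and "\<And>i j x y c. x \<in> component A i \<Longrightarrow> y \<in> component A j
      \<Longrightarrow> dg_mult A x (smul A c y) = smul A c (dg_mult A x y)"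
    and "\<And>i j x x' y. x \<in> component A i \<Longrightarrow> x' \<in> component A i \<Longrightarrow> y \<in> component A j
      \<Longrightarrow> dg_mult A (x + x') y = dg_mult A x y + dg_mult A x' y"
    and "\<And>i j x y y'. x \<in> component A i \<Longrightarrow> y \<in> component A j \<Longrightarrow> y' \<in> component A j
      \<Longrightarrow> dg_mult A x (y + y') = dg_mult A x y + dg_mult A x y'"
    and "\<And>i j x y. x \<in> component A i \<Longrightarrow> y \<in> component A j
      \<Longrightarrow> dg_diff A (dg_mult A x y) = dg_mult A (dg_diff A x) y + signed i (dg_mult A x (dg_diff A y))"
    and "\<And>i j l x y z. x \<in> component A i \<Longrightarrow> y \<in> component A j \<Longrightarrow> z \<in> component A l
      \<Longrightarrow> dg_mult A (dg_mult A x y) z = dg_mult A x (dg_mult A y z)"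
    and "dg_one A \<in> component A 0"
    and "\<And>i x. x \<in> component A i \<Longrightarrow> dg_mult A (dg_one A) x = x"
    and "\<And>i x. x \<in> component A i \<Longrightarrow> dg_mult A x (dg_one A) = x"
  shows "is_dg_algebra A"
  unfolding is_dg_algebra_def
  by (intro conjI ballI allI; (rule assms; assumption)?)

context minimal_algebra
begin

lemma additive_end_diff: "additive end_diff"
  by (rule additive.intro)
    (simp add: fun_eq_iff end_diff_def econj_def[abs_def] comp_eq e_add coder_add split_sum_add
      multilin_add_hd[OF vs_s vs_s multilin_b])

lemma additive_econj: "additive econj"
  by (rule additive.intro) (simp add: fun_eq_iff econj_def e_add)

lemma additive_comp_left: "additive (\<lambda>\<psi> :: 'a list \<Rightarrow> 'a. mod_comp \<psi> \<chi>)"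
  by (rule additive.intro) (simp add: fun_eq_iff comp_eq split_sum_add)

lemma additive_comp_right: "multilin s s \<psi> \<Longrightarrow> additive (mod_comp \<psi>)"
  by (rule additive.intro)
    (simp add: fun_eq_iff comp_eq split_sum_add multilin_add_hd[OF vs_s vs_s])

lemma end_diff_left_mult_single: "end_diff (left_mult [a]) = (\<lambda>xs. 0)"
proof
  fix xs
  have 0: "left_mult [0] = (\<lambda>xs. 0)"
    using multilin_0_hd[OF vs_s vs_fun multilin_left_mult, of "[]"] by (simp add: zero_fun_def)
  have 1: "mod_comp (left_mult [e a]) (\<lambda>xs. 0) = (\<lambda>xs. 0)"
    using end_funD(5)[OF end_fun_left_mult] by (simp add: fun_eq_iff comp_eq split_sum_zero)
  have 2: "mod_comp (\<lambda>xs. 0 :: 'a) (left_mult [a]) = (\<lambda>xs. 0)"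
    by (simp add: fun_eq_iff comp_eq split_sum_zero)
  show "end_diff (left_mult [a]) xs = 0"
    using coder_left_mult[of "[a]" xs] by (simp add: b_single 0 1 2)
qed

end

section \<open>The truncated DG-algebra of endomorphisms\<close>

context graded_minimal_algebra
begin

text \<open>The smart truncation: keeping only the cocycles in degree 0 leaves the cohomology in
  degrees at most 0 unchanged, whereas dropping positive degrees alone would turn every element of
  degree 0 into a cocycle.\<close>

definition fin_comp :: "int \<Rightarrow> ('a list \<Rightarrow> 'a) set" where
  "fin_comp j = (if j > 0 then {\<lambda>xs. 0} else if j = 0 then {\<psi> \<in> end_comp 0. end_diff \<psi> = (\<lambda>xs. 0)}
     else end_comp j)"

definition end_dg :: "('k, 'a list \<Rightarrow> 'a) dg_algebra" where
  "end_dg = \<lparr>smul = scale_fun, component = fin_comp, dg_diff = end_diff, dg_mult = mod_comp,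
     dg_one = end_one\<rparr>"

lemma end_diff_zero [simp]: "end_diff (\<lambda>xs. 0) = (\<lambda>xs. 0)"
  using additive.zero[OF additive_end_diff] by (simp add: zero_fun_def)

lemma fin_comp_sub: "fin_comp j \<subseteq> end_comp j"
  by (auto simp: fin_comp_def end_comp_closed)

lemma fin_comp_neg: "j < 0 \<Longrightarrow> fin_comp j = end_comp j"
  by (simp add: fin_comp_def)

lemma fin_compD:
  assumes "\<psi> \<in> fin_comp j"
  shows "\<psi> \<in> end_comp j" "end_fun \<psi>" "multilin s s \<psi>" "\<psi> (0 # xs) = 0" "econj \<psi> = (\<lambda>xs. signed j (\<psi> xs))"
proof -
  show *: "\<psi> \<in> end_comp j" using fin_comp_sub assms by auto
  show "end_fun \<psi>" by (rule end_compD(1)[OF *])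
  then show "multilin s s \<psi>" "\<psi> (0 # xs) = 0" using end_funD by auto
  show "econj \<psi> = (\<lambda>xs. signed j (\<psi> xs))" by (rule econj_end_comp[OF *])
qed

lemma fin_comp_subspace: "module.subspace scale_fun (fin_comp j)"
proof -
  interpret F: vector_space scale_fun by (rule vs_fun)
  have d: "end_diff (\<lambda>xs. \<psi> xs + \<chi> xs) = (\<lambda>xs. end_diff \<psi> xs + end_diff \<chi> xs)" for \<psi> \<chi>
    using additive.add[OF additive_end_diff, of \<psi> \<chi>] by (simp add: plus_fun_def)
  have ds: "end_diff (\<lambda>xs. s c (\<psi> xs)) = (\<lambda>xs. s c (end_diff \<psi> xs))" for c \<psi>
    using end_diff_scale by auto
  show ?thesis
    unfolding F.subspace_def
    by (auto simp: fin_comp_def zero_fun_def plus_fun_def end_comp_closed d ds)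
qed

lemma fin_comp_closed:
  "(\<lambda>xs. 0) \<in> fin_comp j"
  "\<psi> \<in> fin_comp j \<Longrightarrow> \<chi> \<in> fin_comp j \<Longrightarrow> (\<lambda>xs. \<psi> xs + \<chi> xs) \<in> fin_comp j"
  "\<psi> \<in> fin_comp j \<Longrightarrow> \<chi> \<in> fin_comp j \<Longrightarrow> (\<lambda>xs. \<psi> xs - \<chi> xs) \<in> fin_comp j"
  "\<psi> \<in> fin_comp j \<Longrightarrow> (\<lambda>xs. - \<psi> xs) \<in> fin_comp j"
  "\<psi> \<in> fin_comp j \<Longrightarrow> (\<lambda>xs. signed k (\<psi> xs)) \<in> fin_comp j"
proof -
  interpret F: vector_space scale_fun by (rule vs_fun)
  note S = fin_comp_subspace[of j]
  show "(\<lambda>xs. 0) \<in> fin_comp j" using F.subspace_0[OF S] by (simp add: zero_fun_def)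
  show "\<psi> \<in> fin_comp j \<Longrightarrow> \<chi> \<in> fin_comp j \<Longrightarrow> (\<lambda>xs. \<psi> xs + \<chi> xs) \<in> fin_comp j"
    using F.subspace_add[OF S, of \<psi> \<chi>] by (simp add: plus_fun_def)
  show "\<psi> \<in> fin_comp j \<Longrightarrow> \<chi> \<in> fin_comp j \<Longrightarrow> (\<lambda>xs. \<psi> xs - \<chi> xs) \<in> fin_comp j"
    using F.subspace_diff[OF S, of \<psi> \<chi>] by (simp add: fun_diff_def)
  show n: "\<psi> \<in> fin_comp j \<Longrightarrow> (\<lambda>xs. - \<psi> xs) \<in> fin_comp j"
    using F.subspace_neg[OF S, of \<psi>] by (simp add: fun_Compl_def)
  show "\<psi> \<in> fin_comp j \<Longrightarrow> (\<lambda>xs. signed k (\<psi> xs)) \<in> fin_comp j"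
    using n by (cases "even k") (simp_all add: signed_def)
qed

lemma fin_comp_diff:
  assumes "\<psi> \<in> fin_comp j" shows "end_diff \<psi> \<in> fin_comp (j + 1)"
proof -
  note 1 = fin_compD[OF assms]
  consider "j > 0" | "j = 0" | "j = -1" | "j < -1" by linarith
  then show ?thesis
  proof cases
    case 3
    then show ?thesis
      using end_comp_end_diff[OF 1(1)] end_diff_end_diff[OF 1(2)] by (auto simp: fin_comp_def)
  next
    case 4
    then show ?thesis using end_comp_end_diff[OF 1(1)] by (auto simp: fin_comp_def)
  qed (use assms in \<open>auto simp: fin_comp_def\<close>)
qed

lemma fin_comp_comp:
  assumes "\<psi> \<in> fin_comp i" "\<chi> \<in> fin_comp j"
  shows "mod_comp \<psi> \<chi> \<in> fin_comp (i + j)"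
proof -
  note 1 = fin_compD[OF assms(1)] and 2 = fin_compD[OF assms(2)]
  have z: "mod_comp (\<lambda>xs. 0 :: 'a) \<chi> = (\<lambda>xs. 0)" "mod_comp \<psi> (\<lambda>xs. 0) = (\<lambda>xs. 0)" if "end_fun \<psi>" for \<chi> \<psi> :: "'a list \<Rightarrow> 'a"
    using end_funD(5)[OF that] by (simp_all add: fun_eq_iff comp_eq split_sum_zero)
  consider "i > 0 \<or> j > 0" | "i = 0" "j = 0" | "i \<le> 0" "j \<le> 0" "i + j < 0" by linarith
  then show ?thesis
  proof cases
    case 1
    then have "mod_comp \<psi> \<chi> = (\<lambda>xs. 0)"
      using assms z \<open>end_fun \<psi>\<close> by (auto simp: fin_comp_def)
    then show ?thesis by (simp add: fin_comp_closed)
  next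
    case c: 2
    then have "end_diff \<psi> = (\<lambda>xs. 0)" "end_diff \<chi> = (\<lambda>xs. 0)" using assms by (auto simp: fin_comp_def)
    then have "end_diff (mod_comp \<psi> \<chi>) = (\<lambda>xs. 0)"
      using end_diff_comp[OF 1(2) 2(2)] z[OF 1(2)] z[OF end_fun_econj[OF 1(2)]] by (intro ext) simp
    then show ?thesis using end_comp_comp[OF 1(1) 2(1)] c by (auto simp: fin_comp_def)
  next
    case 3
    then show ?thesis using end_comp_comp[OF 1(1) 2(1)] by (auto simp: fin_comp_def)
  qed
qed

lemma fin_comp_one: "end_one \<in> fin_comp 0"
  using end_comp_one end_diff_one by (auto simp: fin_comp_def)

text \<open>On a fixed homogeneous word the values of the \<open>\<psi> i\<close> lie in the
  components \<open>i + k\<close> with a common shift \<open>k\<close>, so the independence of the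
  components of \<open>C\<close> applies.\<close>

lemma indep_fin_comp:
  assumes I: "finite I" "\<And>i. i \<in> I \<Longrightarrow> \<psi> i \<in> fin_comp i" and sum: "(\<Sum>i\<in>I. \<psi> i) = 0" and i: "i \<in> I"
  shows "\<psi> i = 0"
proof
  fix xs
  have sum_app: "(\<Sum>i\<in>I. \<psi> i ws) = 0" for ws
  proof -
    have "(\<Sum>i\<in>I. \<psi> i ws) = (\<Sum>i\<in>I. \<psi> i) ws" using I(1) by (induction I) auto
    then show ?thesis using sum by simp
  qed
  note 1 = fin_compD[OF I(2)[OF i]]
  show "\<psi> i xs = 0 xs"
  proof (simp, rule eq_0_of_words[OF 1(3) vs_s end_funD(3)[OF 1(2)]])
    fix ws assume ws: "set ws \<subseteq> S"
    obtain ds where ds: "list_all2 (\<lambda>d x. x \<in> C d) ds ws" using S_homogeneous[OF ws] by auto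
    show "\<psi> i ws = 0"
    proof (cases "ws = []")
      case False
      define k where "k = sum_list ds - int (length ws) + 1"
      have m: "\<psi> j ws \<in> C (j + k)" if "j \<in> I" for j
        by (rule hdegD[OF end_compD(2)[OF fin_compD(1)[OF I(2)[OF that]]] False ds]) (simp add: k_def)
      define f where "f l = \<psi> (l - k) ws" for l
      have "f (i + k) = 0"
      proof (rule indep_C[of "(\<lambda>j. j + k) ` I" f])
        show "f l \<in> C l" if "l \<in> (\<lambda>j. j + k) ` I" for l using that m by (auto simp: f_def)
        show "sum f ((\<lambda>j. j + k) ` I) = 0"
          using sum_app by (subst sum.reindex) (auto simp: f_def o_def)
      qed (use I i in auto)
      then show ?thesis by (simp add: f_def)
    qed (use end_funD(2)[OF 1(2)] in simp)
  qed
qed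

theorem is_dg_algebra_end_dg: "is_dg_algebra end_dg"
proof -
  have gv: "graded_vector_space end_dg"
    unfolding graded_vector_space_def end_dg_def graded_space.simps
    using vs_fun fin_comp_subspace indep_fin_comp by (intro conjI allI impI ballI) blast+
  have d: "end_diff (\<psi> + \<chi>) = end_diff \<psi> + end_diff \<chi>" for \<psi> \<chi>
    by (rule additive.add[OF additive_end_diff])
  have ds: "end_diff (\<lambda>xs. s c (\<psi> xs)) = (\<lambda>xs. s c (end_diff \<psi> xs))" for c \<psi>
    using end_diff_scale by auto
  have dd: "end_diff (end_diff \<psi>) = 0" if "\<psi> \<in> fin_comp i" for \<psi> i
    using end_diff_end_diff[OF fin_compD(2)[OF that]] by (auto simp: fun_eq_iff)
  have cs: "mod_comp (\<lambda>xs. s c (\<psi> xs)) \<chi> = (\<lambda>xs. s c (mod_comp \<psi> \<chi> xs))" for c and \<psi> \<chi> :: "'a list \<Rightarrow> 'a"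
    by (simp add: fun_eq_iff comp_eq split_sum_scale[OF vs_s vs_s])
  have sc: "mod_comp \<psi> (\<lambda>xs. s c (\<chi> xs)) = (\<lambda>xs. s c (mod_comp \<psi> \<chi> xs))" if "\<psi> \<in> fin_comp i" for c \<psi> \<chi> i
    by (simp add: fun_eq_iff comp_eq split_sum_scale[OF vs_s vs_s]
        lin_scale[OF vs_s vs_s multilin_lin_hd[OF fin_compD(3)[OF that]]])
  have cr: "mod_comp \<psi> (\<chi> + \<chi>') = mod_comp \<psi> \<chi> + mod_comp \<psi> \<chi>'" if "\<psi> \<in> fin_comp i" for \<psi> \<chi> \<chi>' i
    by (rule additive.add[OF additive_comp_right[OF fin_compD(3)[OF that]]])
  have L: "end_diff (mod_comp \<psi> \<chi>) = mod_comp (end_diff \<psi>) \<chi> + signed i (mod_comp \<psi> (end_diff \<chi>))"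
    if "\<psi> \<in> fin_comp i" "\<chi> \<in> fin_comp j" for \<psi> \<chi> i j
  proof
    fix xs
    have "mod_comp (econj \<psi>) (end_diff \<chi>) xs = signed i (mod_comp \<psi> (end_diff \<chi>) xs)"
      unfolding fin_compD(5)[OF that(1)] by (cases "even i") (simp_all add: signed_def comp_minus_left)
    then show "end_diff (mod_comp \<psi> \<chi>) xs = (mod_comp (end_diff \<psi>) \<chi> + signed i (mod_comp \<psi> (end_diff \<chi>))) xs"
      using end_diff_comp[OF fin_compD(2)[OF that(1)] fin_compD(2)[OF that(2)], of xs]
      by (simp only: signed_apply plus_fun_apply)
  qed
  have as: "mod_comp (mod_comp \<psi> \<chi>) \<omega> = mod_comp \<psi> (mod_comp \<chi> \<omega>)"
    if "\<psi> \<in> fin_comp i" "\<chi> \<in> fin_comp j" for \<psi> \<chi> \<omega> i j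
    by (rule comp_assoc[of \<psi> \<chi>, OF multilin_additive_hd[OF vs_s vs_s fin_compD(3)[OF that(1)]]
          end_funD(2)[OF fin_compD(2)[OF that(2)]]])
  have E: "smul end_dg = scale_fun" "component end_dg = fin_comp" "dg_diff end_dg = end_diff"
    "dg_mult end_dg = mod_comp" "dg_one end_dg = end_one"
    by (simp_all add: end_dg_def)
  show ?thesis
  proof (rule is_dg_algebraI, unfold E, goal_cases)
    case 1 show ?case by (rule gv)
  next case (2 i x) then show ?case by (rule fin_comp_diff)
  next case (3 i x) then show ?case by (rule dd)
  next case (4 i x c) show ?case by (rule ds)
  next case (5 i x y) show ?case by (rule d)
  next case (6 i j x y) then show ?case by (rule fin_comp_comp)
  next case (7 i j x y c) show ?case by (rule cs)
  next case (8 i j x y c) then show ?case by (intro sc)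
  next case (9 i j x x' y) show ?case by (rule additive.add[OF additive_comp_left])
  next case (10 i j x y y') then show ?case by (intro cr)
  next case (11 i j x y) then show ?case by (rule L)
  next case (12 i j l x y z) then show ?case by (intro as)
  next case 13 show ?case by (rule fin_comp_one)
  next case (14 i x) then show ?case by (intro one_comp fin_compD(2))
  next case (15 i x) then show ?case by (intro comp_one fin_compD(2))
  qed
qed

end

section \<open>The twisting cochain into the endomorphisms\<close>

text \<open>The unit laws are required after projection by \<open>p\<close> only; by
  \<open>trans_op_two\<close> this is what makes \<open>u\<close> a unit for the transferred binary
  product.\<close>

locale graded_transfer = transfer_data s e b h p q
  for s :: "'k::field \<Rightarrow> 'a::ab_group_add \<Rightarrow> 'a" and e b h p q +
  fixes C :: "int \<Rightarrow> 'a set" and S :: "'a set" and n :: int and u :: 'a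
  assumes subspace_C: "subspace (C i)"
    and indep_C: "finite I \<Longrightarrow> (\<And>i. i \<in> I \<Longrightarrow> f i \<in> C i) \<Longrightarrow> sum f I = 0 \<Longrightarrow> i \<in> I \<Longrightarrow> f i = 0"
    and e_C: "x \<in> C i \<Longrightarrow> e x = signed (i - 1) x"
    and p_C: "x \<in> C i \<Longrightarrow> p x \<in> C i" and h_C: "x \<in> C i \<Longrightarrow> h x \<in> C (i - 1)"
    and q_C: "x \<in> C i \<Longrightarrow> q x = x" and q_q: "q (q x) = q x"
    and b_C: "hdeg C C 2 b"
    and finite_S: "finite S" and S_C: "S \<subseteq> (\<Union>i. C i)" and p_S: "range p \<subseteq> span S"
    and p_bounds: "x \<in> C i \<Longrightarrow> p x \<noteq> 0 \<Longrightarrow> - n \<le> i \<and> i \<le> 0" and n_nonneg: "n \<ge> 0"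
    and u_C: "u \<in> C 0" and p_u: "p u = u"
    and u_left: "p (b [u, p x]) = p x" and u_right: "p (b [p x, u]) = - e (p x)"
begin

lemma C_sub: "0 \<in> C i" "x \<in> C i \<Longrightarrow> y \<in> C i \<Longrightarrow> x + y \<in> C i" "x \<in> C i \<Longrightarrow> e x \<in> C i"
  "x \<in> C i \<Longrightarrow> - x \<in> C i"
  using subspace_C[of i] e_C[of x i] subspace_neg[OF subspace_C[of i]]
  by (auto simp: subspace_0 subspace_add signed_def)

lemma hdeg_b2: "hdeg C C 2 b2"
  using b_C by (auto simp: hdeg_def b2_def C_sub)

lemma hdeg_iter: "hdeg C C 1 (trans_iter k)"
proof (induction k)
  case 0
  have "p1 xs \<in> C (sum_list ds - int (length xs) + 1)" if hom: "list_all2 (\<lambda>d x. x \<in> C d) ds xs" for ds xs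
  proof (cases "length xs = 1")
    case True
    then obtain x where "xs = [x]" by (auto simp: length_Suc_conv)
    moreover from this obtain d where "ds = [d]" using hom by (auto simp: list_all2_Cons2)
    ultimately show ?thesis using hom by (simp add: p1_def p_C)
  qed (simp add: p1_def C_sub)
  then show ?case by (simp add: hdeg_def)
next
  case (Suc k)
  have "hdeg C C 1 p1" unfolding hdeg_def
  proof (intro allI impI)
    fix ds xs assume hom: "list_all2 (\<lambda>d x. x \<in> C d) ds xs" "xs \<noteq> []"
    show "p1 xs \<in> C (sum_list ds - int (length xs) + 1)"
    proof (cases "length xs = 1")
      case True
      then obtain x where "xs = [x]" by (auto simp: length_Suc_conv)
      moreover from this obtain d where "ds = [d]" using hom by (auto simp: list_all2_Cons2)
      ultimately show ?thesis using hom by (simp add: p1_def p_C)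
    qed (simp add: p1_def C_sub)
  qed
  moreover have "hdeg C C 2 (D2 (trans_iter k))"
    by (rule hdeg_coder[OF _ _ hdeg_b2 _ Suc]) (auto intro: C_sub)
  then have "hdeg C C 1 (Hm (D2 (trans_iter k)))"
    by (rule hdeg_homot[of C C h p e 2, rotated -2]) (auto intro: C_sub h_C p_C)
  ultimately show ?case by (auto simp: hdeg_def C_sub)
qed

lemma hdeg_mor: "hdeg C C 1 trans_mor"
  using hdeg_iter by (auto simp: hdeg_def trans_mor_def)

lemma hdeg_trans_op: "hdeg C C 2 trans_op"
proof (rule hdegI)
  fix ds xs assume ne: "xs \<noteq> []" and hom: "list_all2 (\<lambda>d x. x \<in> C d) ds xs"
  have "hdeg C C 2 (D2 trans_mor)"
    by (rule hdeg_coder[OF _ _ hdeg_b2 _ hdeg_mor]) (auto intro: C_sub)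
  moreover have "list_all2 (\<lambda>d x. x \<in> C d) ds (map p xs)"
    unfolding list_all2_map2 using hom by (rule list_all2_mono) (rule p_C)
  ultimately show "trans_op xs \<in> C (sum_list ds - int (length xs) + 2)"
    unfolding trans_op_def by (intro hdegD[of C C 2 "D2 trans_mor" "map p xs" ds]) (simp_all add: ne)
qed

sublocale H: graded_minimal_algebra s e trans_op p C S n u
proof (unfold_locales, goal_cases)
  case 1 then show ?case by (rule multilin_trans_op)
next case 2 then show ?case by (rule trans_op_Nil)
next case 3 then show ?case by (rule trans_op_single)
next case 4 then show ?case by (rule odd_trans_op)
next case 5 then show ?case by (rule coder_trans_op)
next case 6 then show ?case by (rule trans_op_p)
next case 7 then show ?case by (rule p_trans_op)
next case 8 then show ?case by (rule lin_p)
next case 9 then show ?case by (rule p_e)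
next case 10 then show ?case by (rule p_p)
next case 11 then show ?case by (rule subspace_C)
next case 12 then show ?case by (intro indep_C) auto
next case 13 then show ?case by (rule e_C)
next case 14 then show ?case by (rule p_C)
next case 15 then show ?case by (rule hdeg_trans_op)
next case 16 then show ?case by (rule finite_S)
next case 17 then show ?case by (rule S_C)
next case 18 then show ?case by (rule p_S)
next case 19 then show ?case by (rule p_bounds)
next case 20 then show ?case by (rule n_nonneg)
next case 21 then show ?case by (rule u_C)
next case 22 then show ?case by (rule p_u)
next case 23 show ?case by (simp add: trans_op_two p_u u_left)
next case 24 show ?case by (simp add: trans_op_two p_u u_right)
qed

text \<open>Words of the original algebra act on its cohomology through the transferred morphism,
  followed by left multiplication.\<close>

definition twist :: "'a list \<Rightarrow> 'a list \<Rightarrow> 'a" where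
  "twist = pull trans_mor H.left_mult"

lemma twist_Nil: "twist [] = (\<lambda>xs. 0)"
  by (simp add: twist_def)

lemma twist_single: "twist [x] = H.left_mult [p x]"
  by (simp add: twist_def pull_Cons mor_single)

lemma multilin_twist: "multilin s H.scale_fun twist"
  unfolding twist_def by (rule multilin_pull[OF H.vs_fun multilin_mor H.multilin_left_mult])

lemma normal_map_q: "normal \<phi> \<Longrightarrow> \<phi> (us @ map q xs) = \<phi> (us @ xs)"
proof (induction xs arbitrary: us)
  case (Cons x xs)
  then show ?case using Cons.IH[of "us @ [x]"] normalD[OF Cons.prems, of us x "map q xs"] by simp
qed simp

lemma normal_iff: "normal \<phi> \<longleftrightarrow> (\<forall>xs. \<phi> (map q xs) = \<phi> xs)"
proof
  assume "\<forall>xs. \<phi> (map q xs) = \<phi> xs"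
  then have a: "\<phi> (map q xs) = \<phi> xs" for xs by blast
  show "normal \<phi>" unfolding normal_def
  proof (intro allI)
    show "\<phi> (us @ q x # vs) = \<phi> (us @ x # vs)" for us x vs
      using a[of "us @ q x # vs"] a[of "us @ x # vs"] by (simp add: q_q)
  qed
qed (use normal_map_q[of \<phi> "[]"] in auto)

lemma q_p: "q (p x) = p x"
proof -
  have "p x \<in> span (\<Union>i. C i)" using p_S span_mono[OF S_C] by auto
  then show ?thesis
  proof (induction rule: span_induct_alt)
    case (step c x y)
    then show ?case using linD[OF lin_q, of y c x] q_C by (auto simp: add.commute)
  qed simp
qed

lemma normal_twist: "normal twist"
proof -
  have "trans_mor (map q xs) = trans_mor xs" for xs using normal_mor normal_iff by auto
  moreover have "q (trans_mor xs) = trans_mor xs" for xs using q_p[of "trans_mor xs"] by (simp add: p_mor)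
  moreover have "H.left_mult (map id as) = H.left_mult as" for as by simp
  ultimately show ?thesis
    using pull_map_map[of id trans_mor q H.left_mult] unfolding twist_def normal_iff by simp
qed

lemma end_fun_twist: "H.end_fun (twist xs)"
proof -
  have "twist xs \<in> Collect H.end_fun"
    unfolding twist_def
    by (rule pull_in) (use H.end_fun_left_mult H.end_fun_zero H.end_fun_add in
        \<open>auto simp: zero_fun_def plus_fun_def\<close>)
  then show ?thesis by simp
qed

lemma twist_map_e: "pull trans_mor (\<lambda>as. H.left_mult (map e as)) xs = twist (map e xs)"
  unfolding twist_def by (rule pull_map_map) (rule even_mor)

lemma econj_twist: "H.econj (twist (map e xs)) = (\<lambda>ys. - twist xs ys)"
proof -
  have "H.econj (twist (map e xs)) = pull trans_mor (\<lambda>as. - H.left_mult (map e as)) (map e xs)"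
    unfolding twist_def
    by (simp add: pull_additive[OF H.additive_econj] H.econj_left_mult fun_Compl_def)
  also have "\<dots> = - twist xs" by (simp only: pull_minus twist_map_e map_e_e)
  finally show ?thesis by (simp add: fun_Compl_def)
qed

text \<open>The Maurer-Cartan equation of \<open>left_mult\<close>, pulled back along the coalgebra
  map of \<open>trans_mor\<close>, which commutes with the bar differentials by
  \<open>coder_mor\<close>.\<close>

theorem coder_twist:
  "D twist xs = - (H.end_diff (twist xs) + split_sum (\<lambda>us vs. mod_comp (twist (map e us)) (twist vs)) xs)"
proof -
  have "D twist xs = pull trans_mor (coder trans_op e H.left_mult) xs"
    unfolding twist_def
    by (rule coder_pull[OF H.vs_fun H.multilin_left_mult multilin_mor mor_Nil trans_op_Nil even_mor coder_mor])
  also have "coder trans_op e H.left_mult = (\<lambda>as. - (H.end_diff (H.left_mult as)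
      + split_sum (\<lambda>a1 a2. mod_comp (H.left_mult (map e a1)) (H.left_mult a2)) as))"
    using H.coder_left_mult by (auto simp: fun_eq_iff)
  also have "pull trans_mor \<dots> xs = - (H.end_diff (twist xs) + pull trans_mor
      (split_sum (\<lambda>a1 a2. mod_comp (H.left_mult (map e a1)) (H.left_mult a2))) xs)"
    by (simp only: pull_minus pull_add pull_additive[OF H.additive_end_diff] twist_def)
  also have "pull trans_mor (split_sum (\<lambda>a1 a2. mod_comp (H.left_mult (map e a1)) (H.left_mult a2))) xs
      = split_sum (\<lambda>us vs. mod_comp (twist (map e us)) (twist vs)) xs"
    unfolding pull_split_sum
  proof (rule split_sum_cong)
    fix us vs
    have "pull trans_mor (\<lambda>v. mod_comp (H.left_mult u) (H.left_mult v)) vs = mod_comp (H.left_mult u) (twist vs)" for u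
      unfolding twist_def
      by (rule pull_additive[OF H.additive_comp_right[OF H.end_funD(1)[OF H.end_fun_left_mult]], symmetric])
    then show "pull trans_mor (\<lambda>u. pull trans_mor (\<lambda>v. mod_comp (H.left_mult (map e u)) (H.left_mult v)) vs) us
      = mod_comp (twist (map e us)) (twist vs)"
      by (simp only: pull_additive[OF H.additive_comp_left, symmetric] twist_map_e)
  qed
  finally show ?thesis .
qed

text \<open>After \<open>p\<close> all nonzero letters have degree at most 0, so a word of length
  \<open>m\<close> acts with degree at most \<open>1 - m\<close>. Degree 0 is reached by single
  letters only, and left multiplication by a single letter is a cocycle by minimality; hence the
  values lie in the truncation.\<close>

lemma hdeg_twist: "hdeg C H.fin_comp 1 twist"
  unfolding twist_def
\<comment> \<open>The intermediate components are restricted to the image of \<open>p\<close> so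
  that \<open>p_bounds\<close> applies to their elements.\<close>
proof (rule hdeg_pull[where ?C0.0 = "\<lambda>i. {x \<in> C i. p x = x}"])
  show "hdeg C (\<lambda>i. {x \<in> C i. p x = x}) 1 trans_mor"
    using hdeg_mor p_mor by (auto simp: hdeg_def)
  show "hdeg (\<lambda>i. {x \<in> C i. p x = x}) H.fin_comp 1 H.left_mult"
  proof (rule hdegI)
    fix ds xs
    assume ne: "xs \<noteq> []" and hom: "list_all2 (\<lambda>d x. x \<in> {x \<in> C d. p x = x}) ds xs"
    have hom': "list_all2 (\<lambda>d x. x \<in> C d) ds xs" using hom by (rule list_all2_mono) auto
    show "H.left_mult xs \<in> H.fin_comp (sum_list ds - int (length xs) + 1)"
    proof (cases "0 \<in> set xs")
      case True
      then show ?thesis using multilin_0_mem[OF vs_s H.vs_fun H.multilin_left_mult True]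
        by (simp add: H.fin_comp_closed zero_fun_def)
    next
      case False
      have le: "sum_list ds \<le> 0"
        using hom False by (induction rule: list_all2_induct) (use p_bounds in fastforce)+
      have m: "H.left_mult xs \<in> H.end_comp (sum_list ds - int (length xs) + 1)"
        by (rule H.end_comp_left_mult[OF hom'])
      show ?thesis
      proof (cases "sum_list ds - int (length xs) + 1 = 0")
        case True
        then have "length xs = 1" using le ne by (cases xs) auto
        then obtain x where "xs = [x]" by (auto simp: length_Suc_conv)
        then show ?thesis using m True H.end_diff_left_mult_single by (auto simp: H.fin_comp_def)
      next
        case False
        moreover have "int (length xs) \<ge> 1" using ne by (cases xs) auto
        ultimately show ?thesis using m le by (auto simp: H.fin_comp_def)
      qed
    qed
  qed
qed (auto simp: zero_fun_def plus_fun_def H.fin_comp_closed)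

text \<open>Evaluation at \<open>[u]\<close> kills boundaries, by minimality, and recovers
  \<open>p x\<close> up to sign from left multiplication by \<open>p x\<close>. So
  \<open>p x = 0\<close>, and for a cocycle the contraction then provides a primitive.\<close>

lemma twist_inj:
  assumes "x \<in> C i" "b [x] = 0" "twist [x] = H.end_diff \<chi>" "\<chi> \<in> H.fin_comp (i - 1)"
  obtains y where "y \<in> C (i - 1)" "x = b [y]"
proof -
  have "H.left_mult [p x] [u] = 0"
    using H.end_diff_single[OF H.fin_compD(2)[OF assms(4)], of u] assms(3) by (simp add: twist_single)
  then have "e (p x) = 0" by (simp add: H.left_mult_def H.u_right p_p)
  then have "p x = 0" using e_e[of "p x"] by simp
  then have "x = - b [h x]" using homotopy[of x] assms(1,2) by (simp add: q_C)
  also have "\<dots> = b [- h x]" using multilin_minus_hd[OF vs_s vs_s multilin_b, of "h x" "[]"] by simp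
  finally show ?thesis using that[of "- h x"] h_C[OF assms(1)] C_sub by auto
qed

text \<open>Subtracting a left multiplication makes the value at \<open>[u]\<close> zero, and Yoneda
  applies. Its primitive has degree \<open>i - 1 < 0\<close>, where the truncation changes
  nothing.\<close>

lemma twist_surj:
  assumes \<psi>: "\<psi> \<in> H.fin_comp i" and d: "H.end_diff \<psi> = (\<lambda>xs. 0)"
  obtains x \<chi> where "x \<in> C i" "b [x] = 0" "\<chi> \<in> H.fin_comp (i - 1)" "\<psi> = twist [x] + H.end_diff \<chi>"
proof (cases "i > 0")
  case True
  then have "\<psi> = (\<lambda>xs. 0)" using \<psi> by (simp add: H.fin_comp_def)
  moreover have "twist [0] = (\<lambda>xs. 0)"
    using multilin_0_hd[OF vs_s H.vs_fun multilin_twist, of "[]"] by (simp add: zero_fun_def)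
  ultimately show ?thesis
    using that[of 0 "\<lambda>xs. 0"] multilin_0_hd[OF vs_s vs_s multilin_b, of "[]"]
    by (auto simp: C_sub H.fin_comp_closed fun_eq_iff)
next
  case False
  note 1 = H.fin_compD[OF \<psi>]
  \<comment> \<open>Chosen such that left multiplication by \<open>x\<close> sends \<open>u\<close>
    to \<open>- e x\<close>, which is \<open>\<psi> [u]\<close>.\<close>
  define x where "x = - e (\<psi> [u])"
  have "\<psi> [u] \<in> C i"
    by (rule hdegD[OF H.end_compD(2)[OF 1(1)], of "[u]" "[0]"]) (auto simp: u_C)
  then have x: "x \<in> C i" by (simp add: x_def C_sub)
  have px: "p x = x"
    using H.end_funD(4)[OF 1(2), of "[u]"]
    by (simp add: x_def additive.minus[OF H.additive_p] p_e[symmetric])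
  have bx: "b [x] = 0" using d_p[of x] px by simp
  have tx: "twist [x] = H.left_mult [x]" by (simp add: twist_single px)
  have tE: "twist [x] \<in> H.end_comp i" unfolding tx using H.end_comp_left_mult[of "[i]" "[x]"] x by simp
  define \<psi>' where "\<psi>' xs = \<psi> xs - twist [x] xs" for xs
  have "\<psi>' \<in> H.end_comp i" unfolding \<psi>'_def by (rule H.end_comp_closed(3)[OF 1(1) tE])
  moreover have "H.end_diff \<psi>' = (\<lambda>xs. 0)"
    using additive.diff[OF H.additive_end_diff, of \<psi> "twist [x]"] d H.end_diff_left_mult_single
    by (simp add: \<psi>'_def[abs_def] tx fun_diff_def zero_fun_def)
  moreover have "\<psi>' [u] = 0"
    by (simp add: \<psi>'_def tx H.left_mult_def H.u_right px) (simp add: x_def)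
  ultimately obtain \<chi> where \<chi>: "\<chi> \<in> H.end_comp (i - 1)" "\<psi>' = H.end_diff \<chi>"
    by (rule H.yoneda)
  have "\<psi> = twist [x] + H.end_diff \<chi>" using \<chi>(2) by (auto simp: \<psi>'_def fun_eq_iff algebra_simps)
  then show ?thesis using that[OF x bx _ ] \<chi>(1) False by (simp add: H.fin_comp_neg)
qed

end

subsection \<open>Cohomology\<close>

definition chain_complex :: "('k, 'a::ab_group_add) ainf_algebra \<Rightarrow> bool" where
  "chain_complex A \<longleftrightarrow>
     (\<forall>i. 0 \<in> component A i \<and> (\<forall>x\<in>component A i. - x \<in> component A i \<and>
        (\<forall>y\<in>component A i. x + y \<in> component A i \<and> ops A [x + y] = ops A [x] + ops A [y]))) \<and>
     (\<forall>i. \<forall>x\<in>component A i. ops A [x] \<in> component A (i + 1) \<and> ops A [ops A [x]] = 0)"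

lemma chain_complexD:
  assumes "chain_complex A"
  shows "0 \<in> component A i" "x \<in> component A i \<Longrightarrow> - x \<in> component A i"
    "x \<in> component A i \<Longrightarrow> y \<in> component A i \<Longrightarrow> x + y \<in> component A i"
    "x \<in> component A i \<Longrightarrow> y \<in> component A i \<Longrightarrow> x - y \<in> component A i"
    "x \<in> component A i \<Longrightarrow> y \<in> component A i \<Longrightarrow> ops A [x + y] = ops A [x] + ops A [y]"
    "ops A [0] = 0"
    "x \<in> component A i \<Longrightarrow> ops A [- x] = - ops A [x]"
    "x \<in> component A i \<Longrightarrow> y \<in> component A i \<Longrightarrow> ops A [x - y] = ops A [x] - ops A [y]"
    "x \<in> component A i \<Longrightarrow> ops A [x] \<in> component A (i + 1)"
    "x \<in> component A i \<Longrightarrow> ops A [ops A [x]] = 0"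
proof -
  have 0: "0 \<in> component A i" and m: "\<And>x. x \<in> component A i \<Longrightarrow> - x \<in> component A i"
    and p: "\<And>x y. x \<in> component A i \<Longrightarrow> y \<in> component A i \<Longrightarrow> x + y \<in> component A i"
    and a: "\<And>x y. x \<in> component A i \<Longrightarrow> y \<in> component A i \<Longrightarrow> ops A [x + y] = ops A [x] + ops A [y]" for i
    using assms unfolding chain_complex_def by blast+
  have z: "ops A [0] = 0" using a[OF 0 0] by simp
  have n: "ops A [- x] = - ops A [x]" if "x \<in> component A i" for x
    using a[OF that m[OF that]] z by (simp add: eq_neg_iff_add_eq_0 add.commute)
  show "0 \<in> component A i" "x \<in> component A i \<Longrightarrow> - x \<in> component A i"
    "x \<in> component A i \<Longrightarrow> y \<in> component A i \<Longrightarrow> x + y \<in> component A i"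
    "x \<in> component A i \<Longrightarrow> y \<in> component A i \<Longrightarrow> ops A [x + y] = ops A [x] + ops A [y]"
    "ops A [0] = 0" "x \<in> component A i \<Longrightarrow> ops A [- x] = - ops A [x]"
    by (fact 0 m p a z n)+
  show "x \<in> component A i \<Longrightarrow> y \<in> component A i \<Longrightarrow> x - y \<in> component A i"
    using p[of x i "- y"] m by simp
  show "x \<in> component A i \<Longrightarrow> y \<in> component A i \<Longrightarrow> ops A [x - y] = ops A [x] - ops A [y]"
    using a[of x i "- y"] m n by simp
  show "x \<in> component A i \<Longrightarrow> ops A [x] \<in> component A (i + 1)"
    "x \<in> component A i \<Longrightarrow> ops A [ops A [x]] = 0"
    using assms unfolding chain_complex_def by blast+
qed

lemma coboundaries_closed:
  assumes "chain_complex A"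
  shows "0 \<in> coboundaries A i" "x \<in> coboundaries A i \<Longrightarrow> - x \<in> coboundaries A i"
    "x \<in> coboundaries A i \<Longrightarrow> y \<in> coboundaries A i \<Longrightarrow> x + y \<in> coboundaries A i"
    "x \<in> coboundaries A i \<Longrightarrow> y \<in> coboundaries A i \<Longrightarrow> x - y \<in> coboundaries A i"
    "x \<in> coboundaries A i \<Longrightarrow> x \<in> cocycles A i"
proof -
  note cc = chain_complexD[OF assms]
  show "0 \<in> coboundaries A i" using cc(1,6) unfolding coboundaries_def by force
  show "x \<in> coboundaries A i \<Longrightarrow> - x \<in> coboundaries A i"
    using cc(2,7) unfolding coboundaries_def by force
  show "x \<in> coboundaries A i \<Longrightarrow> y \<in> coboundaries A i \<Longrightarrow> x + y \<in> coboundaries A i"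
    using cc(3,5) unfolding coboundaries_def by force
  show "x \<in> coboundaries A i \<Longrightarrow> y \<in> coboundaries A i \<Longrightarrow> x - y \<in> coboundaries A i"
    using cc(4,8) unfolding coboundaries_def by force
  show "x \<in> coboundaries A i \<Longrightarrow> x \<in> cocycles A i"
    using cc(9)[of _ "i - 1"] cc(10) unfolding coboundaries_def cocycles_def by auto
qed

lemma coh_class_eq_iff:
  assumes "chain_complex A"
  shows "coh_class A i x = coh_class A i y \<longleftrightarrow> x - y \<in> coboundaries A i"
proof
  note cb = coboundaries_closed[OF assms]
  assume "coh_class A i x = coh_class A i y"
  moreover have "x \<in> coh_class A i x" unfolding coh_class_def using cb(1)[of i] by force
  ultimately obtain b where "b \<in> coboundaries A i" "x = y + b" unfolding coh_class_def by blast
  then show "x - y \<in> coboundaries A i" by simp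
next
  note cb = coboundaries_closed[OF assms]
  assume xy: "x - y \<in> coboundaries A i"
  have "x + b \<in> coh_class A i y" if "b \<in> coboundaries A i" for b
    unfolding coh_class_def by (rule image_eqI[of _ _ "(x - y) + b"]) (use cb(3)[OF xy that] in auto)
  moreover have "y + b \<in> coh_class A i x" if "b \<in> coboundaries A i" for b
    unfolding coh_class_def by (rule image_eqI[of _ _ "b - (x - y)"]) (use cb(4)[OF that xy] in auto)
  ultimately show "coh_class A i x = coh_class A i y" unfolding coh_class_def[of A i x]
    by (auto simp: coh_class_def)
qed

text \<open>Cohomology classes are sets; this reduces bijectivity to two conditions on cocycles and
  serves both kinds of quasi-isomorphism.\<close>

lemma bij_betw_coh_map:
  assumes A: "chain_complex A" and B: "chain_complex B"
    and f: "\<And>i x. x \<in> component A i \<Longrightarrow> f x \<in> component B i"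
    and add: "\<And>i x y. x \<in> component A i \<Longrightarrow> y \<in> component A i \<Longrightarrow> f (x + y) = f x + f y"
    and chain: "\<And>i x. x \<in> component A i \<Longrightarrow> f (ops A [x]) = ops B [f x]"
    and inj: "\<And>x. x \<in> cocycles A i \<Longrightarrow> f x \<in> coboundaries B i \<Longrightarrow> x \<in> coboundaries A i"
    and surj: "\<And>y. y \<in> cocycles B i \<Longrightarrow> \<exists>x\<in>cocycles A i. y - f x \<in> coboundaries B i"
  shows "bij_betw (coh_map B i f) (cohomology A i) (cohomology B i)"
proof -
  note cA = chain_complexD[OF A] and bA = coboundaries_closed[OF A]
    and bB = coboundaries_closed[OF B]
  have f0: "f 0 = 0" using add[OF cA(1) cA(1)] by simp
  have diff: "f (x - y) = f x - f y" if "x \<in> component A i" "y \<in> component A i" for x y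
    using add[OF cA(4)[OF that] that(2)] by simp
  have z: "f x \<in> cocycles B i" if "x \<in> cocycles A i" for x
    using that f chain[of x i] f0 by (auto simp: cocycles_def)
  have b: "f x \<in> coboundaries B i" if x: "x \<in> coboundaries A i" for x
  proof -
    obtain y where y: "y \<in> component A (i - 1)" "x = ops A [y]" using x by (auto simp: coboundaries_def)
    show ?thesis unfolding coboundaries_def y(2) chain[OF y(1)] using f[OF y(1)] by auto
  qed
  have map: "coh_map B i f (coh_class A i x) = coh_class B i (f x)" if x: "x \<in> cocycles A i" for x
  proof -
    have "coh_class B i (f (x + y)) = coh_class B i (f x)" if y: "y \<in> coboundaries A i" for y
    proof -
      have "f (x + y) - f x = f y" using add[of x i y] x bA(5)[OF y] by (auto simp: cocycles_def)
      then show ?thesis unfolding coh_class_eq_iff[OF B] using b[OF y] by simp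
    qed
    then show ?thesis using bA(1)[of i] by (auto simp: coh_map_def coh_class_def[of A])
  qed
  show ?thesis unfolding bij_betw_def
  proof
    show "inj_on (coh_map B i f) (cohomology A i)"
    proof (rule inj_onI)
      fix c c' assume c: "c \<in> cohomology A i" "c' \<in> cohomology A i" and eq: "coh_map B i f c = coh_map B i f c'"
      obtain x x' where x: "x \<in> cocycles A i" "x' \<in> cocycles A i" "c = coh_class A i x" "c' = coh_class A i x'"
        using c by (auto simp: cohomology_def)
      have xc: "x \<in> component A i" "x' \<in> component A i" using x by (auto simp: cocycles_def)
      have "f (x - x') \<in> coboundaries B i"
        using eq x unfolding diff[OF xc] by (simp add: map coh_class_eq_iff[OF B])
      moreover have "x - x' \<in> cocycles A i"
        using x xc cA(4,8) by (auto simp: cocycles_def)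
      ultimately show "c = c'" using inj by (simp add: x coh_class_eq_iff[OF A])
    qed
    show "coh_map B i f ` cohomology A i = cohomology B i"
    proof
      show "coh_map B i f ` cohomology A i \<subseteq> cohomology B i"
        using map z by (auto simp: cohomology_def)
      show "cohomology B i \<subseteq> coh_map B i f ` cohomology A i"
      proof
        fix c assume "c \<in> cohomology B i"
        then obtain y where y: "y \<in> cocycles B i" "c = coh_class B i y" by (auto simp: cohomology_def)
        obtain x where x: "x \<in> cocycles A i" "y - f x \<in> coboundaries B i" using surj[OF y(1)] by auto
        then have "c = coh_map B i f (coh_class A i x)" by (simp add: map y coh_class_eq_iff[OF B])
        then show "c \<in> coh_map B i f ` cohomology A i" using x by (auto simp: cohomology_def)
      qed
    qed
  qed
qed

lemma is_dg_algebraD: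
  assumes "is_dg_algebra A"
  shows "graded_vector_space A"
    "x \<in> component A i \<Longrightarrow> dg_diff A x \<in> component A (i + 1)"
    "x \<in> component A i \<Longrightarrow> dg_diff A (dg_diff A x) = 0"
    "x \<in> component A i \<Longrightarrow> dg_diff A (smul A c x) = smul A c (dg_diff A x)"
    "x \<in> component A i \<Longrightarrow> y \<in> component A i \<Longrightarrow> dg_diff A (x + y) = dg_diff A x + dg_diff A y"
    "x \<in> component A i \<Longrightarrow> y \<in> component A j \<Longrightarrow> dg_mult A x y \<in> component A (i + j)"
    "x \<in> component A i \<Longrightarrow> y \<in> component A j \<Longrightarrow> dg_mult A (smul A c x) y = smul A c (dg_mult A x y)"
    "x \<in> component A i \<Longrightarrow> y \<in> component A j \<Longrightarrow> dg_mult A x (smul A c y) = smul A c (dg_mult A x y)"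
    "x \<in> component A i \<Longrightarrow> x' \<in> component A i \<Longrightarrow> y \<in> component A j
      \<Longrightarrow> dg_mult A (x + x') y = dg_mult A x y + dg_mult A x' y"
    "x \<in> component A i \<Longrightarrow> y \<in> component A j \<Longrightarrow> y' \<in> component A j
      \<Longrightarrow> dg_mult A x (y + y') = dg_mult A x y + dg_mult A x y'"
    "x \<in> component A i \<Longrightarrow> y \<in> component A j
      \<Longrightarrow> dg_diff A (dg_mult A x y) = dg_mult A (dg_diff A x) y + signed i (dg_mult A x (dg_diff A y))"
    "x \<in> component A i \<Longrightarrow> y \<in> component A j \<Longrightarrow> z \<in> component A l
      \<Longrightarrow> dg_mult A (dg_mult A x y) z = dg_mult A x (dg_mult A y z)"
    "dg_one A \<in> component A 0"
    "x \<in> component A i \<Longrightarrow> dg_mult A (dg_one A) x = x"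
    "x \<in> component A i \<Longrightarrow> dg_mult A x (dg_one A) = x"
  using assms unfolding is_dg_algebra_def by blast+

lemma graded_vector_spaceD:
  assumes "graded_vector_space V"
  shows "vector_space (smul V)" "module (smul V)" "module.subspace (smul V) (component V i)"
    "finite I \<Longrightarrow> (\<And>i. i \<in> I \<Longrightarrow> f i \<in> component V i) \<Longrightarrow> sum f I = 0 \<Longrightarrow> i \<in> I \<Longrightarrow> f i = 0"
  using assms unfolding graded_vector_space_def
  by (blast, simp add: module_iff_vector_space, blast, blast)

lemma multilinear_familyD:
  assumes "multilinear_family V W p f"
  shows "xs \<noteq> [] \<Longrightarrow> homogeneous V ds xs \<Longrightarrow> f xs \<in> component W (sum_list ds + p (length xs))"
    and "homogeneous V ds us \<Longrightarrow> homogeneous V es vs \<Longrightarrow> x \<in> component V d \<Longrightarrow> y \<in> component V d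
      \<Longrightarrow> f (us @ (x + y) # vs) = f (us @ x # vs) + f (us @ y # vs)"
    and "homogeneous V ds us \<Longrightarrow> homogeneous V es vs \<Longrightarrow> x \<in> component V d
      \<Longrightarrow> f (us @ smul V c x # vs) = smul W c (f (us @ x # vs))"
proof -
  note A = assms[unfolded multilinear_family_def, THEN conjunct1]
    and B = assms[unfolded multilinear_family_def, THEN conjunct2, THEN conjunct1]
    and C = assms[unfolded multilinear_family_def, THEN conjunct2, THEN conjunct2]
  show "xs \<noteq> [] \<Longrightarrow> homogeneous V ds xs \<Longrightarrow> f xs \<in> component W (sum_list ds + p (length xs))"
    by (rule A[rule_format]) simp
  show "homogeneous V ds us \<Longrightarrow> homogeneous V es vs \<Longrightarrow> x \<in> component V d \<Longrightarrow> y \<in> component V d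
      \<Longrightarrow> f (us @ (x + y) # vs) = f (us @ x # vs) + f (us @ y # vs)"
    by (rule B[rule_format, of ds us es vs x d y]) simp
  show "homogeneous V ds us \<Longrightarrow> homogeneous V es vs \<Longrightarrow> x \<in> component V d
      \<Longrightarrow> f (us @ smul V c x # vs) = smul W c (f (us @ x # vs))"
    by (rule C[rule_format, of ds us es vs x d]) simp
qed

lemma chain_complex_dg:
  assumes "is_dg_algebra A" shows "chain_complex (ainf_of_dg A)"
proof -
  note A = is_dg_algebraD[OF assms] and gv = graded_vector_spaceD[OF is_dg_algebraD(1)[OF assms]]
  show ?thesis
    unfolding chain_complex_def ainf_of_dg_def
    using module.subspace_0[OF gv(2,3)] module.subspace_neg[OF gv(2,3)] module.subspace_add[OF gv(2,3)] A(2,3,5)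
    by simp
qed

subsection \<open>Transport of structure\<close>

definition map_dg :: "('k \<Rightarrow> 'y \<Rightarrow> 'y) \<Rightarrow> ('x \<Rightarrow> 'y) \<Rightarrow> ('y \<Rightarrow> 'x) \<Rightarrow> ('k, 'x) dg_algebra \<Rightarrow> ('k, 'y) dg_algebra" where
  "map_dg t \<Theta> \<Xi> A = \<lparr>smul = t, component = (\<lambda>i. \<Theta> ` component A i),
     dg_diff = (\<lambda>y. \<Theta> (dg_diff A (\<Xi> y))), dg_mult = (\<lambda>y z. \<Theta> (dg_mult A (\<Xi> y) (\<Xi> z))),
     dg_one = \<Theta> (dg_one A)\<rparr>"

text \<open>Injectivity is required on a subspace \<open>X\<close> and not just on each component:
  independence of the images of the components is shown by pulling back a vanishing sum of elements
  of different degrees.\<close>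

lemma is_dg_algebra_map:
  fixes A :: "('k::field, 'x::ab_group_add) dg_algebra" and \<Theta> :: "'x \<Rightarrow> 'y::ab_group_add"
  assumes dg: "is_dg_algebra A" and t: "vector_space t" and lin: "lin (smul A) t \<Theta>"
    and X: "module.subspace (smul A) X" "\<And>i. component A i \<subseteq> X"
    and inv: "\<And>x. x \<in> X \<Longrightarrow> \<Xi> (\<Theta> x) = x"
  shows "is_dg_algebra (map_dg t \<Theta> \<Xi> A)"
proof -
  note A = is_dg_algebraD[OF dg]
  note gv = graded_vector_spaceD[OF A(1)]
  have inv': "\<Xi> (\<Theta> x) = x" if "x \<in> component A i" for x i using inv X(2) that by blast
  have add: "\<Theta> (x + y) = \<Theta> x + \<Theta> y" for x y
    using additive.add[OF lin_additive[OF gv(1) t lin]] .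
  have sc: "t c (\<Theta> x) = \<Theta> (smul A c x)" for c x
    using lin_scale[OF gv(1) t lin] by simp
  have sg: "\<Theta> (signed k x) = signed k (\<Theta> x)" for k x
    by (rule additive_signed[OF lin_additive[OF gv(1) t lin]])
  have z: "\<Theta> 0 = 0" using additive.zero[OF lin_additive[OF gv(1) t lin]] .
  note cl = module.subspace_add[OF gv(2,3)] module.subspace_scale[OF gv(2,3)]
  have "module t" by (simp add: t module_iff_vector_space)
  have gv': "graded_vector_space (map_dg t \<Theta> \<Xi> A)"
    unfolding graded_vector_space_def map_dg_def graded_space.simps dg_algebra.simps
  proof (intro conjI allI impI ballI t)
    fix i
    show "module.subspace t (\<Theta> ` component A i)"
      unfolding module.subspace_def[OF \<open>module t\<close>]
      using module.subspace_0[OF gv(2,3), of i] z cl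
      by (auto simp: add[symmetric] sc)
  next
    fix I f i
    assume a: "finite I \<and> (\<forall>i\<in>I. f i \<in> \<Theta> ` component A i) \<and> sum f I = 0" "i \<in> I"
    have "\<forall>i. \<exists>x. i \<in> I \<longrightarrow> x \<in> component A i \<and> f i = \<Theta> x" using a by blast
    then obtain g where g: "\<And>i. i \<in> I \<Longrightarrow> g i \<in> component A i" "\<And>i. i \<in> I \<Longrightarrow> f i = \<Theta> (g i)" by metis
    have "\<Theta> (sum g I) = sum f I"
      using g(2) additive.sum[OF lin_additive[OF gv(1) t lin]] by simp
    then have "\<Theta> (sum g I) = \<Theta> 0" using a z by simp
    moreover have "sum g I \<in> X" using g(1) X by (intro module.subspace_sum[OF gv(2) X(1)]) auto
    ultimately have "sum g I = 0" using inv module.subspace_0[OF gv(2) X(1)] by metis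
    then have "g i = 0" using gv(4)[of I g i] g a by auto
    then show "f i = 0" using g(2)[OF a(2)] z by simp
  qed
  have E: "smul (map_dg t \<Theta> \<Xi> A) = t" "component (map_dg t \<Theta> \<Xi> A) = (\<lambda>i. \<Theta> ` component A i)"
    "dg_diff (map_dg t \<Theta> \<Xi> A) = (\<lambda>y. \<Theta> (dg_diff A (\<Xi> y)))"
    "dg_mult (map_dg t \<Theta> \<Xi> A) = (\<lambda>y z. \<Theta> (dg_mult A (\<Xi> y) (\<Xi> z)))"
    "dg_one (map_dg t \<Theta> \<Xi> A) = \<Theta> (dg_one A)"
    by (simp_all add: map_dg_def)
  show ?thesis
  proof (rule is_dg_algebraI, unfold E, goal_cases)
    case 1 show ?case by (rule gv')
  next case (2 i x) then show ?case by (auto simp: inv' A)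
  next case (3 i x) then obtain x' where x': "x' \<in> component A i" "x = \<Theta> x'" by auto
    then show ?case by (simp add: inv' inv'[OF A(2)[OF x'(1)]] A(3)[OF x'(1)] z)
  next case (4 i x c) then show ?case by (auto simp: sc inv' inv'[OF cl(2)] A)
  next case (5 i x y) then show ?case by (auto simp: add[symmetric] inv' inv'[OF cl(1)] A)
  next case (6 i j x y) then show ?case by (auto simp: inv' intro: A)
  next case (7 i j x y c) then show ?case by (auto simp: sc inv' inv'[OF cl(2)] A)
  next case (8 i j x y c) then show ?case by (auto simp: sc inv' inv'[OF cl(2)] A)
  next case (9 i j x x' y) then show ?case by (auto simp: add[symmetric] inv' inv'[OF cl(1)] A)
  next case (10 i j x y y') then show ?case by (auto simp: add[symmetric] inv' inv'[OF cl(1)] A)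
  next case (11 i j x y)
    then obtain x' y' where "x' \<in> component A i" "x = \<Theta> x'" "y' \<in> component A j" "y = \<Theta> y'" by auto
    then show ?case
      using A(2)[of x' i] A(2)[of y' j] A(6)[of x' i y' j] by (simp add: inv' A(11)[of x' i y' j] add sg)
  next case (12 i j l x y z)
    then obtain x' y' z' where "x' \<in> component A i" "x = \<Theta> x'" "y' \<in> component A j" "y = \<Theta> y'"
      "z' \<in> component A l" "z = \<Theta> z'" by auto
    then show ?case
      using A(6)[of x' i y' j] A(6)[of y' j z' l] A(12)[of x' i y' j z' l] by (simp add: inv')
  next case 13 show ?case using A(13) by simp
  next case (14 i x) then show ?case by (auto simp: inv'[OF A(13)] inv' A)
  next case (15 i x) then show ?case by (auto simp: inv'[OF A(13)] inv' A)
  qed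
qed

text \<open>In the Leibniz rule every term changes sign, in the square of the differential none
  does. The negative is needed because \<open>coder_twist\<close> contains minus the differential of
  the endomorphisms where the equations of a morphism ask for plus that of the target.\<close>

lemma is_dg_algebra_neg:
  assumes dg: "is_dg_algebra A"
  shows "is_dg_algebra (A\<lparr>dg_diff := \<lambda>x. - dg_diff A x\<rparr>)"
proof -
  note A = is_dg_algebraD[OF dg]
  note gv = graded_vector_spaceD[OF A(1)]
  note neg = module.subspace_neg[OF gv(2,3)] module.subspace_0[OF gv(2,3)]
  have sm: "smul A c (- x) = - smul A c x" for c x
    by (rule module.scale_minus_right[OF gv(2)])
  have dn: "dg_diff A (- x) = - dg_diff A x" if "x \<in> component A i" for x i
    using A(4)[OF that, of "-1"] by (simp add: module.scale_minus_left[OF gv(2)] module.scale_one[OF gv(2)])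
  have ml: "dg_mult A (- x) y = - dg_mult A x y" if "x \<in> component A i" "y \<in> component A j" for x y i j
    using A(7)[OF that, of "-1"] by (simp add: module.scale_minus_left[OF gv(2)] module.scale_one[OF gv(2)])
  have mr: "dg_mult A x (- y) = - dg_mult A x y" if "x \<in> component A i" "y \<in> component A j" for x y i j
    using A(8)[OF that, of "-1"] by (simp add: module.scale_minus_left[OF gv(2)] module.scale_one[OF gv(2)])
  have E: "smul (A\<lparr>dg_diff := \<lambda>x. - dg_diff A x\<rparr>) = smul A"
    "component (A\<lparr>dg_diff := \<lambda>x. - dg_diff A x\<rparr>) = component A"
    "dg_diff (A\<lparr>dg_diff := \<lambda>x. - dg_diff A x\<rparr>) = (\<lambda>x. - dg_diff A x)"
    "dg_mult (A\<lparr>dg_diff := \<lambda>x. - dg_diff A x\<rparr>) = dg_mult A"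
    "dg_one (A\<lparr>dg_diff := \<lambda>x. - dg_diff A x\<rparr>) = dg_one A"
    by simp_all
  show ?thesis
  proof (rule is_dg_algebraI, unfold E, goal_cases)
    case 1 show ?case using A(1) by (simp add: graded_vector_space_def)
  next case (2 i x) then show ?case by (simp add: neg A)
  next case (3 i x) then show ?case by (simp add: dn[OF A(2)] A)
  next case (4 i x c) then show ?case by (simp add: sm A)
  next case (5 i x y) then show ?case by (simp add: A)
  next case (6 i j x y) then show ?case by (rule A)
  next case (7 i j x y c) then show ?case by (rule A)
  next case (8 i j x y c) then show ?case by (rule A)
  next case (9 i j x x' y) then show ?case by (rule A)
  next case (10 i j x y y') then show ?case by (rule A)
  next case (11 i j x y)
    then show ?case
      using A(2)[of x i] A(2)[of y j] by (simp add: A(11)[of x i y j] ml[of _ "i + 1" _ j] mr[of _ i _ "j + 1"])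
  next case (12 i j l x y z) then show ?case by (rule A)
  next case 13 show ?case by (rule A)
  next case (14 i x) then show ?case by (rule A)
  next case (15 i x) then show ?case by (rule A)
  qed
qed

lemma coordinates_exist:
  fixes s :: "'k::field \<Rightarrow> 'a::ab_group_add \<Rightarrow> 'a"
  assumes "vector_space s"
  shows "\<exists>c :: 'a \<Rightarrow> 'a \<Rightarrow> 'k. (\<forall>v. lin s (*) (c v)) \<and> (\<forall>x. finite {v. c v x \<noteq> 0})
    \<and> (\<forall>x. (\<forall>v. c v x = 0) \<longrightarrow> x = 0)"
proof -
  interpret vector_space s by fact
  define B where "B = extend_basis {}"
  have B: "independent B" "span B = UNIV"
    by (auto simp: B_def independent_extend_basis[OF independent_empty] span_extend_basis[OF independent_empty])
  show ?thesis
  proof (intro exI[of _ "\<lambda>v x. representation B x v"] conjI allI impI)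
    show "lin s (*) (\<lambda>x. representation B x v)" for v
      by (simp add: lin_def representation_add[OF B(1)] representation_scale[OF B(1)] B(2))
    show "finite {v. representation B x v \<noteq> 0}" for x by (rule finite_representation)
    show "x = 0" if "\<forall>v. representation B x v = 0" for x
      using sum_nonzero_representation_eq[OF B(1), of x] that by (simp add: B(2))
  qed
qed

subsection \<open>Signs\<close>

text \<open>
  The sign relating operations on a graded space to those on its shift.
\<close>

fun shift_exponent :: "int list \<Rightarrow> int" where
  "shift_exponent [] = 0"
| "shift_exponent (d # ds) = int (length ds) * d + shift_exponent ds"

text \<open>The sign \<open>shift_exponent\<close> as an operator: with \<open>g\<close> the parity
  involution, a letter followed by \<open>l\<close> others is modified by \<open>g\<close> to the
  power \<open>l\<close>. So it stays multilinear on words that are not homogeneous.\<close>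

fun sign_list :: "('a \<Rightarrow> 'a) \<Rightarrow> 'a list \<Rightarrow> 'a list" where
  "sign_list g [] = []"
| "sign_list g (x # xs) = (g ^^ length xs) x # sign_list g xs"

lemma shift_exponent_append:
  "shift_exponent (ds @ es) = shift_exponent ds + int (length es) * sum_list ds + shift_exponent es"
  by (induction ds) (auto simp: algebra_simps)

lemma lin_funpow: "lin s s g \<Longrightarrow> lin s s (g ^^ n)"
  by (induction n) (auto simp: lin_def)

lemma multilin_sign_list:
  assumes g: "lin s s g" and "multilin s t \<phi>"
  shows "multilin s t (\<lambda>xs. \<phi> (sign_list g xs))"
proof (rule multilinI)
  fix us vs x y c
  show "\<phi> (sign_list g (us @ (x + s c y) # vs))
      = \<phi> (sign_list g (us @ x # vs)) + t c (\<phi> (sign_list g (us @ y # vs)))"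
    using assms(2)
  proof (induction us arbitrary: \<phi>)
    case Nil
    show ?case using multilinD[OF Nil, of "[]"] linD[OF lin_funpow[OF g]] by simp
  next
    case (Cons z us)
    show ?case using Cons.IH[OF multilin_Cons[OF Cons.prems]] by simp
  qed
qed

lemma sign_list_homogeneous:
  assumes s: "vector_space s" and t: "vector_space t"
    and g: "\<And>i x. x \<in> C i \<Longrightarrow> g x = signed i x" and sub: "\<And>i x. x \<in> C i \<Longrightarrow> - x \<in> C i"
    and "multilin s t \<phi>" "list_all2 (\<lambda>d x. x \<in> C d) ds xs"
  shows "\<phi> (sign_list g xs) = signed (shift_exponent ds) (\<phi> xs)"
    "list_all2 (\<lambda>d x. x \<in> C d) ds (sign_list g xs)"
proof -
  have gn: "(g ^^ n) x = signed (int n * i) x \<and> (g ^^ n) x \<in> C i" if "x \<in> C i" for n i x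
  proof (induction n)
    case (Suc n)
    have 1: "g ((g ^^ n) x) = signed i ((g ^^ n) x)" by (rule g) (use Suc in blast)
    then have 2: "(g ^^ Suc n) x = signed i (signed (int n * i) x)" using Suc by simp
    have "signed i y \<in> C i" if "y \<in> C i" for y using sub that by (auto simp: signed_def)
    then have "signed i ((g ^^ n) x) \<in> C i" using Suc by blast
    then have "(g ^^ Suc n) x \<in> C i" by (simp only: funpow.simps comp_apply 1)
    then show ?case unfolding 2 by (simp add: signed_signed algebra_simps)
  qed (use that in simp)
  show "\<phi> (sign_list g xs) = signed (shift_exponent ds) (\<phi> xs)"
    using assms(5,6)
  proof (induction xs arbitrary: ds \<phi> rule: list.induct)
    case (Cons x xs)
    then obtain d ds' where ds: "ds = d # ds'" "x \<in> C d" "list_all2 (\<lambda>d x. x \<in> C d) ds' xs"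
      by (auto simp: list_all2_Cons2)
    have len: "length ds' = length xs" using list_all2_lengthD[OF ds(3)] .
    have "\<phi> (sign_list g (x # xs)) = \<phi> (signed (int (length xs) * d) x # sign_list g xs)"
      using gn[OF ds(2), of "length xs"] by simp
    also have "\<dots> = signed (int (length xs) * d) (\<phi> (x # sign_list g xs))"
      by (rule additive_signed[OF multilin_additive_hd[OF s t Cons.prems(1)]])
    also have "\<phi> (x # sign_list g xs) = signed (shift_exponent ds') (\<phi> (x # xs))"
      by (rule Cons.IH[OF multilin_Cons[OF Cons.prems(1)] ds(3)])
    finally show ?case by (simp add: ds len signed_signed)
  qed simp
  show "list_all2 (\<lambda>d x. x \<in> C d) ds (sign_list g xs)"
    using assms(6) by (induction rule: list_all2_induct) (auto intro: conjunct2[OF gn])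
qed

text \<open>The bridge from the recursive form to the index set of \<open>insertion_sum\<close>: a
  block starts at the first letter or later.\<close>

lemma coder_eq_sum:
  "coder b e \<phi> xs = (\<Sum>(r, l) \<in> {(r, l). 1 \<le> l \<and> r + l \<le> length xs}.
     \<phi> (map e (take r xs) @ b (take l (drop r xs)) # drop (r + l) xs))"
proof (induction xs arbitrary: \<phi>)
  case Nil
  show ?case by (simp only: coder.simps, rule sum.neutral[symmetric]) auto
next
  case (Cons x xs)
  let ?F = "\<lambda>\<phi> xs. \<lambda>(r, l). \<phi> (map e (take r xs) @ b (take l (drop r xs)) # drop (r + l) xs)"
  let ?I = "\<lambda>n::nat. {(r, l). 1 \<le> l \<and> r + l \<le> n}"
  have fin: "finite (?I n)" for n
    by (rule finite_subset[of _ "{..n} \<times> {..n}"]) auto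
  have split: "?I (length (x # xs)) = (\<lambda>k. (0, Suc k)) ` {..length xs} \<union> (\<lambda>(r, l). (Suc r, l)) ` ?I (length xs)"
  proof (intro set_eqI iffI)
    fix z assume "z \<in> ?I (length (x # xs))"
    then obtain r l where z: "z = (r, l)" "1 \<le> l" "r + l \<le> Suc (length xs)" by auto
    show "z \<in> (\<lambda>k. (0, Suc k)) ` {..length xs} \<union> (\<lambda>(r, l). (Suc r, l)) ` ?I (length xs)"
    proof (cases r)
      case 0
      then have "z = (0, Suc (l - 1))" "l - 1 \<le> length xs" using z by auto
      then show ?thesis by blast
    next
      case (Suc r')
      then show ?thesis using z by (intro UnI2 image_eqI[of _ _ "(r', l)"]) auto
    qed
  qed auto
  have "sum (?F \<phi> (x # xs)) (?I (length (x # xs)))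
     = sum (?F \<phi> (x # xs)) ((\<lambda>k. (0, Suc k)) ` {..length xs})
     + sum (?F \<phi> (x # xs)) ((\<lambda>(r, l). (Suc r, l)) ` ?I (length xs))"
    unfolding split by (rule sum.union_disjoint) (auto simp del: One_nat_def intro: fin)
  also have "sum (?F \<phi> (x # xs)) ((\<lambda>k. (0, Suc k)) ` {..length xs})
     = split_sum (\<lambda>us vs. \<phi> (b (x # us) # vs)) xs"
    by (subst sum.reindex) (auto simp: inj_on_def split_sum_eq_sum)
  also have "sum (?F \<phi> (x # xs)) ((\<lambda>(r, l). (Suc r, l)) ` ?I (length xs))
     = sum (?F (\<lambda>zs. \<phi> (e x # zs)) xs) (?I (length xs))"
    by (subst sum.reindex) (auto simp: inj_on_def intro!: sum.cong)
  finally show ?case by (simp add: Cons.IH)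
qed

lemma sum_signed: "(\<Sum>i\<in>I. signed k (f i)) = signed k (sum f I)"
  by (auto simp: signed_def sum_negf)

locale ainf_shift = shifted_space "smul A" e
  for A :: "('k::field, 'a::ab_group_add) ainf_algebra" and e :: "'a \<Rightarrow> 'a" +
  fixes b :: "'a list \<Rightarrow> 'a"
  assumes ainf: "is_ainf_algebra A"
    and e_component: "x \<in> component A i \<Longrightarrow> e x = signed (i - 1) x"
    and b_hom: "xs \<noteq> [] \<Longrightarrow> homogeneous A ds xs \<Longrightarrow> b xs = signed (shift_exponent ds) (ops A xs)"
begin

definition unshifted :: "'a \<Rightarrow> 'a" where
  "unshifted x = - e x"

lemma lin_unshifted: "lin (smul A) (smul A) unshifted"
  using linD[OF lin_e] by (simp add: lin_def unshifted_def scale_minus_right)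

lemma unshifted_C: "x \<in> component A i \<Longrightarrow> unshifted x = signed i x"
  by (auto simp: unshifted_def e_component signed_def)

lemma ops_C: "xs \<noteq> [] \<Longrightarrow> homogeneous A ds xs \<Longrightarrow> ops A xs \<in> component A (sum_list ds + (2 - int (length xs)))"
  using ainf multilinear_familyD(1)[of A A "\<lambda>n. 2 - int n" "ops A" xs ds] by (simp add: is_ainf_algebra_def)

text \<open>The shift absorbs the signs of \<open>insertion_sum\<close>: the signs in
  \<open>b\<close> and in \<open>G\<close>, and the involution \<open>e\<close> on the letters
  before the block, together reproduce them up to the overall sign of the word.\<close>

lemma coder_eq_insertion_sum:
  assumes t: "vector_space t" and \<phi>: "multilin (smul A) t \<phi>"
    and G: "\<And>ds xs. xs \<noteq> [] \<Longrightarrow> homogeneous A ds xs \<Longrightarrow> G xs = signed (shift_exponent ds) (\<phi> xs)"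
    and hom: "homogeneous A ds xs"
  shows "coder b e \<phi> xs = signed (shift_exponent ds) (insertion_sum G (ops A) ds xs)"
  unfolding coder_eq_sum insertion_sum_def sum_signed[symmetric]
proof (rule sum.cong, rule refl, clarify)
  fix r l :: nat
  assume l: "1 \<le> l" "r + l \<le> length xs"
  define T where "T = length xs - r - l"
  define us ys vs where "us = take r xs" and "ys = take l (drop r xs)" and "vs = drop (r + l) xs"
  define d1 d2 d3 where "d1 = take r ds" and "d2 = take l (drop r ds)" and "d3 = drop (r + l) ds"
  have len: "length ds = length xs" using hom by (simp add: homogeneous_def list_all2_lengthD)
  have ds: "ds = d1 @ d2 @ d3" unfolding d1_def d2_def d3_def
    by (metis add.commute append_take_drop_id drop_drop)
  have h1: "homogeneous A d1 us" and h2: "homogeneous A d2 ys" and h3: "homogeneous A d3 vs"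
    using hom by (auto simp: homogeneous_def d1_def d2_def d3_def us_def ys_def vs_def
        intro!: list_all2_takeI list_all2_dropI)
  have L: "length us = r" "length ys = l" "length d1 = r" "length d2 = l"
    "length vs = T" "length d3 = T"
    using l len by (auto simp: us_def ys_def vs_def d1_def d2_def d3_def T_def)
  have ys: "ys \<noteq> []" using L l by auto
  define k where "k = sum_list d2 + 2 - int l"
  have mk: "ops A ys \<in> component A k" using ops_C[OF ys h2] L by (simp add: k_def algebra_simps)
  have hz: "homogeneous A (d1 @ k # d3) (us @ ops A ys # vs)"
    using h1 h3 mk by (auto simp: homogeneous_def intro!: list_all2_appendI)
  let ?z = "us @ ops A ys # vs"
  let ?t = "int T"
  have "\<phi> (map e us @ b ys # vs) = signed (shift_exponent d2) (\<phi> (map e us @ ops A ys # vs))"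
    unfolding b_hom[OF ys h2] by (rule additive_signed[OF multilin_additive[OF vs_s t \<phi>]])
  also have "\<phi> (map e us @ ops A ys # vs) = signed (sum_list d1 - int r) (\<phi> ?z)"
    using multilin_map_homogeneous[OF vs_s t multilin_append2[OF \<phi>, of "ops A ys # vs"] e_component, of "component A" d1 us "[]"] h1 L
    by (simp add: homogeneous_def)
  finally have 1: "\<phi> (map e us @ b ys # vs) = signed (shift_exponent d2 + (sum_list d1 - int r)) (\<phi> ?z)"
    by (simp add: signed_signed)
  have 2: "G ?z = signed (shift_exponent (d1 @ k # d3)) (\<phi> ?z)" by (rule G[OF _ hz]) simp
  \<comment> \<open>The left side collects the sign of the block and the parity of the letters
    before it; the right side those of the whole word, of \<open>insertion_sum\<close>, and of the
    word with the block replaced by one letter of degree \<open>k\<close>. Expanding over the three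
    parts exhibits the factor 2.\<close>
  have "even (shift_exponent d2 + (sum_list d1 - int r) - (shift_exponent ds +
      (int (r + l * T) + (2 - int l) * sum_list d1 + shift_exponent (d1 @ k # d3))))"
  proof -
    have eq: "shift_exponent d2 + (sum_list d1 - int r) - (shift_exponent ds +
      (int (r + l * T) + (2 - int l) * sum_list d1 + shift_exponent (d1 @ k # d3)))
      = 2 * (- int r - shift_exponent d1 - sum_list d1 - ?t * sum_list d1 - ?t * sum_list d2
          - shift_exponent d3 - ?t)"
      unfolding ds shift_exponent_append shift_exponent.simps k_def
      by (simp add: L algebra_simps)
    show ?thesis unfolding eq by simp
  qed
  then show "\<phi> (map e (take r xs) @ b (take l (drop r xs)) # drop (r + l) xs) =
    signed (shift_exponent ds) (signed (int (r + l * T) + (2 - int l) * sum_list (take r ds))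
      (G (take r xs @ ops A (take l (drop r xs)) # drop (r + l) xs)))"
    unfolding T_def[symmetric] us_def[symmetric] ys_def[symmetric] vs_def[symmetric] d1_def[symmetric] 1 2 signed_signed
    by (simp add: add.assoc signed_cong)
qed

end

locale ainf_resolution = graded_transfer "smul A" e b h p q "component A" S n u + ainf_shift A e b
  for A :: "('k::field, 'a::ab_group_add) ainf_algebra" and e b h p q S n u
begin

lemma chain_complex_A: "chain_complex A"
proof -
  have b1: "ops A [x] = b [x]" if "x \<in> component A i" for i x
    using b_hom[of "[x]" "[i]"] that by (simp add: homogeneous_def)
  have bC: "b [x] \<in> component A (i + 1)" if "x \<in> component A i" for i x
    using ops_C[of "[x]" "[i]"] b1[OF that] that by (simp add: homogeneous_def)
  have "b [b [x]] = 0" for x using coder_b[of "[x]"] by simp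
  moreover have "b [x + y] = b [x] + b [y]" for x y
    by (rule multilin_add_hd[OF vs_s vs_s multilin_b])
  ultimately show ?thesis
    unfolding chain_complex_def
    using C_sub bC by (auto simp: b1[OF bC] b1 C_sub b1[OF C_sub(2)])
qed

end

subsection \<open>Finite dimensional models\<close>

text \<open>A DG-algebra as target has no operations of arity three or more, so only subdivisions
  into one or two blocks contribute to the equations of a morphism.\<close>

lemma sum_over_compositions:
  fixes F :: "nat list \<Rightarrow> 'b::comm_monoid_add"
  assumes "N \<ge> 1" "\<And>ns. length ns \<ge> 3 \<Longrightarrow> F ns = 0"
  shows "(\<Sum>ns \<in> {ns. sum_list ns = N \<and> 0 \<notin> set ns}. F ns) = F [N] + (\<Sum>k\<in>{1..<N}. F [k, N - k])"
proof -
  let ?T = "{ns. sum_list ns = N \<and> 0 \<notin> set ns}"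
  have len: "length ns \<le> sum_list ns" if "0 \<notin> set ns" for ns :: "nat list"
    using that by (induction ns) auto
  have "?T \<subseteq> {ns. set ns \<subseteq> {..N} \<and> length ns \<le> N}"
    using len by (auto simp: member_le_sum_list)
  then have fin: "finite ?T" by (rule finite_subset) (rule finite_lists_length_le, simp)
  have sub: "insert [N] ((\<lambda>k. [k, N - k]) ` {1..<N}) \<subseteq> ?T" using assms(1) by auto
  have "sum F ?T = sum F (insert [N] ((\<lambda>k. [k, N - k]) ` {1..<N}))"
  proof (rule sum.mono_neutral_right[OF fin sub], rule ballI)
    fix ns assume ns: "ns \<in> ?T - insert [N] ((\<lambda>k. [k, N - k]) ` {1..<N})"
    have "length ns \<ge> 3"
    proof (rule ccontr)
      assume "\<not> length ns \<ge> 3"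
      then consider "ns = []" | x where "ns = [x]" | x y where "ns = [x, y]"
        by (cases ns rule: list.exhaust; cases "tl ns"; cases "tl (tl ns)") auto
      then show False
      proof cases
        case (3 x y)
        then have "ns = [x, N - x]" "x \<in> {1..<N}" using ns by auto
        then show False using ns by auto
      qed (use ns assms(1) in auto)
    qed
    then show "F ns = 0" by (rule assms(2))
  qed
  also have "\<dots> = F [N] + sum F ((\<lambda>k. [k, N - k]) ` {1..<N})"
    by (rule sum.insert) auto
  also have "sum F ((\<lambda>k. [k, N - k]) ` {1..<N}) = (\<Sum>k\<in>{1..<N}. F [k, N - k])"
    by (subst sum.reindex) (auto simp: inj_on_def)
  finally show ?thesis .
qed

lemma finite_total_dimension_map_dg:
  fixes \<Theta> :: "'x \<Rightarrow> nat \<Rightarrow> 'k::field"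
  assumes "\<And>x m. m \<ge> K \<Longrightarrow> \<Theta> x m = 0"
  shows "finite_total_dimension (map_dg (\<lambda>c f m. c * f m) \<Theta> \<Xi> A)"
proof -
  define t where "t = (\<lambda>(c :: 'k) f (m :: nat). c * f m)"
  interpret T: vector_space t
    unfolding t_def by unfold_locales (auto simp: fun_eq_iff algebra_simps)
  have "\<Theta> x \<in> T.span ((\<lambda>k m. if m = k then 1 else 0) ` {..<K})" for x
  proof -
    have "\<Theta> x = (\<Sum>k<K. t (\<Theta> x k) (\<lambda>m. if m = k then 1 else 0))"
    proof
      fix m
      have "(\<Sum>k<K. t (\<Theta> x k) (\<lambda>m. if m = k then 1 else 0)) m = (\<Sum>k<K. \<Theta> x k * (if m = k then 1 else 0))"
        by (induction K) (auto simp: t_def)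
      also have "\<dots> = \<Theta> x m" using assms[of m] by (cases "m < K") (simp_all add: if_distrib cong: if_cong)
      finally show "\<Theta> x m = (\<Sum>k<K. t (\<Theta> x k) (\<lambda>m. if m = k then 1 else 0)) m" by simp
    qed
    also have "\<dots> \<in> T.span ((\<lambda>k m. if m = k then 1 else 0) ` {..<K})"
      by (intro T.span_sum T.span_scale T.span_base) auto
    finally show ?thesis .
  qed
  then show ?thesis
    unfolding finite_total_dimension_def map_dg_def t_def[symmetric]
    by (intro exI[of _ "(\<lambda>k m. if m = k then 1 else 0) ` {..<K}"]) auto
qed

context graded_minimal_algebra
begin

text \<open>A subspace containing all components of the truncation, as the transport of structure
  requires. The bound \<open>n + 1\<close> is \<open>n + j + 1\<close> for the largest degree
  \<open>j = 0\<close>.\<close>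

definition bounded_fun :: "('a list \<Rightarrow> 'a) set" where
  "bounded_fun = {\<psi>. end_fun \<psi> \<and> (\<forall>xs. length xs > nat (n + 1) \<longrightarrow> \<psi> xs = 0)}"

lemma fin_comp_bounded: "fin_comp j \<subseteq> bounded_fun"
proof
  fix \<psi> assume \<psi>: "\<psi> \<in> fin_comp j"
  have "\<psi> xs = 0" if "length xs > nat (n + 1)" for xs
  proof (cases "j > 0")
    case True then show ?thesis using \<psi> by (simp add: fin_comp_def)
  next
    case False then show ?thesis using that by (intro end_comp_long[OF fin_compD(1)[OF \<psi>]]) simp
  qed
  then show "\<psi> \<in> bounded_fun" using fin_compD(2)[OF \<psi>] by (simp add: bounded_fun_def)
qed

lemma subspace_bounded: "module.subspace scale_fun bounded_fun"
proof -
  interpret F: vector_space scale_fun by (rule vs_fun)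
  show ?thesis
    unfolding F.subspace_def bounded_fun_def
    by (auto simp: zero_fun_def plus_fun_def end_fun_zero end_fun_add end_fun_scale)
qed

text \<open>A bounded endomorphism is determined by its values on the finitely many short words over
  \<open>S\<close>, and these values lie in the finite dimensional space
  \<open>span S\<close>.\<close>

lemma finite_coordinates:
  obtains \<Theta> :: "('a list \<Rightarrow> 'a) \<Rightarrow> nat \<Rightarrow> 'k" and K
  where "lin scale_fun (\<lambda>c f m. c * f m) \<Theta>" "\<And>\<psi> m. m \<ge> K \<Longrightarrow> \<Theta> \<psi> m = 0" "inj_on \<Theta> bounded_fun"
proof -
  obtain c :: "'a \<Rightarrow> 'a \<Rightarrow> 'k" where c: "\<And>v. lin s (*) (c v)" "\<And>x. finite {v. c v x \<noteq> 0}"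
    "\<And>x. (\<And>v. c v x = 0) \<Longrightarrow> x = 0"
    using coordinates_exist[OF vs_s] by blast
  \<comment> \<open>The basis vectors that occur in elements of \<open>S\<close>; all other
    coordinates vanish on \<open>span S\<close>.\<close>
  define J where "J = (\<Union>x\<in>S. {v. c v x \<noteq> 0})"
  define W where "W = {ws. set ws \<subseteq> S \<and> length ws \<le> nat (n + 1)}"
  have fin: "finite (W \<times> J)"
    using finite_lists_length_le[OF finite_S] c(2) finite_S by (auto simp: W_def J_def)
  obtain \<iota> where \<iota>: "bij_betw \<iota> {0..<card (W \<times> J)} (W \<times> J)"
    using ex_bij_betw_nat_finite[OF fin] by auto
  define K where "K = card (W \<times> J)"
  define \<Theta> :: "('a list \<Rightarrow> 'a) \<Rightarrow> nat \<Rightarrow> 'k"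
    where "\<Theta> \<psi> m = (if m < K then c (snd (\<iota> m)) (\<psi> (fst (\<iota> m))) else 0)" for \<psi> m
  have vsk: "vector_space ((*) :: 'k \<Rightarrow> 'k \<Rightarrow> 'k)"
    by unfold_locales (auto simp: algebra_simps)
  have zero: "c v x = 0" if "v \<notin> J" "x \<in> span S" for v x
    using that(2)
  proof (induction rule: span_induct_alt)
    case base
    show ?case using lin_scale[OF vs_s vsk c(1), of v 0 0] by simp
  next
    case (step a y z)
    have "c v y = 0" using step(1) that(1) by (auto simp: J_def)
    then show ?case using linD[OF c(1), of v z a y] step by (simp add: add.commute)
  qed
  show ?thesis
  proof
    show "lin scale_fun (\<lambda>c f m. c * f m) \<Theta>"
      by (auto simp: lin_def \<Theta>_def fun_eq_iff linD[OF c(1)])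
    show "\<Theta> \<psi> m = 0" if "m \<ge> K" for \<psi> m using that by (simp add: \<Theta>_def)
    show "inj_on \<Theta> bounded_fun"
    proof (rule inj_onI)
      fix \<psi> \<chi> assume a: "\<psi> \<in> bounded_fun" "\<chi> \<in> bounded_fun" "\<Theta> \<psi> = \<Theta> \<chi>"
      have ef: "end_fun (\<lambda>xs. \<psi> xs - \<chi> xs)"
        using a by (intro end_fun_diff) (auto simp: bounded_fun_def)
      have "\<psi> xs - \<chi> xs = 0" for xs
      proof (rule eq_0_of_words[OF end_funD(1)[OF ef] vs_s end_funD(3)[OF ef]])
        fix ws assume ws: "set ws \<subseteq> S"
        show "\<psi> ws - \<chi> ws = 0"
        proof (cases "length ws \<le> nat (n + 1)")
          case True
          then have W: "ws \<in> W" using ws by (simp add: W_def)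
          have sp: "\<psi> ws - \<chi> ws \<in> span S"
            using p_S end_funD(4)[OF ef, of ws] by (metis rangeI subsetD)
          show ?thesis
          proof (rule c(3))
            fix v
            show "c v (\<psi> ws - \<chi> ws) = 0"
            proof (cases "v \<in> J")
              case True
              then obtain m where m: "m < K" "\<iota> m = (ws, v)"
                using W \<iota> unfolding K_def bij_betw_def
                by (metis (no_types, lifting) SigmaI atLeastLessThan_iff imageE)
              have "\<Theta> \<psi> m = \<Theta> \<chi> m" using a(3) by simp
              then have "c v (\<psi> ws) = c v (\<chi> ws)" using m by (simp add: \<Theta>_def)
              then show ?thesis
                using additive.diff[OF lin_additive[OF vs_s vsk c(1)]] by simp
            qed (rule zero[OF _ sp])
          qed
        next
          case False
          then show ?thesis using a by (simp add: bounded_fun_def)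
        qed
      qed
      then show "\<psi> = \<chi>" by (simp add: fun_eq_iff)
    qed
  qed
qed

end

context ainf_resolution
begin

text \<open>The quasi-isomorphism is the twisting cochain in coordinates, freed of the shift. As the
  target is a DG-algebra, the equations of a morphism involve one differential and the products over
  all cuts, which is \<open>coder_twist\<close>.\<close>

theorem finite_model:
  fixes \<Theta> :: "('a list \<Rightarrow> 'a) \<Rightarrow> nat \<Rightarrow> 'k" and K :: nat
  defines "t \<equiv> \<lambda>(c :: 'k) f (m :: nat). c * f m"
  defines "\<Xi> \<equiv> inv_into H.bounded_fun \<Theta>"
  defines "B \<equiv> map_dg t \<Theta> \<Xi> (H.end_dg\<lparr>dg_diff := \<lambda>x. - dg_diff H.end_dg x\<rparr>)"
  assumes \<Theta>: "lin H.scale_fun t \<Theta>" "\<And>\<psi> m. m \<ge> K \<Longrightarrow> \<Theta> \<psi> m = 0" "inj_on \<Theta> H.bounded_fun"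
  shows "is_dg_algebra B" "finite_total_dimension B" "ainf_quasi_isomorphic A (ainf_of_dg B)"
proof -
  have t: "vector_space t"
    unfolding t_def by unfold_locales (auto simp: fun_eq_iff algebra_simps)
  note ad = lin_additive[OF H.vs_fun t \<Theta>(1)]
  have inv: "\<Xi> (\<Theta> \<psi>) = \<psi>" if "\<psi> \<in> H.bounded_fun" for \<psi>
    unfolding \<Xi>_def by (rule inv_into_f_f[OF \<Theta>(3) that])
  have inv': "\<Xi> (\<Theta> \<psi>) = \<psi>" if "\<psi> \<in> H.fin_comp j" for \<psi> j
    using inv H.fin_comp_bounded that by blast
  have E: "smul H.end_dg = H.scale_fun" "component H.end_dg = H.fin_comp"
    "dg_diff H.end_dg = H.end_diff" "dg_mult H.end_dg = mod_comp"
    by (simp_all add: H.end_dg_def)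
  have BE: "smul B = t" "component B = (\<lambda>i. \<Theta> ` H.fin_comp i)"
    "dg_diff B = (\<lambda>y. \<Theta> (- H.end_diff (\<Xi> y)))" "dg_mult B = (\<lambda>y z. \<Theta> (mod_comp (\<Xi> y) (\<Xi> z)))"
    by (simp_all add: B_def map_dg_def E)
  show dgB: "is_dg_algebra B"
    unfolding B_def
  proof (rule is_dg_algebra_map[where X = H.bounded_fun])
    show "is_dg_algebra (H.end_dg\<lparr>dg_diff := \<lambda>x. - dg_diff H.end_dg x\<rparr>)"
      by (rule is_dg_algebra_neg[OF H.is_dg_algebra_end_dg])
  qed (use t \<Theta>(1) H.subspace_bounded H.fin_comp_bounded inv in \<open>simp_all add: E\<close>)
  show "finite_total_dimension B"
    unfolding B_def t_def by (rule finite_total_dimension_map_dg[of K \<Theta>, OF \<Theta>(2)])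
  define \<phi> where "\<phi> xs = \<Theta> (twist xs)" for xs
  \<comment> \<open>\<open>\<phi>\<close> satisfies the equations with shifted signs;
    \<open>sign_list\<close> converts it to the convention of \<open>ainf_morphism\<close>.\<close>
  define f where "f xs = \<phi> (sign_list unshifted xs)" for xs
  have m\<phi>: "multilin (smul A) t \<phi>" unfolding \<phi>_def by (rule multilin_comp[OF multilin_twist \<Theta>(1)])
  have mf: "multilin (smul A) t f" unfolding f_def by (rule multilin_sign_list[OF lin_unshifted m\<phi>])
  have f\<phi>: "f xs = signed (shift_exponent ds) (\<phi> xs)" if "homogeneous A ds xs" for ds xs
    unfolding f_def using that
    by (intro sign_list_homogeneous(1)[OF vs_s t unshifted_C C_sub(4) m\<phi>]) (auto simp: homogeneous_def)
  have tw: "twist xs \<in> H.fin_comp (sum_list ds - int (length xs) + 1)"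
    if "homogeneous A ds xs" for ds xs
  proof (cases "xs = []")
    case True then show ?thesis by (simp add: twist_Nil H.fin_comp_closed)
  next
    case False
    show ?thesis by (rule hdegD[OF hdeg_twist False]) (use that in \<open>auto simp: homogeneous_def\<close>)
  qed
  have Bneg: "x \<in> component B i \<Longrightarrow> signed k x \<in> component B i" for x i k
    using chain_complexD(2)[OF chain_complex_dg[OF dgB], of x i] by (auto simp: signed_def ainf_of_dg_def)
  have fB: "f xs \<in> component B (sum_list ds - int (length xs) + 1)" if "homogeneous A ds xs" for ds xs
    unfolding f\<phi>[OF that] \<phi>_def using tw[OF that] by (intro Bneg) (auto simp: BE)
  have mfam: "multilinear_family A (ainf_of_dg B) (\<lambda>n. 1 - int n) f"
    unfolding multilinear_family_def
  proof (intro conjI allI impI, goal_cases)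
    case (1 ds xs)
    then show ?case using fB[of ds xs] by (simp add: ainf_of_dg_def algebra_simps)
  next
    case (2 ds es us vs d x y)
    show ?case by (rule additive.add[OF multilin_additive[OF vs_s t mf]])
  next
    case (3 ds es us vs d x c)
    show ?case using lin_scale[OF vs_s t multilin_lin[OF mf]] by (simp add: ainf_of_dg_def BE)
  qed
  have mor: "insertion_sum f (ops A) ds xs =
      (\<Sum>ns \<in> {ns. sum_list ns = length xs \<and> 0 \<notin> set ns}.
         signed (block_exponent ns ds) (ops (ainf_of_dg B) (map f (blocks ns xs))))"
    if ne: "xs \<noteq> []" and hom: "homogeneous A ds xs" for ds xs
  proof -
    define N where "N = length xs"
    have N: "N \<ge> 1" using ne by (cases xs) (auto simp: N_def)
    have len: "length ds = N" using hom by (simp add: homogeneous_def list_all2_lengthD N_def)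
    have "coder b e \<phi> xs = signed (shift_exponent ds) (insertion_sum f (ops A) ds xs)"
      by (rule coder_eq_insertion_sum[OF t m\<phi> f\<phi> hom])
    then have "insertion_sum f (ops A) ds xs = signed (shift_exponent ds) (coder b e \<phi> xs)"
      by (simp add: signed_signed signed_even)
    also have "coder b e \<phi> xs = \<Theta> (D twist xs)"
      unfolding \<phi>_def by (rule coder_additive[OF ad, symmetric])
    also have "\<dots> = - \<Theta> (H.end_diff (twist xs))
        - split_sum (\<lambda>us vs. \<Theta> (mod_comp (twist (map e us)) (twist vs))) xs"
      by (simp add: coder_twist additive.minus[OF ad] additive.diff[OF ad] split_sum_additive[OF ad])
    finally have 1: "insertion_sum f (ops A) ds xs = signed (shift_exponent ds) (- \<Theta> (H.end_diff (twist xs))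
        - split_sum (\<lambda>us vs. \<Theta> (mod_comp (twist (map e us)) (twist vs))) xs)" .
    have 2: "signed (shift_exponent ds) (- \<Theta> (H.end_diff (twist xs))) = dg_diff B (f xs)"
    proof -
      have "dg_diff B (f xs) = signed (shift_exponent ds) (dg_diff B (\<phi> xs))"
        unfolding f\<phi>[OF hom]
        using chain_complexD(7)[OF chain_complex_dg[OF dgB], of "\<phi> xs"] tw[OF hom]
        by (auto simp: signed_def ainf_of_dg_def \<phi>_def BE)
      then show ?thesis by (simp add: BE \<phi>_def inv'[OF tw[OF hom]] additive.minus[OF ad])
    qed
    \<comment> \<open>Signs for the cut after \<open>k\<close> letters. On the left: unshifting the
      whole word, the minus in \<open>coder_twist\<close>, and the parity \<open>map e\<close> of
      the first piece. On the right: \<open>block_exponent\<close> and unshifting the two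
      pieces.\<close>
    have 3: "signed (shift_exponent ds + 1) (\<Theta> (mod_comp (twist (map e (take k xs))) (twist (drop k xs))))
        = signed (block_exponent [k, N - k] ds) (dg_mult B (f (take k xs)) (f (drop k xs)))"
      if k: "k \<in> {1..<N}" for k
    proof -
      have h: "homogeneous A (take k ds) (take k xs)" "homogeneous A (drop k ds) (drop k xs)"
        using hom by (auto simp: homogeneous_def intro!: list_all2_takeI list_all2_dropI)
      have te: "twist (map e (take k xs)) = signed (sum_list (take k ds) - int k) (twist (take k xs))"
        using H.map_e_homogeneous[OF H.vs_fun multilin_twist, of "take k ds" "take k xs" "[]"] h(1) k
        by (simp add: homogeneous_def N_def)
      have sl: "mod_comp (signed i \<psi>) \<chi> = signed i (mod_comp \<psi> \<chi>)" for i and \<psi> \<chi> :: "'a list \<Rightarrow> 'a"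
        by (rule additive_signed[OF H.additive_comp_left])
      have sr: "mod_comp (twist ys) (signed i \<chi>) = signed i (mod_comp (twist ys) \<chi>)" for i ys \<chi>
        by (rule additive_signed[OF H.additive_comp_right[OF H.end_funD(1)[OF end_fun_twist]]])
      have s\<Theta>: "\<Theta> (signed i \<psi>) = signed i (\<Theta> \<psi>)" for i \<psi>
        by (rule additive_signed[OF ad])
      have fi: "\<Xi> (f ys) = signed (shift_exponent es) (twist ys)" if "homogeneous A es ys" for es ys
      proof -
        have "signed i (twist ys) \<in> H.fin_comp (sum_list es - int (length ys) + 1)" for i
          using H.fin_comp_closed(5)[OF tw[OF that], of i] tw[OF that] H.fin_comp_closed(4)[OF tw[OF that]]
          by (simp add: signed_def fun_Compl_def)
        then show ?thesis unfolding f\<phi>[OF that] \<phi>_def s\<Theta>[symmetric] by (rule inv')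
      qed
      define P where "P = \<Theta> (mod_comp (twist (take k xs)) (twist (drop k xs)))"
      have "dg_mult B (f (take k xs)) (f (drop k xs))
          = signed (shift_exponent (take k ds) + shift_exponent (drop k ds)) P"
        by (simp add: BE fi[OF h(1)] fi[OF h(2)] sl sr s\<Theta> signed_signed P_def)
      moreover have "\<Theta> (mod_comp (twist (map e (take k xs))) (twist (drop k xs)))
          = signed (sum_list (take k ds) - int k) P"
        by (simp add: te sl s\<Theta> P_def)
      moreover have "block_exponent [k, N - k] ds = (int k - 1) + (int (N - k) - 1) * sum_list (take k ds)"
        by (simp add: block_exponent_def)
      moreover have "even (shift_exponent ds + 1 + (sum_list (take k ds) - int k) -
          ((int k - 1) + (int (N - k) - 1) * sum_list (take k ds)
            + (shift_exponent (take k ds) + shift_exponent (drop k ds))))"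
      proof -
        have "shift_exponent ds = shift_exponent (take k ds) + int (N - k) * sum_list (take k ds)
            + shift_exponent (drop k ds)"
          using shift_exponent_append[of "take k ds" "drop k ds"] len by simp
        then have eq: "shift_exponent ds + 1 + (sum_list (take k ds) - int k) -
          ((int k - 1) + (int (N - k) - 1) * sum_list (take k ds)
            + (shift_exponent (take k ds) + shift_exponent (drop k ds))) = 2 * (1 + sum_list (take k ds) - int k)"
          by (simp add: algebra_simps)
        show ?thesis unfolding eq by simp
      qed
      ultimately show ?thesis by (simp add: signed_signed) (rule signed_cong, simp)
    qed
    \<comment> \<open>Cuts with an empty piece drop out because \<open>twist [] = 0\<close>.\<close>
    have 4: "split_sum (\<lambda>us vs. \<Theta> (mod_comp (twist (map e us)) (twist vs))) xs
       = (\<Sum>k\<in>{1..<N}. \<Theta> (mod_comp (twist (map e (take k xs))) (twist (drop k xs))))"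
    proof -
      have z1: "mod_comp (twist (map e [])) \<chi> = 0" for \<chi>
        using additive.zero[OF H.additive_comp_left] by (simp add: twist_Nil zero_fun_def)
      have z2: "mod_comp (twist us) (twist []) = 0" for us
        using additive.zero[OF H.additive_comp_right[OF H.end_funD(1)[OF end_fun_twist]]]
        by (simp add: twist_Nil zero_fun_def)
      show ?thesis
        unfolding split_sum_eq_sum N_def[symmetric]
      proof (rule sum.mono_neutral_right)
        show "\<forall>i\<in>{..N} - {1..<N}. \<Theta> (mod_comp (twist (map e (take i xs))) (twist (drop i xs))) = 0"
        proof
          fix i assume "i \<in> {..N} - {1..<N}"
          then consider "i = 0" | "i = N" by force
          then show "\<Theta> (mod_comp (twist (map e (take i xs))) (twist (drop i xs))) = 0"
            by cases (use z1 z2 additive.zero[OF ad] N_def in auto)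
        qed
      qed auto
    qed
    have "insertion_sum f (ops A) ds xs = dg_diff B (f xs) +
      (\<Sum>k\<in>{1..<N}. signed (block_exponent [k, N - k] ds) (dg_mult B (f (take k xs)) (f (drop k xs))))"
    proof -
      have "insertion_sum f (ops A) ds xs = dg_diff B (f xs) + signed (shift_exponent ds + 1)
        (split_sum (\<lambda>us vs. \<Theta> (mod_comp (twist (map e us)) (twist vs))) xs)"
        unfolding 1 2[symmetric] by (simp add: signed_def)
      then show ?thesis unfolding 4 sum_signed[symmetric] using 3 by simp
    qed
    also have "\<dots> = (\<Sum>ns \<in> {ns. sum_list ns = N \<and> 0 \<notin> set ns}.
         signed (block_exponent ns ds) (ops (ainf_of_dg B) (map f (blocks ns xs))))"
    proof (subst sum_over_compositions[OF N])
      fix ns :: "nat list" assume "3 \<le> length ns"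
      then obtain n1 n2 n3 ns' where "ns = n1 # n2 # n3 # ns'"
        by (metis One_nat_def Suc_le_length_iff numeral_3_eq_3)
      then show "signed (block_exponent ns ds) (ops (ainf_of_dg B) (map f (blocks ns xs))) = 0"
        by (simp add: ainf_of_dg_def)
    next
      have "block_exponent [N] ds = 0" by (simp add: block_exponent_def)
      moreover have "take (N - k) (drop k xs) = drop k xs" for k by (simp add: N_def)
      ultimately show "dg_diff B (f xs) +
      (\<Sum>k\<in>{1..<N}. signed (block_exponent [k, N - k] ds) (dg_mult B (f (take k xs)) (f (drop k xs)))) =
        signed (block_exponent [N] ds) (ops (ainf_of_dg B) (map f (blocks [N] xs))) +
        (\<Sum>k = 1..<N. signed (block_exponent [k, N - k] ds)
            (ops (ainf_of_dg B) (map f (blocks [k, N - k] xs))))"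
        by (simp add: ainf_of_dg_def N_def)
    qed
    finally show ?thesis by (simp add: N_def)
  qed
  have f1: "f [x] = \<Theta> (twist [x])" for x by (simp add: f_def \<phi>_def)
  have b1: "ops A [x] = b [x]" if "x \<in> component A i" for i x
    using b_hom[of "[x]" "[i]"] that by (simp add: homogeneous_def)
  have tE: "twist [x] \<in> H.fin_comp i" if "x \<in> component A i" for x i
    using tw[of "[i]" "[x]"] that by (simp add: homogeneous_def)
  have bij: "bij_betw (coh_map (ainf_of_dg B) i (\<lambda>x. f [x])) (cohomology A i) (cohomology (ainf_of_dg B) i)" for i
  proof (rule bij_betw_coh_map[OF chain_complex_A chain_complex_dg[OF dgB]])
    show "f [x] \<in> component (ainf_of_dg B) i" if "x \<in> component A i" for i x
      using tE[OF that] by (simp add: f1 ainf_of_dg_def BE)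
    show "f [x + y] = f [x] + f [y]" for x y
      by (rule multilin_add_hd[OF vs_s t mf])
    \<comment> \<open>The equation of a morphism on words of length one says that \<open>f\<close>
      is a chain map.\<close>
    show "f [ops A [x]] = ops (ainf_of_dg B) [f [x]]" if x: "x \<in> component A i" for x i
    proof -
      have h: "homogeneous A [i] [x]" using x by (simp add: homogeneous_def)
      have I: "{(r, l). 1 \<le> l \<and> r + l \<le> length [x]} = {(0, 1)}" by auto
      have "insertion_sum f (ops A) [i] [x] = f [ops A [x]]"
        unfolding insertion_sum_def I by simp
      moreover have "(\<Sum>ns \<in> {ns. sum_list ns = 1 \<and> 0 \<notin> set ns}.
          signed (block_exponent ns [i]) (ops (ainf_of_dg B) (map f (blocks ns [x])))) = ops (ainf_of_dg B) [f [x]]"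
      proof (subst sum_over_compositions)
        fix ns :: "nat list" assume "3 \<le> length ns"
        then obtain n1 n2 n3 ns' where "ns = n1 # n2 # n3 # ns'"
          by (metis One_nat_def Suc_le_length_iff numeral_3_eq_3)
        then show "signed (block_exponent ns [i]) (ops (ainf_of_dg B) (map f (blocks ns [x]))) = 0"
          by (simp add: ainf_of_dg_def)
      qed (simp_all add: block_exponent_def)
      ultimately show ?thesis using mor[OF _ h] by simp
    qed
    show "x \<in> coboundaries A i" if x: "x \<in> cocycles A i" and fx: "f [x] \<in> coboundaries (ainf_of_dg B) i" for x
    proof -
      have xC: "x \<in> component A i" and "b [x] = 0" using x b1 by (auto simp: cocycles_def)
      obtain \<chi> where \<chi>: "\<chi> \<in> H.fin_comp (i - 1)" "f [x] = dg_diff B (\<Theta> \<chi>)"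
        using fx by (auto simp: coboundaries_def ainf_of_dg_def BE)
      have m: "- H.end_diff \<chi> \<in> H.fin_comp i"
        using H.fin_comp_closed(4)[OF H.fin_comp_diff[OF \<chi>(1)]] by (simp add: fun_Compl_def)
      have "\<Xi> (\<Theta> (twist [x])) = \<Xi> (\<Theta> (- H.end_diff \<chi>))"
        using \<chi>(2) by (simp add: f1 BE inv'[OF \<chi>(1)])
      then have "twist [x] = - H.end_diff \<chi>" by (simp only: inv'[OF tE[OF xC]] inv'[OF m])
      \<comment> \<open>The differential of \<open>B\<close> is the negative one, hence the sign of
        the primitive.\<close>
      also have "\<dots> = H.end_diff (- \<chi>)" by (simp add: additive.minus[OF H.additive_end_diff])
      finally have "twist [x] = H.end_diff (- \<chi>)" .
      moreover have "- \<chi> \<in> H.fin_comp (i - 1)"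
        using H.fin_comp_closed(4)[OF \<chi>(1)] by (simp add: fun_Compl_def)
      ultimately obtain y where "y \<in> component A (i - 1)" "x = b [y]"
        by (rule twist_inj[OF xC \<open>b [x] = 0\<close>])
      then show ?thesis using b1 by (auto simp: coboundaries_def)
    qed
    show "\<exists>x\<in>cocycles A i. y - f [x] \<in> coboundaries (ainf_of_dg B) i" if y: "y \<in> cocycles (ainf_of_dg B) i" for y
    proof -
      obtain \<psi> where \<psi>: "\<psi> \<in> H.fin_comp i" "y = \<Theta> \<psi>" "\<Theta> (- H.end_diff \<psi>) = 0"
        using y by (auto simp: cocycles_def ainf_of_dg_def BE inv')
      have m: "- H.end_diff \<psi> \<in> H.fin_comp (i + 1)"
        using H.fin_comp_closed(4)[OF H.fin_comp_diff[OF \<psi>(1)]] by (simp add: fun_Compl_def)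
      have "\<Xi> (\<Theta> (- H.end_diff \<psi>)) = \<Xi> (\<Theta> 0)" using \<psi>(3) additive.zero[OF ad] by simp
      moreover have "0 \<in> H.fin_comp i" using H.fin_comp_closed(1) by (simp add: zero_fun_def)
      ultimately have "- H.end_diff \<psi> = 0" by (simp only: inv'[OF m] inv')
      then have "H.end_diff \<psi> = (\<lambda>xs. 0)" by (simp add: zero_fun_def fun_eq_iff)
      then obtain x \<chi> where x: "x \<in> component A i" "b [x] = 0" "\<chi> \<in> H.fin_comp (i - 1)"
        "\<psi> = twist [x] + H.end_diff \<chi>"
        using twist_surj[OF \<psi>(1)] by metis
      have "y - f [x] = \<Theta> (H.end_diff \<chi>)" by (simp add: \<psi>(2) x(4) f1 additive.add[OF ad])
      moreover have nm: "- \<chi> \<in> H.fin_comp (i - 1)" using H.fin_comp_closed(4)[OF x(3)] by (simp add: fun_Compl_def)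
      moreover have "dg_diff B (\<Theta> (- \<chi>)) = \<Theta> (H.end_diff \<chi>)"
        using additive.minus[OF H.additive_end_diff, of \<chi>] by (simp add: BE inv'[OF nm])
      ultimately have "y - f [x] \<in> coboundaries (ainf_of_dg B) i"
        by (auto simp: coboundaries_def ainf_of_dg_def BE intro!: image_eqI[of _ _ "\<Theta> (- \<chi>)"])
      then show ?thesis using x b1 by (auto simp: cocycles_def)
    qed
  qed
  have "ainf_quasi_isomorphism A (ainf_of_dg B) f"
    unfolding ainf_quasi_isomorphism_def ainf_morphism_def using mfam mor bij by blast
  then show "ainf_quasi_isomorphic A (ainf_of_dg B)"
    unfolding ainf_quasi_isomorphic_def by blast
qed

end

subsection \<open>Projections onto the components\<close>

lemma linear_iff_lin:
  assumes "vector_space s" "vector_space t"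
  shows "Vector_Spaces.linear s t f \<longleftrightarrow> lin s t f"
proof
  assume "Vector_Spaces.linear s t f"
  then show "lin s t f" by (simp add: Vector_Spaces.linear_iff lin_def)
next
  assume "lin s t f"
  then show "Vector_Spaces.linear s t f"
    using assms lin_scale[OF assms] additive.add[OF lin_additive[OF assms]]
    by (simp add: Vector_Spaces.linear_iff)
qed

text \<open>Bases of the components are jointly independent and extend to a basis of the ambient
  type, on which the projections are prescribed; the added vectors go to 0. Supports are finite
  because each basis vector lies in at most one component.\<close>

lemma graded_projections_exist:
  fixes V :: "('k::field, 'a::ab_group_add, 'm) graded_space_scheme"
  assumes V: "graded_vector_space V"
  shows "\<exists>\<pi>. (\<forall>i. lin (smul V) (smul V) (\<pi> i)) \<and> (\<forall>i x. \<pi> i x \<in> component V i)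
    \<and> (\<forall>i. \<forall>x\<in>component V i. \<pi> i x = x) \<and> (\<forall>i j. i \<noteq> j \<longrightarrow> (\<forall>x\<in>component V j. \<pi> i x = 0))
    \<and> (\<forall>x. finite {i. \<pi> i x \<noteq> 0})"
proof -
  note V = graded_vector_spaceD[OF V]
  interpret vector_space "smul V" by (rule V(1))
  interpret vector_space_pair "smul V" "smul V" ..
  have "\<exists>B. B \<subseteq> component V i \<and> independent B \<and> component V i \<subseteq> span B" for i
    using maximal_independent_subset by metis
  then obtain B where B: "\<And>i. B i \<subseteq> component V i" "\<And>i. independent (B i)"
    "\<And>i. component V i \<subseteq> span (B i)" by metis
  have inter: "x = 0" if "x \<in> component V i" "x \<in> component V j" "i \<noteq> j" for x i j
  proof -
    have "(if i = i then x else - x) = 0"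
      by (rule V(4)[of "{i, j}" "\<lambda>l. if l = i then x else - x"])
        (use that subspace_neg[OF V(3)] in auto)
    then show ?thesis by simp
  qed
  have disj: "b \<notin> B j" if "b \<in> B i" "i \<noteq> j" for b i j
    using inter[of b i j] B(1) that dependent_zero[of "B i"] B(2) by blast
  have ind: "independent (\<Union>i. B i)"
  proof
    assume "dependent (\<Union>i. B i)"
    then obtain T f v where T: "finite T" "T \<subseteq> (\<Union>i. B i)" "v \<in> T" "f v \<noteq> 0"
      "(\<Sum>v\<in>T. smul V (f v) v) = 0"
      unfolding dependent_explicit by blast
    obtain dg where dg: "\<And>v. v \<in> T \<Longrightarrow> v \<in> B (dg v)" using T(2) by (metis UN_E subsetD)
    \<comment> \<open>A linear relation is grouped by degree; independence of the components makes
      each group vanish, contradicting independence of a single \<open>B i\<close>.\<close>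
    have "(\<Sum>i\<in>dg ` T. \<Sum>w | w \<in> T \<and> dg w = i. smul V (f w) w) = 0"
      using sum.group[of T "dg ` T" dg "\<lambda>w. smul V (f w) w"] T by simp
    moreover have "(\<Sum>w | w \<in> T \<and> dg w = i. smul V (f w) w) \<in> component V i" for i
      using dg B(1) by (intro subspace_sum[OF V(3)] subspace_scale[OF V(3)]) auto
    ultimately have z: "(\<Sum>w | w \<in> T \<and> dg w = dg v. smul V (f w) w) = 0"
      using V(4)[of "dg ` T" "\<lambda>i. \<Sum>w | w \<in> T \<and> dg w = i. smul V (f w) w" "dg v"] T by auto
    have "{w \<in> T. dg w = dg v} \<subseteq> B (dg v)" using dg by fastforce
    then have "dependent (B (dg v))"
      unfolding dependent_explicit
      by (intro exI[of _ "{w \<in> T. dg w = dg v}"] exI[of _ f]) (use T z in auto)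
    then show False using B(2) by blast
  qed
  define E where "E = extend_basis (\<Union>i. B i)"
  have E: "independent E" "span E = UNIV" "(\<Union>i. B i) \<subseteq> E"
    using ind by (auto simp: E_def independent_extend_basis span_extend_basis extend_basis_superset)
  have "\<forall>i. \<exists>g. Vector_Spaces.linear (smul V) (smul V) g \<and> (\<forall>b\<in>E. g b = (if b \<in> B i then b else 0))"
    by (intro allI linear_independent_extend[OF E(1)])
  then obtain \<pi> where \<pi>: "\<And>i. Vector_Spaces.linear (smul V) (smul V) (\<pi> i)"
    "\<And>i b. b \<in> E \<Longrightarrow> \<pi> i b = (if b \<in> B i then b else 0)" by metis
  have lin: "lin (smul V) (smul V) (\<pi> i)" for i using \<pi>(1) linear_iff_lin[OF V(1) V(1)] by blast
  note lD = linD[OF lin]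
  have on: "\<pi> i x = x" if "x \<in> component V i" for i x
  proof -
    have "x \<in> span (B i)" using that B(3) by blast
    then show ?thesis
    proof (induction rule: span_induct_alt)
      case base show ?case using lin_scale[OF V(1) V(1) lin, of i 0 0] by simp
    next
      case (step c x y)
      have "x \<in> E" using E(3) step(1) by blast
      then have "\<pi> i x = x" using \<pi>(2) step(1) by simp
      then show ?case using lD[of i y c x] step(2) by (simp add: add.commute)
    qed
  qed
  have off: "\<pi> i x = 0" if "x \<in> component V j" "i \<noteq> j" for i j x
  proof -
    have "x \<in> span (B j)" using that B(3) by blast
    then show ?thesis
    proof (induction rule: span_induct_alt)
      case base show ?case using lin_scale[OF V(1) V(1) lin, of i 0 0] by simp
    next
      case (step c x y)
      have "x \<in> E" using E(3) step(1) by blast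
      then have "\<pi> i x = 0" using \<pi>(2)[of x i] disj[OF step(1)] that(2) by auto
      then show ?case using lD[of i y c x] step(2) by (simp add: add.commute)
    qed
  qed
  have mem: "\<pi> i x \<in> component V i \<and> finite {i. \<pi> i x \<noteq> 0}" for i x
  proof -
    have "x \<in> span E" using E(2) by simp
    then have "(\<forall>i. \<pi> i x \<in> component V i) \<and> finite {i. \<pi> i x \<noteq> 0}"
    proof (induction rule: span_induct_alt)
      case base
      have "\<pi> i 0 = 0" for i using lin_scale[OF V(1) V(1) lin, of i 0 0] by simp
      then show ?case using subspace_0[OF V(3)] by simp
    next
      case (step c b y)
      have b: "\<pi> i b \<in> component V i" for i
        using \<pi>(2)[OF step(1)] B(1) subspace_0[OF V(3)] by auto
      have "{i. \<pi> i b \<noteq> 0} \<subseteq> {i. b \<in> B i}" using \<pi>(2)[OF step(1)] by auto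
      moreover have "finite {i. b \<in> B i}"
      proof (cases "\<exists>j. b \<in> B j")
        case True
        then obtain j where "b \<in> B j" by blast
        then have "{i. b \<in> B i} \<subseteq> {j}" using disj by auto
        then show ?thesis by (rule finite_subset) simp
      qed simp
      ultimately have "finite ({i. \<pi> i y \<noteq> 0} \<union> {i. \<pi> i b \<noteq> 0})"
        using step(2) finite_subset by blast
      moreover have "{i. \<pi> i (smul V c b + y) \<noteq> 0} \<subseteq> {i. \<pi> i y \<noteq> 0} \<union> {i. \<pi> i b \<noteq> 0}"
        using lD[of _ y c b] by (auto simp: add.commute)
      ultimately have "finite {i. \<pi> i (smul V c b + y) \<noteq> 0}" using finite_subset by blast
      moreover have "\<pi> i (smul V c b + y) \<in> component V i" for i
        using lD[of i y c b] b step(2) subspace_add[OF V(3)] subspace_scale[OF V(3)]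
        by (simp add: add.commute)
      ultimately show ?case by blast
    qed
    then show ?thesis by blast
  qed
  show ?thesis
    by (rule exI[of _ \<pi>]) (use lin mem on off in blast)
qed

locale graded_projections = vector_space s
  for s :: "'k::field \<Rightarrow> 'a::ab_group_add \<Rightarrow> 'a" +
  fixes C :: "int \<Rightarrow> 'a set" and \<pi> :: "int \<Rightarrow> 'a \<Rightarrow> 'a"
  assumes subspace_C: "subspace (C i)" and lin_\<pi>: "lin s s (\<pi> i)" and \<pi>_C: "\<pi> i x \<in> C i"
    and \<pi>_on: "x \<in> C i \<Longrightarrow> \<pi> i x = x" and \<pi>_off: "x \<in> C j \<Longrightarrow> i \<noteq> j \<Longrightarrow> \<pi> i x = 0"
    and finite_\<pi>: "finite {i. \<pi> i x \<noteq> 0}"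
begin

lemma vs_s: "vector_space s" ..

lemmas additive_\<pi> = lin_additive[OF vs_s vs_s lin_\<pi>]

lemma \<pi>_\<pi>: "\<pi> i (\<pi> j x) = (if i = j then \<pi> i x else 0)"
  using \<pi>_on[OF \<pi>_C] \<pi>_off[OF \<pi>_C] by auto

text \<open>Glues maps given on the components to one map on the ambient type, which vanishes where
  all projections do.\<close>

definition dsum :: "(int \<Rightarrow> 'a \<Rightarrow> 'c::ab_group_add) \<Rightarrow> 'a \<Rightarrow> 'c" where
  "dsum F x = (\<Sum>i | \<pi> i x \<noteq> 0. F i (\<pi> i x))"

lemma dsum_superset:
  "finite I \<Longrightarrow> {i. \<pi> i x \<noteq> 0} \<subseteq> I \<Longrightarrow> (\<And>i. F i 0 = 0) \<Longrightarrow> dsum F x = (\<Sum>i\<in>I. F i (\<pi> i x))"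
  unfolding dsum_def by (rule sum.mono_neutral_left) auto

lemma lin_dsum:
  assumes t: "vector_space t"
    and F: "\<And>i x y c. x \<in> C i \<Longrightarrow> y \<in> C i \<Longrightarrow> F i (x + s c y) = F i x + t c (F i y)"
  shows "lin s t (dsum F)"
proof -
  have F0: "F i 0 = 0" for i
    using F[of 0 i 0 1] subspace_0[OF subspace_C] vector_space.vector_space_assms(4)[OF t]
    by simp
  show ?thesis unfolding lin_def
  proof (intro allI)
    fix x y c
    define I where "I = {i. \<pi> i x \<noteq> 0} \<union> {i. \<pi> i y \<noteq> 0}"
    have I: "finite I" using finite_\<pi> by (simp add: I_def)
    have "{i. \<pi> i (x + s c y) \<noteq> 0} \<subseteq> I" using linD[OF lin_\<pi>] by (auto simp: I_def)
    then have "dsum F (x + s c y) = (\<Sum>i\<in>I. F i (\<pi> i (x + s c y)))"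
      by (intro dsum_superset I F0)
    also have "\<dots> = (\<Sum>i\<in>I. F i (\<pi> i x)) + t c (\<Sum>i\<in>I. F i (\<pi> i y))"
      by (simp add: additive.sum[OF scale_additive[OF t t]] linD[OF lin_\<pi>] F[OF \<pi>_C \<pi>_C] sum.distrib)
    finally show "dsum F (x + s c y) = dsum F x + t c (dsum F y)"
      using dsum_superset[OF I, of x F] dsum_superset[OF I, of y F] F0 by (auto simp: I_def)
  qed
qed

lemma dsum_C: "x \<in> C i \<Longrightarrow> (\<And>i. F i 0 = 0) \<Longrightarrow> dsum F x = F i x"
  using dsum_superset[of "{i}" x F] \<pi>_on[of x i] \<pi>_off[of x i] by force

definition q :: "'a \<Rightarrow> 'a" where "q = dsum (\<lambda>i x. x)"

lemma lin_q: "lin s s q"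
  unfolding q_def by (rule lin_dsum[OF vs_s]) simp

lemma q_C: "x \<in> C i \<Longrightarrow> q x = x"
  unfolding q_def by (rule dsum_C) auto

lemma \<pi>_q: "\<pi> i (q x) = \<pi> i x"
proof -
  have "\<pi> i (q x) = (\<Sum>j | \<pi> j x \<noteq> 0. if i = j then \<pi> i x else 0)"
    unfolding q_def dsum_def by (simp add: additive.sum[OF additive_\<pi>] \<pi>_\<pi>)
  then show ?thesis by (simp add: finite_\<pi>)
qed

lemma q_q: "q (q x) = q x"
  by (simp add: q_def dsum_def) (simp add: \<pi>_q[unfolded q_def dsum_def])

lemma q_dsum:
  assumes "\<And>i x. x \<in> C i \<Longrightarrow> F i x \<in> C (i + k)"
  shows "q (dsum F x) = dsum F x"
  unfolding dsum_def[of F]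
  using q_C[OF assms[OF \<pi>_C]] by (simp add: additive.sum[OF lin_additive[OF vs_s vs_s lin_q]])

lemma dsum_q: "dsum F (q x) = dsum F x"
  by (simp add: dsum_def \<pi>_q)

text \<open>An identity that factors through \<open>q\<close> need only be checked on homogeneous
  elements, since \<open>q x\<close> is the sum of the projections of \<open>x\<close>.\<close>

lemma lin_eq_0:
  assumes "lin s t F" "vector_space t" "\<And>x. F (q x) = F x" "\<And>i x. x \<in> C i \<Longrightarrow> F x = 0"
  shows "F x = 0"
proof -
  have "F x = F (\<Sum>i | \<pi> i x \<noteq> 0. \<pi> i x)" using assms(3)[of x] by (simp add: q_def dsum_def)
  also have "\<dots> = 0"
    by (simp add: additive.sum[OF lin_additive[OF vs_s assms(2,1)]] assms(4)[OF \<pi>_C])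
  finally show ?thesis .
qed

lemma multilin_eq_0:
  assumes \<phi>: "multilin s t \<phi>" and t: "vector_space t"
    and n: "\<And>us x vs. \<phi> (us @ q x # vs) = \<phi> (us @ x # vs)"
    and h: "\<And>ds xs. list_all2 (\<lambda>d x. x \<in> C d) ds xs \<Longrightarrow> \<phi> xs = 0"
  shows "\<phi> xs = 0"
proof -
  have "\<phi> (us @ vs) = 0" if "list_all2 (\<lambda>d x. x \<in> C d) ds us" for us vs ds
    using that
  proof (induction vs arbitrary: us ds)
    case Nil then show ?case using h by simp
  next
    case (Cons v vs)
    show ?case
    proof (rule lin_eq_0[OF multilin_lin[OF \<phi>] t n])
      fix i x assume "x \<in> C i"
      then have "list_all2 (\<lambda>d x. x \<in> C d) (ds @ [i]) (us @ [x])"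
        using Cons.prems by (intro list_all2_appendI) auto
      from Cons.IH[OF this] show "\<phi> (us @ x # vs) = 0" by simp
    qed
  qed
  from this[of "[]" "[]" xs] show ?thesis by simp
qed

definition hmultilin :: "('k \<Rightarrow> 'c::ab_group_add \<Rightarrow> 'c) \<Rightarrow> ('a list \<Rightarrow> 'c) \<Rightarrow> bool" where
  "hmultilin t \<phi> \<longleftrightarrow> (\<forall>ds es us vs d x y c. list_all2 (\<lambda>d x. x \<in> C d) ds us \<and>
     list_all2 (\<lambda>d x. x \<in> C d) es vs \<and> x \<in> C d \<and> y \<in> C d \<longrightarrow>
     \<phi> (us @ (x + s c y) # vs) = \<phi> (us @ x # vs) + t c (\<phi> (us @ y # vs)))"

lemma hmultilinD:
  "hmultilin t \<phi> \<Longrightarrow> list_all2 (\<lambda>d x. x \<in> C d) ds us \<Longrightarrow> list_all2 (\<lambda>d x. x \<in> C d) es vs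
   \<Longrightarrow> x \<in> C d \<Longrightarrow> y \<in> C d \<Longrightarrow> \<phi> (us @ (x + s c y) # vs) = \<phi> (us @ x # vs) + t c (\<phi> (us @ y # vs))"
  unfolding hmultilin_def by blast

lemma hmultilin_Cons:
  assumes "hmultilin t \<phi>" "x \<in> C i" shows "hmultilin t (\<lambda>zs. \<phi> (x # zs))"
  unfolding hmultilin_def
proof (intro allI impI)
  fix ds es us vs d y z c
  assume a: "list_all2 (\<lambda>d x. x \<in> C d) ds us \<and> list_all2 (\<lambda>d x. x \<in> C d) es vs \<and> y \<in> C d \<and> z \<in> C d"
  then have "list_all2 (\<lambda>d x. x \<in> C d) (i # ds) (x # us)" using assms(2) by simp
  from hmultilinD[OF assms(1) this, of es vs y d z c] a
  show "\<phi> (x # us @ (y + s c z) # vs) = \<phi> (x # us @ y # vs) + t c (\<phi> (x # us @ z # vs))" by simp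
qed

text \<open>The operations of an A_infinity algebra are constrained on homogeneous arguments only.
  Decomposing each letter gives a map with the same values there that is multilinear on all
  words.\<close>

primrec ext :: "('a list \<Rightarrow> 'c::ab_group_add) \<Rightarrow> 'a list \<Rightarrow> 'c" where
  "ext \<phi> [] = \<phi> []"
| "ext \<phi> (x # xs) = dsum (\<lambda>i y. ext (\<lambda>zs. \<phi> (y # zs)) xs) x"

lemma ext_cong:
  "(\<And>ds zs. list_all2 (\<lambda>d x. x \<in> C d) ds zs \<Longrightarrow> \<phi> zs = \<psi> zs) \<Longrightarrow> ext \<phi> xs = ext \<psi> xs"
proof (induction xs arbitrary: \<phi> \<psi>)
  case Nil then show ?case using Nil[of "[]" "[]"] by simp
next
  case (Cons x xs)
  have "ext (\<lambda>zs. \<phi> (\<pi> i x # zs)) xs = ext (\<lambda>zs. \<psi> (\<pi> i x # zs)) xs" for i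
  proof (rule Cons.IH)
    fix ds zs assume "list_all2 (\<lambda>d x. x \<in> C d) ds zs"
    then show "\<phi> (\<pi> i x # zs) = \<psi> (\<pi> i x # zs)" using Cons.prems[of "i # ds" "\<pi> i x # zs"] \<pi>_C by simp
  qed
  then show ?case by (simp add: dsum_def)
qed

lemma ext_linear:
  assumes t: "vector_space t"
  shows "ext (\<lambda>zs. \<phi> zs + t c (\<psi> zs)) xs = ext \<phi> xs + t c (ext \<psi> xs)"
  by (induction xs arbitrary: \<phi> \<psi>)
    (simp_all add: dsum_def sum.distrib additive.sum[OF scale_additive[OF t t]])

lemma multilin_ext:
  assumes t: "vector_space t" and "hmultilin t \<phi>"
  shows "multilin s t (ext \<phi>)"
proof (rule multilinI)
  fix us vs x y c
  show "ext \<phi> (us @ (x + s c y) # vs) = ext \<phi> (us @ x # vs) + t c (ext \<phi> (us @ y # vs))"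
    using assms(2)
  proof (induction us arbitrary: \<phi>)
    case Nil
    have "lin s t (dsum (\<lambda>i y. ext (\<lambda>zs. \<phi> (y # zs)) vs))"
    proof (rule lin_dsum[OF t])
      fix i x y c assume xy: "x \<in> C i" "y \<in> C i"
      have "ext (\<lambda>zs. \<phi> ((x + s c y) # zs)) vs = ext (\<lambda>zs. \<phi> (x # zs) + t c (\<phi> (y # zs))) vs"
        by (rule ext_cong) (use hmultilinD[OF Nil, of "[]" "[]"] xy in auto)
      then show "ext (\<lambda>zs. \<phi> ((x + s c y) # zs)) vs
          = ext (\<lambda>zs. \<phi> (x # zs)) vs + t c (ext (\<lambda>zs. \<phi> (y # zs)) vs)"
        by (simp add: ext_linear[OF t])
    qed
    from linD[OF this] show ?case by simp
  next
    case (Cons z us)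
    then show ?case using Cons.IH[OF hmultilin_Cons[OF Cons.prems \<pi>_C]]
      by (simp add: dsum_def sum.distrib additive.sum[OF scale_additive[OF t t]])
  qed
qed

lemma ext_homogeneous:
  assumes t: "vector_space t" and "hmultilin t \<phi>" "list_all2 (\<lambda>d x. x \<in> C d) ds xs"
  shows "ext \<phi> xs = \<phi> xs"
  using assms(2,3)
proof (induction xs arbitrary: ds \<phi> rule: list.induct)
  case (Cons x xs)
  then obtain d ds' where ds: "ds = d # ds'" and x: "x \<in> C d"
    and hom: "list_all2 (\<lambda>d x. x \<in> C d) ds' xs"
    by (auto simp: list_all2_Cons2)
  have z: "ext (\<lambda>zs. \<phi> (0 # zs)) xs = 0"
  proof -
    have "0 \<in> C d" using subspace_0[OF subspace_C] .
    then have "\<phi> (0 # zs) = 0" if "list_all2 (\<lambda>d x. x \<in> C d) es zs" for es zs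
      using hmultilinD[OF Cons.prems(1), of "[]" "[]" es zs 0 d 0 1] that
        vector_space.vector_space_assms(4)[OF t] by simp
    then have "ext (\<lambda>zs. \<phi> (0 # zs)) xs = ext (\<lambda>zs. 0) xs" by (rule ext_cong)
    also have "ext (\<lambda>zs. 0) xs = 0" by (induction xs) (auto simp: dsum_def)
    finally show ?thesis .
  qed
  have "ext \<phi> (x # xs) = ext (\<lambda>zs. \<phi> (x # zs)) xs"
    using dsum_C[OF x, of "\<lambda>i y. ext (\<lambda>zs. \<phi> (y # zs)) xs"] z by simp
  also have "\<dots> = \<phi> (x # xs)" by (rule Cons.IH[OF hmultilin_Cons[OF Cons.prems(1) x] hom])
  finally show ?case .
qed simp

lemma ext_q: "ext \<phi> (us @ q x # vs) = ext \<phi> (us @ x # vs)"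
  by (induction us arbitrary: \<phi>) (simp only: append.simps ext.simps dsum_q, simp add: dsum_def)

end

subsection \<open>Existence of the transfer data\<close>

locale proper_connective_ainf = graded_projections "smul A" "component A" \<pi>
  for A :: "('k::field, 'a::ab_group_add) ainf_algebra" and \<pi> +
  assumes ainf: "is_ainf_algebra A" and unital: "homologically_unital A"
    and proper: "proper A" and connective: "connective A"
begin

abbreviation C :: "int \<Rightarrow> 'a set" where "C \<equiv> component A"

lemmas C_0 = subspace_0[OF subspace_C] and C_add = subspace_add[OF subspace_C]
  and C_neg = subspace_neg[OF subspace_C] and C_diff = subspace_diff[OF subspace_C]
  and C_scale = subspace_scale[OF subspace_C]

lemma C_signed: "x \<in> C i \<Longrightarrow> signed k x \<in> C i"
  using C_neg by (auto simp: signed_def)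

definition half :: "'a \<Rightarrow> 'a" where
  "half = dsum (\<lambda>i x. if even i then x else 0)"

text \<open>The parity of the shifted degree \<open>i - 1\<close>. It is written as the identity
  minus twice the projection \<open>half\<close> onto even degrees, and not as a signed sum of
  projections, so that it is an involution on the whole ambient type.\<close>

definition e :: "'a \<Rightarrow> 'a" where
  "e x = x - (half x + half x)"

lemma lin_half: "lin (smul A) (smul A) half"
  unfolding half_def by (rule lin_dsum[OF vs_s]) simp

lemmas additive_half = lin_additive[OF vs_s vs_s lin_half]
lemmas additive_q = lin_additive[OF vs_s vs_s lin_q]

lemma half_C: "x \<in> C i \<Longrightarrow> half x = (if even i then x else 0)"
  unfolding half_def by (rule dsum_C) auto

lemma lin_compose: "lin s t f \<Longrightarrow> lin t r g \<Longrightarrow> lin s r (\<lambda>x. g (f x))"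
  by (simp add: lin_def)

lemma lin_minus: "lin (smul A) (smul A) f \<Longrightarrow> lin (smul A) (smul A) g \<Longrightarrow> lin (smul A) (smul A) (\<lambda>x. f x - g x)"
  by (simp add: lin_def scale_right_diff_distrib)

lemma lin_plus: "lin (smul A) (smul A) f \<Longrightarrow> lin (smul A) (smul A) g \<Longrightarrow> lin (smul A) (smul A) (\<lambda>x. f x + g x)"
  by (simp add: lin_def scale_right_distrib)

lemma lin_neg: "lin (smul A) (smul A) f \<Longrightarrow> lin (smul A) (smul A) (\<lambda>x. - f x)"
  by (simp add: lin_def scale_minus_right)

lemma lin_id: "lin (smul A) (smul A) (\<lambda>x. x)"
  by (simp add: lin_def)

lemma half_q: "half (q x) = half x"
  unfolding half_def by (rule dsum_q)

lemma half_half: "half (half x) = half x"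
proof -
  have "half (half x) - half x = 0"
    by (rule lin_eq_0[OF lin_minus[OF lin_compose[OF lin_half lin_half] lin_half] vs_s])
      (auto simp: half_C half_q additive.zero[OF additive_half])
  then show ?thesis by simp
qed

lemma lin_e: "lin (smul A) (smul A) e"
  unfolding e_def[abs_def] by (intro lin_minus lin_plus lin_id lin_half)

lemma e_C: "x \<in> C i \<Longrightarrow> e x = signed (i - 1) x"
  by (auto simp: e_def half_C signed_def)

lemma e_e: "e (e x) = x"
  by (simp add: e_def additive.diff[OF additive_half] additive.add[OF additive_half] half_half)

lemma q_half: "q (half x) = half x"
  unfolding half_def by (rule q_dsum[where k = 0]) (auto simp: C_0)

lemma e_q: "e (q x) = q (e x)"
  by (simp add: e_def additive.diff[OF additive_q] additive.add[OF additive_q] q_half half_q)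

sublocale E: shifted_space "smul A" e
  by unfold_locales (simp_all add: lin_e e_e)

text \<open>\<open>- e\<close> is the unshifted parity that \<open>sign_list\<close> expects. The
  empty list gets 0 because the value of \<open>ops A\<close> there is arbitrary.\<close>

definition b :: "'a list \<Rightarrow> 'a" where
  "b xs = (if length xs \<noteq> 0 then ext (ops A) (sign_list (\<lambda>x. - e x) xs) else 0)"

lemma hmultilin_ops: "hmultilin (smul A) (ops A)"
  unfolding hmultilin_def
proof (intro allI impI)
  fix ds es us vs d x y c
  assume a: "list_all2 (\<lambda>d x. x \<in> C d) ds us \<and> list_all2 (\<lambda>d x. x \<in> C d) es vs \<and> x \<in> C d \<and> y \<in> C d"
  have mf: "multilinear_family A A (\<lambda>n. 2 - int n) (ops A)" using ainf by (simp add: is_ainf_algebra_def)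
  have "ops A (us @ (x + smul A c y) # vs) = ops A (us @ x # vs) + ops A (us @ smul A c y # vs)"
    by (rule multilinear_familyD(2)[OF mf, of ds us es vs _ d])
      (use a C_scale[of y d c] in \<open>auto simp: homogeneous_def\<close>)
  moreover have "ops A (us @ smul A c y # vs) = smul A c (ops A (us @ y # vs))"
    by (rule multilinear_familyD(3)[OF mf, of ds us es vs _ d]) (use a in \<open>auto simp: homogeneous_def\<close>)
  ultimately show "ops A (us @ (x + smul A c y) # vs) = ops A (us @ x # vs) + smul A c (ops A (us @ y # vs))"
    by simp
qed

lemma multilin_b: "multilin (smul A) (smul A) b"
  unfolding b_def[abs_def]
proof -
  have m: "multilin (smul A) (smul A) (\<lambda>xs. ext (ops A) (sign_list (\<lambda>x. - e x) xs))"
    by (rule multilin_sign_list[OF lin_neg[OF lin_e] multilin_ext[OF vs_s hmultilin_ops]])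
  show "multilin (smul A) (smul A) (\<lambda>xs. if length xs \<noteq> 0 then ext (ops A) (sign_list (\<lambda>x. - e x) xs) else 0)"
    using multilinD[OF m] by (simp add: multilin_def)
qed

lemma b_hom:
  assumes "xs \<noteq> []" "homogeneous A ds xs"
  shows "b xs = signed (shift_exponent ds) (ops A xs)"
proof -
  have h: "list_all2 (\<lambda>d x. x \<in> C d) ds xs" using assms(2) by (simp add: homogeneous_def)
  have "ext (ops A) (sign_list (\<lambda>x. - e x) xs) = signed (shift_exponent ds) (ext (ops A) xs)"
    by (rule sign_list_homogeneous(1)[OF vs_s vs_s _ C_neg multilin_ext[OF vs_s hmultilin_ops] h])
      (auto simp: e_C signed_def)
  then show ?thesis using assms(1) ext_homogeneous[OF vs_s hmultilin_ops h] by (simp add: b_def)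
qed

sublocale ainf_shift A e b
  by unfold_locales (simp_all add: ainf e_C b_hom)

lemma sign_list_q: "ext \<phi> (us @ sign_list (\<lambda>x. - e x) (xs @ q x # ys)) = ext \<phi> (us @ sign_list (\<lambda>x. - e x) (xs @ x # ys))"
proof (induction xs arbitrary: us)
  case Nil
  have "((\<lambda>x. - e x) ^^ k) (q x) = q (((\<lambda>x. - e x) ^^ k) x)" for k
    by (induction k) (simp_all add: e_q additive.minus[OF additive_q])
  then show ?case by (simp add: ext_q)
next
  case (Cons z xs)
  show ?case using Cons.IH[of "us @ [((\<lambda>x. - e x) ^^ Suc (length xs + length ys)) z]"] by simp
qed

lemma b_q: "b (us @ q x # vs) = b (us @ x # vs)"
  using sign_list_q[of "ops A" "[]"] by (simp add: b_def)

lemma b_C: "hdeg C C 2 b"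
proof (rule hdegI)
  fix ds xs assume "xs \<noteq> []" "list_all2 (\<lambda>d x. x \<in> C d) ds xs"
  then have h: "xs \<noteq> []" "homogeneous A ds xs" by (auto simp: homogeneous_def)
  show "b xs \<in> C (sum_list ds - int (length xs) + 2)"
    unfolding b_hom[OF h] by (rule C_signed, rule mem_degree[of _ C, OF ops_C[OF h]]) simp
qed

lemma odd_b: "e (b xs) = - b (map e xs)"
proof -
  have m: "multilin (smul A) (smul A) (\<lambda>xs. e (b xs) + b (map e xs))"
    by (intro multilin_plus[OF vs_s vs_s] multilin_comp[OF multilin_b lin_e] multilin_map multilin_b lin_e)
  have "e (b xs) + b (map e xs) = 0"
  proof (rule multilin_eq_0[OF m vs_s])
    show "e (b (us @ q x # vs)) + b (map e (us @ q x # vs)) = e (b (us @ x # vs)) + b (map e (us @ x # vs))" for us x vs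
      by (simp add: b_q e_q)
    fix ds xs assume h: "list_all2 (\<lambda>d x. x \<in> C d) ds xs"
    show "e (b xs) + b (map e xs) = 0"
    proof (cases "xs = []")
      case False
      have "e (b xs) = signed (sum_list ds - int (length xs) + 2 - 1) (b xs)"
        by (rule e_C, rule hdegD[OF b_C False h]) simp
      moreover have "b (map e xs) = signed (sum_list ds - int (length xs)) (b xs)"
        using multilin_map_homogeneous[OF vs_s vs_s multilin_b e_C h, of "[]"] by simp
      ultimately show ?thesis by (auto simp: signed_def)
    qed (simp add: b_def E.e_zero)
  qed
  then show ?thesis by (simp add: eq_neg_iff_add_eq_0)
qed

lemma coder_b: "coder b e b xs = 0"
proof (rule multilin_eq_0[OF multilin_coder[OF vs_s vs_s multilin_b multilin_b lin_e] vs_s])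
  show "coder b e b (us @ q x # vs) = coder b e b (us @ x # vs)" for us x vs
    by (rule coder_replace) (simp_all add: b_q e_q)
  fix ds xs assume h: "list_all2 (\<lambda>d x. x \<in> C d) ds xs"
  show "coder b e b xs = 0"
  proof (cases "xs = []")
    case False
    have hx: "homogeneous A ds xs" using h by (simp add: homogeneous_def)
    have "coder b e (\<lambda>zs. b zs) xs = signed (shift_exponent ds) (insertion_sum (ops A) (ops A) ds xs)"
      by (rule coder_eq_insertion_sum[OF vs_s multilin_b _ hx])
        (simp add: b_hom signed_signed signed_even)
    then show ?thesis using ainf hx False by (simp add: is_ainf_algebra_def)
  qed simp
qed

definition d :: "'a \<Rightarrow> 'a" where "d x = b [x]"

lemma lin_d: "lin (smul A) (smul A) d"
  unfolding d_def[abs_def] by (rule multilin_lin_hd[OF multilin_b])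

lemmas additive_d = lin_additive[OF vs_s vs_s lin_d]

lemma d_d: "d (d x) = 0"
  using coder_b[of "[x]"] by (simp add: d_def)

lemma d_C: "x \<in> C i \<Longrightarrow> d x \<in> C (i + 1)"
  unfolding d_def by (rule hdegD[OF b_C, of _ "[i]"]) auto

lemma d_ops: "x \<in> C i \<Longrightarrow> ops A [x] = d x"
  using b_hom[of "[x]" "[i]"] by (simp add: homogeneous_def d_def)

lemma d_q: "d (q x) = d x"
  using b_q[of "[]" x "[]"] by (simp add: d_def)

lemma \<pi>_d: "\<pi> (i + 1) (d x) = d (\<pi> i x)"
proof -
  have "\<pi> (i + 1) (d x) - d (\<pi> i x) = 0"
  proof (rule lin_eq_0[OF lin_minus[OF lin_compose[OF lin_d lin_\<pi>] lin_compose[OF lin_\<pi> lin_d]] vs_s])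
    fix j x assume x: "x \<in> C j"
    show "\<pi> (i + 1) (d x) - d (\<pi> i x) = 0"
      using \<pi>_on[OF x] \<pi>_off[OF x, of i] \<pi>_on[OF d_C[OF x]] \<pi>_off[OF d_C[OF x], of "i + 1"]
      by (cases "i = j") (auto simp: additive.zero[OF additive_d])
  qed (simp add: d_q \<pi>_q)
  then show ?thesis by simp
qed

lemma q_d: "q (d x) = d x"
proof -
  have "q (d x) - d x = 0"
    by (rule lin_eq_0[OF lin_minus[OF lin_compose[OF lin_d lin_q] lin_d] vs_s])
      (simp_all add: d_q q_C[OF d_C])
  then show ?thesis by simp
qed

text \<open>A linear right inverse of \<open>d\<close> on its image is corrected until it has degree
  -1 and satisfies the side conditions of a contraction.\<close>

lemma homotopy_exists:
  obtains h where "lin (smul A) (smul A) h" "\<And>x. d (h (d x)) = d x" "\<And>x. h (d (h x)) = h x"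
    "\<And>x. h (h x) = 0" "\<And>x. h (q x) = h x" "\<And>x. q (h x) = h x" "\<And>i x. x \<in> C i \<Longrightarrow> h x \<in> C (i - 1)"
proof -
  interpret vector_space_pair "smul A" "smul A" ..
  obtain g where g: "Vector_Spaces.linear (smul A) (smul A) g" "\<And>x. d (g (d x)) = d x"
    using linear_exists_right_inverse_on[of d UNIV] lin_d linear_iff_lin[OF vs_s vs_s] by auto
  have lin_g: "lin (smul A) (smul A) g" using g(1) linear_iff_lin[OF vs_s vs_s] by blast
  \<comment> \<open>\<open>g\<close> ignores the grading. Its part of degree -1 still satisfies
    \<open>d h1 d = d\<close>, since the projections commute with \<open>d\<close> up to the shift
    of the index.\<close>
  define h1 where "h1 = dsum (\<lambda>i x. \<pi> (i - 1) (g x))"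
  have l1: "lin (smul A) (smul A) h1"
    unfolding h1_def by (rule lin_dsum[OF vs_s]) (simp add: linD[OF lin_g] linD[OF lin_\<pi>])
  have g0: "g 0 = 0" using lin_scale[OF vs_s vs_s lin_g, of 0 0] by simp
  have h1C: "h1 x = \<pi> (i - 1) (g x)" if "x \<in> C i" for x i
    unfolding h1_def by (rule dsum_C[OF that]) (simp add: g0 additive.zero[OF additive_\<pi>])
  have h1q: "h1 (q x) = h1 x" for x unfolding h1_def by (rule dsum_q)
  have qh1: "q (h1 x) = h1 x" for x unfolding h1_def by (rule q_dsum[where k = "-1"]) (simp add: \<pi>_C)
  have 1: "d (h1 (d x)) = d x" for x
  proof -
    have "d (h1 (d x)) - d x = 0"
    proof (rule lin_eq_0[OF lin_minus[OF lin_compose[OF lin_compose[OF lin_d l1] lin_d] lin_d] vs_s])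
      fix i x assume x: "x \<in> C i"
      have "d (h1 (d x)) = d (\<pi> i (g (d x)))" using h1C[OF d_C[OF x]] by simp
      also have "\<dots> = \<pi> (i + 1) (d x)" by (simp add: \<pi>_d[symmetric] g(2))
      finally show "d (h1 (d x)) - d x = 0" using \<pi>_on[OF d_C[OF x]] by simp
    qed (simp add: d_q)
    then show ?thesis by simp
  qed
  \<comment> \<open>From \<open>d h1 d = d\<close> the composite \<open>h1 d h1\<close> inherits
    this property and also satisfies \<open>h d h = h\<close>.\<close>
  define h2 where "h2 x = h1 (d (h1 x))" for x
  have l2: "lin (smul A) (smul A) h2"
    unfolding h2_def by (intro lin_compose[OF lin_compose[OF l1 lin_d] l1])
  note a2 = lin_additive[OF vs_s vs_s l2]
  have 2: "d (h2 (d x)) = d x" "h2 (d (h2 x)) = h2 x" for x by (simp_all add: h2_def 1)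
  have h2C: "h2 x \<in> C (i - 1)" if "x \<in> C i" for x i
  proof -
    have "h1 x \<in> C (i - 1)" by (simp add: h1C[OF that] \<pi>_C)
    then have "d (h1 x) \<in> C i" using d_C[of "h1 x" "i - 1"] by simp
    then show ?thesis by (simp add: h2_def h1C \<pi>_C)
  qed
  \<comment> \<open>Kills the part of \<open>h2\<close> on which it fails to square to zero.\<close>
  define h where "h x = h2 (x - h2 (d x))" for x
  have hd: "h (d x) = h2 (d x)" for x by (simp add: h_def d_d additive.zero[OF a2])
  have h2h: "h2 (x - h2 (d x)) - h2 (h2 (d (h2 (x - h2 (d x))))) = h x - h2 (h x)" for x
    by (simp add: h_def 2)
  show ?thesis
  proof
    show "lin (smul A) (smul A) h"
      unfolding h_def[abs_def]
      by (intro lin_compose[OF lin_minus[OF lin_id lin_compose[OF lin_d l2]] l2])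
    show "d (h (d x)) = d x" for x by (simp add: hd 2)
    show "h (d (h x)) = h x" for x by (simp only: hd) (simp add: h_def 2)
    show "h (h x) = 0" for x
    proof -
      have "h (h x) = h2 (h x) - h2 (h2 (d (h x)))" by (simp add: h_def[of "h x"] additive.diff[OF a2])
      also have "h2 (d (h x)) = h x" by (simp add: h_def 2)
      finally show ?thesis by simp
    qed
    show "h (q x) = h x" for x
      by (simp add: h_def additive.diff[OF a2] d_q) (simp add: h2_def h1q)
    show "q (h x) = h x" for x by (simp add: h_def h2_def qh1)
    show "h x \<in> C (i - 1)" if "x \<in> C i" for x i
      unfolding h_def using that h2C[of "d x" "i + 1"] d_C[OF that] by (intro h2C C_diff) auto
  qed
qed

lemma chain_complex_A: "chain_complex A"
  unfolding chain_complex_def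
proof (intro conjI allI ballI)
  fix i x assume x: "x \<in> C i"
  show "ops A [x] \<in> C (i + 1)" "ops A [ops A [x]] = 0"
    using d_C[OF x] by (simp_all add: d_ops[OF x] d_ops[OF d_C[OF x]] d_d)
  show "- x \<in> C i" using x by (rule C_neg)
  fix y assume y: "y \<in> C i"
  show "x + y \<in> C i" using x y by (rule C_add)
  show "ops A [x + y] = ops A [x] + ops A [y]"
    using d_ops[OF C_add[OF x y]] by (simp add: d_ops[OF x] d_ops[OF y] additive.add[OF additive_d])
qed (rule C_0)

lemma coboundary_d: "x \<in> coboundaries A i \<Longrightarrow> \<exists>y\<in>C (i - 1). x = d y"
  using d_ops by (auto simp: coboundaries_def)

text \<open>The image of \<open>p\<close> consists of cocycles, and \<open>p\<close> kills
  coboundaries. So \<open>p x\<close> is determined by its class, and the finiteness and the bounds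
  of the cohomology pass to the image of \<open>p\<close>.\<close>

theorem resolution_exists: "\<exists>h p S n u. ainf_resolution A e b h p q S n u"
proof -
  obtain h' where h': "lin (smul A) (smul A) h'" "\<And>x. d (h' (d x)) = d x" "\<And>x. h' (d (h' x)) = h' x"
    "\<And>x. h' (h' x) = 0" "\<And>x. h' (q x) = h' x" "\<And>x. q (h' x) = h' x"
    "\<And>i x. x \<in> C i \<Longrightarrow> h' x \<in> C (i - 1)"
    using homotopy_exists by blast
  note a' = lin_additive[OF vs_s vs_s h'(1)]
  \<comment> \<open>The sign brings \<open>d h' + h' d = q - p\<close> into the form of
    \<open>homotopy\<close>.\<close>
  define h where "h x = - h' x" for x
  define p where "p x = q x - (d (h' x) + h' (d x))" for x
  have lin_p: "lin (smul A) (smul A) p"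
    unfolding p_def[abs_def]
    by (intro lin_minus lin_q lin_plus lin_compose[OF h'(1) lin_d] lin_compose[OF lin_d h'(1)])
  note ap = lin_additive[OF vs_s vs_s lin_p]
  note z = additive.zero[OF additive_d] additive.zero[OF a'] additive.zero[OF additive_q]
  note al = additive.add[OF additive_d] additive.diff[OF additive_d] additive.minus[OF additive_d]
    additive.add[OF a'] additive.diff[OF a'] additive.minus[OF a']
    additive.add[OF additive_q] additive.diff[OF additive_q] additive.minus[OF additive_q]
  note R = d_d d_q q_d q_q h'(2-6)
  have p_d: "p (d x) = 0" and d_p: "d (p x) = 0" and h_p: "h' (p x) = 0" and p_h: "p (h' x) = 0"
    and p_q: "p (q x) = p x" and q_p: "q (p x) = p x" for x
    by (simp_all add: p_def al R z)
  have p_p: "p (p x) = p x" for x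
  proof -
    have "p (p x) = q (p x) - (d (h' (p x)) + h' (d (p x)))" by (simp only: p_def[of "p x"])
    then show ?thesis by (simp add: q_p h_p d_p z)
  qed
  have p_C: "p x \<in> C i" if "x \<in> C i" for x i
    unfolding p_def q_C[OF that]
    using that d_C[OF h'(7)[OF that]] h'(7)[OF d_C[OF that]] by (intro C_diff C_add) auto
  have h_C: "h x \<in> C (i - 1)" if "x \<in> C i" for x i
    unfolding h_def by (rule C_neg[OF h'(7)[OF that]])
  have lin_h: "lin (smul A) (smul A) h" unfolding h_def[abs_def] by (rule lin_neg[OF h'(1)])
  have h_e: "e (h x) = - h (e x)" for x
  proof -
    have "e (h x) + h (e x) = 0"
    proof (rule lin_eq_0[OF lin_plus[OF lin_compose[OF lin_h lin_e] lin_compose[OF lin_e lin_h]] vs_s])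
      show "e (h (q x)) + h (e (q x)) = e (h x) + h (e x)" for x
        by (simp add: h_def h' e_q)
      show "e (h x) + h (e x) = 0" if "x \<in> C i" for i x
        using e_C[OF that] e_C[OF h_C[OF that]] additive.minus[OF lin_additive[OF vs_s vs_s lin_h]]
        by (auto simp: signed_def)
    qed
    then show ?thesis by (simp add: eq_neg_iff_add_eq_0)
  qed
  have d_e: "e (d x) = - d (e x)" for x using odd_b[of "[x]"] by (simp add: d_def)
  have p_e: "e (p x) = p (e x)" for x
  proof -
    have he: "e (h' x) = - h' (e x)" for x
    proof -
      have "- e (h' x) = h' (e x)" using h_e[of x] by (simp add: h_def)
      then show ?thesis by (metis minus_minus)
    qed
    show ?thesis
      by (simp add: p_def additive.diff[OF E.additive_e] additive.add[OF E.additive_e] e_q he d_e al)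
  qed
  have coh: "p x = p y" if "coh_class A i x = coh_class A i y" for x y i
  proof -
    have "x - y \<in> coboundaries A i" using that by (simp add: coh_class_eq_iff[OF chain_complex_A])
    then obtain w where "x - y = d w" using coboundary_d by blast
    then have "p (x - y) = 0" by (simp add: p_d)
    then show ?thesis by (simp add: additive.diff[OF ap])
  qed
  have cocycle: "p x \<in> cocycles A i" if "x \<in> C i" for x i
    using p_C[OF that] by (simp add: cocycles_def d_ops[OF p_C[OF that]] d_p)
  have cohp: "coh_class A i (p x) \<in> cohomology A i" if "x \<in> C i" for x i
    using cocycle[OF that] by (simp add: cohomology_def)
  define I where "I = {i. cohomology A i \<noteq> {coh_class A i 0}}"
  have finI: "finite I" using proper by (simp add: proper_def I_def)
  have I_le: "i \<le> 0" if "i \<in> I" for i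
    using connective that by (auto simp: connective_def I_def not_le[symmetric])
  \<comment> \<open>If the cohomology in degree \<open>i\<close> vanishes, the cocycle
    \<open>p x\<close> has the class of 0, and \<open>coh\<close> gives
    \<open>p x = p (p x) = 0\<close>.\<close>
  have p_I: "i \<in> I" if "x \<in> C i" "p x \<noteq> 0" for x i
  proof (rule ccontr)
    assume "i \<notin> I"
    then have "coh_class A i (p x) = coh_class A i 0" using cohp[OF that(1)] by (simp add: I_def)
    from coh[OF this] show False using that(2) by (simp add: p_p additive.zero[OF ap])
  qed
  have "\<forall>i. \<exists>S. finite S \<and> S \<subseteq> cocycles A i \<and> cohomology A i = coh_class A i ` span S"
    using proper by (simp add: proper_def)
  then obtain T where T: "\<And>i. finite (T i)" "\<And>i. T i \<subseteq> cocycles A i"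
    "\<And>i. cohomology A i = coh_class A i ` span (T i)" by metis
  \<comment> \<open>The cocycles \<open>T i\<close> span the cohomology only up to coboundaries,
    which \<open>p\<close> removes.\<close>
  define S where "S = (\<Union>i\<in>I. p ` T i)"
  have S: "finite S" "S \<subseteq> (\<Union>i. C i)"
    using finI T(1) T(2) p_C by (auto simp: S_def cocycles_def) blast
  have pS: "p x \<in> span S" if x: "x \<in> C i" for x i
  proof (cases "p x = 0")
    case True then show ?thesis by (simp add: span_zero)
  next
    case False
    then have i: "i \<in> I" using p_I x by blast
    obtain w where w: "w \<in> span (T i)" "coh_class A i (p x) = coh_class A i w"
      using cohp[OF x] T(3) by auto
    have "p w \<in> span S"
      using w(1)
    proof (induction rule: span_induct_alt)
      case base then show ?case by (simp add: additive.zero[OF ap] span_zero)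
    next
      case (step c y z)
      have "p y \<in> span S" using step(1) i by (intro span_base) (auto simp: S_def)
      then show ?case using step(2) linD[OF lin_p, of z c y] by (simp add: add.commute span_add span_scale)
    qed
    then show ?thesis using coh[OF w(2)] by (simp add: p_p)
  qed
  have p_S: "range p \<subseteq> span S"
  proof clarify
    fix x
    have "p x = p (q x)" by (simp add: p_q)
    also have "\<dots> = (\<Sum>i | \<pi> i x \<noteq> 0. p (\<pi> i x))"
      by (simp add: q_def dsum_def additive.sum[OF ap])
    also have "\<dots> \<in> span S" by (intro span_sum pS[OF \<pi>_C])
    finally show "p x \<in> span S" .
  qed
  \<comment> \<open>A bound for the absolute values of the finitely many degrees with nonzero
    cohomology.\<close>
  define n where "n = (\<Sum>i\<in>I. \<bar>i\<bar>)"
  have n: "n \<ge> 0" by (simp add: n_def sum_nonneg)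
  have bounds: "- n \<le> i \<and> i \<le> 0" if "x \<in> C i" "p x \<noteq> 0" for x i
  proof -
    have "i \<in> I" by (rule p_I[OF that])
    moreover from this have "\<bar>i\<bar> \<le> n" unfolding n_def by (intro member_le_sum finI) auto
    ultimately show ?thesis using I_le by auto
  qed
  obtain e0 where e0: "e0 \<in> cocycles A 0" "\<And>i x. x \<in> cocycles A i \<Longrightarrow>
      coh_class A i (ops A [e0, x]) = coh_class A i x \<and> coh_class A i (ops A [x, e0]) = coh_class A i x"
    using unital unfolding homologically_unital_def by blast
  have e0C: "e0 \<in> C 0" "d e0 = 0" using e0(1) d_ops by (auto simp: cocycles_def)
  \<comment> \<open>The homological unit \<open>e0\<close> need not lie in the image of
    \<open>p\<close>; \<open>u\<close> differs from it by a coboundary, which \<open>left\<close>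
    and \<open>right\<close> discard.\<close>
  define u where "u = p e0"
  have uC: "u \<in> C 0" unfolding u_def by (rule p_C[OF e0C(1)])
  have u_eq: "u = e0 - d (h' e0)" by (simp add: u_def p_def q_C[OF e0C(1)] e0C(2) z)
  have two: "coder b e b [x, y] = b [d x, y] + d (b [x, y]) + b [e x, d y]" for x y
    by (simp add: d_def)
  have b2: "b [x - y, w] = b [x, w] - b [y, w]" "b [w, x - y] = b [w, x] - b [w, y]"
    "b [0, w] = 0" "b [w, 0] = 0" for x y w
    using additive.diff[OF multilin_additive[OF vs_s vs_s multilin_b, of "[]" "[w]"]]
      additive.diff[OF multilin_additive[OF vs_s vs_s multilin_b, of "[w]" "[]"]]
      multilin_0[OF vs_s vs_s multilin_b, of "[]" "[w]"] multilin_0[OF vs_s vs_s multilin_b, of "[w]" "[]"]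
    by simp_all
  \<comment> \<open>The A_infinity relation in arity two makes the product of a coboundary and a
    cocycle a coboundary.\<close>
  have left: "p (b [d c, y]) = 0" and right: "p (b [y, d c]) = 0" if "d y = 0" for c y
  proof -
    have "b [d c, y] = d (- b [c, y])"
      using two[of c y] coder_b[of "[c, y]"] that by (simp add: b2 al eq_neg_iff_add_eq_0)
    then show "p (b [d c, y]) = 0" by (simp add: p_d)
    have "d (e y) = 0" using d_e[of y] that E.e_zero by simp
    then have "b [y, d c] = d (- b [e y, c])"
      using two[of "e y" c] coder_b[of "[e y, c]"] by (simp add: b2 al e_e eq_neg_iff_add_eq_0 add.commute)
    then show "p (b [y, d c]) = 0" by (simp add: p_d)
  qed
  have lin_l: "lin (smul A) (smul A) (\<lambda>x. b [u, x])" and lin_r: "lin (smul A) (smul A) (\<lambda>x. b [x, u])"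
    using multilin_lin[OF multilin_b, of "[u]" "[]"] multilin_lin[OF multilin_b, of "[]" "[u]"] by simp_all
  have u_left: "p (b [u, p x]) = p x" for x
  proof -
    have "p (b [u, p x]) - p x = 0"
    proof (rule lin_eq_0[OF lin_minus[OF lin_compose[OF lin_compose[OF lin_p lin_l] lin_p] lin_p] vs_s])
      fix i x assume x: "x \<in> C i"
      have "b [e0, p x] = ops A [e0, p x]"
        using b_hom[of "[e0, p x]" "[0, i]"] e0C p_C[OF x] by (simp add: homogeneous_def)
      then have "p (b [e0, p x]) = p (p x)" using e0(2)[OF cocycle[OF x]] coh by metis
      then show "p (b [u, p x]) - p x = 0"
        unfolding u_eq b2 additive.diff[OF ap] using left[OF d_p] by (simp add: p_p)
    qed (simp add: p_q)
    then show ?thesis by simp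
  qed
  have u_right: "p (b [p x, u]) = - e (p x)" for x
  proof -
    have "p (b [p x, u]) + e (p x) = 0"
    proof (rule lin_eq_0[OF lin_plus[OF lin_compose[OF lin_compose[OF lin_p lin_r] lin_p] lin_compose[OF lin_p lin_e]] vs_s])
      fix i x assume x: "x \<in> C i"
      have "b [p x, e0] = signed i (ops A [p x, e0])"
        using b_hom[of "[p x, e0]" "[i, 0]"] e0C p_C[OF x] by (simp add: homogeneous_def)
      then have "p (b [p x, e0]) = signed i (p (p x))"
        using e0(2)[OF cocycle[OF x]] coh additive_signed[OF ap] by metis
      then show "p (b [p x, u]) + e (p x) = 0"
        unfolding u_eq b2 additive.diff[OF ap] using right[OF d_p] e_C[OF p_C[OF x]]
        by (auto simp: p_p signed_def)
    qed (simp add: p_q)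
    then show ?thesis by (simp add: eq_neg_iff_add_eq_0)
  qed
  have gv: "graded_vector_space A" using ainf by (simp add: is_ainf_algebra_def)
  have "ainf_resolution A e b h p q S n u"
  proof (unfold_locales, goal_cases)
    case 1 show ?case by (rule multilin_b)
  next case 2 show ?case by (simp add: b_def)
  next case 3 show ?case by (rule odd_b)
  next case 4 show ?case by (rule coder_b)
  next case 5 show ?case by (rule b_q)
  next case 6 show ?case by (rule lin_h)
  next case 7 show ?case by (rule lin_p)
  next case 8 show ?case by (rule lin_q)
  next case 9 show ?case by (rule h_e)
  next case 10 show ?case by (rule p_e)
  next case 11 show ?case by (simp add: e_q)
  next case (12 x) show ?case unfolding d_def[symmetric] by (simp add: h_def p_def al)
  next case 13 show ?case unfolding d_def[symmetric] by (rule p_d)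
  next case 14 show ?case unfolding d_def[symmetric] by (rule d_p)
  next case 15 show ?case by (simp add: h_def al h'(4))
  next case 16 show ?case by (simp add: h_def h_p)
  next case 17 show ?case by (simp add: h_def additive.minus[OF ap] p_h)
  next case 18 show ?case by (rule p_p)
  next case 19 show ?case by (simp add: h_def h')
  next case 20 show ?case by (rule p_q)
  next case 21 show ?case by (rule subspace_C)
  next case (22 I f i) then show ?case using graded_vector_spaceD(4)[OF gv] by blast
  next case 23 then show ?case by (rule e_C)
  next case 24 then show ?case by (rule p_C)
  next case 25 then show ?case by (rule h_C)
  next case 26 then show ?case by (rule q_C)
  next case 27 show ?case by (rule q_q)
  next case 28 show ?case by (rule b_C)
  next case 29 show ?case by (rule S(1))
  next case 30 show ?case by (rule S(2))
  next case 31 show ?case by (rule p_S)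
  next case 32 then show ?case by (rule bounds)
  next case 33 show ?case by (rule n)
  next case 34 show ?case by (rule uC)
  next case 35 show ?case by (simp add: u_def p_p)
  next case 36 show ?case by (rule u_left)
  next case 37 show ?case by (rule u_right)
  qed
  then show ?thesis by blast
qed

end

subsection \<open>The triangular DG-algebra of a twisting cochain\<close>

context minimal_algebra
begin

lemma econj_end_diff:
  assumes "end_fun \<psi>" shows "econj (end_diff \<psi>) = - end_diff (econj \<psi>)"
proof
  fix xs
  note E = end_funD[OF end_fun_econj[OF assms]]
  have "econj (end_diff \<psi>) xs = econj (mod_comp b \<psi>) xs - econj (coder b e (econj \<psi>)) xs"
    by (simp add: econj_def end_diff_def additive.diff[OF additive_e])
  then show "econj (end_diff \<psi>) xs = (- end_diff (econj \<psi>)) xs"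
    by (simp add: econj_comp econj_b comp_minus_left econj_coder[OF E(1)] end_diff_def)
qed

lemma lin_econj: "lin scale_fun scale_fun econj"
  by (simp add: lin_def econj_def fun_eq_iff linD[OF lin_e])

lemma lin_end_diff: "lin scale_fun scale_fun end_diff"
proof (rule linI[OF additive_end_diff])
  show "end_diff (\<lambda>xs. s c (\<psi> xs)) = (\<lambda>xs. s c (end_diff \<psi> xs))" for c \<psi>
  proof
    fix xs
    have "b (s c x # xs) = s c (b (x # xs))" for x xs
      using lin_scale[OF vs_s vs_s multilin_lin_hd[OF multilin_b]] .
    then show "end_diff (\<lambda>xs. s c (\<psi> xs)) xs = s c (end_diff \<psi> xs)"
      by (simp add: end_diff_def econj_def[abs_def] comp_eq lin_scale[OF vs_s vs_s lin_e]
          coder_scale[OF vs_s vs_s] split_sum_scale[OF vs_s vs_s] scale_right_diff_distrib)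
  qed
qed

lemma lin_comp_left: "lin scale_fun scale_fun (\<lambda>\<psi>. mod_comp \<psi> \<chi>)"
  by (rule linI[OF additive_comp_left]) (simp add: fun_eq_iff comp_eq split_sum_scale[OF vs_s vs_s])

lemma lin_comp_right: "multilin s s \<psi> \<Longrightarrow> lin scale_fun scale_fun (mod_comp \<psi>)"
  by (rule linI[OF additive_comp_right])
    (simp_all add: fun_eq_iff comp_eq split_sum_scale[OF vs_s vs_s] lin_scale[OF vs_s vs_s multilin_lin_hd])

lemma comp_assoc_end:
  assumes "end_fun \<psi>" "end_fun \<chi>"
  shows "mod_comp (mod_comp \<psi> \<chi>) \<omega> = mod_comp \<psi> (mod_comp \<chi> \<omega>)"
  by (rule comp_assoc[of \<psi> \<chi>, OF multilin_additive_hd[OF vs_s vs_s end_funD(1)[OF assms(1)]] end_funD(2)[OF assms(2)]])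

end

locale dg_resolution = proper_connective_ainf "ainf_of_dg G" \<pi>
  + R: ainf_resolution "ainf_of_dg G" e b h p q S n u
  for G :: "('k::field, 'a::ab_group_add) dg_algebra" and \<pi> h p S n u +
  assumes dg: "is_dg_algebra G"
begin

lemma G_simps: "smul (ainf_of_dg G) = smul G" "component (ainf_of_dg G) = component G"
  by (simp_all add: ainf_of_dg_def)

abbreviation sG :: "'k \<Rightarrow> 'a \<Rightarrow> 'a" where "sG \<equiv> smul (ainf_of_dg G)"
abbreviation one :: 'a where "one \<equiv> dg_one G"
abbreviation tau :: "'a list \<Rightarrow> 'a list \<Rightarrow> 'a" where "tau \<equiv> R.twist"
abbreviation ed where "ed \<equiv> R.H.end_diff"
abbreviation ec where "ec \<equiv> R.H.econj"
abbreviation fin where "fin \<equiv> R.H.fin_comp"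
abbreviation efun where "efun \<equiv> R.H.end_fun"
abbreviation sf where "sf \<equiv> \<lambda>c (\<psi> :: 'a list \<Rightarrow> 'a) xs. sG c (\<psi> xs)"
abbreviation DD :: "('a list \<Rightarrow> 'c::ab_group_add) \<Rightarrow> 'a list \<Rightarrow> 'c" where "DD \<equiv> coder b e"

lemmas dgD = is_dg_algebraD[OF dg, folded G_simps]
lemmas vsf = R.H.vs_fun
lemmas vsG = vs_s
lemmas CC = C_0 C_add C_neg
  C_signed
lemmas ml_b = multilin_b
lemmas eC = e_C

lemma b_one: "x \<in> C i \<Longrightarrow> b [x] = dg_diff G x"
  using b_hom[of "[x]" "[i]"] by (simp add: homogeneous_def ainf_of_dg_def)

lemma b_two: "x \<in> C i \<Longrightarrow> y \<in> C j \<Longrightarrow> b [x, y] = signed i (dg_mult G x y)"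
  using b_hom[of "[x, y]" "[i, j]"] by (simp add: homogeneous_def ainf_of_dg_def)

lemma b_long: "length xs \<ge> 3 \<Longrightarrow> b xs = 0"
proof -
  have "(\<lambda>xs. if length xs \<ge> 3 then b xs else 0) xs = 0"
  proof (rule multilin_eq_0[OF _ vs_s])
    show "multilin sG sG (\<lambda>xs. if length xs \<ge> 3 then b xs else 0)"
      using multilinD[OF multilin_b] scale_zero_right by (simp add: multilin_def)
    show "(if 3 \<le> length (us @ q x # vs) then b (us @ q x # vs) else 0)
       = (if 3 \<le> length (us @ x # vs) then b (us @ x # vs) else 0)" for us x vs
      by (simp add: b_q)
    fix ds xs assume h: "list_all2 (\<lambda>d x. x \<in> C d) ds xs"
    show "(if 3 \<le> length xs then b xs else 0) = 0"
    proof (cases "3 \<le> length xs")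
      case True
      then obtain x y z xs' where "xs = x # y # z # xs'"
        by (metis One_nat_def Suc_le_length_iff numeral_3_eq_3)
      then show ?thesis using b_hom[of xs ds] h by (simp add: homogeneous_def ainf_of_dg_def)
    qed simp
  qed
  then show "length xs \<ge> 3 \<Longrightarrow> b xs = 0" by simp
qed

text \<open>The product of \<open>G\<close> extended bilinearly to the whole ambient type by way of
  \<open>b\<close>; the involution and the minus cancel the sign in \<open>b_two\<close>.\<close>

definition mu :: "'a \<Rightarrow> 'a \<Rightarrow> 'a" where "mu x y = - b [e x, y]"

lemma b_minus: "b [- x, y] = - b [x, y]" "b [x, - y] = - b [x, y]" "b [- x] = - b [x]"
  using multilin_minus_mem_map[OF vsG vsG ml_b, of "[]" x "[y]"]
    multilin_minus_mem_map[OF vsG vsG ml_b, of "[x]" y "[]"]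
    multilin_minus_mem_map[OF vsG vsG ml_b, of "[]" x "[]"] by auto

lemma lin_mu_left: "lin sG sG (\<lambda>x. mu x y)"
proof -
  have "lin sG sG (\<lambda>x. b (x # [y]))" by (rule multilin_lin_hd[OF ml_b])
  then show ?thesis
    using linD[OF lin_e]
    by (simp add: lin_def mu_def scale_minus_right)
qed

lemma lin_mu_right: "lin sG sG (mu x)"
proof -
  have "lin sG sG (\<lambda>y. b ([e x] @ y # []))" by (rule multilin_lin[OF ml_b])
  then show ?thesis
    by (simp add: lin_def mu_def scale_minus_right)
qed

lemmas ad_mu_left = lin_additive[OF vsG vsG lin_mu_left]
lemmas ad_mu_right = lin_additive[OF vsG vsG lin_mu_right]

lemma mu_eq: "x \<in> C i \<Longrightarrow> y \<in> C j \<Longrightarrow> mu x y = dg_mult G x y"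
  using b_two[of x i y j] eC[of x i] by (auto simp: mu_def signed_def b_minus)

lemma mu_C: "x \<in> C i \<Longrightarrow> y \<in> C j \<Longrightarrow> mu x y \<in> C (i + j)"
  using mu_eq dgD(6) by simp

lemma mu_q: "mu x (q y) = mu x y"
  using b_q[of "[e x]" y "[]"] by (simp add: mu_def)

lemma e_one: "e one = - one"
  using eC[OF dgD(13)] by (simp add: signed_def)

lemma mu_one: "mu one y = q y"
proof -
  have "mu one y - q y = 0"
  proof (rule lin_eq_0[OF lin_minus[of "mu one" q] vs_s])
    show "lin sG sG (mu one)" by (rule lin_mu_right)
    show "lin sG sG q" by (rule lin_q)
    show "mu one (q y) - q (q y) = mu one y - q y" for y by (simp add: mu_q q_q)
    show "mu one y - q y = 0" if "y \<in> C i" for i y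
      using that mu_eq[OF dgD(13)] dgD(14) q_C[OF that] by simp
  qed
  then show ?thesis by simp
qed

lemma b_one_left: "b [one, y] = q y"
  using mu_one[of y] by (simp add: mu_def e_one b_minus)

lemma d_one: "b [one] = 0"
proof -
  note o = dgD(13)
  have "dg_diff G one = dg_diff G (dg_mult G one one)" using dgD(14)[OF o] by simp
  also have "\<dots> = dg_mult G (dg_diff G one) one + signed 0 (dg_mult G one (dg_diff G one))"
    by (rule dgD(11)[OF o o])
  also have "\<dots> = dg_diff G one + dg_diff G one"
    using dgD(14)[OF dgD(2)[OF o]] dgD(15)[OF dgD(2)[OF o]] by simp
  finally show ?thesis using b_one[OF o] by simp
qed

lemma two: "b [b [x], y] + b [b [x, y]] + b [e x, b [y]] = 0"
  using coder_b[of "[x, y]"] by (simp add: add.assoc)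

lemma d_mu: "b [mu x y] = mu (b [x]) y + mu (- e x) (b [y])"
proof -
  have "b [b [e x, y]] = - b [b [e x], y] - b [x, b [y]]"
    using two[of "e x" y] by (simp add: e_e eq_neg_iff_add_eq_0 eq_diff_eq algebra_simps)
  moreover have "b [e (b [x]), y] = - b [b [e x], y]" using odd_b[of "[x]"] by (simp add: b_minus)
  ultimately show ?thesis by (simp add: mu_def b_minus e_e)
qed

lemma b_two_two: "b [b [x, y], z] + b [e x, b [y, z]] = 0"
  using coder_b[of "[x, y, z]"] b_long multilin_0_hd[OF vsG vsG ml_b, of "[]"]
  by simp

text \<open>Read off from the A_infinity relation in arity three and not from the DG axioms, so it
  holds on the whole ambient type.\<close>

lemma mu_assoc: "mu x (mu y z) = mu (mu x y) z"
  using b_two_two[of x "e y" z] odd_b[of "[e x, y]"]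
  by (simp add: mu_def b_minus e_e additive.minus[OF E.additive_e] add_eq_0_iff)

lemma e_mu: "e (mu x y) = mu (- e x) (e y)"
  using odd_b[of "[e x, y]"] by (simp add: mu_def b_minus e_e additive.minus[OF E.additive_e])

text \<open>
  The bimodule \<open>bim\<close> of functions from the bar construction to endomorphisms; \<open>xdiff\<close> is its
  differential, twisted by \<open>tau\<close> on the right.
\<close>

definition bim :: "('a list \<Rightarrow> 'a list \<Rightarrow> 'a) set" where
  "bim = {\<xi>. multilin sG sf \<xi> \<and> \<xi> [] = 0 \<and> (\<forall>us x vs. \<xi> (us @ q x # vs) = \<xi> (us @ x # vs))
     \<and> (\<forall>xs. efun (\<xi> xs))}"

definition xconj :: "('a list \<Rightarrow> 'a list \<Rightarrow> 'a) \<Rightarrow> 'a list \<Rightarrow> 'a list \<Rightarrow> 'a" where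
  "xconj \<xi> xs = ec (\<xi> (map e xs))"

definition cup :: "('a list \<Rightarrow> 'a list \<Rightarrow> 'a) \<Rightarrow> 'a list \<Rightarrow> 'a list \<Rightarrow> 'a" where
  "cup \<xi> = split_sum (\<lambda>us vs. mod_comp (ec (\<xi> us)) (tau vs))"

definition xdiff :: "('a list \<Rightarrow> 'a list \<Rightarrow> 'a) \<Rightarrow> 'a list \<Rightarrow> 'a list \<Rightarrow> 'a" where
  "xdiff \<xi> xs = ed (\<xi> xs) - DD (xconj \<xi>) xs - cup \<xi> xs"

definition lact :: "('a list \<Rightarrow> 'a) \<Rightarrow> ('a list \<Rightarrow> 'a list \<Rightarrow> 'a) \<Rightarrow> 'a list \<Rightarrow> 'a list \<Rightarrow> 'a" where
  "lact \<beta> \<xi> xs = mod_comp \<beta> (\<xi> xs)"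

text \<open>The first letter plays the part of the free factor in the bar resolution, and
  multiplication into it gives the right action.\<close>

definition ract :: "('a list \<Rightarrow> 'a list \<Rightarrow> 'a) \<Rightarrow> 'a \<Rightarrow> 'a list \<Rightarrow> 'a list \<Rightarrow> 'a" where
  "ract \<xi> a xs = (case xs of [] \<Rightarrow> 0 | y # ys \<Rightarrow> \<xi> (mu a y # ys))"

lemma bimD:
  assumes "\<xi> \<in> bim"
  shows "multilin sG sf \<xi>" "\<xi> [] = 0" "\<xi> (us @ q x # vs) = \<xi> (us @ x # vs)" "efun (\<xi> xs)"
    "\<xi> (0 # xs) = 0" "\<xi> (q x # vs) = \<xi> (x # vs)" "multilin sG sG (\<xi> xs)"
proof -
  show m: "multilin sG sf \<xi>" "\<xi> [] = 0" "efun (\<xi> xs)" using assms by (auto simp: bim_def)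
  show n: "\<xi> (us @ q x # vs) = \<xi> (us @ x # vs)" for us x vs using assms by (simp add: bim_def)
  show "\<xi> (0 # xs) = 0" by (rule multilin_0_hd[OF vsG vsf m(1)])
  show "\<xi> (q x # vs) = \<xi> (x # vs)" using n[of "[]"] by simp
  show "multilin sG sG (\<xi> xs)" using R.H.end_funD(1)[OF m(3)] by simp
qed

lemmas ad_ed = R.H.additive_end_diff
lemmas ad_ec = R.H.additive_econj
lemmas ad_cl = R.H.additive_comp_left

lemma ad_cr: "efun \<psi> \<Longrightarrow> additive (mod_comp \<psi>)"
  by (rule R.H.additive_comp_right[OF R.H.end_funD(1)])

lemma efun_0: "efun 0" using R.H.end_fun_zero by (simp add: zero_fun_def)

lemma efun_add: "efun \<psi> \<Longrightarrow> efun \<chi> \<Longrightarrow> efun (\<psi> + \<chi>)"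
  using R.H.end_fun_add by (simp add: plus_fun_def)

lemma efun_diff: "efun \<psi> \<Longrightarrow> efun \<chi> \<Longrightarrow> efun (\<psi> - \<chi>)"
  using R.H.end_fun_diff by (simp add: fun_diff_def)

lemma efun_minus: "efun \<psi> \<Longrightarrow> efun (- \<psi>)"
  using efun_diff[OF efun_0, of \<psi>] by simp

lemma efun_split_sum: "(\<And>us vs. efun (K us vs)) \<Longrightarrow> efun (split_sum K xs)"
  using split_sum_in[of xs K "Collect efun"] efun_add by simp

lemma efun_coder: "(\<And>zs. efun (\<xi> zs)) \<Longrightarrow> efun (DD \<xi> xs)"
  by (induction xs arbitrary: \<xi>) (auto simp: efun_0 intro!: efun_add efun_split_sum)

lemma bim_add: "\<xi> \<in> bim \<Longrightarrow> \<eta> \<in> bim \<Longrightarrow> (\<lambda>xs. \<xi> xs + \<eta> xs) \<in> bim"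
  by (auto simp: bim_def efun_add intro: multilin_plus[OF vsG vsf])

lemma bim_diff: "\<xi> \<in> bim \<Longrightarrow> \<eta> \<in> bim \<Longrightarrow> (\<lambda>xs. \<xi> xs - \<eta> xs) \<in> bim"
  by (auto simp: bim_def efun_diff intro: multilin_diff[OF vsG vsf])

lemma bim_minus: "\<xi> \<in> bim \<Longrightarrow> (\<lambda>xs. - \<xi> xs) \<in> bim"
  by (auto simp: bim_def efun_minus intro: multilin_uminus[OF vsG vsf])

lemma bim_zero: "(\<lambda>xs. 0) \<in> bim"
  by (auto simp: bim_def efun_0 intro: multilin_zero[OF vsG vsf])

lemma lin_sf: "lin sf sf (sf c)"
  using scale_right_distrib
  by (simp add: lin_def fun_eq_iff scale_scale mult.commute)

lemma bim_scale: "\<xi> \<in> bim \<Longrightarrow> (\<lambda>xs. sf c (\<xi> xs)) \<in> bim"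
  using R.H.end_fun_scale multilin_comp[OF _ lin_sf] scale_zero_right
  by (auto simp: bim_def zero_fun_def)

lemma bim_tau: "tau \<in> bim"
  using R.multilin_twist R.twist_Nil R.normalD[OF R.normal_twist] R.end_fun_twist
  by (simp add: bim_def zero_fun_def)

lemma bim_xconj:
  assumes "\<xi> \<in> bim" shows "xconj \<xi> \<in> bim"
proof -
  note x = bimD[OF assms]
  have "multilin sG sf (xconj \<xi>)"
    unfolding xconj_def[abs_def]
    by (intro multilin_comp[OF multilin_map[OF x(1) lin_e]])
      (use R.H.lin_econj in simp)
  then show ?thesis
    by (simp add: bim_def xconj_def x(2,3,4) e_q R.H.end_fun_econj additive.zero[OF ad_ec])
qed

lemma multilin_cup_terms:
  assumes "\<xi> \<in> bim"
  shows "multilin sG sf (\<lambda>us. mod_comp (ec (\<xi> us)) \<chi>)"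
    "efun \<psi> \<Longrightarrow> multilin sG sf (\<lambda>us. mod_comp \<psi> (\<xi> us))"
proof -
  note x = bimD[OF assms]
  have "multilin sG sf (\<lambda>us. ec (\<xi> us))"
    by (rule multilin_comp[OF x(1)]) (use R.H.lin_econj in simp)
  then show "multilin sG sf (\<lambda>us. mod_comp (ec (\<xi> us)) \<chi>)"
    by (rule multilin_comp) (use R.H.lin_comp_left in simp)
  show "efun \<psi> \<Longrightarrow> multilin sG sf (\<lambda>us. mod_comp \<psi> (\<xi> us))"
    by (rule multilin_comp[OF x(1)]) (use R.H.lin_comp_right[OF R.H.end_funD(1)] in simp)
qed

lemma bim_cup:
  assumes "\<xi> \<in> bim" shows "cup \<xi> \<in> bim"
proof -
  note x = bimD[OF assms] and t = bimD[OF bim_tau]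
  have ef: "efun (ec (\<xi> us))" for us by (rule R.H.end_fun_econj[OF x(4)])
  have "multilin sG sf (cup \<xi>)"
    unfolding cup_def
    by (intro multilin_split_sum[OF vsG vsf] multilin_cup_terms assms bim_tau ef)
  moreover have "cup \<xi> (us @ q y # vs) = cup \<xi> (us @ y # vs)" for us y vs
    unfolding cup_def by (rule split_sum_replace) (simp_all add: x(3) t(3))
  moreover have "efun (cup \<xi> xs)" for xs
    unfolding cup_def by (intro efun_split_sum R.H.end_fun_comp ef t(4))
  ultimately show ?thesis
    by (simp add: bim_def) (simp add: cup_def x(2) additive.zero[OF ad_ec] additive.zero[OF ad_cl])
qed

lemma bim_coder:
  assumes "\<xi> \<in> bim" shows "DD \<xi> \<in> bim"
proof -
  note x = bimD[OF assms]
  have "DD \<xi> (us @ q y # vs) = DD \<xi> (us @ y # vs)" for us y vs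
    by (rule coder_replace) (simp_all add: b_q e_q x(3))
  then show ?thesis
    by (simp add: bim_def efun_coder x multilin_coder[OF vsG vsf x(1) ml_b lin_e])
qed

lemma bim_ed:
  assumes "\<xi> \<in> bim" shows "(\<lambda>xs. ed (\<xi> xs)) \<in> bim"
proof -
  note x = bimD[OF assms]
  have "multilin sG sf (\<lambda>xs. ed (\<xi> xs))"
    by (rule multilin_comp[OF x(1)]) (use R.H.lin_end_diff in simp)
  then show ?thesis
    by (simp add: bim_def x R.H.end_fun_end_diff additive.zero[OF ad_ed])
qed

lemma bim_xdiff: "\<xi> \<in> bim \<Longrightarrow> xdiff \<xi> \<in> bim"
  unfolding xdiff_def[abs_def] by (intro bim_diff bim_ed bim_coder bim_xconj bim_cup)

lemma bim_lact:
  assumes "efun \<beta>" "\<xi> \<in> bim" shows "lact \<beta> \<xi> \<in> bim"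
  using multilin_cup_terms(2)[OF assms(2,1)] bimD[OF assms(2)]
  by (simp add: bim_def lact_def[abs_def] R.H.end_fun_comp assms(1) additive.zero[OF ad_cr[OF assms(1)]])

lemma bim_ract:
  assumes "\<xi> \<in> bim" shows "ract \<xi> a \<in> bim"
proof -
  note x = bimD[OF assms]
  have "multilin sG sf (ract \<xi> a)"
  proof (rule multilinI)
    fix us vs y z c
    show "ract \<xi> a (us @ (y + sG c z) # vs) = ract \<xi> a (us @ y # vs) + sf c (ract \<xi> a (us @ z # vs))"
      using multilinD[OF x(1), of "[]"] multilinD[OF x(1), of "_ # _"] linD[OF lin_mu_right]
      by (cases us) (simp_all add: ract_def)
  qed
  moreover have "ract \<xi> a (us @ q y # vs) = ract \<xi> a (us @ y # vs)" for us y vs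
    using x(3)[of "_ # _"] by (cases us) (simp_all add: ract_def mu_q)
  moreover have "efun (ract \<xi> a xs)" for xs
    by (cases xs) (simp_all add: ract_def efun_0 x(4))
  ultimately show ?thesis by (simp add: bim_def) (simp add: ract_def)
qed

lemma xconj_xconj [simp]: "xconj (xconj \<xi>) = \<xi>"
  by (simp add: xconj_def fun_eq_iff)

lemma xconj_tau: "xconj tau xs = - tau xs"
  unfolding xconj_def R.econj_twist by (simp add: fun_Compl_def)

lemma xconj_ed: "\<xi> \<in> bim \<Longrightarrow> xconj (\<lambda>xs. ed (\<xi> xs)) xs = - ed (xconj \<xi> xs)"
  unfolding xconj_def by (rule R.H.econj_end_diff[OF bimD(4)])

lemma xconj_coder:
  assumes "\<xi> \<in> bim" shows "xconj (DD \<xi>) xs = - DD (xconj \<xi>) xs"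
proof -
  have m: "multilin sG sf (\<lambda>zs. ec (\<xi> zs))"
    by (rule multilin_comp[OF bimD(1)[OF assms]]) (use R.H.lin_econj in simp)
  have "xconj (DD \<xi>) xs = DD (\<lambda>zs. ec (\<xi> zs)) (map e xs)"
    unfolding xconj_def by (rule coder_additive[OF ad_ec])
  then show ?thesis
    unfolding xconj_def[abs_def]
    using E.coder_map_e[of sf "\<lambda>zs. ec (\<xi> zs)" b xs, OF vsf m odd_b] by simp
qed

lemma xconj_cup:
  assumes "\<xi> \<in> bim" shows "xconj (cup \<xi>) xs = - cup (xconj \<xi>) xs"
proof -
  have "ec (mod_comp (ec (\<xi> (map e us))) (tau (map e vs))) = - mod_comp (ec (xconj \<xi> us)) (tau vs)" for us vs
    using xconj_tau[of vs] additive.minus[OF ad_cr[OF bimD(4)[OF assms]]]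
    by (simp add: R.H.econj_comp xconj_def)
  moreover have "xconj (cup \<xi>) xs
      = split_sum (\<lambda>us vs. ec (mod_comp (ec (\<xi> (map e us))) (tau (map e vs)))) xs"
    by (simp add: xconj_def cup_def split_sum_map split_sum_additive[OF ad_ec])
  ultimately show ?thesis by (simp add: cup_def split_sum_minus)
qed

lemma xconj_xdiff:
  assumes "\<xi> \<in> bim" shows "xconj (xdiff \<xi>) xs = - xdiff (xconj \<xi>) xs"
proof -
  have "xconj (xdiff \<xi>) xs = xconj (\<lambda>xs. ed (\<xi> xs)) xs - xconj (DD (xconj \<xi>)) xs - xconj (cup \<xi>) xs"
    by (simp add: xconj_def[of "xdiff \<xi>"] xconj_def[of "\<lambda>xs. ed (\<xi> xs)"] xconj_def[of "DD (xconj \<xi>)"]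
        xconj_def[of "cup \<xi>"] xdiff_def additive.diff[OF ad_ec])
  then show ?thesis
    unfolding xconj_ed[OF assms] xconj_coder[OF bim_xconj[OF assms]] xconj_cup[OF assms]
    by (simp add: xdiff_def)
qed

lemma cup_additive: "cup (\<lambda>xs. \<xi> xs + \<eta> xs) xs = cup \<xi> xs + cup \<eta> xs"
  unfolding cup_def by (simp add: additive.add[OF ad_ec] additive.add[OF ad_cl] split_sum_add)

lemma cup_diff: "cup (\<lambda>xs. \<xi> xs - \<eta> xs) xs = cup \<xi> xs - cup \<eta> xs"
  unfolding cup_def by (simp add: additive.diff[OF ad_ec] additive.diff[OF ad_cl] split_sum_diff)

lemma cup_minus: "cup (\<lambda>xs. - \<xi> xs) xs = - cup \<xi> xs"
  unfolding cup_def by (simp add: additive.minus[OF ad_ec] additive.minus[OF ad_cl] split_sum_minus)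

lemma xconj_add: "xconj (\<lambda>xs. \<xi> xs + \<eta> xs) = (\<lambda>xs. xconj \<xi> xs + xconj \<eta> xs)"
  by (simp add: xconj_def fun_eq_iff additive.add[OF ad_ec])

lemma xconj_minus: "xconj (\<lambda>xs. - \<xi> xs) = (\<lambda>xs. - xconj \<xi> xs)"
  by (simp add: xconj_def fun_eq_iff additive.minus[OF ad_ec])

lemma xdiff_add: "xdiff (\<lambda>xs. \<xi> xs + \<eta> xs) xs = xdiff \<xi> xs + xdiff \<eta> xs"
  by (simp add: xdiff_def cup_additive xconj_add coder_add additive.add[OF ad_ed])

lemma xdiff_minus: "xdiff (\<lambda>xs. - \<xi> xs) xs = - xdiff \<xi> xs"
  by (simp add: xdiff_def cup_minus xconj_minus coder_minus additive.minus[OF ad_ed])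

lemma xdiff_scale: "xdiff (\<lambda>xs. sf c (\<xi> xs)) xs = sf c (xdiff \<xi> xs)"
proof -
  have 1: "ed (sf c \<psi>) = sf c (ed \<psi>)" "ec (sf c \<psi>) = sf c (ec \<psi>)" "mod_comp (sf c \<psi>) \<chi> = sf c (mod_comp \<psi> \<chi>)" for \<psi> \<chi>
    using lin_scale[OF vsf vsf, of ed c \<psi>] R.H.lin_end_diff lin_scale[OF vsf vsf, of ec c \<psi>] R.H.lin_econj
      lin_scale[OF vsf vsf, of "\<lambda>\<psi>. mod_comp \<psi> \<chi>" c \<psi>] R.H.lin_comp_left by simp_all
  have 2: "xconj (\<lambda>xs. sf c (\<xi> xs)) = (\<lambda>xs. sf c (xconj \<xi> xs))" by (simp add: xconj_def[abs_def] 1(2))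
  have 3: "cup (\<lambda>xs. sf c (\<xi> xs)) xs = sf c (cup \<xi> xs)"
    unfolding cup_def 1 by (rule split_sum_scale[OF vsG vsf])
  have "xdiff (\<lambda>xs. sf c (\<xi> xs)) xs = sf c (ed (\<xi> xs)) - sf c (DD (xconj \<xi>) xs) - sf c (cup \<xi> xs)"
    unfolding xdiff_def 1 2 3 using coder_scale[OF vsG vsf, of b e c "xconj \<xi>" xs] by simp
  also have "\<dots> = sf c (xdiff \<xi> xs)"
    by (simp add: xdiff_def fun_eq_iff scale_right_diff_distrib)
  finally show ?thesis .
qed

definition rcomp :: "('a list \<Rightarrow> 'a list \<Rightarrow> 'a) \<Rightarrow> ('a list \<Rightarrow> 'a list \<Rightarrow> 'a) \<Rightarrow> 'a list \<Rightarrow> 'a list \<Rightarrow> 'a" where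
  "rcomp \<xi> \<zeta> = split_sum (\<lambda>us vs. mod_comp (\<xi> us) (\<zeta> vs))"

lemma tau_equation: "ed (tau xs) + DD tau xs + rcomp (\<lambda>us. tau (map e us)) tau xs = 0"
  using R.coder_twist[of xs] by (simp add: rcomp_def)

lemma ed_cup:
  assumes "\<xi> \<in> bim"
  shows "ed (cup \<xi> xs) = - cup (\<lambda>xs. ed (\<xi> xs)) xs + rcomp \<xi> (\<lambda>vs. ed (tau vs)) xs"
proof -
  have "ed (mod_comp (ec (\<xi> us)) (tau vs)) = - mod_comp (ec (ed (\<xi> us))) (tau vs) + mod_comp (\<xi> us) (ed (tau vs))" for us vs
  proof -
    note x = bimD(4)[OF assms, of us]
    have "ed (mod_comp (ec (\<xi> us)) (tau vs)) = mod_comp (ed (ec (\<xi> us))) (tau vs) + mod_comp (ec (ec (\<xi> us))) (ed (tau vs))"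
      using R.H.end_diff_comp[OF R.H.end_fun_econj[OF x] R.end_fun_twist] by (auto simp: fun_eq_iff)
    moreover have "ed (ec (\<xi> us)) = - ec (ed (\<xi> us))" using R.H.econj_end_diff[OF x] by simp
    ultimately show ?thesis by (simp add: additive.minus[OF ad_cl])
  qed
  then show ?thesis
    unfolding cup_def rcomp_def
    by (simp add: split_sum_additive[OF ad_ed] split_sum_add[symmetric] split_sum_minus[symmetric])
qed

lemma coder_cup:
  assumes "\<xi> \<in> bim"
  shows "DD (cup \<xi>) xs = cup (DD \<xi>) xs + rcomp (xconj \<xi>) (DD tau) xs"
proof -
  have ad: "additive (\<lambda>\<psi>. mod_comp (ec \<psi>) \<chi>)" for \<chi>
    by (rule additive.intro) (simp add: additive.add[OF ad_ec] additive.add[OF ad_cl])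
  have 1: "DD (\<lambda>u. mod_comp (ec (\<xi> u)) (tau vs)) us = mod_comp (ec (DD \<xi> us)) (tau vs)" for us vs
    by (rule coder_additive[OF ad, symmetric])
  have 2: "DD (\<lambda>v. mod_comp (ec (\<xi> (map e us))) (tau v)) vs = mod_comp (xconj \<xi> us) (DD tau vs)" for us vs
    unfolding xconj_def
    by (rule coder_additive[OF ad_cr[OF R.H.end_fun_econj[OF bimD(4)[OF assms]]], symmetric])
  show ?thesis
    unfolding cup_def rcomp_def coder_split_sum by (simp only: 1 2 split_sum_add)
qed

lemma cup_cup:
  assumes "\<xi> \<in> bim"
  shows "cup (cup \<xi>) xs = - rcomp \<xi> (rcomp (\<lambda>us. tau (map e us)) tau) xs"
proof -
  note x = bimD(4)[OF assms]
  have et: "ec (tau v) = - tau (map e v)" for v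
    using xconj_tau[of "map e v"] by (simp add: xconj_def)
  have "ec (cup \<xi> us) = - split_sum (\<lambda>u v. mod_comp (\<xi> u) (tau (map e v))) us" for us
    unfolding cup_def split_sum_minus[symmetric] split_sum_additive[OF ad_ec]
    by (simp add: R.H.econj_comp et additive.minus[OF ad_cr[OF x]])
  then have "mod_comp (ec (cup \<xi> us)) (tau vs)
      = - split_sum (\<lambda>u v. mod_comp (\<xi> u) (mod_comp (tau (map e v)) (tau vs))) us" for us vs
    by (simp add: additive.minus[OF ad_cl] split_sum_additive[OF ad_cl]
        R.H.comp_assoc_end[OF x R.end_fun_twist])
  then have "cup (cup \<xi>) xs = - split_sum (\<lambda>us vs. split_sum
      (\<lambda>u v. mod_comp (\<xi> u) (mod_comp (tau (map e v)) (tau vs))) us) xs"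
    by (simp add: cup_def[of "cup \<xi>"] split_sum_minus)
  also have "\<dots> = - rcomp \<xi> (rcomp (\<lambda>us. tau (map e us)) tau) xs"
    unfolding split_sum_assoc rcomp_def by (simp add: split_sum_additive[OF ad_cr[OF x]])
  finally show ?thesis .
qed

lemma rcomp_add:
  assumes "\<xi> \<in> bim"
  shows "rcomp \<xi> (\<lambda>xs. \<zeta> xs + \<omega> xs) xs = rcomp \<xi> \<zeta> xs + rcomp \<xi> \<omega> xs"
  unfolding rcomp_def by (simp add: split_sum_add[symmetric] additive.add[OF ad_cr[OF bimD(4)[OF assms]]])

text \<open>All terms cancel except the composition of \<open>\<xi>\<close> with the left-hand side
  of the Maurer-Cartan equation \<open>tau_equation\<close>.\<close>

theorem xdiff_xdiff:
  assumes "\<xi> \<in> bim" shows "xdiff (xdiff \<xi>) xs = 0"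
proof -
  note c = bim_xconj[OF assms]
  have 1: "ed (xdiff \<xi> xs) = - DD (\<lambda>xs. ed (xconj \<xi> xs)) xs + cup (\<lambda>xs. ed (\<xi> xs)) xs - rcomp \<xi> (\<lambda>vs. ed (tau vs)) xs"
  proof -
    have "ed (ed (\<xi> xs)) = 0" using R.H.end_diff_end_diff[OF bimD(4)[OF assms]] by (simp add: fun_eq_iff)
    then show ?thesis
      by (simp add: xdiff_def additive.diff[OF ad_ed] coder_additive[OF ad_ed] ed_cup[OF assms])
  qed
  have 2: "DD (xconj (xdiff \<xi>)) xs = - DD (\<lambda>xs. ed (xconj \<xi> xs)) xs + cup (DD (xconj \<xi>)) xs + rcomp \<xi> (DD tau) xs"
  proof -
    have "DD (xconj (xdiff \<xi>)) xs = - DD (xdiff (xconj \<xi>)) xs"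
    proof -
      have "xconj (xdiff \<xi>) = (\<lambda>xs. - xdiff (xconj \<xi>) xs)"
        by (rule ext) (rule xconj_xdiff[OF assms])
      then show ?thesis by (simp add: coder_minus)
    qed
    also have "DD (xdiff (xconj \<xi>)) xs = DD (\<lambda>xs. ed (xconj \<xi> xs)) xs - DD (DD \<xi>) xs - DD (cup (xconj \<xi>)) xs"
      by (simp add: xdiff_def[abs_def] coder_diff)
    also have "DD (DD \<xi>) xs = 0"
      by (rule E.coder_coder[of sf \<xi> b, OF vsf bimD(1)[OF assms] multilin_b odd_b coder_b])
    finally have *: "DD (xconj (xdiff \<xi>)) xs
        = - (DD (\<lambda>xs. ed (xconj \<xi> xs)) xs - 0 - DD (cup (xconj \<xi>)) xs)" .
    show ?thesis unfolding * coder_cup[OF c] xconj_xconj by (rule ext) simp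
  qed
  have 3: "cup (xdiff \<xi>) xs = cup (\<lambda>xs. ed (\<xi> xs)) xs - cup (DD (xconj \<xi>)) xs
      + rcomp \<xi> (rcomp (\<lambda>us. tau (map e us)) tau) xs"
    by (simp add: xdiff_def[abs_def] cup_diff cup_cup[OF assms])
  have "rcomp \<xi> (\<lambda>xs. ed (tau xs) + DD tau xs + rcomp (\<lambda>us. tau (map e us)) tau xs) xs = 0"
    unfolding tau_equation
    by (simp add: rcomp_def additive.zero[OF ad_cr[OF bimD(4)[OF assms]]] split_sum_zero)
  then have 4: "rcomp \<xi> (\<lambda>vs. ed (tau vs)) xs + rcomp \<xi> (DD tau) xs
      + rcomp \<xi> (rcomp (\<lambda>us. tau (map e us)) tau) xs = 0"
    by (simp add: rcomp_add[OF assms])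
  have "xdiff (xdiff \<xi>) xs = - (rcomp \<xi> (\<lambda>vs. ed (tau vs)) xs + rcomp \<xi> (DD tau) xs
      + rcomp \<xi> (rcomp (\<lambda>us. tau (map e us)) tau) xs)"
    unfolding xdiff_def[of "xdiff \<xi>"] 1 2 3 by (simp add: algebra_simps)
  then show ?thesis unfolding 4 by simp
qed

text \<open>Since the twist is on one side only, the Maurer-Cartan equation itself says that
  \<open>tau\<close> is a cocycle of the bimodule.\<close>

lemma xdiff_tau: "xdiff tau xs = 0"
proof -
  have "ec (tau v) = - tau (map e v)" for v
    using xconj_tau[of "map e v"] by (simp add: xconj_def)
  then have "cup tau xs = - rcomp (\<lambda>us. tau (map e us)) tau xs"
    unfolding cup_def rcomp_def by (simp add: additive.minus[OF ad_cl] split_sum_minus)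
  moreover have "DD (xconj tau) xs = - DD tau xs"
  proof -
    have "xconj tau = (\<lambda>xs. - tau xs)" by (rule ext) (rule xconj_tau)
    then show ?thesis by (simp add: coder_minus)
  qed
  ultimately show ?thesis using tau_equation[of xs] by (simp add: xdiff_def)
qed

lemma xdiff_lact:
  assumes \<beta>: "efun \<beta>" and \<xi>: "\<xi> \<in> bim"
  shows "xdiff (lact \<beta> \<xi>) xs = lact (ed \<beta>) \<xi> xs + lact (ec \<beta>) (xdiff \<xi>) xs"
proof -
  note x = bimD(4)[OF \<xi>] and eb = R.H.end_fun_econj[OF \<beta>]
  have 1: "ed (lact \<beta> \<xi> xs) = mod_comp (ed \<beta>) (\<xi> xs) + mod_comp (ec \<beta>) (ed (\<xi> xs))"
    using R.H.end_diff_comp[OF \<beta> x] by (auto simp: lact_def fun_eq_iff)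
  have "xconj (lact \<beta> \<xi>) = lact (ec \<beta>) (xconj \<xi>)"
    by (simp add: xconj_def lact_def fun_eq_iff R.H.econj_comp)
  then have 2: "DD (xconj (lact \<beta> \<xi>)) xs = mod_comp (ec \<beta>) (DD (xconj \<xi>) xs)"
    by (simp add: coder_additive[OF ad_cr[OF eb]] lact_def[abs_def])
  have 3: "cup (lact \<beta> \<xi>) xs = mod_comp (ec \<beta>) (cup \<xi> xs)"
    unfolding cup_def split_sum_additive[OF ad_cr[OF eb]]
    by (simp add: lact_def R.H.econj_comp R.H.comp_assoc_end[OF eb R.H.end_fun_econj[OF x]])
  show ?thesis
    unfolding xdiff_def[of "lact \<beta> \<xi>"] 1 2 3
    by (simp add: lact_def xdiff_def additive.diff[OF ad_cr[OF eb]])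
qed

text \<open>Multiplication by \<open>a\<close> matters only for blocks starting at the first letter.
  A block of length one gives the Leibniz rule, which leaves the term with \<open>b [a]\<close>;
  length two gives associativity; longer blocks vanish because \<open>G\<close> is a
  DG-algebra.\<close>

lemma coder_ract:
  assumes "\<zeta> \<in> bim"
  shows "DD (ract \<zeta> (- e a)) xs = ract (DD \<zeta>) a xs - ract \<zeta> (b [a]) xs"
proof (cases xs)
  case (Cons y ys)
  note z = bimD[OF assms]
  have 1: "DD (ract \<zeta> (- e a)) xs = split_sum (\<lambda>us vs. \<zeta> (mu (- e a) (b (y # us)) # vs)) ys
     + DD (\<lambda>zs. \<zeta> (mu (- e a) (e y) # zs)) ys"
    by (simp add: Cons ract_def)
  have 2: "ract (DD \<zeta>) a xs = split_sum (\<lambda>us vs. \<zeta> (b (mu a y # us) # vs)) ys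
     + DD (\<lambda>zs. \<zeta> (mu (- e a) (e y) # zs)) ys"
    by (simp add: Cons ract_def e_mu)
  have "split_sum (\<lambda>us vs. \<zeta> (mu (- e a) (b (y # us)) # vs) - \<zeta> (b (mu a y # us) # vs)) ys = - ract \<zeta> (b [a]) xs"
  proof (subst split_sum_only_Nil)
    fix us vs assume us: "us \<noteq> []" "us @ vs = ys"
    show "\<zeta> (mu (- e a) (b (y # us)) # vs) - \<zeta> (b (mu a y # us) # vs) = 0"
    proof (cases "tl us")
      case Nil
      then obtain w where w: "us = [w]" using us(1) by (cases us) auto
      have "mu (- e a) (b [y, w]) = b [mu a y, w]"
        using b_two_two[of "e a" y w] by (simp add: mu_def b_minus e_e additive.minus[OF E.additive_e] eq_neg_iff_add_eq_0 add.commute)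
      then show ?thesis using w by simp
    next
      case (Cons w ws)
      then have l: "length us \<ge> 2" by (cases us) auto
      have "b (y # us) = 0" "b (mu a y # us) = 0" by (rule b_long, use l in simp)+
      then show ?thesis by (simp add: additive.zero[OF ad_mu_right])
    qed
  next
    have "\<zeta> (b [mu a y] # ys) = \<zeta> (mu (b [a]) y # ys) + \<zeta> (mu (- e a) (b [y]) # ys)"
      by (simp add: d_mu multilin_add_hd[OF vsG vsf z(1)])
    then show "\<zeta> (mu (- e a) (b [y]) # ys) - \<zeta> (b [mu a y] # ys) = - ract \<zeta> (b [a]) xs"
      by (simp add: Cons ract_def)
  qed
  then show ?thesis unfolding 1 2 by (simp add: split_sum_diff algebra_simps)
qed (simp add: ract_def)

lemma xconj_ract: "xconj (ract \<xi> a) = ract (xconj \<xi>) (- e a)"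
proof
  fix xs
  have "mu a (e y) = e (mu (- e a) y)" for y by (simp add: e_mu e_e additive.minus[OF E.additive_e])
  then show "xconj (ract \<xi> a) xs = ract (xconj \<xi>) (- e a) xs"
    by (cases xs) (simp_all add: xconj_def ract_def additive.zero[OF ad_ec])
qed

lemma xdiff_ract:
  assumes "\<xi> \<in> bim"
  shows "xdiff (ract \<xi> a) xs = ract (xdiff \<xi>) a xs + ract (xconj \<xi>) (b [a]) xs"
proof (cases xs)
  case Nil
  have "xdiff (ract \<xi> a) [] = 0" using bimD(2)[OF bim_xdiff[OF bim_ract[OF assms]]] .
  then show ?thesis using Nil by (simp add: ract_def)
next
  case (Cons y ys)
  note x = bimD[OF assms]
  have 1: "DD (xconj (ract \<xi> a)) xs = ract (DD (xconj \<xi>)) a xs - ract (xconj \<xi>) (b [a]) xs"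
    unfolding xconj_ract by (rule coder_ract[OF bim_xconj[OF assms]])
  have 2: "cup (ract \<xi> a) xs = ract (cup \<xi>) a xs"
    by (simp add: Cons cup_def ract_def x(2) additive.zero[OF ad_ec] additive.zero[OF ad_cl])
  show ?thesis unfolding xdiff_def[of "ract \<xi> a"] 1 2 by (simp add: Cons ract_def xdiff_def)
qed

lemma ract_ract: "ract (ract \<xi> a) a' = ract \<xi> (mu a a')"
  by (auto simp: ract_def fun_eq_iff mu_assoc split: list.split)

lemma ract_lact: "efun \<beta> \<Longrightarrow> ract (lact \<beta> \<xi>) a = lact \<beta> (ract \<xi> a)"
  using additive.zero[OF ad_cr] by (auto simp: ract_def lact_def fun_eq_iff split: list.split)

lemma lact_lact: "efun \<beta> \<Longrightarrow> efun \<beta>' \<Longrightarrow> lact (mod_comp \<beta> \<beta>') \<xi> = lact \<beta> (lact \<beta>' \<xi>)"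
  by (simp add: lact_def fun_eq_iff R.H.comp_assoc_end)

lemma lact_one: "\<xi> \<in> bim \<Longrightarrow> lact R.H.end_one \<xi> = \<xi>"
  using R.H.one_comp[OF bimD(4)] by (simp add: lact_def fun_eq_iff)

lemma ract_one: "\<xi> \<in> bim \<Longrightarrow> ract \<xi> one = \<xi>"
  using bimD(2,6) by (auto simp: ract_def fun_eq_iff mu_one split: list.split)

end

section \<open>Graded pieces of the bimodule and the triangular algebra\<close>

lemma signed_Pair: "signed k (x, y) = (signed k x, signed k y)"
  by (simp add: signed_def)

context dg_resolution
begin

lemma fin_zero: "0 \<in> fin j"
  using R.H.fin_comp_closed(1) by (simp add: zero_fun_def)

lemma fin_add: "\<psi> \<in> fin j \<Longrightarrow> \<chi> \<in> fin j \<Longrightarrow> \<psi> + \<chi> \<in> fin j"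
  using R.H.fin_comp_closed(2) by (simp add: plus_fun_def)

lemma fin_diff: "\<psi> \<in> fin j \<Longrightarrow> \<chi> \<in> fin j \<Longrightarrow> \<psi> - \<chi> \<in> fin j"
  using R.H.fin_comp_closed(3) by (simp add: fun_diff_def)

lemma fin_minus: "\<psi> \<in> fin j \<Longrightarrow> - \<psi> \<in> fin j"
  using R.H.fin_comp_closed(4) by (simp add: fun_Compl_def)

lemma fin_scale: "\<psi> \<in> fin j \<Longrightarrow> sf c \<psi> \<in> fin j"
  using module.subspace_scale[OF _ R.H.fin_comp_subspace] vsf module_iff_vector_space by blast

lemma fin_signed: "\<psi> \<in> fin j \<Longrightarrow> signed k \<psi> \<in> fin j"
  by (auto simp: signed_def fin_minus)

lemma fin_ec: "\<psi> \<in> fin j \<Longrightarrow> ec \<psi> = signed j \<psi>"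
  using R.H.fin_compD(5)[of \<psi> j] by (auto simp: fun_eq_iff signed_apply)

lemma fin_ec_mem: "\<psi> \<in> fin j \<Longrightarrow> ec \<psi> \<in> fin j"
  by (simp add: fin_ec fin_signed)

lemma fin_ed: "\<psi> \<in> fin j \<Longrightarrow> k = j + 1 \<Longrightarrow> ed \<psi> \<in> fin k"
  using R.H.fin_comp_diff by simp

lemma fin_comp: "\<psi> \<in> fin i \<Longrightarrow> \<chi> \<in> fin j \<Longrightarrow> k = i + j \<Longrightarrow> mod_comp \<psi> \<chi> \<in> fin k"
  using R.H.fin_comp_comp by simp

lemma fin_efun: "\<psi> \<in> fin j \<Longrightarrow> efun \<psi>"
  by (rule R.H.fin_compD(2))

lemma ed_ec: "efun \<psi> \<Longrightarrow> ed (ec \<psi>) = - ec (ed \<psi>)"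
  by (simp add: R.H.econj_end_diff)

lemma ed_ed: "efun \<psi> \<Longrightarrow> ed (ed \<psi>) = 0"
  using R.H.end_diff_end_diff by (simp add: fun_eq_iff)

lemma ed_comp: "efun \<psi> \<Longrightarrow> efun \<chi> \<Longrightarrow> ed (mod_comp \<psi> \<chi>) = mod_comp (ed \<psi>) \<chi> + mod_comp (ec \<psi>) (ed \<chi>)"
  using R.H.end_diff_comp by (simp add: fun_eq_iff)

text \<open>Degrees are normalised such that \<open>tau\<close> has degree 1, as the off-diagonal
  term of the differential of \<open>tri\<close> requires.\<close>

definition bimc :: "int \<Rightarrow> ('a list \<Rightarrow> 'a list \<Rightarrow> 'a) set" where
  "bimc j = {\<xi> \<in> bim. hdeg C fin j \<xi>}"

lemma bimc_bim: "\<xi> \<in> bimc j \<Longrightarrow> \<xi> \<in> bim"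
  by (simp add: bimc_def)

lemma bimc_deg: "\<xi> \<in> bimc j \<Longrightarrow> list_all2 (\<lambda>d x. x \<in> C d) ds xs
  \<Longrightarrow> k = sum_list ds - int (length xs) + j \<Longrightarrow> \<xi> xs \<in> fin k"
  using bimD(2)[of \<xi>] hdegD[of C fin j \<xi> xs ds k] fin_zero
  by (cases "xs = []") (auto simp: bimc_def)

lemma bimc_xconj:
  assumes "\<xi> \<in> bimc j" shows "xconj \<xi> xs = signed j (\<xi> xs)"
proof -
  note x = bimD[OF bimc_bim[OF assms]] and c = bimD[OF bim_xconj[OF bimc_bim[OF assms]]]
  have "multilin sG sf (\<lambda>xs. signed j (\<xi> xs))"
    using x(1) multilin_uminus[OF vsG vsf x(1)] by (cases "even j") (simp_all add: signed_def)
  from multilin_diff[OF vsG vsf c(1) this]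
  have "xconj \<xi> xs - signed j (\<xi> xs) = 0"
  proof (rule multilin_eq_0[OF _ vsf])
    show "xconj \<xi> (us @ q y # vs) - signed j (\<xi> (us @ q y # vs)) = xconj \<xi> (us @ y # vs) - signed j (\<xi> (us @ y # vs))"
      for us y vs by (simp add: x(3) c(3))
    fix ds xs assume h: "list_all2 (\<lambda>d x. x \<in> C d) ds xs"
    have "\<xi> (map e xs) = signed (sum_list ds - int (length xs)) (\<xi> xs)"
      using multilin_map_homogeneous[OF vsG vsf x(1) eC h, of "[]"] by simp
    then have "xconj \<xi> xs = signed (sum_list ds - int (length xs)) (ec (\<xi> xs))"
      by (simp add: xconj_def additive_signed[OF ad_ec])
    also have "ec (\<xi> xs) = signed (sum_list ds - int (length xs) + j) (\<xi> xs)"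
      by (rule fin_ec[OF bimc_deg[OF assms h]]) simp
    also have "signed (sum_list ds - int (length xs)) (signed (sum_list ds - int (length xs) + j) (\<xi> xs))
        = signed (sum_list ds - int (length xs) + (sum_list ds - int (length xs) + j)) (\<xi> xs)"
      by (simp only: signed_signed)
    also have "\<dots> = signed j (\<xi> xs)" by (rule signed_cong) simp
    finally show "xconj \<xi> xs - signed j (\<xi> xs) = 0" by simp
  qed
  then show ?thesis by simp
qed

lemma bimc_closed:
  "(\<lambda>xs. 0) \<in> bimc j"
  "\<xi> \<in> bimc j \<Longrightarrow> \<eta> \<in> bimc j \<Longrightarrow> (\<lambda>xs. \<xi> xs + \<eta> xs) \<in> bimc j"
  "\<xi> \<in> bimc j \<Longrightarrow> \<eta> \<in> bimc j \<Longrightarrow> (\<lambda>xs. \<xi> xs - \<eta> xs) \<in> bimc j"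
  "\<xi> \<in> bimc j \<Longrightarrow> (\<lambda>xs. - \<xi> xs) \<in> bimc j"
  "\<xi> \<in> bimc j \<Longrightarrow> (\<lambda>xs. sf c (\<xi> xs)) \<in> bimc j"
  "\<xi> \<in> bimc j \<Longrightarrow> xconj \<xi> \<in> bimc j"
proof -
  show "(\<lambda>xs. 0) \<in> bimc j" by (simp add: bimc_def bim_zero hdeg_def fin_zero)
  show "\<xi> \<in> bimc j \<Longrightarrow> \<eta> \<in> bimc j \<Longrightarrow> (\<lambda>xs. \<xi> xs + \<eta> xs) \<in> bimc j"
    by (simp add: bimc_def bim_add hdeg_def fin_add)
  show "\<xi> \<in> bimc j \<Longrightarrow> \<eta> \<in> bimc j \<Longrightarrow> (\<lambda>xs. \<xi> xs - \<eta> xs) \<in> bimc j"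
    by (simp add: bimc_def bim_diff hdeg_def fin_diff)
  show m: "\<xi> \<in> bimc j \<Longrightarrow> (\<lambda>xs. - \<xi> xs) \<in> bimc j"
    by (simp add: bimc_def bim_minus hdeg_def fin_minus)
  show "\<xi> \<in> bimc j \<Longrightarrow> (\<lambda>xs. sf c (\<xi> xs)) \<in> bimc j"
    by (simp add: bimc_def bim_scale hdeg_def fin_scale)
  have "xconj \<xi> = (\<lambda>xs. signed j (\<xi> xs))" if "\<xi> \<in> bimc j"
    by (rule ext) (rule bimc_xconj[OF that])
  then show "\<xi> \<in> bimc j \<Longrightarrow> xconj \<xi> \<in> bimc j"
    using m by (cases "even j") (simp_all add: signed_def)
qed

lemma bimc_tau: "tau \<in> bimc 1"
  using R.hdeg_twist by (simp add: bimc_def bim_tau)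

lemma bimc_lact: "\<beta> \<in> fin i \<Longrightarrow> \<xi> \<in> bimc j \<Longrightarrow> k = i + j \<Longrightarrow> lact \<beta> \<xi> \<in> bimc k"
  unfolding bimc_def
  by (auto simp: bim_lact fin_efun lact_def intro!: hdegI fin_comp hdegD[of C fin j \<xi>])

lemma bimc_ract:
  assumes x: "\<xi> \<in> bimc j" and a: "a \<in> C i" and k: "k = i + j"
  shows "ract \<xi> a \<in> bimc k"
proof -
  have "ract \<xi> a xs \<in> fin (sum_list ds - int (length xs) + k)"
    if ne: "xs \<noteq> []" and h: "list_all2 (\<lambda>d x. x \<in> C d) ds xs" for ds xs
  proof -
    obtain y ys where xs: "xs = y # ys" using ne by (cases xs) auto
    obtain d ds' where ds: "ds = d # ds'" using h xs by (auto simp: list_all2_Cons2)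
    have "\<xi> (mu a y # ys) \<in> fin (sum_list ds - int (length xs) + k)"
      by (rule bimc_deg[OF x, of "(i + d) # ds'"]) (use h xs ds k mu_C[OF a] in auto)
    then show ?thesis by (simp add: xs ract_def)
  qed
  then show ?thesis by (simp add: bimc_def bim_ract[OF bimc_bim[OF x]] hdeg_def)
qed

lemma bimc_cup: 
  assumes x: "\<xi> \<in> bimc j" and k: "k = j + 1" shows "cup \<xi> \<in> bimc k"
proof -
  have "cup \<xi> xs \<in> fin (sum_list ds - int (length xs) + k)"
    if h: "list_all2 (\<lambda>d x. x \<in> C d) ds xs" for ds xs
    unfolding cup_def
  proof (rule split_sum_in)
    fix us vs assume uv: "us @ vs = xs"
    obtain d1 d2 where d: "ds = d1 @ d2" "list_all2 (\<lambda>d x. x \<in> C d) d1 us"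
      "list_all2 (\<lambda>d x. x \<in> C d) d2 vs"
      using homogeneous_append[OF h uv] .
    show "mod_comp (ec (\<xi> us)) (tau vs) \<in> fin (sum_list ds - int (length xs) + k)"
      by (rule fin_comp[OF fin_ec_mem[OF bimc_deg[OF x d(2) refl]] bimc_deg[OF bimc_tau d(3) refl]])
        (use d uv k in auto)
  qed (rule fin_add)
  then show ?thesis by (simp add: bimc_def bim_cup[OF bimc_bim[OF x]] hdeg_def)
qed

lemma bimc_coder:
  assumes x: "\<xi> \<in> bimc j" and k: "k = j + 1" shows "DD \<xi> \<in> bimc k"
proof -
  have "hdeg C fin k (DD \<xi>)"
    by (rule hdeg_coder[of fin C b e j \<xi>])
      (use x k b_C fin_zero fin_add eC CC(4) in \<open>auto simp: bimc_def\<close>)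
  then show ?thesis by (simp add: bimc_def bim_coder[OF bimc_bim[OF x]])
qed

lemma bimc_ed: "\<xi> \<in> bimc j \<Longrightarrow> k = j + 1 \<Longrightarrow> (\<lambda>xs. ed (\<xi> xs)) \<in> bimc k"
  unfolding bimc_def by (auto simp: bim_ed intro!: hdegI fin_ed hdegD[of C fin j \<xi>])

lemma bimc_xdiff: "\<xi> \<in> bimc j \<Longrightarrow> k = j + 1 \<Longrightarrow> xdiff \<xi> \<in> bimc k"
  unfolding xdiff_def[abs_def] by (intro bimc_closed bimc_ed bimc_coder bimc_cup)

text \<open>The off-diagonal term is the graded commutator with the matrix whose only entry is
  \<open>tau\<close>. That matrix is a cocycle of degree 1 with square zero, which is why adding the
  commutator to the entrywise differential gives a differential that still satisfies the Leibniz
  rule.\<close>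

definition tri :: "('k, ('a list \<Rightarrow> 'a) \<times> ('a list \<Rightarrow> 'a list \<Rightarrow> 'a) \<times> 'a) dg_algebra" where
  "tri = \<lparr>smul = (\<lambda>c (\<beta>, \<xi>, a). (sf c \<beta>, \<lambda>xs. sf c (\<xi> xs), sG c a)),
     component = (\<lambda>j. fin j \<times> bimc j \<times> C j),
     dg_diff = (\<lambda>(\<beta>, \<xi>, a). (ed \<beta>, \<lambda>xs. xdiff \<xi> xs + ract tau a xs - lact (ec \<beta>) tau xs, b [a])),
     dg_mult = (\<lambda>(\<beta>, \<xi>, a) (\<beta>', \<xi>', a'). (mod_comp \<beta> \<beta>', \<lambda>xs. lact \<beta> \<xi>' xs + ract \<xi> a' xs, mu a a')),
     dg_one = (R.H.end_one, \<lambda>xs. 0, one)\<rparr>"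

lemma tri_simps:
  "smul tri c (\<beta>, \<xi>, a) = (sf c \<beta>, \<lambda>xs. sf c (\<xi> xs), sG c a)"
  "component tri j = fin j \<times> bimc j \<times> C j"
  "dg_diff tri (\<beta>, \<xi>, a) = (ed \<beta>, \<lambda>xs. xdiff \<xi> xs + ract tau a xs - lact (ec \<beta>) tau xs, b [a])"
  "dg_mult tri (\<beta>, \<xi>, a) (\<beta>', \<xi>', a') = (mod_comp \<beta> \<beta>', \<lambda>xs. lact \<beta> \<xi>' xs + ract \<xi> a' xs, mu a a')"
  "dg_one tri = (R.H.end_one, \<lambda>xs. 0, one)"
  by (simp_all add: tri_def)

lemma vector_space_tri: "vector_space (smul tri)"
  unfolding vector_space_def
  by (auto simp: tri_simps fun_eq_iff scale_right_distrib scale_left_distrib)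

lemma indep_bimc:
  assumes I: "finite I" "\<And>i. i \<in> I \<Longrightarrow> \<xi> i \<in> bimc i" "(\<Sum>i\<in>I. \<xi> i) = 0" and i: "i \<in> I"
  shows "\<xi> i = 0"
proof
  fix xs
  note x = bimD[OF bimc_bim[OF I(2)[OF i]]]
  have "\<xi> i xs = 0"
  proof (rule multilin_eq_0[OF x(1) vsf x(3)])
    fix ds ws assume h: "list_all2 (\<lambda>d x. x \<in> C d) ds ws"
    define k where "k = sum_list ds - int (length ws)"
    have app: "(\<Sum>i\<in>I. \<xi> i ws) = 0"
    proof -
      have "(\<Sum>i\<in>I. \<xi> i ws) = (\<Sum>i\<in>I. \<xi> i) ws" using I(1) by (induction I) auto
      then show ?thesis using I(3) by simp
    qed
    have "\<xi> (i + k - k) ws = 0"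
    proof (rule R.H.indep_fin_comp[of "(\<lambda>j. j + k) ` I" "\<lambda>l. \<xi> (l - k) ws" "i + k"])
      show "\<xi> (l - k) ws \<in> fin l" if "l \<in> (\<lambda>j. j + k) ` I" for l
      proof -
        from that obtain j where j: "j \<in> I" "l = j + k" by auto
        show ?thesis using bimc_deg[OF I(2)[OF j(1)] h, of l] j(2) by (simp add: k_def)
      qed
      show "(\<Sum>l\<in>(\<lambda>j. j + k) ` I. \<xi> (l - k) ws) = 0"
        using app by (subst sum.reindex) (auto simp: o_def)
    qed (use I i in auto)
    then show "\<xi> i ws = 0" by simp
  qed
  then show "\<xi> i xs = 0 xs" by simp
qed

lemma graded_tri: "graded_vector_space tri"
  unfolding graded_vector_space_def
proof (intro conjI allI impI ballI)
  show "vector_space (smul tri)" by (rule vector_space_tri)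
  then have m: "module (smul tri)" by (simp add: module_iff_vector_space)
  show "module.subspace (smul tri) (component tri i)" for i
    unfolding module.subspace_def[OF m]
    using fin_zero[of i] bimc_closed(1,2,5) fin_add fin_scale subspace_0[OF subspace_C] CC C_scale
    by (auto simp: tri_simps zero_prod_def zero_fun_def plus_fun_def)
next
  fix I f i
  assume a: "finite I \<and> (\<forall>i\<in>I. f i \<in> component tri i) \<and> sum f I = 0" and i: "i \<in> I"
  then have c: "fst (f j) \<in> fin j" "fst (snd (f j)) \<in> bimc j" "snd (snd (f j)) \<in> C j" if "j \<in> I" for j
    using that by (force simp: tri_simps)+
  have s: "(\<Sum>j\<in>I. fst (f j)) = 0" "(\<Sum>j\<in>I. fst (snd (f j))) = 0" "(\<Sum>j\<in>I. snd (snd (f j))) = 0"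
    using a by (simp_all add: fst_sum[symmetric] snd_sum[symmetric])
  have "fst (f i) = 0" by (rule R.H.indep_fin_comp[OF _ c(1) s(1) i]) (use a in auto)
  moreover have "fst (snd (f i)) = 0" by (rule indep_bimc[OF _ c(2) s(2) i]) (use a in auto)
  moreover have "snd (snd (f i)) = 0"
    using graded_vector_spaceD(4)[OF dgD(1), of I "\<lambda>j. snd (snd (f j))" i] a c(3) s(3) i
    by (simp add: G_simps)
  ultimately show "f i = 0" by (simp add: prod_eq_iff)
qed

theorem is_dg_algebra_tri: "is_dg_algebra tri"
proof (rule is_dg_algebraI)
  show "graded_vector_space tri" by (rule graded_tri)
next
  fix i x assume "x \<in> component tri i"
  then obtain \<beta> \<xi> a where x: "x = (\<beta>, \<xi>, a)" "\<beta> \<in> fin i" "\<xi> \<in> bimc i" "a \<in> C i"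
    by (auto simp: tri_simps)
  show "dg_diff tri x \<in> component tri (i + 1)"
    using d_C[OF x(4)] x
    by (auto simp: tri_simps d_def intro!: fin_ed bimc_closed bimc_xdiff bimc_ract[OF bimc_tau] bimc_lact[OF fin_ec_mem _ ] bimc_tau)
  have ef: "efun \<beta>" "efun (ec \<beta>)" using fin_efun x(2) fin_ec_mem by auto
  have "(\<lambda>xs. xdiff (\<lambda>xs. xdiff \<xi> xs + ract tau a xs - lact (ec \<beta>) tau xs) xs + ract tau (b [a]) xs - lact (ec (ed \<beta>)) tau xs) = (\<lambda>xs. 0)"
  proof
    fix xs
    have "xdiff (\<lambda>xs. xdiff \<xi> xs + ract tau a xs - lact (ec \<beta>) tau xs) xs
      = xdiff (xdiff \<xi>) xs + xdiff (ract tau a) xs - xdiff (lact (ec \<beta>) tau) xs"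
      using xdiff_add[of "\<lambda>xs. xdiff \<xi> xs + ract tau a xs" "\<lambda>xs. - lact (ec \<beta>) tau xs"]
      by (simp add: xdiff_add xdiff_minus)
    moreover have "xdiff (lact (ec \<beta>) tau) xs = - lact (ec (ed \<beta>)) tau xs"
      using xdiff_lact[OF ef(2) bim_tau, of xs] xdiff_tau
      by (simp add: ed_ec[OF ef(1)] lact_def additive.minus[OF ad_cl] additive.zero[OF ad_cr[OF ef(1)]])
    moreover have "ract (xconj tau) (b [a]) xs = - ract tau (b [a]) xs"
      by (cases xs) (simp_all add: ract_def xconj_tau)
    then have "xdiff (ract tau a) xs = - ract tau (b [a]) xs"
      using xdiff_ract[OF bim_tau, of a xs] xdiff_tau by (cases xs) (simp_all add: ract_def)
    ultimately show "xdiff (\<lambda>xs. xdiff \<xi> xs + ract tau a xs - lact (ec \<beta>) tau xs) xs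
        + ract tau (b [a]) xs - lact (ec (ed \<beta>)) tau xs = 0"
      using xdiff_xdiff[OF bimc_bim[OF x(3)]] by simp
  qed
  then show "dg_diff tri (dg_diff tri x) = 0"
    using d_d[of a] by (simp add: x(1) tri_simps zero_prod_def ed_ed[OF ef(1)] zero_fun_def d_def)
  show "dg_diff tri (smul tri c x) = smul tri c (dg_diff tri x)" for c
  proof -
    have 1: "ed (sf c \<beta>) = sf c (ed \<beta>)" "ec (sf c \<beta>) = sf c (ec \<beta>)" "mod_comp (sf c \<psi>) \<chi> = sf c (mod_comp \<psi> \<chi>)" for \<psi> \<chi>
      using lin_scale[OF vsf vsf R.H.lin_end_diff, of c \<beta>] lin_scale[OF vsf vsf R.H.lin_econj, of c \<beta>]
        lin_scale[OF vsf vsf R.H.lin_comp_left, of c \<psi> \<chi>] by simp_all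
    have 2: "ract tau (sG c a) xs = sf c (ract tau a xs)" for xs
      using lin_scale[OF vsG vsf multilin_lin_hd[OF bimD(1)[OF bim_tau]]]
      by (cases xs) (simp_all add: ract_def lin_scale[OF vsG vsG lin_mu_left] zero_fun_def)
    have 3: "b [sG c a] = sG c (b [a])" using lin_scale[OF vsG vsG multilin_lin_hd[OF ml_b]] .
    show ?thesis
      unfolding x(1) tri_simps 1 2 3 xdiff_scale lact_def
      by (simp add: fun_eq_iff scale_right_distrib scale_right_diff_distrib)
  qed
next
  fix i x y assume "x \<in> component tri i" "y \<in> component tri i"
  obtain \<beta> \<xi> a \<beta>' \<xi>' a' where x: "x = (\<beta>, \<xi>, a)" and y: "y = (\<beta>', \<xi>', a')"
    by (cases x, cases y) auto
  have 1: "ract tau (a + a') xs = ract tau a xs + ract tau a' xs" for xs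
    by (cases xs) (simp_all add: ract_def additive.add[OF ad_mu_left] multilin_add_hd[OF vsG vsf bimD(1)[OF bim_tau]])
  have 2: "b [a + a'] = b [a] + b [a']" by (rule multilin_add_hd[OF vsG vsG ml_b])
  show "dg_diff tri (x + y) = dg_diff tri x + dg_diff tri y"
  proof -
    have "xdiff (\<xi> + \<xi>') xs = xdiff \<xi> xs + xdiff \<xi>' xs" for xs
      using xdiff_add[of \<xi> \<xi>'] by (simp add: plus_fun_def)
    then have "(\<lambda>xs. xdiff (\<xi> + \<xi>') xs + ract tau (a + a') xs - lact (ec (\<beta> + \<beta>')) tau xs)
      = (\<lambda>xs. xdiff \<xi> xs + ract tau a xs - lact (ec \<beta>) tau xs)
      + (\<lambda>xs. xdiff \<xi>' xs + ract tau a' xs - lact (ec \<beta>') tau xs)"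
      by (intro ext)
        (simp add: 1 lact_def additive.add[OF ad_ec] additive.add[OF ad_cl])
    then show ?thesis
      by (simp only: x y tri_simps add_Pair 2 additive.add[OF ad_ed])
  qed
next
  fix i j x y assume "x \<in> component tri i" "y \<in> component tri j"
  then obtain \<beta> \<xi> a \<beta>' \<xi>' a' where x: "x = (\<beta>, \<xi>, a)" "\<beta> \<in> fin i" "\<xi> \<in> bimc i" "a \<in> C i"
    and y: "y = (\<beta>', \<xi>', a')" "\<beta>' \<in> fin j" "\<xi>' \<in> bimc j" "a' \<in> C j"
    by (auto simp: tri_simps)
  note ef = fin_efun[OF x(2)] fin_efun[OF fin_ec_mem[OF x(2)]]
    fin_efun[OF y(2)] fin_efun[OF fin_ec_mem[OF y(2)]]
  show "dg_mult tri x y \<in> component tri (i + j)"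
    using mu_C[OF x(4) y(4)] x y
    by (auto simp: tri_simps intro!: fin_comp bimc_closed bimc_lact bimc_ract)
  show "dg_mult tri (smul tri c x) y = smul tri c (dg_mult tri x y)" for c
  proof -
    have "mod_comp (sf c \<beta>) \<chi> = sf c (mod_comp \<beta> \<chi>)" for \<chi>
      using lin_scale[OF vsf vsf R.H.lin_comp_left, of c \<beta> \<chi>] by simp
    moreover have "ract (\<lambda>xs. sf c (\<xi> xs)) a' xs = sf c (ract \<xi> a' xs)" for xs
      by (cases xs) (simp_all add: ract_def zero_fun_def)
    ultimately show ?thesis
      by (simp add: x y tri_simps lact_def lin_scale[OF vsG vsG lin_mu_left] scale_right_distrib fun_eq_iff)
  qed
  show "dg_mult tri x (smul tri c y) = smul tri c (dg_mult tri x y)" for c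
  proof -
    have "mod_comp \<beta> (sf c \<chi>) = sf c (mod_comp \<beta> \<chi>)" for \<chi>
      using lin_scale[OF vsf vsf R.H.lin_comp_right[OF R.H.end_funD(1)[OF ef(1)]], of c \<chi>] by simp
    moreover have "ract \<xi> (sG c a') xs = sf c (ract \<xi> a' xs)" for xs
      using lin_scale[OF vsG vsf multilin_lin_hd[OF bimD(1)[OF bimc_bim[OF x(3)]]]]
      by (cases xs) (simp_all add: ract_def zero_fun_def lin_scale[OF vsG vsG lin_mu_left])
    ultimately show ?thesis
      by (simp add: x y tri_simps lact_def lin_scale[OF vsG vsG lin_mu_right] scale_right_distrib fun_eq_iff)
  qed
  show "dg_diff tri (dg_mult tri x y) = dg_mult tri (dg_diff tri x) y + signed i (dg_mult tri x (dg_diff tri y))"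
  proof -
    have A: "b [mu a a'] = mu (b [a]) a' + signed i (mu a (b [a']))"
      using eC[OF x(4)] by (auto simp: d_mu signed_def additive.minus[OF ad_mu_left])
    have B: "ed (mod_comp \<beta> \<beta>') = mod_comp (ed \<beta>) \<beta>' + signed i (mod_comp \<beta> (ed \<beta>'))"
      by (simp add: ed_comp[OF ef(1,3)] fin_ec[OF x(2)] additive_signed[OF ad_cl])
    have X: "xdiff (\<lambda>xs. lact \<beta> \<xi>' xs + ract \<xi> a' xs) xs + ract tau (mu a a') xs - lact (ec (mod_comp \<beta> \<beta>')) tau xs
      = lact (ed \<beta>) \<xi>' xs + ract (\<lambda>xs. xdiff \<xi> xs + ract tau a xs - lact (ec \<beta>) tau xs) a' xs
       + signed i (lact \<beta> (\<lambda>xs. xdiff \<xi>' xs + ract tau a' xs - lact (ec \<beta>') tau xs) xs + ract \<xi> (b [a']) xs)" for xs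
    proof -
      have 1: "ract (\<lambda>xs. xdiff \<xi> xs + ract tau a xs - lact (ec \<beta>) tau xs) a' xs
          = ract (xdiff \<xi>) a' xs + ract tau (mu a a') xs - lact (ec \<beta>) (ract tau a') xs"
        unfolding ract_ract[symmetric] ract_lact[OF ef(2), symmetric] by (cases xs) (simp_all add: ract_def)
      have 2: "signed i (lact \<beta> \<eta> xs) = lact (ec \<beta>) \<eta> xs" for \<eta>
        by (simp add: lact_def fin_ec[OF x(2)] additive_signed[OF ad_cl])
      have "ract (xconj \<xi>) c xs = signed i (ract \<xi> c xs)" for c
        by (cases xs) (simp_all add: ract_def bimc_xconj[OF x(3)])
      then have 3: "signed i (ract \<xi> (b [a']) xs) = ract (xconj \<xi>) (b [a']) xs" by simp
      have 4: "lact (ec \<beta>) (\<lambda>xs. xdiff \<xi>' xs + ract tau a' xs - lact (ec \<beta>') tau xs) xs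
        = lact (ec \<beta>) (xdiff \<xi>') xs + lact (ec \<beta>) (ract tau a') xs - lact (ec (mod_comp \<beta> \<beta>')) tau xs"
        unfolding R.H.econj_comp lact_lact[OF ef(2,4)]
        by (simp add: lact_def additive.diff[OF ad_cr[OF ef(2)]] additive.add[OF ad_cr[OF ef(2)]])
      show ?thesis
        unfolding signed_add 1 2 3 4 xdiff_add xdiff_lact[OF ef(1) bimc_bim[OF y(3)]]
          xdiff_ract[OF bimc_bim[OF x(3)]]
        by simp
    qed
    show ?thesis
      unfolding x(1) y(1) tri_simps signed_Pair A B X by (simp add: fun_eq_iff signed_apply)
  qed
next
  fix i j x x' y assume "x \<in> component tri i" "x' \<in> component tri i" "y \<in> component tri j"
  obtain \<beta> \<xi> a \<beta>' \<xi>' a' \<beta>'' \<xi>'' a'' where x: "x = (\<beta>, \<xi>, a)" "x' = (\<beta>', \<xi>', a')" "y = (\<beta>'', \<xi>'', a'')"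
    by (cases x, cases x', cases y) auto
  have "ract (\<xi> + \<xi>') a'' xs = ract \<xi> a'' xs + ract \<xi>' a'' xs" for xs
    by (cases xs) (simp_all add: ract_def)
  then show "dg_mult tri (x + x') y = dg_mult tri x y + dg_mult tri x' y"
    by (simp add: x tri_simps lact_def additive.add[OF ad_cl] additive.add[OF ad_mu_left] fun_eq_iff algebra_simps)
next
  fix i j x y y' assume "x \<in> component tri i" "y \<in> component tri j" "y' \<in> component tri j"
  then obtain \<beta> \<xi> a \<beta>' \<xi>' a' \<beta>'' \<xi>'' a'' where x: "x = (\<beta>, \<xi>, a)" "\<beta> \<in> fin i" "\<xi> \<in> bimc i"
    and y: "y = (\<beta>', \<xi>', a')" "y' = (\<beta>'', \<xi>'', a'')"
    by (cases x, cases y, cases y') (auto simp: tri_simps)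
  have "ract \<xi> (a' + a'') xs = ract \<xi> a' xs + ract \<xi> a'' xs" for xs
    by (cases xs) (simp_all add: ract_def additive.add[OF ad_mu_left]
        multilin_add_hd[OF vsG vsf bimD(1)[OF bimc_bim[OF x(3)]]])
  then show "dg_mult tri x (y + y') = dg_mult tri x y + dg_mult tri x y'"
    by (simp add: x y tri_simps lact_def additive.add[OF ad_cr[OF fin_efun[OF x(2)]]] additive.add[OF ad_mu_right]
        fun_eq_iff algebra_simps)
next
  fix i j l x y z assume "x \<in> component tri i" "y \<in> component tri j" "z \<in> component tri l"
  then obtain \<beta> \<xi> a \<beta>' \<xi>' a' \<beta>'' \<xi>'' a'' where x: "x = (\<beta>, \<xi>, a)" "\<beta> \<in> fin i"
    and y: "y = (\<beta>', \<xi>', a')" "\<beta>' \<in> fin j" and z: "z = (\<beta>'', \<xi>'', a'')"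
    by (cases x, cases y, cases z) (auto simp: tri_simps)
  note ef = fin_efun[OF x(2)] fin_efun[OF y(2)]
  have 1: "ract (\<lambda>xs. lact \<beta> \<xi>' xs + ract \<xi> a' xs) a'' xs = lact \<beta> (ract \<xi>' a'') xs + ract \<xi> (mu a' a'') xs" for xs
    unfolding ract_ract[symmetric] ract_lact[OF ef(1), symmetric] by (cases xs) (simp_all add: ract_def)
  have 2: "lact \<beta> (\<lambda>xs. lact \<beta>' \<xi>'' xs + ract \<xi>' a'' xs) xs = lact (mod_comp \<beta> \<beta>') \<xi>'' xs + lact \<beta> (ract \<xi>' a'') xs" for xs
    unfolding lact_lact[OF ef] by (simp add: lact_def additive.add[OF ad_cr[OF ef(1)]])
  show "dg_mult tri (dg_mult tri x y) z = dg_mult tri x (dg_mult tri y z)"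
    unfolding x(1) y(1) z tri_simps 1 2 by (simp add: R.H.comp_assoc_end[OF ef] mu_assoc add.assoc)
next
  show "dg_one tri \<in> component tri 0"
    by (simp add: tri_simps R.H.fin_comp_one bimc_closed dgD(13))
next
  fix i x assume "x \<in> component tri i"
  then obtain \<beta> \<xi> a where x: "x = (\<beta>, \<xi>, a)" "\<beta> \<in> fin i" "\<xi> \<in> bimc i" "a \<in> C i"
    by (auto simp: tri_simps)
  have 0: "ract (\<lambda>xs. 0) a xs = 0" "lact \<beta> (\<lambda>xs. 0) xs = 0" for xs
    using additive.zero[OF ad_cr[OF fin_efun[OF x(2)]]] by (cases xs; simp add: ract_def lact_def)+
  show "dg_mult tri (dg_one tri) x = x"
    using mu_eq[OF dgD(13) x(4)] dgD(14)[OF x(4)]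
    by (simp add: x(1) tri_simps 0 lact_one[OF bimc_bim[OF x(3)]] R.H.one_comp[OF fin_efun[OF x(2)]])
  show "dg_mult tri x (dg_one tri) = x"
    using mu_eq[OF x(4) dgD(13)] dgD(15)[OF x(4)]
    by (simp add: x(1) tri_simps 0 ract_one[OF bimc_bim[OF x(3)]] R.H.comp_one[OF fin_efun[OF x(2)]])
qed

end

subsection \<open>Quasi-isomorphisms of DG-algebras\<close>

text \<open>Injectivity and surjectivity on cohomology in terms of elements, a form that composes
  without passing to classes; \<open>dg_quasi_isomorphismI\<close> returns to the official
  notion.\<close>

definition dg_qiso :: "('k::field, 'a::ab_group_add) dg_algebra \<Rightarrow> ('k, 'b::ab_group_add) dg_algebra \<Rightarrow> ('a \<Rightarrow> 'b) \<Rightarrow> bool" where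
  "dg_qiso A B f \<longleftrightarrow> dg_morphism A B f \<and>
     (\<forall>i. \<forall>x\<in>component A i. \<forall>y\<in>component B (i - 1). dg_diff A x = 0 \<longrightarrow> f x = dg_diff B y
        \<longrightarrow> (\<exists>z\<in>component A (i - 1). x = dg_diff A z)) \<and>
     (\<forall>i. \<forall>y\<in>component B i. dg_diff B y = 0
        \<longrightarrow> (\<exists>x\<in>component A i. dg_diff A x = 0 \<and> (\<exists>z\<in>component B (i - 1). y - f x = dg_diff B z)))"

lemma dg_qisoD:
  assumes "dg_qiso A B f"
  shows "dg_morphism A B f"
    "x \<in> component A i \<Longrightarrow> y \<in> component B (i - 1) \<Longrightarrow> dg_diff A x = 0 \<Longrightarrow> f x = dg_diff B y
       \<Longrightarrow> \<exists>z\<in>component A (i - 1). x = dg_diff A z"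
    "y \<in> component B i \<Longrightarrow> dg_diff B y = 0
       \<Longrightarrow> \<exists>x\<in>component A i. dg_diff A x = 0 \<and> (\<exists>z\<in>component B (i - 1). y - f x = dg_diff B z)"
  using assms unfolding dg_qiso_def by blast+

lemma dg_morphismD:
  assumes "dg_morphism A B f"
  shows "x \<in> component A i \<Longrightarrow> f x \<in> component B i"
    "x \<in> component A i \<Longrightarrow> f (dg_diff A x) = dg_diff B (f x)"
    "x \<in> component A i \<Longrightarrow> f (smul A c x) = smul B c (f x)"
    "x \<in> component A i \<Longrightarrow> y \<in> component A i \<Longrightarrow> f (x + y) = f x + f y"
    "x \<in> component A i \<Longrightarrow> y \<in> component A j \<Longrightarrow> f (dg_mult A x y) = dg_mult B (f x) (f y)"
    "f (dg_one A) = dg_one B"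
  using assms unfolding dg_morphism_def by blast+

lemma dg_quasi_isomorphismI:
  assumes A: "is_dg_algebra A" and B: "is_dg_algebra B" and f: "dg_qiso A B f"
  shows "dg_quasi_isomorphism A B f"
proof -
  note m = dg_morphismD[OF dg_qisoD(1)[OF f]]
  have "bij_betw (coh_map (ainf_of_dg B) i f) (cohomology (ainf_of_dg A) i) (cohomology (ainf_of_dg B) i)" for i
  proof (rule bij_betw_coh_map[OF chain_complex_dg[OF A] chain_complex_dg[OF B]])
    show "x \<in> coboundaries (ainf_of_dg A) i"
      if "x \<in> cocycles (ainf_of_dg A) i" "f x \<in> coboundaries (ainf_of_dg B) i" for x
      using that dg_qisoD(2)[OF f, of x i] by (force simp: ainf_of_dg_def cocycles_def coboundaries_def)
    show "\<exists>x\<in>cocycles (ainf_of_dg A) i. y - f x \<in> coboundaries (ainf_of_dg B) i"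
      if "y \<in> cocycles (ainf_of_dg B) i" for y
      using that dg_qisoD(3)[OF f, of y i] by (force simp: ainf_of_dg_def cocycles_def coboundaries_def)
  qed (use m in \<open>simp_all add: ainf_of_dg_def\<close>)
  then show ?thesis using dg_qisoD(1)[OF f] by (simp add: dg_quasi_isomorphism_def)
qed

lemma dg_components:
  assumes "is_dg_algebra A"
  shows "0 \<in> component A i" "x \<in> component A i \<Longrightarrow> y \<in> component A i \<Longrightarrow> x + y \<in> component A i"
    "x \<in> component A i \<Longrightarrow> y \<in> component A i \<Longrightarrow> x - y \<in> component A i"
    "x \<in> component A i \<Longrightarrow> y \<in> component A i \<Longrightarrow> dg_diff A (x - y) = dg_diff A x - dg_diff A y"
    "dg_diff A 0 = 0"
  using chain_complexD[OF chain_complex_dg[OF assms]] by (simp_all add: ainf_of_dg_def)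

lemma dg_qiso_comp:
  assumes A: "is_dg_algebra A" and B: "is_dg_algebra B" and C: "is_dg_algebra C"
    and f: "dg_qiso A B f" and g: "dg_qiso B C g"
  shows "dg_qiso A C (\<lambda>x. g (f x))"
proof -
  note F = dg_morphismD[OF dg_qisoD(1)[OF f]] and G = dg_morphismD[OF dg_qisoD(1)[OF g]]
  have g0: "g 0 = 0" using G(4)[OF dg_components(1)[OF B] dg_components(1)[OF B]] by simp
  have gd: "g (x - y) = g x - g y" if "x \<in> component B i" "y \<in> component B i" for x y i
    using G(4)[OF dg_components(3)[OF B that] that(2)] by simp
  have f0: "f 0 = 0" using F(4)[OF dg_components(1)[OF A] dg_components(1)[OF A]] by simp
  have "dg_morphism A C (\<lambda>x. g (f x))"
    unfolding dg_morphism_def using F G(1,6) by (auto simp: G(2)[OF F(1)] G(3)[OF F(1)] G(4)[OF F(1) F(1)] G(5)[OF F(1) F(1)])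
  moreover have "\<exists>z\<in>component A (i - 1). x = dg_diff A z"
    if x: "x \<in> component A i" "y \<in> component C (i - 1)" "dg_diff A x = 0" "g (f x) = dg_diff C y" for x y i
  proof -
    have "dg_diff B (f x) = 0" using F(2)[OF x(1)] x(3) f0 by simp
    from dg_qisoD(2)[OF g F(1)[OF x(1)] x(2) this x(4)] obtain z
      where z: "z \<in> component B (i - 1)" "f x = dg_diff B z" by blast
    show ?thesis by (rule dg_qisoD(2)[OF f x(1) z(1) x(3) z(2)])
  qed
  moreover have "\<exists>x\<in>component A i. dg_diff A x = 0 \<and> (\<exists>z\<in>component C (i - 1). y - g (f x) = dg_diff C z)"
    if y: "y \<in> component C i" "dg_diff C y = 0" for y i
  proof -
    obtain w z where w: "w \<in> component B i" "dg_diff B w = 0" "z \<in> component C (i - 1)" "y - g w = dg_diff C z"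
      using dg_qisoD(3)[OF g y] by blast
    obtain x v where x: "x \<in> component A i" "dg_diff A x = 0" "v \<in> component B (i - 1)" "w - f x = dg_diff B v"
      using dg_qisoD(3)[OF f w(1,2)] by blast
    have "y - g (f x) = (y - g w) + g (w - f x)" by (simp add: gd[OF w(1) F(1)[OF x(1)]])
    also have "\<dots> = dg_diff C z + dg_diff C (g v)" by (simp add: w(4) x(4) G(2)[OF x(3)])
    also have "\<dots> = dg_diff C (z + g v)" by (simp add: is_dg_algebraD(5)[OF C w(3) G(1)[OF x(3)]])
    finally show ?thesis using x dg_components(2)[OF C w(3) G(1)[OF x(3)]] by blast
  qed
  ultimately show ?thesis unfolding dg_qiso_def by blast
qed

text \<open>Both directions are used: the map into coordinates for the finite model, and the inverse
  for the coordinate form of the apex.\<close>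

lemma dg_qiso_map:
  fixes A :: "('k::field, 'x::ab_group_add) dg_algebra" and \<Theta> :: "'x \<Rightarrow> 'y::ab_group_add"
  assumes dg: "is_dg_algebra A" and t: "vector_space t" and lin: "lin (smul A) t \<Theta>"
    and X: "module.subspace (smul A) X" "\<And>i. component A i \<subseteq> X"
    and inv: "\<And>x. x \<in> X \<Longrightarrow> \<Xi> (\<Theta> x) = x"
  shows "dg_qiso A (map_dg t \<Theta> \<Xi> A) \<Theta>" "dg_qiso (map_dg t \<Theta> \<Xi> A) A \<Xi>"
proof -
  let ?B = "map_dg t \<Theta> \<Xi> A"
  have B: "is_dg_algebra ?B" by (rule is_dg_algebra_map[OF dg t lin X inv])
  note gv = graded_vector_spaceD[OF is_dg_algebraD(1)[OF dg]]
  have inv': "\<Xi> (\<Theta> x) = x" if "x \<in> component A i" for x i using inv X(2) that by blast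
  note ad = lin_additive[OF gv(1) t lin]
  have E: "smul ?B = t" "component ?B = (\<lambda>i. \<Theta> ` component A i)"
    "dg_diff ?B = (\<lambda>y. \<Theta> (dg_diff A (\<Xi> y)))" "dg_mult ?B = (\<lambda>y z. \<Theta> (dg_mult A (\<Xi> y) (\<Xi> z)))"
    "dg_one ?B = \<Theta> (dg_one A)" by (simp_all add: map_dg_def)
  note D = is_dg_algebraD[OF dg]
  note cl = module.subspace_add[OF gv(2,3)] module.subspace_scale[OF gv(2,3)]
  have t\<Theta>: "t c (\<Theta> x) = \<Theta> (smul A c x)" for c x using lin_scale[OF gv(1) t lin] by simp
  have inj: "x = y" if "x \<in> component A i" "y \<in> component A i" "\<Theta> x = \<Theta> y" for x y i
    using inv'[OF that(1)] inv'[OF that(2)] that(3) by metis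
  have m1: "dg_morphism A ?B \<Theta>"
    unfolding dg_morphism_def E
    by (auto simp: inv' t\<Theta> additive.add[OF ad])
  have m2: "dg_morphism ?B A \<Xi>"
    unfolding dg_morphism_def E
    by (auto simp: inv' inv'[OF D(2)] t\<Theta> inv'[OF cl(2)] additive.add[OF ad, symmetric] inv'[OF cl(1)]
        inv'[OF D(6)] inv'[OF D(13)])
  show "dg_qiso A ?B \<Theta>"
    unfolding dg_qiso_def
  proof (intro conjI allI ballI impI m1)
    fix i x y assume x: "x \<in> component A i" and y: "y \<in> component ?B (i - 1)" and e: "\<Theta> x = dg_diff ?B y"
    then obtain z where z: "z \<in> component A (i - 1)" "y = \<Theta> z" by (auto simp: E)
    have "x = dg_diff A z"
      using e D(2)[OF z(1)] by (intro inj[OF x]) (simp_all add: E z inv'[OF z(1)])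
    then show "\<exists>z\<in>component A (i - 1). x = dg_diff A z" using z by blast
  next
    fix i y assume y: "y \<in> component ?B i" "dg_diff ?B y = 0"
    then obtain x where x: "x \<in> component A i" "y = \<Theta> x" by (auto simp: E)
    have "dg_diff A x = 0"
      using y(2) by (intro inj[OF D(2)[OF x(1)] dg_components(1)[OF dg]])
        (simp add: E x inv'[OF x(1)] additive.zero[OF ad])
    moreover have "y - \<Theta> x = dg_diff ?B 0" using dg_components(5)[OF B] by (simp add: x)
    ultimately show "\<exists>x\<in>component A i. dg_diff A x = 0 \<and> (\<exists>z\<in>component ?B (i - 1). y - \<Theta> x = dg_diff ?B z)"
      using x dg_components(1)[OF B] by blast
  qed
  show "dg_qiso ?B A \<Xi>"
    unfolding dg_qiso_def
  proof (intro conjI allI ballI impI m2)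
    fix i x y assume x: "x \<in> component ?B i" and y: "y \<in> component A (i - 1)" and e: "\<Xi> x = dg_diff A y"
    then obtain z where z: "z \<in> component A i" "x = \<Theta> z" by (auto simp: E)
    have "x = dg_diff ?B (\<Theta> y)" using e by (simp add: E z inv'[OF z(1)] inv'[OF y])
    then show "\<exists>z\<in>component ?B (i - 1). x = dg_diff ?B z" using y by (auto simp: E)
  next
    fix i y assume y: "y \<in> component A i" "dg_diff A y = 0"
    have "dg_diff ?B (\<Theta> y) = 0" using y by (simp add: E inv'[OF y(1)] additive.zero[OF ad])
    moreover have "y - \<Xi> (\<Theta> y) = dg_diff A 0" using dg_components(5)[OF dg] by (simp add: inv'[OF y(1)])
    ultimately show "\<exists>x\<in>component ?B i. dg_diff ?B x = 0 \<and> (\<exists>z\<in>component A (i - 1). y - \<Xi> x = dg_diff A z)"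
      using y dg_components(1)[OF dg] by (intro bexI[of _ "\<Theta> y"]) (auto simp: E)
  qed
qed

section \<open>The contraction of the bimodule and the two projections\<close>

context dg_resolution
begin

definition prep :: "('a list \<Rightarrow> 'a list \<Rightarrow> 'a) \<Rightarrow> 'a list \<Rightarrow> 'a list \<Rightarrow> 'a" where
  "prep \<xi> xs = (if xs = [] then 0 else \<xi> (one # xs))"

lemma one_C: "one \<in> C 0" by (rule dgD(13))

lemma bimc_prep:
  assumes x: "\<xi> \<in> bimc j" and k: "k = j - 1" shows "prep \<xi> \<in> bimc k"
proof -
  note m = bimD[OF bimc_bim[OF x]]
  have "multilin sG sf (prep \<xi>)"
    using multilinD[OF multilin_Cons[OF m(1)]] by (simp add: multilin_def prep_def)
  moreover have "prep \<xi> (us @ q y # vs) = prep \<xi> (us @ y # vs)" for us y vs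
    using m(3)[of "one # us"] by (simp add: prep_def)
  moreover have "efun (prep \<xi> xs)" for xs by (simp add: prep_def efun_0 m(4))
  moreover have "hdeg C fin k (prep \<xi>)"
  proof (rule hdegI)
    fix ds xs assume "xs \<noteq> []" and h: "list_all2 (\<lambda>d x. x \<in> C d) ds xs"
    then show "prep \<xi> xs \<in> fin (sum_list ds - int (length xs) + k)"
      using bimc_deg[OF x, of "0 # ds" "one # xs"] one_C k by (simp add: prep_def algebra_simps)
  qed
  ultimately show ?thesis by (simp add: bimc_def bim_def) (simp add: prep_def)
qed

text \<open>The unit of \<open>G\<close> is strict: among the blocks starting with
  \<open>one\<close> only \<open>[one, y]\<close> contributes, and it reproduces
  \<open>\<xi>\<close>. The last term is the cut after \<open>one\<close> in \<open>cup\<close>,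
  where \<open>\<xi>\<close> sees nothing but the unit.\<close>

lemma xdiff_one:
  assumes x: "\<xi> \<in> bim" and ne: "xs \<noteq> []"
  shows "xdiff \<xi> (one # xs) = xdiff (prep \<xi>) xs - xconj \<xi> xs - mod_comp (ec (\<xi> [one])) (tau xs)"
proof -
  note m = bimD[OF x] and c = bimD[OF bim_xconj[OF x]]
  obtain y ys where xs: "xs = y # ys" using ne by (cases xs) auto
  have 1: "DD (xconj \<xi>) (one # xs) = xconj \<xi> xs + DD (xconj (prep \<xi>)) xs"
  proof -
    have "split_sum (\<lambda>us vs. xconj \<xi> (b (one # us) # vs)) xs
        = split_sum (\<lambda>us vs. xconj \<xi> (b (one # y # us) # vs)) ys"
      by (simp add: xs d_one c(5))
    also have "\<dots> = xconj \<xi> (q y # ys)"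
      by (subst split_sum_only_Nil) (auto simp: b_long Suc_le_eq c(5) b_one_left)
    also have "\<dots> = xconj \<xi> xs" by (simp add: c(6) xs)
    finally have "split_sum (\<lambda>us vs. xconj \<xi> (b (one # us) # vs)) xs = xconj \<xi> xs" .
    moreover have "DD (\<lambda>zs. xconj \<xi> (e one # zs)) xs = DD (xconj (prep \<xi>)) xs"
      by (rule coder_cong) (simp add: xconj_def prep_def e_e)
    ultimately show ?thesis by simp
  qed
  have 2: "cup \<xi> (one # xs) = cup (prep \<xi>) xs + mod_comp (ec (\<xi> [one])) (tau xs)"
    by (simp add: cup_def xs prep_def m(2) additive.zero[OF ad_ec] additive.zero[OF ad_cl])
  have 3: "\<xi> (one # xs) = prep \<xi> xs" using ne by (simp add: prep_def)
  show ?thesis unfolding xdiff_def 1 2 3 by simp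
qed

lemma tau_Nil: "tau [] = 0" using bimD(2)[OF bim_tau] .

lemma xdiff_one_single:
  assumes x: "\<xi> \<in> bim" shows "xdiff \<xi> [one] = ed (\<xi> [one])"
proof -
  note m = bimD[OF x] and c = bimD[OF bim_xconj[OF x]]
  have "DD (xconj \<xi>) [one] = 0" by (simp add: d_one c(5))
  moreover have "cup \<xi> [one] = 0"
    using additive.zero[OF ad_cr[OF R.H.end_fun_econj[OF m(4)]]]
    by (simp add: cup_def m(2) additive.zero[OF ad_ec] additive.zero[OF ad_cl] tau_Nil)
  ultimately show ?thesis by (simp add: xdiff_def)
qed

text \<open>Unlike in the Yoneda argument one application of the homotopy suffices, by
  \<open>xdiff_one\<close>; the obstruction is the value at \<open>[one]\<close>, which survives as
  a multiple of \<open>tau\<close>.\<close>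

lemma contract:
  assumes x: "\<xi> \<in> bimc j" and d: "\<And>xs. xdiff \<xi> xs = 0"
  obtains \<eta> where "\<eta> \<in> bimc (j - 1)" "\<And>xs. \<xi> xs = xdiff \<eta> xs + lact (\<xi> [one]) tau xs"
proof
  note b = bimc_bim[OF x]
  define \<eta> where "\<eta> = (\<lambda>xs. signed j (prep \<xi> xs))"
  have p: "prep \<xi> \<in> bimc (j - 1)" by (rule bimc_prep[OF x refl])
  show "\<eta> \<in> bimc (j - 1)"
    using p bimc_closed(4)[OF p] by (cases "even j") (simp_all add: \<eta>_def signed_def)
  have x1: "\<xi> [one] \<in> fin (j - 1)" by (rule bimc_deg[OF x, of "[0]"]) (simp_all add: one_C)
  show "\<xi> xs = xdiff \<eta> xs + lact (\<xi> [one]) tau xs" for xs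
  proof (cases "xs = []")
    case True
    have "\<xi> [] = 0" "xdiff \<eta> [] = 0"
      using bimD(2)[OF b] bimD(2)[OF bim_xdiff[OF bimc_bim[OF \<open>\<eta> \<in> _\<close>]]] by auto
    then show ?thesis
      using True additive.zero[OF ad_cr[OF fin_efun[OF x1]]] by (simp add: lact_def tau_Nil)
  next
    case False
    have "signed j (\<xi> xs) = xdiff (prep \<xi>) xs - signed (j - 1) (lact (\<xi> [one]) tau xs)"
      using xdiff_one[OF b False] d[of "one # xs"]
      by (simp add: bimc_xconj[OF x] fin_ec[OF x1] lact_def additive_signed[OF ad_cl] algebra_simps)
    moreover have "xdiff \<eta> xs = signed j (xdiff (prep \<xi>) xs)"
      using xdiff_minus by (cases "even j") (simp_all add: \<eta>_def signed_def)
    ultimately show ?thesis by (cases "even j") (auto simp: signed_def minus_equation_iff[of "\<xi> xs"])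
  qed
qed

lemma ed_tau_single: "b [a] = 0 \<Longrightarrow> ed (tau [a]) = 0"
proof -
  assume a: "b [a] = 0"
  have "DD tau [a] = 0" by (simp add: a bimD(5)[OF bim_tau])
  moreover have "split_sum (\<lambda>us vs. mod_comp (tau (map e us)) (tau vs)) [a] = 0"
    using additive.zero[OF ad_cr[OF bimD(4)[OF bim_tau]]] by (simp add: tau_Nil additive.zero[OF ad_cl])
  ultimately show ?thesis using R.coder_twist[of "[a]"] by simp
qed

lemma mu_one_right: "a \<in> C i \<Longrightarrow> mu a one = a"
  using mu_eq[OF _ one_C] dgD(15) by simp

lemma tau_single_fin: "a \<in> C i \<Longrightarrow> tau [a] \<in> fin i"
  by (rule bimc_deg[OF bimc_tau, of "[i]"]) simp_all

lemma xdiff_ract_tau: "xdiff (ract tau a) xs = - ract tau (b [a]) xs"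
proof -
  have "ract (xconj tau) (b [a]) xs = - ract tau (b [a]) xs"
    by (cases xs) (simp_all add: ract_def xconj_tau)
  then show ?thesis using xdiff_ract[OF bim_tau, of a xs] xdiff_tau by (cases xs) (simp_all add: ract_def)
qed

lemma ract_zero: "\<xi> \<in> bim \<Longrightarrow> ract \<xi> 0 xs = 0"
  using additive.zero[OF ad_mu_left] by (cases xs) (simp_all add: ract_def bimD(5) fun_eq_iff)

text \<open>\<open>contract\<close> applied to \<open>\<tau> a\<close>, whose value at
  \<open>[one]\<close> is \<open>\<tau>[a]\<close>. This compares right multiples of
  \<open>tau\<close> with left multiples.\<close>

lemma ract_tau_contract:
  assumes a: "a \<in> C i" "b [a] = 0"
  obtains \<eta> where "\<eta> \<in> bimc i" "\<And>xs. ract tau a xs = xdiff \<eta> xs + lact (tau [a]) tau xs"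
proof -
  have m: "ract tau a \<in> bimc (1 + i)" by (rule bimc_ract[OF bimc_tau a(1)]) simp
  have "xdiff (ract tau a) xs = 0" for xs by (simp add: xdiff_ract_tau a(2) ract_zero[OF bim_tau])
  from contract[OF m this] obtain \<eta> where "\<eta> \<in> bimc i" "\<And>xs. ract tau a xs = xdiff \<eta> xs + lact (ract tau a [one]) tau xs"
    by auto
  then show ?thesis using that[of \<eta>] by (simp add: ract_def mu_one_right[OF a(1)])
qed

lemma ed_one: "ed R.H.end_one = 0"
  using R.H.end_diff_one by (simp add: fun_eq_iff)

lemma tau_one:
  obtains \<gamma> where "\<gamma> \<in> fin (- 1)" "tau [one] = R.H.end_one + ed \<gamma>"
proof -
  obtain a \<chi> where a: "a \<in> C 0" "b [a] = 0" "\<chi> \<in> fin (0 - 1)" "R.H.end_one = tau [a] + ed \<chi>"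
    using R.twist_surj[OF R.H.fin_comp_one] ed_one by (metis zero_fun_def)
  have ba: "b [a, one] = a"
    using b_two[OF a(1) one_C] dgD(15)[OF a(1)] by simp
  have "DD tau [a, one] = tau [a]"
    using d_one multilin_0[OF vsG vsf bimD(1)[OF bim_tau], of "[_]" "[]"]
    by (simp add: a(2) ba bimD(5)[OF bim_tau])
  moreover have "split_sum (\<lambda>us vs. mod_comp (tau (map e us)) (tau vs)) [a, one] = - mod_comp (tau [a]) (tau [one])"
    using additive.zero[OF ad_cr[OF bimD(4)[OF bim_tau]]] eC[OF a(1)]
      multilin_minus_hd[OF vsG vsf bimD(1)[OF bim_tau], of a "[]"]
    by (simp add: tau_Nil additive.zero[OF ad_cl] signed_def additive.minus[OF ad_cl])
  ultimately have 1: "tau [a] = - ed (tau [a, one]) + mod_comp (tau [a]) (tau [one])"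
    using R.coder_twist[of "[a, one]"] by simp
  have t: "tau [a] = R.H.end_one - ed \<chi>" using a(4) by simp
  have 2: "mod_comp (tau [a]) (tau [one]) = tau [one] - ed (mod_comp \<chi> (tau [one]))"
  proof -
    have "ed (mod_comp \<chi> (tau [one])) = mod_comp (ed \<chi>) (tau [one])"
      using ed_comp[OF fin_efun[OF a(3)] R.end_fun_twist[of "[one]"]] ed_tau_single[OF d_one]
        additive.zero[OF ad_cr[OF R.H.end_fun_econj[OF fin_efun[OF a(3)]]]] by simp
    then show ?thesis unfolding t by (simp add: additive.diff[OF ad_cl] R.H.one_comp[OF R.end_fun_twist])
  qed
  have "tau [one] = R.H.end_one + ed (tau [a, one] - \<chi> + mod_comp \<chi> (tau [one]))"
    using 1[unfolded 2] unfolding t by (simp add: additive.add[OF ad_ed] additive.diff[OF ad_ed] algebra_simps)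
  moreover have "tau [a, one] - \<chi> + mod_comp \<chi> (tau [one]) \<in> fin (- 1)"
  proof (intro fin_add fin_diff)
    show "tau [a, one] \<in> fin (- 1)" by (rule bimc_deg[OF bimc_tau, of "[0, 0]"]) (simp_all add: a(1) one_C)
    show "\<chi> \<in> fin (- 1)" using a(3) by simp
    show "mod_comp \<chi> (tau [one]) \<in> fin (- 1)" by (rule fin_comp[OF a(3) tau_single_fin[OF one_C]]) simp
  qed
  ultimately show ?thesis using that by blast
qed

text \<open>The value of \<open>\<beta> \<tau>\<close> at \<open>[one]\<close> is
  \<open>\<beta> \<tau>[one]\<close>, so this says that \<open>\<beta>\<close> is exact if that
  value is; it holds because \<open>\<tau>[one]\<close> is the identity up to a boundary.\<close>

lemma exact_of_tau_one:
  assumes \<beta>: "\<beta> \<in> fin i" "ed \<beta> = 0" and \<theta>: "\<theta> \<in> fin (i - 1)" "mod_comp \<beta> (tau [one]) = ed \<theta>"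
  obtains \<theta>' where "\<theta>' \<in> fin (i - 1)" "\<beta> = ed \<theta>'"
proof -
  obtain \<gamma> where \<gamma>: "\<gamma> \<in> fin (- 1)" "tau [one] = R.H.end_one + ed \<gamma>" by (rule tau_one)
  note ef = fin_efun[OF \<beta>(1)] fin_efun[OF fin_ec_mem[OF \<beta>(1)]]
  have "ed (mod_comp (ec \<beta>) \<gamma>) = mod_comp \<beta> (ed \<gamma>)"
    using ed_comp[OF ef(2) fin_efun[OF \<gamma>(1)]] ed_ec[OF ef(1)] \<beta>(2)
    by (simp add: additive.zero[OF ad_ec] additive.zero[OF ad_cl])
  moreover have "mod_comp \<beta> (tau [one]) = \<beta> + mod_comp \<beta> (ed \<gamma>)"
    unfolding \<gamma>(2) by (simp add: additive.add[OF ad_cr[OF ef(1)]] R.H.comp_one[OF ef(1)])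
  ultimately have "\<beta> = ed (\<theta> - mod_comp (ec \<beta>) \<gamma>)"
    using \<theta>(2) by (simp add: additive.diff[OF ad_ed] algebra_simps)
  moreover have "\<theta> - mod_comp (ec \<beta>) \<gamma> \<in> fin (i - 1)"
    by (intro fin_diff \<theta>(1) fin_comp[OF fin_ec_mem[OF \<beta>(1)] \<gamma>(1)]) simp
  ultimately show ?thesis using that by blast
qed

lemma xdiff_lact_tau: "efun \<beta> \<Longrightarrow> xdiff (lact \<beta> tau) xs = lact (ed \<beta>) tau xs"
  using xdiff_lact[OF _ bim_tau, of \<beta> xs] xdiff_tau additive.zero[OF ad_cr[OF R.H.end_fun_econj]]
  by (simp add: lact_def[of "ec \<beta>"])

lemma lact_add: "lact (\<beta> + \<gamma>) \<xi> xs = lact \<beta> \<xi> xs + lact \<gamma> \<xi> xs"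
  by (simp add: lact_def additive.add[OF ad_cl])

lemma lact_minus: "lact (- \<beta>) \<xi> xs = - lact \<beta> \<xi> xs"
  by (simp add: lact_def additive.minus[OF ad_cl])

lemma ract_tau_add: "ract tau (a + a') xs = ract tau a xs + ract tau a' xs"
  by (cases xs) (simp_all add: ract_def additive.add[OF ad_mu_left] multilin_add_hd[OF vsG vsf bimD(1)[OF bim_tau]])

lemma b_add: "b [x + y] = b [x] + b [y]"
  by (rule multilin_add_hd[OF vsG vsG ml_b])

text \<open>The kernel of the projection consists of the pairs \<open>(\<beta>, \<xi>)\<close> and
  is acyclic, because the multiples \<open>\<beta> \<tau>\<close> account for the cohomology of the
  bimodule.\<close>

theorem tri_qiso_G: "dg_qiso tri G (\<lambda>(\<beta>, \<xi>, a). a)"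
  unfolding dg_qiso_def
proof (intro conjI allI ballI impI)
  show "dg_morphism tri G (\<lambda>(\<beta>, \<xi>, a). a)"
    unfolding dg_morphism_def
    using b_one mu_eq by (auto simp: tri_simps G_simps)
next
  fix i x y assume x: "x \<in> component tri i" and y: "y \<in> component G (i - 1)"
    and dx: "dg_diff tri x = 0" and xy: "(case x of (\<beta>, \<xi>, a) \<Rightarrow> a) = dg_diff G y"
  obtain \<beta> \<xi> a where X: "x = (\<beta>, \<xi>, a)" "\<beta> \<in> fin i" "\<xi> \<in> bimc i" "a \<in> C i"
    using x by (auto simp: tri_simps)
  have yC: "y \<in> C (i - 1)" using y by (simp add: G_simps)
  have a: "a = b [y]" using xy b_one[OF yC] by (simp add: X(1))
  have d\<beta>: "ed \<beta> = 0" and dX: "xdiff \<xi> xs + ract tau a xs - lact (ec \<beta>) tau xs = 0" for xs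
    using dx by (simp_all add: X(1) tri_simps zero_prod_def fun_eq_iff)
  note ef = fin_efun[OF X(2)] fin_efun[OF fin_ec_mem[OF X(2)]]
  \<comment> \<open>Subtracts the off-diagonal entry of the differential of
    \<open>(0, 0, y)\<close>, which accounts for \<open>a\<close>.\<close>
  define \<xi>' where "\<xi>' xs = \<xi> xs - ract tau y xs" for xs
  have m': "\<xi>' \<in> bimc i" unfolding \<xi>'_def by (intro bimc_closed X bimc_ract[OF bimc_tau yC]) simp
  have d': "xdiff \<xi>' xs = lact (ec \<beta>) tau xs" for xs
  proof -
    have "xdiff \<xi>' xs = xdiff \<xi> xs - xdiff (ract tau y) xs"
      using xdiff_add[of \<xi> "\<lambda>xs. - ract tau y xs"] by (simp add: \<xi>'_def[abs_def] xdiff_minus)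
    then show ?thesis using dX[of xs] by (simp add: xdiff_ract_tau a[symmetric] algebra_simps)
  qed
  have "\<xi>' [one] \<in> fin (i - 1)" by (rule bimc_deg[OF m', of "[0]"]) (simp_all add: one_C)
  \<comment> \<open>At the word \<open>[one]\<close> the differential of the bimodule is that of the
    endomorphisms, so \<open>exact_of_tau_one\<close> applies to \<open>ec \<beta>\<close>.\<close>
  moreover have "mod_comp (ec \<beta>) (tau [one]) = ed (\<xi>' [one])"
    using xdiff_one_single[OF bimc_bim[OF m']] d'[of "[one]"] by (simp add: lact_def)
  moreover have "ed (ec \<beta>) = 0" using ed_ec[OF ef(1)] d\<beta> by (simp add: additive.zero[OF ad_ec])
  ultimately obtain \<theta> where \<theta>: "\<theta> \<in> fin (i - 1)" "ec \<beta> = ed \<theta>"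
    using exact_of_tau_one[OF fin_ec_mem[OF X(2)]] by blast
  have ef\<theta>: "efun \<theta>" using fin_efun \<theta>(1) by blast
  define \<xi>'' where "\<xi>'' xs = \<xi>' xs - lact \<theta> tau xs" for xs
  have m'': "\<xi>'' \<in> bimc i" unfolding \<xi>''_def by (intro bimc_closed m' bimc_lact[OF \<theta>(1) bimc_tau]) simp
  have d'': "xdiff \<xi>'' xs = 0" for xs
  proof -
    have "xdiff \<xi>'' xs = xdiff \<xi>' xs - xdiff (lact \<theta> tau) xs"
      using xdiff_add[of \<xi>' "\<lambda>xs. - lact \<theta> tau xs"] by (simp add: \<xi>''_def[abs_def] xdiff_minus)
    then show ?thesis by (simp add: d' xdiff_lact_tau[OF ef\<theta>] \<theta>(2))
  qed
  obtain \<eta> where \<eta>: "\<eta> \<in> bimc (i - 1)" "\<And>xs. \<xi>'' xs = xdiff \<eta> xs + lact (\<xi>'' [one]) tau xs"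
    using contract[OF m'' d''] by blast
  define \<psi> where "\<psi> = \<xi>'' [one]"
  have \<psi>: "\<psi> \<in> fin (i - 1)" unfolding \<psi>_def by (rule bimc_deg[OF m'', of "[0]"]) (simp_all add: one_C)
  have d\<psi>: "ed \<psi> = 0" using xdiff_one_single[OF bimc_bim[OF m'']] d'' by (simp add: \<psi>_def)
  \<comment> \<open>The leftover \<open>\<psi> \<tau>\<close> is absorbed into the first entry of
    the primitive; the minus and \<open>ec\<close> undo those in the off-diagonal term.\<close>
  define \<delta> where "\<delta> = - ec (\<theta> + \<psi>)"
  have \<delta>: "\<delta> \<in> fin (i - 1)" unfolding \<delta>_def by (intro fin_minus fin_ec_mem fin_add \<theta>(1) \<psi>)
  have "ed \<delta> = \<beta>"
    using ed_ec[OF fin_efun[OF fin_add[OF \<theta>(1) \<psi>]]] d\<psi> arg_cong[OF \<theta>(2), of ec]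
    by (simp add: \<delta>_def additive.minus[OF ad_ed] additive.add[OF ad_ed])
  moreover have "xdiff \<eta> xs + ract tau y xs - lact (ec \<delta>) tau xs = \<xi> xs" for xs
  proof -
    have "ec \<delta> = - (\<theta> + \<psi>)" by (simp add: \<delta>_def additive.minus[OF ad_ec])
    then have "lact (ec \<delta>) tau xs = - (lact \<theta> tau xs + lact \<psi> tau xs)"
      by (simp only: lact_minus lact_add)
    then show ?thesis using \<eta>(2)[of xs] by (simp add: \<xi>''_def \<xi>'_def \<psi>_def algebra_simps)
  qed
  ultimately have "x = dg_diff tri (\<delta>, \<eta>, y)" by (simp add: X(1) tri_simps a)
  then show "\<exists>z\<in>component tri (i - 1). x = dg_diff tri z"
    using \<delta> \<eta>(1) yC by (intro bexI[of _ "(\<delta>, \<eta>, y)"]) (simp_all add: tri_simps)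
next
  fix i a assume aG: "a \<in> component G i" and da: "dg_diff G a = 0"
  have a: "a \<in> C i" "b [a] = 0" using aG da b_one[of a i] by (simp_all add: G_simps)
  obtain \<eta> where \<eta>: "\<eta> \<in> bimc i" "\<And>xs. ract tau a xs = xdiff \<eta> xs + lact (tau [a]) tau xs"
    using ract_tau_contract[OF a] by blast
  \<comment> \<open>\<open>\<tau> a\<close> and \<open>\<tau>[a] \<tau>\<close> differ by the
    differential of \<open>\<eta>\<close>, so with these entries the off-diagonal term
    vanishes.\<close>
  define x where "x = (ec (tau [a]), \<lambda>xs. - \<eta> xs, a)"
  have "x \<in> component tri i"
    using tau_single_fin[OF a(1)] a(1) \<eta>(1) by (simp add: x_def tri_simps fin_ec_mem bimc_closed)
  moreover have "dg_diff tri x = 0"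
    using \<eta>(2) ed_ec[OF R.end_fun_twist[of "[a]"]] ed_tau_single[OF a(2)] a(2)
    by (simp add: x_def tri_simps zero_prod_def fun_eq_iff xdiff_minus additive.zero[OF ad_ec])
  moreover have "a - (case x of (\<beta>, \<xi>, a) \<Rightarrow> a) = dg_diff G 0" using dg_components(5)[OF dg] by (simp add: x_def)
  ultimately show "\<exists>x\<in>component tri i. dg_diff tri x = 0 \<and>
      (\<exists>z\<in>component G (i - 1). a - (case x of (\<beta>, \<xi>, a) \<Rightarrow> a) = dg_diff G z)"
    using dg_components(1)[OF dg] by blast
qed

text \<open>Here \<open>twist_inj\<close> and \<open>twist_surj\<close> enter: up to boundaries
  \<open>\<tau> a\<close> is \<open>\<tau>[a] \<tau>\<close>, so right multiples of
  \<open>tau\<close> exhaust the cohomology of the bimodule as left multiples do.\<close>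

theorem tri_qiso_end: "dg_qiso tri R.H.end_dg fst"
  unfolding dg_qiso_def
proof (intro conjI allI ballI impI)
  have E: "smul R.H.end_dg = sf" "component R.H.end_dg = fin" "dg_diff R.H.end_dg = ed"
    "dg_mult R.H.end_dg = mod_comp" "dg_one R.H.end_dg = R.H.end_one"
    by (simp_all add: R.H.end_dg_def)
  show "dg_morphism tri R.H.end_dg fst"
    unfolding dg_morphism_def E by (auto simp: tri_simps)
  fix i
  {
    fix x \<theta> assume x: "x \<in> component tri i" and \<theta>: "\<theta> \<in> component R.H.end_dg (i - 1)"
      and dx: "dg_diff tri x = 0" and fx: "fst x = dg_diff R.H.end_dg \<theta>"
    obtain \<beta> \<xi> a where X: "x = (\<beta>, \<xi>, a)" "\<beta> \<in> fin i" "\<xi> \<in> bimc i" "a \<in> C i"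
      using x by (auto simp: tri_simps)
    have \<theta>f: "\<theta> \<in> fin (i - 1)" and \<beta>: "\<beta> = ed \<theta>" using \<theta> fx by (simp_all add: E X(1))
    have ef: "efun \<theta>" "efun (ec \<theta>)" using fin_efun \<theta>f fin_ec_mem by auto
    have da: "b [a] = 0" and dX: "xdiff \<xi> xs + ract tau a xs - lact (ec \<beta>) tau xs = 0" for xs
      using dx by (simp_all add: X(1) tri_simps zero_prod_def fun_eq_iff)
    define \<xi>' where "\<xi>' xs = \<xi> xs + lact (ec \<theta>) tau xs" for xs
    have m': "\<xi>' \<in> bimc i" unfolding \<xi>'_def
      by (intro bimc_closed X bimc_lact[OF fin_ec_mem[OF \<theta>f] bimc_tau]) simp
    have d': "xdiff \<xi>' xs = - ract tau a xs" for xs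
    proof -
      have "xdiff (lact (ec \<theta>) tau) xs = - lact (ec \<beta>) tau xs"
        by (simp add: xdiff_lact_tau[OF ef(2)] ed_ec[OF ef(1)] \<beta> lact_minus)
      then show ?thesis using dX[of xs] by (simp add: \<xi>'_def[abs_def] xdiff_add algebra_simps)
    qed
    \<comment> \<open>Evaluation at the unit exhibits \<open>\<tau>[a]\<close> as exact, and
      \<open>twist_inj\<close> turns this into a primitive of \<open>a\<close>.\<close>
    have "ed (\<xi>' [one]) = - tau [a]"
      using xdiff_one_single[OF bimc_bim[OF m']] d'[of "[one]"]
      by (simp add: ract_def mu_one_right[OF X(4)])
    then have "tau [a] = ed (- \<xi>' [one])" by (simp add: additive.minus[OF ad_ed])
    moreover have "- \<xi>' [one] \<in> fin (i - 1)"
      by (rule fin_minus, rule bimc_deg[OF m', of "[0]"]) (simp_all add: one_C)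
    ultimately obtain y where y: "y \<in> C (i - 1)" "a = b [y]"
      using R.twist_inj[OF X(4) da] by blast
    define \<xi>'' where "\<xi>'' xs = \<xi>' xs - ract tau y xs" for xs
    have m'': "\<xi>'' \<in> bimc i" unfolding \<xi>''_def by (intro bimc_closed m' bimc_ract[OF bimc_tau y(1)]) simp
    have d'': "xdiff \<xi>'' xs = 0" for xs
    proof -
      have "xdiff \<xi>'' xs = xdiff \<xi>' xs - xdiff (ract tau y) xs"
        using xdiff_add[of \<xi>' "\<lambda>xs. - ract tau y xs"] by (simp add: \<xi>''_def[abs_def] xdiff_minus)
      then show ?thesis by (simp add: d' xdiff_ract_tau y(2)[symmetric])
    qed
    obtain \<eta> where \<eta>: "\<eta> \<in> bimc (i - 1)" "\<And>xs. \<xi>'' xs = xdiff \<eta> xs + lact (\<xi>'' [one]) tau xs"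
      using contract[OF m'' d''] by blast
    define \<psi> where "\<psi> = \<xi>'' [one]"
    have \<psi>: "\<psi> \<in> fin (i - 1)" unfolding \<psi>_def by (rule bimc_deg[OF m'', of "[0]"]) (simp_all add: one_C)
    have d\<psi>: "ed \<psi> = 0" using xdiff_one_single[OF bimc_bim[OF m'']] d'' by (simp add: \<psi>_def)
    \<comment> \<open>The first entry of the primitive stays \<open>\<theta>\<close>; the leftover
      \<open>\<psi> \<tau>\<close> goes to the last entry, as \<open>\<psi>\<close> is cohomologous
      to \<open>\<tau>[y']\<close> and \<open>\<tau>[y'] \<tau>\<close> to
      \<open>\<tau> y'\<close>.\<close>
    obtain y' \<chi> where y': "y' \<in> C (i - 1)" "b [y'] = 0" "\<chi> \<in> fin (i - 1 - 1)" "\<psi> = tau [y'] + ed \<chi>"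
      using R.twist_surj[OF \<psi>] d\<psi> by (metis zero_fun_def)
    obtain \<omega> where \<omega>: "\<omega> \<in> bimc (i - 1)" "\<And>xs. ract tau y' xs = xdiff \<omega> xs + lact (tau [y']) tau xs"
      using ract_tau_contract[OF y'(1,2)] by blast
    define \<zeta> where "\<zeta> xs = \<eta> xs - \<omega> xs + lact \<chi> tau xs" for xs
    have \<zeta>: "\<zeta> \<in> bimc (i - 1)" unfolding \<zeta>_def
      by (intro bimc_closed \<eta>(1) \<omega>(1) bimc_lact[OF y'(3) bimc_tau]) simp
    have d\<zeta>: "xdiff \<zeta> xs = xdiff \<eta> xs - xdiff \<omega> xs + lact (ed \<chi>) tau xs" for xs
      using xdiff_add[of \<eta> "\<lambda>xs. - \<omega> xs"] xdiff_lact_tau[OF fin_efun[OF y'(3)]]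
        xdiff_add[of "\<lambda>xs. \<eta> xs - \<omega> xs" "lact \<chi> tau"]
      by (simp add: \<zeta>_def[abs_def] xdiff_minus)
    have "xdiff \<zeta> xs + ract tau (y + y') xs - lact (ec \<theta>) tau xs = \<xi> xs" for xs
    proof -
      have "lact \<psi> tau xs = lact (tau [y']) tau xs + lact (ed \<chi>) tau xs"
        unfolding y'(4) by (rule lact_add)
      then show ?thesis
        using \<eta>(2)[of xs] \<omega>(2)[of xs]
        by (simp add: d\<zeta> ract_tau_add \<xi>''_def \<xi>'_def \<psi>_def algebra_simps)
    qed
    then have "x = dg_diff tri (\<theta>, \<zeta>, y + y')"
      using y(2) y'(2) by (simp add: X(1) tri_simps \<beta> b_add)
    then show "\<exists>z\<in>component tri (i - 1). x = dg_diff tri z"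
      using \<theta>f \<zeta> y(1) y'(1) CC by (intro bexI[of _ "(\<theta>, \<zeta>, y + y')"]) (simp_all add: tri_simps)
  next
    fix \<beta> assume \<beta>: "\<beta> \<in> component R.H.end_dg i" "dg_diff R.H.end_dg \<beta> = 0"
    have \<beta>f: "\<beta> \<in> fin i" "ed \<beta> = 0" using \<beta> by (simp_all add: E)
    have "ed (ec \<beta>) = 0"
      using ed_ec[OF fin_efun[OF \<beta>f(1)]] \<beta>f(2) by (simp add: additive.zero[OF ad_ec])
    then obtain a \<chi> where a: "a \<in> C i" "b [a] = 0" "\<chi> \<in> fin (i - 1)" "ec \<beta> = tau [a] + ed \<chi>"
      using R.twist_surj[OF fin_ec_mem[OF \<beta>f(1)]] by (metis zero_fun_def)
    obtain \<eta> where \<eta>: "\<eta> \<in> bimc i" "\<And>xs. ract tau a xs = xdiff \<eta> xs + lact (tau [a]) tau xs"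
      using ract_tau_contract[OF a(1,2)] by blast
    \<comment> \<open>\<open>\<chi>\<close> relates \<open>ec \<beta>\<close> to
      \<open>\<tau>[a]\<close> and \<open>\<eta>\<close> relates \<open>\<tau> a\<close> to
      \<open>\<tau>[a] \<tau>\<close>; the off-diagonal entry collects both corrections.\<close>
    define \<xi> where "\<xi> xs = lact \<chi> tau xs - \<eta> xs" for xs
    have \<xi>: "\<xi> \<in> bimc i" unfolding \<xi>_def by (intro bimc_closed \<eta>(1) bimc_lact[OF a(3) bimc_tau]) simp
    have "xdiff \<xi> xs + ract tau a xs - lact (ec \<beta>) tau xs = 0" for xs
      using xdiff_add[of "lact \<chi> tau" "\<lambda>xs. - \<eta> xs"] xdiff_lact_tau[OF fin_efun[OF a(3)]]
      by (simp add: \<xi>_def[abs_def] xdiff_minus \<eta>(2) a(4) lact_add)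
    then have "dg_diff tri (\<beta>, \<xi>, a) = 0"
      by (simp add: tri_simps zero_prod_def \<beta>f(2) a(2) zero_fun_def)
    moreover have "(\<beta>, \<xi>, a) \<in> component tri i" using \<beta>f \<xi> a by (simp add: tri_simps)
    moreover have "\<beta> - fst (\<beta>, \<xi>, a) = dg_diff R.H.end_dg 0" by (simp add: E additive.zero[OF ad_ed])
    moreover have "0 \<in> component R.H.end_dg (i - 1)" by (simp add: E fin_zero)
    ultimately show "\<exists>x\<in>component tri i. dg_diff tri x = 0 \<and>
        (\<exists>z\<in>component R.H.end_dg (i - 1). \<beta> - fst x = dg_diff R.H.end_dg z)"
      by blast
  }
qed

theorem dg_finite_model:
  "\<exists>B :: ('k, nat \<Rightarrow> 'k) dg_algebra. is_dg_algebra B \<and> finite_total_dimension B \<and> dg_quasi_isomorphic G B"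
proof -
  obtain \<Theta> :: "('a list \<Rightarrow> 'a) \<Rightarrow> nat \<Rightarrow> 'k" and K
    where \<Theta>: "lin sf (\<lambda>c f m. c * f m) \<Theta>" "\<And>\<psi> m. m \<ge> K \<Longrightarrow> \<Theta> \<psi> m = 0" "inj_on \<Theta> R.H.bounded_fun"
    using R.H.finite_coordinates by blast
  define t where "t = (\<lambda>(c :: 'k) f (m :: nat). c * f m)"
  have vt: "vector_space t" unfolding t_def by unfold_locales (auto simp: fun_eq_iff algebra_simps)
  define \<Xi> where "\<Xi> = inv_into R.H.bounded_fun \<Theta>"
  have inv: "\<Xi> (\<Theta> \<psi>) = \<psi>" if "\<psi> \<in> R.H.bounded_fun" for \<psi>
    unfolding \<Xi>_def by (rule inv_into_f_f[OF \<Theta>(3) that])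
  have E: "smul R.H.end_dg = sf" "component R.H.end_dg = fin" by (simp_all add: R.H.end_dg_def)
  have lE: "lin (smul R.H.end_dg) t \<Theta>" "module.subspace (smul R.H.end_dg) R.H.bounded_fun"
    "\<And>i. component R.H.end_dg i \<subseteq> R.H.bounded_fun"
    using \<Theta>(1) R.H.subspace_bounded R.H.fin_comp_bounded by (simp_all add: E t_def)
  define B where "B = map_dg t \<Theta> \<Xi> R.H.end_dg"
  have B: "is_dg_algebra B" unfolding B_def
    by (rule is_dg_algebra_map[where A = R.H.end_dg and t = t and \<Theta> = \<Theta> and X = R.H.bounded_fun and \<Xi> = \<Xi>,
      OF R.H.is_dg_algebra_end_dg vt lE inv])
  have qB: "dg_qiso R.H.end_dg B \<Theta>" unfolding B_def
    by (rule dg_qiso_map(1)[where A = R.H.end_dg and t = t and \<Theta> = \<Theta> and X = R.H.bounded_fun and \<Xi> = \<Xi>,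
      OF R.H.is_dg_algebra_end_dg vt lE inv])
  obtain c :: "'a \<Rightarrow> 'a \<Rightarrow> 'k" where c: "\<And>v. lin sG (*) (c v)" "\<And>x. (\<And>v. c v x = 0) \<Longrightarrow> x = 0"
    using coordinates_exist[OF vsG] by blast
  \<comment> \<open>The type of the apex is prescribed, so the three entries are coded by the length
    of the word: \<open>[[v]]\<close> for \<open>a\<close>, \<open>[ys, [v]]\<close> for
    \<open>\<beta>\<close> and \<open>[xs, ys, [v]]\<close> for \<open>\<xi>\<close>, where
    \<open>v\<close> selects a coordinate. Every entry can be read back.\<close>
  define \<Psi> :: "('a list \<Rightarrow> 'a) \<times> ('a list \<Rightarrow> 'a list \<Rightarrow> 'a) \<times> 'a \<Rightarrow> 'a list list \<Rightarrow> 'k"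
    where "\<Psi> = (\<lambda>(\<beta>, \<xi>, a) w. if length w = 1 then c (hd (w ! 0)) a
      else if length w = 2 then c (hd (w ! 1)) (\<beta> (w ! 0))
      else if length w = 3 then c (hd (w ! 2)) (\<xi> (w ! 0) (w ! 1)) else 0)"
  define r where "r = (\<lambda>(c :: 'k) f (w :: 'a list list). c * f w)"
  have vr: "vector_space r" unfolding r_def by unfold_locales (auto simp: fun_eq_iff algebra_simps)
  have vk: "vector_space ((*) :: 'k \<Rightarrow> 'k \<Rightarrow> 'k)" by unfold_locales (auto simp: algebra_simps)
  have lin\<Psi>: "lin (smul tri) r \<Psi>"
    by (auto simp: lin_def \<Psi>_def tri_simps r_def fun_eq_iff linD[OF c(1)])
  have inj\<Psi>: "inj \<Psi>"
  proof (rule injI)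
    fix x y assume xy: "\<Psi> x = \<Psi> y"
    obtain \<beta> \<xi> a \<beta>' \<xi>' a' where x: "x = (\<beta>, \<xi>, a)" and y: "y = (\<beta>', \<xi>', a')"
      by (cases x, cases y) auto
    have eq: "z = z'" if "\<And>v. c v z = c v z'" for z z'
      using c(2)[of "z - z'"] that additive.diff[OF lin_additive[OF vsG vk c(1)]] by simp
    have "a = a'" by (rule eq) (use fun_cong[OF xy, of "[[_]]"] in \<open>simp add: x y \<Psi>_def\<close>)
    moreover have "\<beta> ys = \<beta>' ys" for ys
      by (rule eq) (use fun_cong[OF xy, of "[ys, [_]]"] in \<open>simp add: x y \<Psi>_def\<close>)
    moreover have "\<xi> xs ys = \<xi>' xs ys" for xs ys
      by (rule eq) (use fun_cong[OF xy, of "[xs, ys, [_]]"] in \<open>simp add: x y \<Psi>_def\<close>)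
    ultimately show "x = y" by (simp add: x y fun_eq_iff)
  qed
  have inv\<Psi>: "inv \<Psi> (\<Psi> x) = x" for x by (rule inv_f_f[OF inj\<Psi>])
  have mt: "module (smul tri)" using vector_space_tri by (simp add: module_iff_vector_space)
  have U: "module.subspace (smul tri) UNIV" by (simp add: module.subspace_def[OF mt])
  define T where "T = map_dg r \<Psi> (inv \<Psi>) tri"
  have T: "is_dg_algebra T" unfolding T_def
    by (rule is_dg_algebra_map[OF is_dg_algebra_tri vr lin\<Psi> U]) (simp_all add: inv\<Psi>)
  have qT: "dg_qiso T tri (inv \<Psi>)" unfolding T_def
    by (rule dg_qiso_map(2)[OF is_dg_algebra_tri vr lin\<Psi> U]) (simp_all add: inv\<Psi>)
  have "dg_qiso T G (\<lambda>x. (\<lambda>(\<beta>, \<xi>, a). a) (inv \<Psi> x))"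
    by (rule dg_qiso_comp[OF T is_dg_algebra_tri dg qT tri_qiso_G])
  moreover have "dg_qiso T B (\<lambda>x. \<Theta> (fst (inv \<Psi> x)))"
    by (rule dg_qiso_comp[OF T R.H.is_dg_algebra_end_dg B
          dg_qiso_comp[OF T is_dg_algebra_tri R.H.is_dg_algebra_end_dg qT tri_qiso_end] qB])
  ultimately have "dg_quasi_isomorphic G B"
    unfolding dg_quasi_isomorphic_def
    using T dg_quasi_isomorphismI[OF T dg] dg_quasi_isomorphismI[OF T B] by blast
  moreover have "finite_total_dimension B"
    unfolding B_def t_def by (rule finite_total_dimension_map_dg[of K \<Theta>, OF \<Theta>(2)])
  ultimately show ?thesis using B by blast
qed

end

section \<open>DG-algebras as A_infinity algebras, and the conclusion\<close>

text \<open>In arities one, two and three the relations are the vanishing square of the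
  differential, the Leibniz rule and associativity. In arity four or more one of the two nested
  operations has at least three inputs.\<close>

lemma is_ainf_of_dg:
  fixes G :: "('k::field, 'a::ab_group_add) dg_algebra"
  assumes dg: "is_dg_algebra G"
  shows "is_ainf_algebra (ainf_of_dg G)" "homologically_unital (ainf_of_dg G)"
proof -
  let ?A = "ainf_of_dg G"
  note D = is_dg_algebraD[OF dg] and c = dg_components[OF dg]
  note gv = graded_vector_spaceD[OF D(1)]
  define m where "m = ops ?A"
  have m: "m [x] = dg_diff G x" "m [x, y] = dg_mult G x y" for x y
    by (simp_all add: m_def ainf_of_dg_def)
  have long: "m xs = 0" if "3 \<le> length xs" for xs
  proof -
    from that obtain x y z zs where "xs = x # y # z # zs" by (auto simp: Suc_le_length_iff numeral_eq_Suc)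
    then show ?thesis by (simp add: m_def ainf_of_dg_def)
  qed
  have S: "smul ?A = smul G" "component ?A = component G" by (simp_all add: ainf_of_dg_def)
  have hom: "homogeneous ?A ds xs \<longleftrightarrow> list_all2 (\<lambda>d x. x \<in> component G d) ds xs" for ds xs
    by (simp add: homogeneous_def S)
  have s0: "smul G a 0 = 0" for a using module.scale_zero_right[OF gv(2)] .
  have short: "(us = [] \<and> vs = []) \<or> (us = [] \<and> (\<exists>v. vs = [v])) \<or> ((\<exists>u. us = [u]) \<and> vs = []) \<or>
      3 \<le> length us + length vs + 1" for us vs :: "'a list"
    by (cases us; cases "tl us"; cases vs; cases "tl vs") auto
  have degree: "m xs \<in> component G (sum_list ds + (2 - int (length xs)))"
    if "xs \<noteq> []" "homogeneous ?A ds xs" for ds xs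
  proof -
    from that(1) obtain x vs where xs: "xs = x # vs" by (cases xs) auto
    consider "vs = []" | v where "vs = [v]" | "3 \<le> length xs" using short[of "[]" vs] xs by auto
    then show ?thesis
      using that(2) by cases (auto simp: xs hom m list_all2_Cons2 long c(1) D(2) D(6))
  qed
  have add: "m (us @ (x + y) # vs) = m (us @ x # vs) + m (us @ y # vs)"
    if h: "homogeneous ?A ds us" "homogeneous ?A es vs" "x \<in> component G d" "y \<in> component G d" for ds es us vs d x y
  proof -
    consider "us = []" "vs = []" | v where "us = []" "vs = [v]" | u where "us = [u]" "vs = []"
      | "3 \<le> length us + length vs + 1" using short[of us vs] by blast
    then show ?thesis
    proof cases
      case 1 then show ?thesis using D(5)[OF h(3,4)] by (simp add: m)
    next
      case 2
      then obtain j where "v \<in> component G j" using h(2) by (auto simp: hom list_all2_Cons2)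
      then show ?thesis using D(9)[OF h(3,4)] by (simp add: 2 m)
    next
      case 3
      then obtain j where "u \<in> component G j" using h(1) by (auto simp: hom list_all2_Cons2)
      then show ?thesis using D(10)[OF _ h(3,4)] by (simp add: 3 m)
    next
      case 4 then show ?thesis by (simp add: long)
    qed
  qed
  have scale: "m (us @ smul G a x # vs) = smul G a (m (us @ x # vs))"
    if h: "homogeneous ?A ds us" "homogeneous ?A es vs" "x \<in> component G d" for ds es us vs d x a
  proof -
    consider "us = []" "vs = []" | v where "us = []" "vs = [v]" | u where "us = [u]" "vs = []"
      | "3 \<le> length us + length vs + 1" using short[of us vs] by blast
    then show ?thesis
    proof cases
      case 1 then show ?thesis using D(4)[OF h(3)] by (simp add: m)
    next
      case 2
      then obtain j where "v \<in> component G j" using h(2) by (auto simp: hom list_all2_Cons2)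
      then show ?thesis using D(7)[OF h(3)] by (simp add: 2 m)
    next
      case 3
      then obtain j where "u \<in> component G j" using h(1) by (auto simp: hom list_all2_Cons2)
      then show ?thesis using D(8)[OF _ h(3)] by (simp add: 3 m)
    next
      case 4 then show ?thesis by (simp add: long s0)
    qed
  qed
  have m0: "m (us @ 0 # vs) = 0" if "homogeneous ?A ds us" "homogeneous ?A es vs" for ds es us vs
    using scale[OF that c(1), of 0] by (simp add: module.scale_zero_left[OF gv(2)])
  have "multilinear_family ?A ?A (\<lambda>n. 2 - int n) m"
    unfolding multilinear_family_def S
    by (intro conjI allI impI; elim conjE) (rule degree add scale; assumption)+
  moreover have "insertion_sum m m ds xs = 0" if ne: "xs \<noteq> []" and h: "homogeneous ?A ds xs" for ds xs
  proof (cases "length xs \<le> 3")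
    case False
    have "m (take r xs @ m (take s (drop r xs)) # drop (r + s) xs) = 0"
      if "1 \<le> s" "r + s \<le> length xs" for r s
    proof (cases "s \<le> 2")
      case True
      then show ?thesis using False that by (intro long) simp
    next
      case s: False
      have "m (take s (drop r xs)) = 0" using s that by (intro long) simp
      moreover have "homogeneous ?A (take r ds) (take r xs)" "homogeneous ?A (drop (r + s) ds) (drop (r + s) xs)"
        using h by (simp_all add: hom list_all2_takeI list_all2_dropI)
      ultimately show ?thesis using m0 by simp
    qed
    then show ?thesis unfolding insertion_sum_def by (intro sum.neutral) (auto simp: signed_def)
  next
    case True
    obtain x vs where xs: "xs = x # vs" using ne by (cases xs) auto
    consider "xs = [x]" | y where "xs = [x, y]" | y z where "xs = [x, y, z]"
      using True unfolding xs by (cases vs; cases "tl vs") auto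
    then show ?thesis
    proof cases
      case 1
      obtain i where i: "x \<in> component G i" using h by (auto simp: 1 hom list_all2_Cons2)
      have I: "{(r, s). 1 \<le> s \<and> r + s \<le> length xs} = {(0, 1)}" by (auto simp: 1)
      show ?thesis unfolding insertion_sum_def I by (simp add: 1 m D(3)[OF i] signed_def)
    next
      case 2
      obtain i j where ij: "ds = [i, j]" "x \<in> component G i" "y \<in> component G j"
        using h by (auto simp: 2 hom list_all2_Cons2)
      have I: "{(r, s). 1 \<le> s \<and> r + s \<le> length xs} = {(0, 1), (1, 1), (0, 2)}" by (auto simp: 2)
      show ?thesis unfolding insertion_sum_def I
        using D(11)[OF ij(2,3)] by (simp add: 2 m ij(1) signed_def eval_nat_numeral)
    next
      case 3
      obtain i j k where ij: "ds = [i, j, k]" "x \<in> component G i" "y \<in> component G j" "z \<in> component G k"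
        using h by (auto simp: 3 hom list_all2_Cons2)
      have I: "{(r, s). 1 \<le> s \<and> r + s \<le> length xs} = {(0, 1), (1, 1), (2, 1), (0, 2), (1, 2), (0, 3)}"
        by (auto simp: 3)
      show ?thesis unfolding insertion_sum_def I
        using D(12)[OF ij(2,3,4)] c(5) by (simp add: 3 m long ij(1) signed_def eval_nat_numeral)
    qed
  qed
  moreover have "graded_vector_space ?A" using D(1) by (simp add: graded_vector_space_def S)
  ultimately show "is_ainf_algebra ?A" by (simp add: is_ainf_algebra_def m_def)
  have "dg_diff G (dg_one G) = dg_diff G (dg_one G) + dg_diff G (dg_one G)"
    using D(11)[OF D(13) D(13)] D(14)[OF D(13)] D(15)[OF D(2)[OF D(13)]] D(14)[OF D(2)[OF D(13)]]
    by (simp add: signed_def)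
  then have "dg_one G \<in> cocycles ?A 0" using D(13) by (simp add: cocycles_def S m_def[symmetric] m)
  moreover have "coh_class ?A i (m [dg_one G, x]) = coh_class ?A i x" "coh_class ?A i (m [x, dg_one G]) = coh_class ?A i x"
    if "x \<in> cocycles ?A i" for i x
    using that D(14)[of x i] D(15)[of x i] by (simp_all add: cocycles_def S m)
  ultimately show "homologically_unital ?A" unfolding homologically_unital_def m_def by blast
qed

theorem theoremA3:
  shows
    "(\<forall>A :: ('k::field, 'a::ab_group_add) ainf_algebra.
        is_ainf_algebra A \<and> homologically_unital A \<and> proper A \<and> connective A \<longrightarrow>
        (\<exists>B :: ('k, nat \<Rightarrow> 'k) dg_algebra.
           is_dg_algebra B \<and> finite_total_dimension B \<and>
           ainf_quasi_isomorphic A (ainf_of_dg B))) \<and>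
     (\<forall>A :: ('k, 'a) dg_algebra.
        is_dg_algebra A \<and> proper (ainf_of_dg A) \<and> connective (ainf_of_dg A) \<longrightarrow>
        (\<exists>B :: ('k, nat \<Rightarrow> 'k) dg_algebra.
           is_dg_algebra B \<and> finite_total_dimension B \<and> dg_quasi_isomorphic A B))"
proof (intro conjI allI impI)
  fix A :: "('k, 'a) ainf_algebra"
  assume A: "is_ainf_algebra A \<and> homologically_unital A \<and> proper A \<and> connective A"
  then have gv: "graded_vector_space A" by (simp add: is_ainf_algebra_def)
  note V = graded_vector_spaceD[OF gv]
  obtain \<pi> where \<pi>: "\<And>i. lin (smul A) (smul A) (\<pi> i)" "\<And>i x. \<pi> i x \<in> component A i"
    "\<And>i x. x \<in> component A i \<Longrightarrow> \<pi> i x = x" "\<And>i j x. i \<noteq> j \<Longrightarrow> x \<in> component A j \<Longrightarrow> \<pi> i x = 0"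
    "\<And>x. finite {i. \<pi> i x \<noteq> 0}"
    using graded_projections_exist[OF gv] by blast
  interpret vector_space "smul A" by (rule V(1))
  interpret proper_connective_ainf A \<pi>
    by unfold_locales (use A \<pi> V in auto)
  obtain h p S n u where "ainf_resolution A e b h p q S n u" using resolution_exists by blast
  then interpret R: ainf_resolution A e b h p q S n u .
  obtain \<Theta> :: "('a list \<Rightarrow> 'a) \<Rightarrow> nat \<Rightarrow> 'k" and K
    where \<Theta>: "lin R.H.scale_fun (\<lambda>c f m. c * f m) \<Theta>" "\<And>\<psi> m. m \<ge> K \<Longrightarrow> \<Theta> \<psi> m = 0" "inj_on \<Theta> R.H.bounded_fun"
    using R.H.finite_coordinates by blast
  show "\<exists>B :: ('k, nat \<Rightarrow> 'k) dg_algebra. is_dg_algebra B \<and> finite_total_dimension B \<and>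
      ainf_quasi_isomorphic A (ainf_of_dg B)"
    using R.finite_model[OF \<Theta>] by blast
next
  fix A :: "('k, 'a) dg_algebra"
  assume A: "is_dg_algebra A \<and> proper (ainf_of_dg A) \<and> connective (ainf_of_dg A)"
  let ?A = "ainf_of_dg A"
  have dg: "is_dg_algebra A" using A by simp
  have gv: "graded_vector_space ?A" using is_ainf_of_dg(1)[OF dg] by (simp add: is_ainf_algebra_def)
  note V = graded_vector_spaceD[OF gv]
  obtain \<pi> where \<pi>: "\<And>i. lin (smul ?A) (smul ?A) (\<pi> i)" "\<And>i x. \<pi> i x \<in> component ?A i"
    "\<And>i x. x \<in> component ?A i \<Longrightarrow> \<pi> i x = x" "\<And>i j x. i \<noteq> j \<Longrightarrow> x \<in> component ?A j \<Longrightarrow> \<pi> i x = 0"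
    "\<And>x. finite {i. \<pi> i x \<noteq> 0}"
    using graded_projections_exist[OF gv] by blast
  interpret vector_space "smul ?A" by (rule V(1))
  interpret proper_connective_ainf ?A \<pi>
    by unfold_locales (use A \<pi> V is_ainf_of_dg[OF dg] in auto)
  obtain h p S n u where "ainf_resolution ?A e b h p q S n u" using resolution_exists by blast
  then interpret R: ainf_resolution ?A e b h p q S n u .
  interpret dg_resolution A \<pi> h p S n u
    by unfold_locales (rule dg)
  show "\<exists>B :: ('k, nat \<Rightarrow> 'k) dg_algebra. is_dg_algebra B \<and> finite_total_dimension B \<and> dg_quasi_isomorphic A B"
    by (rule dg_finite_model)
qed

end
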